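(* Let $\Bbbk$ be a field and let $0\ne q\in\Bbbk$ be not a root of unity. Set $\delta=1\pm(q+q^{-1})$ (either choice of sign). Then $$\mathrm{End}_{\mathbf U_q(\mathfrak{gl}_2)}(V^{\otimes k})\cong\mathsf{PTL}_k(\delta).$$ Hence $V^{\otimes k}$ satisfies Schur--Weyl duality with respect to the commuting actions of $\mathbf U_q(\mathfrak{gl}_2)$ and $\mathsf{PTL}_k(\delta)$; that is, the image of each algebra in $\mathrm{End}_\Bbbk(V^{\otimes k})$ is the full centralizer of the image of the other.
   Context: **Diagram algebras.** Let $[k]=\{1,\dots,k\}$, $[k]'=\{1',\dots,k'\}$. A Motzkin $k$-diagram is a set partition of $[k]\sqcup[k]'$ into blocks of size at most $2$ which, with top row $1,\dots,k$ and bottom row $1',\dots,k'$, can be drawn in the rectangle without crossings; blocks of size $2$ are edges; an edge is a cup if both endpoints are in $[k]$, a cap if both are in $[k]'$; cups and caps are horizontal. $\mathsf M_k(\delta)$ is the $\Bbbk$-algebra free on Motzkin $k$-diagrams; $d_1d_2=\delta^{N_1}\,d_1\circ d_2$, where one stacks $d_1$ above $d_2$, identifies $i'$ of $d_1$ with $i$ of $d_2$, $d_1\circ d_2$ records connectivity of the outer rows and $N_1$ is the number of closed loops in the middle (interior paths contribute factor $1$). $p_j$ has $j,j'$ isolated and vertical edges $\{i,i'\}$, $i\ne j$. $e_i$ has edges $\{i,i+1\}$, $\{i',(i+1)'\}$; $r_i$ has the edge $\{i+1,i'\}$ with $i,(i+1)'$ isolated; $l_i$ has the edge $\{i,(i+1)'\}$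 with $i+1,i'$ isolated; all have vertical edges $\{j,j'\}$ for $j\neq i,i+1$. For a Motzkin diagram $d$, $\tilde d=\prod_i(1-p_i)\,d\,\prod_j(1-p_j)$, with $i$ (resp. $j$) running over the $i\in[k]$ (resp. $j$ with $j'\in[k]'$) that are endpoints of horizontal edges of $d$. $\mathsf{PTL}_k(\delta)\subseteq\mathsf M_k(\delta)$ is the subalgebra spanned by the $\tilde d$ for $d$ balanced (as many cups as caps). It is generated by the $r_i,l_i$, $\varepsilon_i=\tilde e_i=(1-p_i)e_i(1-p_i)$ ($1\le i\le k-1$) together with the $p_j$. **Quantum group.** $\mathbf U_q(\mathfrak{gl}_2)$ is generated by $E,F,K_1^{\pm1},K_2^{\pm1}$ with relations $K_1K_2=K_2K_1$, $K_iK_i^{-1}=K_i^{-1}K_i=1$, $K_1EK_1^{-1}=qE$, $K_2EK_2^{-1}=q^{-1}E$, $K_1FK_1^{-1}=q^{-1}F$, $K_2FK_2^{-1}=qF$, $EF-FE=(K-K^{-1})/(q-q^{-1})$, $K=K_1K_2^{-1}$; coproduct $\Delta(E)=E\otimes K+1\otimes E$, $\Delta(F)=F\otimes1+K^{-1}\otimes F$, $\Delta(K_i)=K_i\otimes K_i$; counit $\epsilon(E)=\epsilon(F)=0$, $\epsilon(K_i)=1$. $V=V(0)\oplus V(1)$ with basis $\{v_1,v_0,v_{-1}\}$: $V(0)=\Bbbk v_0$ is trivial (acted on through $\epsilon$), and on $V(1)=\Bbbk v_1\oplus\Bbbk v_{-1}$: $Ev_1=0$, $Ev_{-1}=v_1$,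 $Fv_1=v_{-1}$, $Fv_{-1}=0$, $K_1v_1=qv_1$, $K_1v_{-1}=v_{-1}$, $K_2v_1=v_1$, $K_2v_{-1}=qv_{-1}$. $V^{\otimes k}$ is a module via the iterated coproduct. **Action of $\mathsf{PTL}_k(\delta)$ on $V^{\otimes k}$.** Write $v_{i,j}=v_i\otimes v_j$. $r_i,l_i,\varepsilon_i$ act in tensor positions $i,i+1$ (identity elsewhere) by the operators on $V\otimes V$: $r\,v_{i,j}=\delta_{j,0}v_{0,i}$, $l\,v_{i,j}=\delta_{i,0}v_{j,0}$ (Kronecker deltas), and $\varepsilon\,v_{1,-1}=\pm(q\,v_{1,-1}-v_{-1,1})$, $\varepsilon\,v_{-1,1}=\pm(-v_{1,-1}+q^{-1}v_{-1,1})$, $\varepsilon\,v_{i,j}=0$ otherwise, with the same sign as in $\delta=1\pm(q+q^{-1})$; $p_j$ acts as the projection $V\to V(0)$ (killing $V(1)$) in position $j$. *)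

theory Defs
  imports
    "HOL-Algebra.Algebra"
    "HOL-Library.Poly_Mapping"
    "HOL-Library.Product_Plus"
    "HOL-Library.Disjoint_Sets"
begin

text \<open>
  A vector space with basis \<open>'b\<close> over the field \<open>'a\<close> is modelled by the type \<open>'b \<Rightarrow>\<^sub>0 'a\<close> of
  finitely supported functions, or by the functions supported on a given subset of \<open>'b\<close>.
\<close>

definition scale :: "'a \<Rightarrow> ('b \<Rightarrow>\<^sub>0 'a) \<Rightarrow> ('b \<Rightarrow>\<^sub>0 'a::field)" where
  "scale c x = Poly_Mapping.map (\<lambda>a. c * a) x"

definition lin_ext :: "('b \<Rightarrow> 'c \<Rightarrow>\<^sub>0 'a) \<Rightarrow> ('b \<Rightarrow>\<^sub>0 'a) \<Rightarrow> ('c \<Rightarrow>\<^sub>0 'a::field)" where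
  "lin_ext f x = (\<Sum>b\<in>Poly_Mapping.keys x. scale (Poly_Mapping.lookup x b) (f b))"

definition alg_hom ::
  "('a, 'x, 'm) module_scheme \<Rightarrow> ('a, 'y, 'n) module_scheme \<Rightarrow> ('x \<Rightarrow> 'y) set" where
  "alg_hom A B = {f \<in> ring_hom A B. \<forall>c. \<forall>x\<in>carrier A. f (c \<odot>\<^bsub>A\<^esub> x) = c \<odot>\<^bsub>B\<^esub> f x}"

definition alg_iso ::
  "('a, 'x, 'm) module_scheme \<Rightarrow> ('a, 'y, 'n) module_scheme \<Rightarrow> ('x \<Rightarrow> 'y) set" where
  "alg_iso A B = {f \<in> alg_hom A B. bij_betw f (carrier A) (carrier B)}"

definition centralizer :: "('x, 'm) ring_scheme \<Rightarrow> 'x set \<Rightarrow> 'x set" where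
  "centralizer A S = {x \<in> carrier A. \<forall>s\<in>S. x \<otimes>\<^bsub>A\<^esub> s = s \<otimes>\<^bsub>A\<^esub> x}"


section \<open>Motzkin diagrams and the Motzkin algebra\<close>

text \<open>\<open>Top i\<close> and \<open>Bot i\<close> stand for \<open>i\<close> and \<open>i'\<close>.\<close>

datatype vertex = Top nat | Bot nat

type_synonym diagram = "vertex set set"

definition vertices :: "nat \<Rightarrow> vertex set" where
  "vertices k = Top ` {1..k} \<union> Bot ` {1..k}"

text \<open>
  \<open>circ k\<close> lists the vertices in the order in which they are met when the boundary of the
  rectangle is traversed once.  Arcs inside the rectangle joining two pairs of boundary points can
  be drawn disjointly iff the pairs do not interleave in this order.
\<close>

fun circ :: "nat \<Rightarrow> vertex \<Rightarrow> nat" where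
  "circ k (Top i) = i"
| "circ k (Bot i) = 2 * k + 1 - i"

definition noncrossing :: "nat \<Rightarrow> diagram \<Rightarrow> bool" where
  "noncrossing k d \<longleftrightarrow>
     \<not> (\<exists>u v x y. {u, v} \<in> d \<and> {x, y} \<in> d \<and>
          circ k u < circ k x \<and> circ k x < circ k v \<and> circ k v < circ k y)"

definition motzkin_diagrams :: "nat \<Rightarrow> diagram set" where
  "motzkin_diagrams k =
     {d. partition_on (vertices k) d \<and> (\<forall>B\<in>d. card B \<le> 2) \<and> noncrossing k d}"

definition cups :: "diagram \<Rightarrow> diagram" where
  "cups d = {B \<in> d. card B = 2 \<and> B \<subseteq> range Top}"

definition caps :: "diagram \<Rightarrow> diagram" where
  "caps d = {B \<in> d. card B = 2 \<and> B \<subseteq> range Bot}"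

text \<open>
  Stacking \<open>d1\<close> above \<open>d2\<close> gives a graph on three rows; the bottom row of \<open>d1\<close> is identified with
  the top row of \<open>d2\<close>.
\<close>

datatype stacked = Upper nat | Middle nat | Lower nat

fun in_upper :: "vertex \<Rightarrow> stacked" where
  "in_upper (Top i) = Upper i"
| "in_upper (Bot i) = Middle i"

fun in_lower :: "vertex \<Rightarrow> stacked" where
  "in_lower (Top i) = Middle i"
| "in_lower (Bot i) = Lower i"

fun outer :: "vertex \<Rightarrow> stacked" where
  "outer (Top i) = Upper i"
| "outer (Bot i) = Lower i"

definition linked :: "diagram \<Rightarrow> diagram \<Rightarrow> stacked rel" where
  "linked d1 d2 =
     (\<Union>B\<in>d1. in_upper ` B \<times> in_upper ` B) \<union> (\<Union>B\<in>d2. in_lower ` B \<times> in_lower ` B)"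

definition components :: "diagram \<Rightarrow> diagram \<Rightarrow> stacked set set" where
  "components d1 d2 = Field (linked d1 d2) // (linked d1 d2)\<^sup>+"

definition diagram_comp :: "diagram \<Rightarrow> diagram \<Rightarrow> diagram" where
  "diagram_comp d1 d2 = (\<lambda>C. outer -` C) ` components d1 d2 - {{}}"

text \<open>
  A component contained in the middle row is either a path or a closed loop; it is a loop iff
  each of its vertices lies on an edge of \<open>d1\<close> and on an edge of \<open>d2\<close>.
\<close>

definition loops :: "diagram \<Rightarrow> diagram \<Rightarrow> nat" where
  "loops d1 d2 = card {C \<in> components d1 d2. C \<subseteq> range Middle \<and>
     (\<forall>i. Middle i \<in> C \<longrightarrow>
        (\<exists>B\<in>d1. Bot i \<in> B \<and> card B = 2) \<and> (\<exists>B\<in>d2. Top i \<in> B \<and> card B = 2))}"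

definition id_diagram :: "nat \<Rightarrow> diagram" where
  "id_diagram k = (\<lambda>i. {Top i, Bot i}) ` {1..k}"

definition p_diagram :: "nat \<Rightarrow> nat \<Rightarrow> diagram" where
  "p_diagram k j = (\<lambda>i. {Top i, Bot i}) ` ({1..k} - {j}) \<union> {{Top j}, {Bot j}}"

definition e_diagram :: "nat \<Rightarrow> nat \<Rightarrow> diagram" where
  "e_diagram k i = (\<lambda>j. {Top j, Bot j}) ` ({1..k} - {i, i + 1}) \<union>
     {{Top i, Top (i + 1)}, {Bot i, Bot (i + 1)}}"

definition r_diagram :: "nat \<Rightarrow> nat \<Rightarrow> diagram" where
  "r_diagram k i = (\<lambda>j. {Top j, Bot j}) ` ({1..k} - {i, i + 1}) \<union>
     {{Top (i + 1), Bot i}, {Top i}, {Bot (i + 1)}}"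

definition l_diagram :: "nat \<Rightarrow> nat \<Rightarrow> diagram" where
  "l_diagram k i = (\<lambda>j. {Top j, Bot j}) ` ({1..k} - {i, i + 1}) \<union>
     {{Top i, Bot (i + 1)}, {Top (i + 1)}, {Bot i}}"

definition motzkin_mult ::
  "'a \<Rightarrow> (diagram \<Rightarrow>\<^sub>0 'a) \<Rightarrow> (diagram \<Rightarrow>\<^sub>0 'a) \<Rightarrow> (diagram \<Rightarrow>\<^sub>0 'a::field)" where
  "motzkin_mult \<delta> x y =
     lin_ext (\<lambda>d1. lin_ext (\<lambda>d2.
       Poly_Mapping.single (diagram_comp d1 d2) (\<delta> ^ loops d1 d2)) y) x"

definition Motzkin :: "'a \<Rightarrow> nat \<Rightarrow> ('a::field, diagram \<Rightarrow>\<^sub>0 'a) module" where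
  "Motzkin \<delta> k =
     \<lparr>carrier = {x. Poly_Mapping.keys x \<subseteq> motzkin_diagrams k},
      monoid.mult = motzkin_mult \<delta>,
      one = Poly_Mapping.single (id_diagram k) 1,
      ring.zero = 0,
      ring.add = (+),
      smult = scale\<rparr>"


section \<open>The partial Temperley--Lieb algebra\<close>

definition one_minus_p :: "nat \<Rightarrow> nat \<Rightarrow> (diagram \<Rightarrow>\<^sub>0 'a::field)" where
  "one_minus_p k j = Poly_Mapping.single (id_diagram k) 1 - Poly_Mapping.single (p_diagram k j) 1"

text \<open>The elements \<open>p\<^sub>j\<close> commute with each other, so the order of the factors is immaterial.\<close>

definition tilde :: "'a \<Rightarrow> nat \<Rightarrow> diagram \<Rightarrow> (diagram \<Rightarrow>\<^sub>0 'a::field)" where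
  "tilde \<delta> k d =
     foldl (\<lambda>x j. x \<otimes>\<^bsub>Motzkin \<delta> k\<^esub> one_minus_p k j)
       (foldr (\<lambda>i x. one_minus_p k i \<otimes>\<^bsub>Motzkin \<delta> k\<^esub> x)
          (filter (\<lambda>i. Top i \<in> \<Union>(cups d)) [1..<k + 1])
          (Poly_Mapping.single d 1))
       (filter (\<lambda>j. Bot j \<in> \<Union>(caps d)) [1..<k + 1])"

definition balanced_diagrams :: "nat \<Rightarrow> diagram set" where
  "balanced_diagrams k = {d \<in> motzkin_diagrams k. card (cups d) = card (caps d)}"

text \<open>The set of balanced diagrams is finite, so the carrier below is the linear span.\<close>

definition PTL :: "'a \<Rightarrow> nat \<Rightarrow> ('a::field, diagram \<Rightarrow>\<^sub>0 'a) module" where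
  "PTL \<delta> k = (Motzkin \<delta> k)
     \<lparr>carrier := {x. \<exists>c. x = (\<Sum>d\<in>balanced_diagrams k. scale (c d) (tilde \<delta> k d))}\<rparr>"


section \<open>The quantum group\<close>

text \<open>
  With concatenation as addition on lists, \<open>'g list \<Rightarrow>\<^sub>0 'a\<close> with its convolution product is the
  free associative algebra on \<open>'g\<close>, and \<open>('g list \<times> 'g list) \<Rightarrow>\<^sub>0 'a\<close> is its tensor square.
\<close>

instantiation list :: (type) monoid_add
begin

definition zero_list :: "'a list" where "zero_list = []"

definition plus_list :: "'a list \<Rightarrow> 'a list \<Rightarrow> 'a list" where "plus_list xs ys = xs @ ys"

instance
  by standard (simp_all add: zero_list_def plus_list_def)

end

text \<open>\<open>K1i\<close> and \<open>K2i\<close> stand for the inverses of \<open>K1\<close> and \<open>K2\<close>.\<close>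

datatype gen = E | F | K1 | K1i | K2 | K2i

type_synonym 'a free_alg = "gen list \<Rightarrow>\<^sub>0 'a"

definition free_gen :: "gen \<Rightarrow> 'a::field free_alg" where
  "free_gen a = Poly_Mapping.single [a] 1"

definition free_const :: "'a::field \<Rightarrow> 'a free_alg" where
  "free_const c = Poly_Mapping.single [] c"

definition Uq_relators :: "'a::field \<Rightarrow> 'a free_alg set" where
  "Uq_relators q =
    {free_gen K1 * free_gen K2 - free_gen K2 * free_gen K1,
     free_gen K1 * free_gen K1i - 1, free_gen K1i * free_gen K1 - 1,
     free_gen K2 * free_gen K2i - 1, free_gen K2i * free_gen K2 - 1,
     free_gen K1 * free_gen E * free_gen K1i - free_const q * free_gen E,
     free_gen K2 * free_gen E * free_gen K2i - free_const (inverse q) * free_gen E,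
     free_gen K1 * free_gen F * free_gen K1i - free_const (inverse q) * free_gen F,
     free_gen K2 * free_gen F * free_gen K2i - free_const q * free_gen F,
     (free_gen E * free_gen F - free_gen F * free_gen E)
       - free_const (1 / (q - inverse q)) * (free_gen K1 * free_gen K2i - free_gen K2 * free_gen K1i)}"

definition free_ring :: "'a::field free_alg ring" where
  "free_ring = \<lparr>carrier = UNIV, monoid.mult = (*), one = 1, ring.zero = 0, ring.add = (+)\<rparr>"

definition Uq :: "'a::field \<Rightarrow> 'a free_alg set ring" where
  "Uq q = free_ring Quot (Idl\<^bsub>free_ring\<^esub> (Uq_relators q))"

text \<open>
  The coproduct and the counit, lifted to the free algebra.  The basis element \<open>(a, b)\<close> of the
  tensor square stands for \<open>a \<otimes> b\<close>; again \<open>K = K1 K2i\<close> and its inverse is \<open>K2 K1i\<close>.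
\<close>

fun coproduct_gen :: "gen \<Rightarrow> ((gen list \<times> gen list) \<Rightarrow>\<^sub>0 'a::field)" where
  "coproduct_gen E = Poly_Mapping.single ([E], [K1, K2i]) 1 + Poly_Mapping.single ([], [E]) 1"
| "coproduct_gen F = Poly_Mapping.single ([F], []) 1 + Poly_Mapping.single ([K2, K1i], [F]) 1"
| "coproduct_gen a = Poly_Mapping.single ([a], [a]) 1"

definition coproduct :: "'a free_alg \<Rightarrow> ((gen list \<times> gen list) \<Rightarrow>\<^sub>0 'a::field)" where
  "coproduct = lin_ext (\<lambda>w. prod_list (map coproduct_gen w))"

fun counit_gen :: "gen \<Rightarrow> 'a::field" where
  "counit_gen E = 0"
| "counit_gen F = 0"
| "counit_gen a = 1"

definition counit :: "'a free_alg \<Rightarrow> 'a::field" where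
  "counit u = (\<Sum>w\<in>Poly_Mapping.keys u. Poly_Mapping.lookup u w * prod_list (map counit_gen w))"


section \<open>The module \<open>V\<close> and its tensor powers\<close>

text \<open>The basis vectors \<open>v\<^sub>1\<close>, \<open>v\<^sub>0\<close>, \<open>v\<^sub>-\<^sub>1\<close> of \<open>V = V(0) \<oplus> V(1)\<close>.\<close>

datatype basis = Pos | Nul | Neg

fun V_gen :: "'a::field \<Rightarrow> gen \<Rightarrow> basis \<Rightarrow> (basis \<Rightarrow>\<^sub>0 'a)" where
  "V_gen q a Nul = Poly_Mapping.single Nul (counit_gen a)"
| "V_gen q E Pos = 0"
| "V_gen q E Neg = Poly_Mapping.single Pos 1"
| "V_gen q F Pos = Poly_Mapping.single Neg 1"
| "V_gen q F Neg = 0"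
| "V_gen q K1 Pos = Poly_Mapping.single Pos q"
| "V_gen q K1 Neg = Poly_Mapping.single Neg 1"
| "V_gen q K1i Pos = Poly_Mapping.single Pos (inverse q)"
| "V_gen q K1i Neg = Poly_Mapping.single Neg 1"
| "V_gen q K2 Pos = Poly_Mapping.single Pos 1"
| "V_gen q K2 Neg = Poly_Mapping.single Neg q"
| "V_gen q K2i Pos = Poly_Mapping.single Pos 1"
| "V_gen q K2i Neg = Poly_Mapping.single Neg (inverse q)"

definition V_act :: "'a::field \<Rightarrow> gen list \<Rightarrow> (basis \<Rightarrow>\<^sub>0 'a) \<Rightarrow> (basis \<Rightarrow>\<^sub>0 'a)" where
  "V_act q w = foldr (\<lambda>a. lin_ext (V_gen q a)) w"

text \<open>
  The \<open>k\<close>-fold tensor power of \<open>V\<close> has as basis the words of length \<open>k\<close>; concatenation of words,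
  that is, the product of \<open>basis list \<Rightarrow>\<^sub>0 'a\<close>, is the tensor product of vectors.
\<close>

type_synonym 'a tensor = "basis list \<Rightarrow>\<^sub>0 'a"

definition tensor_power :: "nat \<Rightarrow> 'a::field tensor set" where
  "tensor_power k = {x. \<forall>w\<in>Poly_Mapping.keys x. length w = k}"

definition V_to_tensor :: "(basis \<Rightarrow>\<^sub>0 'a) \<Rightarrow> 'a::field tensor" where
  "V_to_tensor = lin_ext (\<lambda>b. Poly_Mapping.single [b] 1)"

text \<open>
  The action through the iterated coproduct: \<open>V\<^sup>\<otimes>\<^sup>0\<close> is the trivial module, and \<open>u\<close> acts on
  \<open>v \<otimes> x\<close>, with \<open>v\<close> in \<open>V\<close> and \<open>x\<close> in the \<open>k\<close>-th power, as the sum of all \<open>u1 v \<otimes> u2 x\<close>, where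
  \<open>u1 \<otimes> u2\<close> runs over the terms of the coproduct of \<open>u\<close>.
\<close>

primrec free_act :: "'a::field \<Rightarrow> nat \<Rightarrow> 'a free_alg \<Rightarrow> 'a tensor \<Rightarrow> 'a tensor" where
  "free_act q 0 u = scale (counit u)"
| "free_act q (Suc k) u =
     lin_ext (\<lambda>w. lin_ext (\<lambda>(a, b).
         V_to_tensor (V_act q a (Poly_Mapping.single (hd w) 1)) *
         free_act q k (Poly_Mapping.single b 1) (Poly_Mapping.single (tl w) 1))
       (coproduct u))"

definition End_space :: "nat \<Rightarrow> ('a::field tensor \<Rightarrow> 'a tensor) set" where
  "End_space k = {T \<in> tensor_power k \<rightarrow>\<^sub>E tensor_power k.
     (\<forall>x\<in>tensor_power k. \<forall>y\<in>tensor_power k. T (x + y) = T x + T y) \<and>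
     (\<forall>c. \<forall>x\<in>tensor_power k. T (scale c x) = scale c (T x))}"

definition End_alg :: "nat \<Rightarrow> ('a::field, 'a tensor \<Rightarrow> 'a tensor) module" where
  "End_alg k =
     \<lparr>carrier = End_space k,
      monoid.mult = compose (tensor_power k),
      one = (\<lambda>x\<in>tensor_power k. x),
      ring.zero = (\<lambda>x\<in>tensor_power k. 0),
      ring.add = (\<lambda>S T. \<lambda>x\<in>tensor_power k. S x + T x),
      smult = (\<lambda>c T. \<lambda>x\<in>tensor_power k. scale c (T x))\<rparr>"

text \<open>
  An element of the quotient ring \<open>Uq q\<close> is a coset in the free algebra, and all its members
  act by the same operator on the tensor power.
\<close>

definition Uq_rep :: "'a::field \<Rightarrow> nat \<Rightarrow> 'a free_alg set \<Rightarrow> 'a tensor \<Rightarrow> 'a tensor" where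
  "Uq_rep q k C = the_elem ((\<lambda>u. \<lambda>x\<in>tensor_power k. free_act q k u x) ` C)"

definition End_Uq :: "'a \<Rightarrow> nat \<Rightarrow> ('a::field, 'a tensor \<Rightarrow> 'a tensor) module" where
  "End_Uq q k = (End_alg k)
     \<lparr>carrier := {T \<in> End_space k. \<forall>C\<in>carrier (Uq q). \<forall>x\<in>tensor_power k.
        T (Uq_rep q k C x) = Uq_rep q k C (T x)}\<rparr>"


section \<open>The action of the partial Temperley--Lieb algebra\<close>

text \<open>
  The operator on the \<open>k\<close>-th tensor power that applies \<open>A\<close> (given on basis words of length \<open>n\<close>) to
  the tensor positions \<open>m + 1, \<dots>, m + n\<close>.
\<close>

definition local_op ::
  "nat \<Rightarrow> nat \<Rightarrow> nat \<Rightarrow> (basis list \<Rightarrow> 'a tensor) \<Rightarrow> 'a::field tensor \<Rightarrow> 'a tensor" where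
  "local_op k m n A = (\<lambda>x\<in>tensor_power k. lin_ext (\<lambda>w.
     Poly_Mapping.single (take m w) 1 * A (take n (drop m w)) *
     Poly_Mapping.single (drop (m + n) w) 1) x)"

fun r_op :: "basis list \<Rightarrow> 'a::field tensor" where
  "r_op [i, j] = (if j = Nul then Poly_Mapping.single [Nul, i] 1 else 0)"
| "r_op _ = 0"

fun l_op :: "basis list \<Rightarrow> 'a::field tensor" where
  "l_op [i, j] = (if i = Nul then Poly_Mapping.single [j, Nul] 1 else 0)"
| "l_op _ = 0"

fun p_op :: "basis list \<Rightarrow> 'a::field tensor" where
  "p_op [i] = (if i = Nul then Poly_Mapping.single [Nul] 1 else 0)"
| "p_op _ = 0"

fun eps_op :: "'a \<Rightarrow> 'a \<Rightarrow> basis list \<Rightarrow> 'a::field tensor" where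
  "eps_op s q [Pos, Neg] =
     scale s (Poly_Mapping.single [Pos, Neg] q - Poly_Mapping.single [Neg, Pos] 1)"
| "eps_op s q [Neg, Pos] =
     scale s (- Poly_Mapping.single [Pos, Neg] 1 + Poly_Mapping.single [Neg, Pos] (inverse q))"
| "eps_op s q _ = 0"

text \<open>
  \<open>\<rho>\<close> is the action of \<open>PTL \<delta> k\<close>: the homomorphism with the given values on the generators.
  The sign in the action of \<open>\<epsilon>\<^sub>i\<close> is \<open>s\<close>.
\<close>

definition PTL_action ::
  "'a \<Rightarrow> 'a \<Rightarrow> 'a \<Rightarrow> nat \<Rightarrow> ((diagram \<Rightarrow>\<^sub>0 'a) \<Rightarrow> 'a tensor \<Rightarrow> 'a::field tensor) \<Rightarrow> bool" where
  "PTL_action \<delta> s q k \<rho> \<longleftrightarrow>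
     \<rho> \<in> alg_hom (PTL \<delta> k) (End_alg k) \<and>
     (\<forall>j\<in>{1..k}. \<rho> (Poly_Mapping.single (p_diagram k j) 1) = local_op k (j - 1) 1 p_op) \<and>
     (\<forall>i\<in>{1..<k}.
        \<rho> (Poly_Mapping.single (r_diagram k i) 1) = local_op k (i - 1) 2 r_op \<and>
        \<rho> (Poly_Mapping.single (l_diagram k i) 1) = local_op k (i - 1) 2 l_op \<and>
        \<rho> (tilde \<delta> k (e_diagram k i)) = local_op k (i - 1) 2 (eps_op s q))"

end

theory Submission
  imports Defs
begin

text \<open>
  With \<open>t = - s q\<close>, so that \<open>\<delta> = 1 - t - 1/t\<close>, a diagram acts by the matrix whose entries are the
  products of local arc weights (an invariant form on \<open>V(1)\<close> and the trivial form on \<open>V(0)\<close>) over its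
  blocks.  Contracting two neighbouring points of a planar matching multiplies the weight by \<open>\<delta>\<close>
  if they form an arc and merges their blocks otherwise; hence stacking diagrams corresponds to
  multiplying matrices.  Conjugation by signs passes from \<open>t\<close> to \<open>q\<close>.

  The operators commute with \<open>E\<close> since the two terms coming from the ends of an arc cancel.  Folding
  the bottom row around turns an operator commuting with \<open>E\<close> and the \<open>K\<^sub>i\<close> into a highest weight
  vector of weight \<open>0\<close> in \<open>2 k\<close> tensor factors.  Such a vector is determined by its coefficients at
  ballot words, and ballot words correspond to the balanced diagrams in such a way that the
  coefficients of the \<open>tilde\<close> elements at them form a triangular matrix; this gives both spanning and
  linear independence.  Commutation with \<open>F\<close> is automatic: the commutator would be a highest weight
  vector of weight \<open>-2\<close>, and there is none when \<open>q\<close> is not a root of unity.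

  Conversely, \<open>V\<^sup>\<otimes>\<^sup>k\<close> is spanned by the ladders \<open>F\<^sup>i u\<close> over the highest weight vectors \<open>u\<close>, and the
  projections onto their rungs are polynomials in \<open>E\<close>, \<open>F\<close>, \<open>K\<^sub>1\<close>, \<open>K\<^sub>2\<close>.  An operator commuting with
  all maps between ladders of the same type acts on each ladder by a matrix depending only on the
  type, so it is a combination of products of these projections with powers of \<open>F\<close> and \<open>E\<close>.
\<close>

section \<open>Weights of planar matchings\<close>

text \<open>The action has to be a homomorphism on the whole span of the diagrams. Instead of
  checking relations among generators, every Motzkin diagram gets a matrix for every parameter t,
  and multiplicativity is reduced to joining one pair of neighbouring points at a time. A closed
  loop is worth 1 from V(0) and - t - 1/t from V(1); this forces t = - s q and hence the conjugation
  by signs.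

  The obstacle is that E and K = K1/K2 do not see the number of letters in V(1): a bare cup also
  produces v_0 \<otimes> v_0, so its matrix commutes with the raising operator but not with K1 K2,
  which multiplies a word by q to that number. The factors 1 - p_j in a \<open>tilde\<close> element
  delete exactly these terms. Afterwards the number changes by twice the excess of cups over caps,
  so that balanced diagrams preserve it.

  Complete reducibility is not quoted but obtained by solving equations in E rung by rung. That q is
  not a root of unity enters through nonzero quantum integers and distinct powers of q.\<close>

fun neg :: "basis \<Rightarrow> basis" where
  "neg Pos = Neg" | "neg Nul = Nul" | "neg Neg = Pos"

lemma neg_neg [simp]: "neg (neg b) = b"
  by (cases b) auto

lemma UNIV_basis: "UNIV = {Pos, Nul, Neg}"
  using basis.exhaust by auto

instance basis :: finite
  by standard (simp add: UNIV_basis)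

lemma sum_basis: "(\<Sum>b\<in>UNIV. g b) = g Pos + g Nul + g Neg"
  for g :: "basis \<Rightarrow> 'b::comm_monoid_add"
  by (simp add: UNIV_basis add.assoc)

text \<open>The two ends of an arc are paired by this form, left end first. On V(1) the ratio - 1/t
  is the one for which the vector with these coefficients is killed by
  \<open>raising t\<close>.\<close>

fun arc :: "'a::field \<Rightarrow> basis \<Rightarrow> basis \<Rightarrow> 'a" where
  "arc t Nul Nul = 1"
| "arc t Pos Neg = 1"
| "arc t Neg Pos = - inverse t"
| "arc t _ _ = 0"

text \<open>Coefficients of the copairing inverse to \<open>arc\<close>: v_c \<otimes> v_(neg c)
  occurs with coefficient \<open>fold_wt t c\<close>. Inserted between two arcs it merges them into
  one, and paired with itself it gives the loop value - t + 1 - 1/t.\<close>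

fun fold_wt :: "'a::field \<Rightarrow> basis \<Rightarrow> 'a" where
  "fold_wt t Pos = - t" | "fold_wt t Nul = 1" | "fold_wt t Neg = 1"

text \<open>An isolated point only admits the letter of V(0). \<open>Min\<close> and
  \<open>Max\<close> orient an arc, which matters because \<open>arc\<close> is not
  symmetric.\<close>

definition block_wt :: "'a::field \<Rightarrow> (nat \<Rightarrow> basis) \<Rightarrow> nat set \<Rightarrow> 'a" where
  "block_wt t x B =
     (if Min B = Max B then of_bool (x (Min B) = Nul) else arc t (x (Min B)) (x (Max B)))"

definition matching_wt :: "'a::field \<Rightarrow> nat set set \<Rightarrow> (nat \<Rightarrow> basis) \<Rightarrow> 'a" where
  "matching_wt t D x = (\<Prod>B\<in>D. block_wt t x B)"

text \<open>Two points c, d of one block lie both or neither between two points a, b of another. In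
  this form no end has to be named as left or right, and singletons satisfy the condition
  trivially.\<close>

definition planar :: "nat set set \<Rightarrow> bool" where
  "planar D \<longleftrightarrow> (\<forall>B\<in>D. \<forall>B'\<in>D. B \<noteq> B' \<longrightarrow> (\<forall>a\<in>B. \<forall>b\<in>B. \<forall>c\<in>B'. \<forall>d\<in>B'.
     ((a < c) = (b < c)) = ((a < d) = (b < d))))"

definition planar_matching :: "nat set \<Rightarrow> nat set set \<Rightarrow> bool" where
  "planar_matching S D \<longleftrightarrow> finite S \<and> partition_on S D \<and> (\<forall>B\<in>D. card B \<le> 2) \<and> planar D"

text \<open>The matching left after the points \<open>u\<close> and \<open>v\<close> are joined by an arc and removed.\<close>

definition contract :: "nat \<Rightarrow> nat \<Rightarrow> nat set set \<Rightarrow> nat set set" where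
  "contract u v D = insert (\<Union>{B \<in> D. u \<in> B \<or> v \<in> B} - {u, v}) {B \<in> D. u \<notin> B \<and> v \<notin> B} - {{}}"

lemma block_wt_single [simp]: "block_wt t x {a} = of_bool (x a = Nul)"
  by (simp add: block_wt_def)

lemma block_wt_pair: "a < b \<Longrightarrow> block_wt t x {a, b} = arc t (x a) (x b)"
  by (simp add: block_wt_def)

lemma block_wt_pair': "a < b \<Longrightarrow> block_wt t x {b, a} = arc t (x a) (x b)"
  by (simp add: block_wt_def)

lemma block_wt_cong:
  assumes "finite B" "B \<noteq> {}" "\<And>p. p \<in> B \<Longrightarrow> x p = y p"
  shows "block_wt t x B = block_wt t y B"
  using assms Min_in[of B] Max_in[of B] by (simp add: block_wt_def)

lemma partition_block_unique:
  assumes "partition_on S D" "B \<in> D" "B' \<in> D" "a \<in> B" "a \<in> B'"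
  shows "B = B'"
  using assms disjointD[of D B B'] unfolding partition_on_def by blast

lemma matching_finite:
  assumes "planar_matching S D"
  shows "finite D" "B \<in> D \<Longrightarrow> finite B" "B \<in> D \<Longrightarrow> B \<noteq> {}" "B \<in> D \<Longrightarrow> B \<subseteq> S"
  using assms finite_elements[of S D] unfolding planar_matching_def partition_on_def
  by (auto intro: finite_subset)

lemma card_le_2_cases:
  assumes "finite B" "a \<in> B" "card B \<le> 2"
  obtains "B = {a}" | b where "b \<noteq> a" "B = {a, b}"
proof -
  have "card (B - {a}) \<le> 1" using assms by simp
  moreover have "finite (B - {a})" using assms by simp
  ultimately have "B - {a} = {} \<or> (\<exists>b. B - {a} = {b})"
    by (metis One_nat_def card_0_eq card_1_singletonE le_Suc_eq le_zero_eq)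
  then show ?thesis
  proof
    assume "B - {a} = {}" then show ?thesis using assms that(1) by blast
  next
    assume "\<exists>b. B - {a} = {b}"
    then obtain b where "B - {a} = {b}" ..
    then have "b \<noteq> a" "B = {a, b}" using assms by blast+
    then show ?thesis using that(2) by blast
  qed
qed

lemma matching_wt_cong:
  assumes "planar_matching S D" "\<And>p. p \<in> S \<Longrightarrow> x p = y p"
  shows "matching_wt t D x = matching_wt t D y"
  unfolding matching_wt_def
  using matching_finite[OF assms(1)] assms(2)
  by (intro prod.cong block_wt_cong) (auto, blast)

section \<open>Contraction of two neighbouring points\<close>

lemma contract_closed:
  assumes "partition_on S D" "{u, v} \<in> D"
  shows "contract u v D = D - {{u, v}}"
proof -
  have "{B \<in> D. u \<in> B \<or> v \<in> B} = {{u, v}}"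
    using assms partition_block_unique[OF assms(1)] by blast
  then show ?thesis
    using assms unfolding contract_def partition_on_def by auto
qed

text \<open>\<open>Bu\<close> and \<open>Bv\<close> may coincide. Removing \<open>{}\<close>
  discards the remainder when nothing is left of the merged block.\<close>

lemma contract_open:
  assumes "partition_on S D" "Bu \<in> D" "Bv \<in> D" "u \<in> Bu" "v \<in> Bv"
  shows "contract u v D = insert (Bu \<union> Bv - {u, v}) (D - {Bu, Bv}) - {{}}"
proof -
  have *: "{B \<in> D. u \<in> B \<or> v \<in> B} = {Bu, Bv}"
    using assms partition_block_unique[OF assms(1)] by blast
  then have "{B \<in> D. u \<notin> B \<and> v \<notin> B} = D - {Bu, Bv}" by blast
  then show ?thesis
    unfolding contract_def * by simp
qed

lemma planarD:
  assumes "planar D" "B \<in> D" "B' \<in> D" "B \<noteq> B'" "a \<in> B" "b \<in> B" "c \<in> B'" "d \<in> B'"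
  shows "((a < c) = (b < c)) = ((a < d) = (b < d))"
  using assms(1)[unfolded planar_def, rule_format, OF assms(2-8)] .

lemma partition_on_contract:
  assumes "partition_on S D" "u \<in> S" "v \<in> S"
  shows "partition_on (S - {u, v}) (contract u v D)"
proof -
  obtain Bu Bv where B: "Bu \<in> D" "u \<in> Bu" "Bv \<in> D" "v \<in> Bv"
    using assms unfolding partition_on_def by blast
  have S: "\<Union>D = S" and dis: "disjoint D" and ne: "{} \<notin> D"
    using assms unfolding partition_on_def by auto
  have uni: "\<And>Z Y z. Z \<in> D \<Longrightarrow> Y \<in> D \<Longrightarrow> z \<in> Z \<Longrightarrow> z \<in> Y \<Longrightarrow> Z = Y"
    using partition_block_unique[OF assms(1)] by blast
  show ?thesis
    unfolding contract_open[OF assms(1) B(1,3,2,4)] 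
  proof (rule partition_onI)
    show "\<Union> (insert (Bu \<union> Bv - {u, v}) (D - {Bu, Bv}) - {{}}) = S - {u, v}"
    proof -
      have "z \<in> \<Union>(D - {Bu, Bv}) \<longleftrightarrow> z \<in> \<Union>D \<and> z \<notin> Bu \<and> z \<notin> Bv" for z
        using uni[OF _ B(1), of _ z] uni[OF _ B(3), of _ z] by blast
      then have "\<Union>(D - {Bu, Bv}) = S - Bu - Bv"
        unfolding S[symmetric] by blast
      moreover have "Bu \<subseteq> S" "Bv \<subseteq> S" using B S by auto
      moreover have "\<Union>(insert A \<D> - {{}}) = A \<union> \<Union>\<D>" for A :: "nat set" and \<D> by auto
      ultimately show ?thesis using B(2,4) by (simp only:) blast
    qed
  next
    fix p q
    assume "p \<in> insert (Bu \<union> Bv - {u, v}) (D - {Bu, Bv}) - {{}}"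
      "q \<in> insert (Bu \<union> Bv - {u, v}) (D - {Bu, Bv}) - {{}}" "p \<noteq> q"
    then show "disjnt p q"
      using B uni unfolding disjnt_def by blast
  qed auto
qed

text \<open>No point of S lies between u and v, so every other point sees both on the same side.
  Separation by points of the merged block thus reduces to separation by \<open>Bu\<close> and by
  \<open>Bv\<close>, with u and v as intermediaries.\<close>

lemma planar_contract:
  assumes "planar D" "partition_on S D" "u \<in> S" "v \<in> S" "u < v" "\<And>p. p \<in> S \<Longrightarrow> \<not> (u < p \<and> p < v)"
  shows "planar (contract u v D)"
proof -
  obtain Bu Bv where B: "Bu \<in> D" "u \<in> Bu" "Bv \<in> D" "v \<in> Bv"
    using assms unfolding partition_on_def by blast
  have S: "\<Union>D = S" using assms unfolding partition_on_def by auto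
  have key: "((a < c) = (b < c)) = ((a < d) = (b < d))"
    if Z: "Z \<in> D" "Z \<noteq> Bu" "Z \<noteq> Bv" and cd: "c \<in> Z" "d \<in> Z"
      and ab: "a \<in> Bu \<union> Bv - {u, v}" "b \<in> Bu \<union> Bv - {u, v}" for Z a b c d
  proof -
    have "c \<noteq> u" "c \<noteq> v" "d \<noteq> u" "d \<noteq> v"
      using Z cd B partition_block_unique[OF assms(2)] by blast+
    moreover have "c \<in> S" "d \<in> S" using Z cd S by auto
    ultimately have uv: "(u < c) = (v < c)" "(u < d) = (v < d)"
      using assms(5,6) by (metis less_trans linorder_neqE_nat)+
    have pl: "((a' < c) = (b' < c)) = ((a' < d) = (b' < d))"
      if "a' \<in> Y" "b' \<in> Y" "Y \<in> D" "Z \<noteq> Y" for a' b' Y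
      using planarD[OF assms(1) that(3) Z(1)] that cd by blast
    from ab consider "a \<in> Bu" "b \<in> Bu" | "a \<in> Bv" "b \<in> Bv" | "a \<in> Bu" "b \<in> Bv" | "a \<in> Bv" "b \<in> Bu"
      by blast
    then show ?thesis
    proof cases
      case 1 then show ?thesis using pl B Z by blast
    next
      case 2 then show ?thesis using pl B Z by blast
    next
      case 3
      then show ?thesis using pl[OF 3(1) B(2,1) Z(2)] pl[OF 3(2) B(4,3) Z(3)] uv by argo
    next
      case 4
      then show ?thesis using pl[OF 4(2) B(2,1) Z(2)] pl[OF 4(1) B(4,3) Z(3)] uv by argo
    qed
  qed
  \<comment> \<open>The roles of the merged and the untouched block are exchanged; the inequalities
    may be flipped because points of different blocks are distinct.\<close>
  have key': "((c < a) = (d < a)) = ((c < b) = (d < b))"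
    if Z: "Z \<in> D" "Z \<noteq> Bu" "Z \<noteq> Bv" and cd: "c \<in> Z" "d \<in> Z"
      and ab: "a \<in> Bu \<union> Bv - {u, v}" "b \<in> Bu \<union> Bv - {u, v}" for Z a b c d
  proof -
    have "a \<noteq> c" "a \<noteq> d" "b \<noteq> c" "b \<noteq> d"
      using Z cd ab B partition_block_unique[OF assms(2)] by blast+
    then have "(c < a) = (\<not> a < c)" "(d < a) = (\<not> a < d)" "(c < b) = (\<not> b < c)" "(d < b) = (\<not> b < d)"
      by linarith+
    then show ?thesis using key[OF that] by argo
  qed
  show ?thesis
    unfolding contract_open[OF assms(2) B(1,3,2,4)] planar_def
  proof (intro ballI impI)
    fix Y Z a b c d
    assume Y: "Y \<in> insert (Bu \<union> Bv - {u, v}) (D - {Bu, Bv}) - {{}}"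
      and Z: "Z \<in> insert (Bu \<union> Bv - {u, v}) (D - {Bu, Bv}) - {{}}"
      and ne: "Y \<noteq> Z" and el: "a \<in> Y" "b \<in> Y" "c \<in> Z" "d \<in> Z"
    consider "Y \<in> D" "Z \<in> D" | "Y = Bu \<union> Bv - {u, v}" "Z \<in> D" "Z \<noteq> Bu" "Z \<noteq> Bv"
      | "Z = Bu \<union> Bv - {u, v}" "Y \<in> D" "Y \<noteq> Bu" "Y \<noteq> Bv"
    proof -
      have "Y = Bu \<union> Bv - {u, v} \<or> Y \<in> D \<and> Y \<noteq> Bu \<and> Y \<noteq> Bv"
        "Z = Bu \<union> Bv - {u, v} \<or> Z \<in> D \<and> Z \<noteq> Bu \<and> Z \<noteq> Bv"
        using Y Z by auto
      then show ?thesis using that ne by metis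
    qed
    then show "((a < c) = (b < c)) = ((a < d) = (b < d))"
    proof cases
      case 1 show ?thesis using planarD[OF assms(1) 1 ne el] .
    next
      case 2 show ?thesis using key[OF 2(2-4) el(3,4)] el(1,2) unfolding 2(1) by blast
    next
      case 3 show ?thesis using key'[OF 3(2-4) el(1,2)] el(3,4) unfolding 3(1) by blast
    qed
  qed
qed

lemma planar_matching_contract:
  assumes "planar_matching S D" "u \<in> S" "v \<in> S" "u < v" "\<And>p. p \<in> S \<Longrightarrow> \<not> (u < p \<and> p < v)"
  shows "planar_matching (S - {u, v}) (contract u v D)"
proof -
  have p: "partition_on S D" "planar D" "finite S" "\<And>B. B \<in> D \<Longrightarrow> card B \<le> 2"
    using assms unfolding planar_matching_def by auto
  obtain Bu Bv where B: "Bu \<in> D" "u \<in> Bu" "Bv \<in> D" "v \<in> Bv"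
    using p assms unfolding partition_on_def by blast
  have f: "finite Bu" "finite Bv" using B matching_finite[OF assms(1)] by auto
  have "card (Bu \<union> Bv - {u, v}) \<le> 2"
  proof -
    have "card (Bu \<union> Bv - {u, v}) \<le> card ((Bu - {u}) \<union> (Bv - {v}))"
      using f by (intro card_mono) auto
    also have "\<dots> \<le> card (Bu - {u}) + card (Bv - {v})" by (rule card_Un_le)
    also have "\<dots> \<le> 1 + 1" using p(4)[OF B(1)] p(4)[OF B(3)] B f by (intro add_mono) auto
    finally show ?thesis by simp
  qed
  then have "\<forall>Z\<in>contract u v D. card Z \<le> 2"
    unfolding contract_open[OF p(1) B(1,3,2,4)] using p(4) by auto
  then show ?thesis
    using partition_on_contract[OF p(1)] planar_contract[OF p(2,1)] assms p
    unfolding planar_matching_def by auto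
qed

text \<open>Arcs ending at two neighbours u < v either point away from each other, or both point to
  the same side with one nested inside the other.\<close>

lemma planar_pairs_order:
  fixes a b u v :: nat
  assumes "planar D" "{u, a} \<in> D" "{v, b} \<in> D" "{u, a} \<noteq> {v, b}" "u < v"
    "\<not> (u < a \<and> a < v)" "\<not> (u < b \<and> b < v)" "a \<noteq> u" "a \<noteq> v" "b \<noteq> u" "b \<noteq> v" "a \<noteq> b"
  shows "a < u \<and> v < b \<or> b < a \<and> a < u \<or> v < b \<and> b < a"
proof -
  have "((a < b) = (u < b)) = ((a < v) = (u < v))"
    using planarD[OF assms(1-4), of a u b v] by blast
  then show ?thesis using assms(5-) by linarith
qed

text \<open>Summing over the labels (c, neg c) inserts the copairing at u and v. Blocks away from u
  and v give a common factor; what remains is the loop value if u and v form an arc, and otherwise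
  the fact that the copairing joins two legs into one.\<close>

lemma matching_wt_contract:
  assumes "t \<noteq> 0" "planar_matching S D" "u \<in> S" "v \<in> S" "u < v"
    "\<And>p. p \<in> S \<Longrightarrow> \<not> (u < p \<and> p < v)"
  shows "(\<Sum>c\<in>UNIV. fold_wt t c * matching_wt t D (x(u := c, v := neg c))) =
    (if {u, v} \<in> D then 1 - t - inverse t else 1) * matching_wt t (contract u v D) x"
proof -
  have p: "partition_on S D" "planar D" "finite S" "\<And>B. B \<in> D \<Longrightarrow> card B \<le> 2"
    using assms unfolding planar_matching_def by auto
  note fin = matching_finite[OF assms(2)]
  obtain Bu Bv where B: "Bu \<in> D" "u \<in> Bu" "Bv \<in> D" "v \<in> Bv"
    using p assms unfolding partition_on_def by blast
  define W where "W = (\<Prod>B\<in>D - {Bu, Bv}. block_wt t x B)"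
  have rest: "(\<Prod>B\<in>D - {Bu, Bv}. block_wt t (x(u := c, v := c')) B) = W" for c c'
    unfolding W_def
  proof (rule prod.cong[OF refl])
    fix Z assume Z: "Z \<in> D - {Bu, Bv}"
    then have "u \<notin> Z" "v \<notin> Z" using B partition_block_unique[OF p(1)] by auto
    then show "block_wt t (x(u := c, v := c')) Z = block_wt t x Z"
      using Z fin by (intro block_wt_cong) auto
  qed
  show ?thesis
  proof (cases "Bu = Bv")
    case True
    then have uv: "{u, v} \<in> D"
      using card_le_2_cases[OF fin(2)[OF B(1)] B(2) p(4)[OF B(1)]] B assms(5)
      by (metis insertE less_irrefl singletonD)
    then have Bu: "Bu = {u, v}" using B partition_block_unique[OF p(1)] by blast
    have "matching_wt t D (x(u := c, v := neg c)) = arc t c (neg c) * W" for c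
    proof -
      have D: "D = insert {u, v} (D - {Bu, Bv})" "{u, v} \<notin> D - {Bu, Bv}"
        using uv Bu True by auto
      show ?thesis
        unfolding matching_wt_def
        by (subst D(1), subst prod.insert)
          (use D(2) fin(1) rest assms(5) block_wt_pair[OF assms(5), of t "x(u := c, v := neg c)"] in simp_all)
    qed
    moreover have "matching_wt t (contract u v D) x = W"
      unfolding contract_closed[OF p(1) uv] W_def matching_wt_def using True Bu by auto
    ultimately show ?thesis
      using uv by (simp add: sum_basis algebra_simps assms(1))
  next
    case False
    then have nuv: "{u, v} \<notin> D" using B partition_block_unique[OF p(1)] by (metis insertCI)
    have vnot: "v \<notin> Bu" "u \<notin> Bv" using B False partition_block_unique[OF p(1)] by blast+
    have split: "matching_wt t D y = block_wt t y Bu * block_wt t y Bv * (\<Prod>B\<in>D - {Bu, Bv}. block_wt t y B)" for y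
    proof -
      have D: "D = insert Bu (insert Bv (D - {Bu, Bv}))" using B by auto
      show ?thesis unfolding matching_wt_def
        by (subst D) (use fin False in \<open>simp add: mult.assoc\<close>)
    qed
    have new: "matching_wt t (contract u v D) x =
        (if Bu \<union> Bv - {u, v} = {} then 1 else block_wt t x (Bu \<union> Bv - {u, v})) * W"
    proof (cases "Bu \<union> Bv - {u, v} = {}")
      case True
      then have "contract u v D = D - {Bu, Bv}"
        unfolding contract_open[OF p(1) B(1,3,2,4)] using fin(3) by auto
      then show ?thesis using True by (simp add: matching_wt_def W_def)
    next
      case F: False
      then have C: "contract u v D = insert (Bu \<union> Bv - {u, v}) (D - {Bu, Bv})"
        unfolding contract_open[OF p(1) B(1,3,2,4)] using fin(3) by auto
      have "Bu \<union> Bv - {u, v} \<notin> D - {Bu, Bv}"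
      proof
        assume N: "Bu \<union> Bv - {u, v} \<in> D - {Bu, Bv}"
        from F obtain z where "z \<in> Bu \<union> Bv - {u, v}" by blast
        with N show False using B partition_block_unique[OF p(1)] by blast
      qed
      then show ?thesis
        unfolding if_not_P[OF F] C matching_wt_def W_def using fin(1) by simp
    qed
    \<comment> \<open>The local computation: each of \<open>Bu\<close> and \<open>Bv\<close> is a
      point or an arc, for two arcs \<open>planar_pairs_order\<close> leaves three relative
      positions, and each is a finite check over the labels.\<close>
    have main: "(\<Sum>c\<in>UNIV. fold_wt t c * (block_wt t (x(u := c, v := neg c)) Bu * block_wt t (x(u := c, v := neg c)) Bv)) =
        (if Bu \<union> Bv - {u, v} = {} then 1 else block_wt t x (Bu \<union> Bv - {u, v}))"
    proof (rule card_le_2_cases[OF fin(2)[OF B(1)] B(2) p(4)[OF B(1)]])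
      assume Bu: "Bu = {u}"
      show ?thesis
      proof (rule card_le_2_cases[OF fin(2)[OF B(3)] B(4) p(4)[OF B(3)]])
        assume Bv: "Bv = {v}"
        show ?thesis using assms(5) unfolding Bu Bv by (simp add: sum_basis)
      next
        fix b assume b: "b \<noteq> v" "Bv = {v, b}"
        then have "Bu \<union> Bv - {u, v} = {b}" "b \<noteq> u" using Bu vnot by auto
        then show ?thesis using assms(1,5) b unfolding Bu b(2)
          by (cases "b < v"; cases "x b") (auto simp: sum_basis block_wt_pair block_wt_pair')
      qed
    next
      fix a assume a: "a \<noteq> u" "Bu = {u, a}"
      have av: "a \<noteq> v" using vnot a by auto
      have aS: "\<not> (u < a \<and> a < v)" using assms(6)[of a] a B(1) fin(4)[of Bu] by auto
      show ?thesis
      proof (rule card_le_2_cases[OF fin(2)[OF B(3)] B(4) p(4)[OF B(3)]])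
        assume Bv: "Bv = {v}"
        then have "Bu \<union> Bv - {u, v} = {a}" using a av by auto
        then show ?thesis using assms(1,5) a av unfolding Bv a(2)
          by (cases "a < u"; cases "x a") (auto simp: sum_basis block_wt_pair block_wt_pair')
      next
        fix b assume b: "b \<noteq> v" "Bv = {v, b}"
        have bu: "b \<noteq> u" using vnot b by auto
        have bS: "\<not> (u < b \<and> b < v)" using assms(6)[of b] b B(3) fin(4)[of Bv] by auto
        have ab: "a \<noteq> b" using False a b B partition_block_unique[OF p(1)] by blast
        have un: "Bu \<union> Bv - {u, v} = {a, b}" using a b av bu by auto
        have "a < u \<and> v < b \<or> b < a \<and> a < u \<or> v < b \<and> b < a"
          using planar_pairs_order[of D u a v b] p(2) B a b False assms(5) aS bS av bu ab by auto
        then consider "a < u" "v < b" | "b < a" "a < u" | "v < b" "b < a" by blast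
        then show ?thesis
        proof cases
          case 1
          then have "a < b" "u \<noteq> b" using assms(5) by auto
          with 1 show ?thesis using assms(1,5) a b av bu ab unfolding un unfolding a(2) b(2)
            by (cases "x a"; cases "x b") (auto simp: sum_basis block_wt_pair block_wt_pair')
        next
          case 2
          then have "b < v" "u \<noteq> b" using assms(5) by auto
          with 2 show ?thesis using assms(1,5) a b av bu ab unfolding un unfolding a(2) b(2)
            by (cases "x a"; cases "x b") (auto simp: sum_basis block_wt_pair block_wt_pair')
        next
          case 3
          then have "u < a" "u \<noteq> b" using assms(5) by auto
          with 3 show ?thesis using assms(1,5) a b av bu ab unfolding un unfolding a(2) b(2)
            by (cases "x a"; cases "x b") (auto simp: sum_basis block_wt_pair block_wt_pair')
        qed
      qed
    qed
    have "(\<Sum>c\<in>UNIV. fold_wt t c * matching_wt t D (x(u := c, v := neg c))) =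
      (\<Sum>c\<in>UNIV. fold_wt t c * (block_wt t (x(u := c, v := neg c)) Bu * block_wt t (x(u := c, v := neg c)) Bv)) * W"
      unfolding split rest sum_distrib_right by (simp add: mult.assoc)
    then show ?thesis unfolding main new using nuv by simp
  qed
qed

section \<open>Stacking diagrams as a sequence of contractions\<close>

definition glue :: "nat \<Rightarrow> nat \<Rightarrow> (nat \<Rightarrow> nat \<Rightarrow> bool) \<Rightarrow> nat \<Rightarrow> nat \<Rightarrow> bool" where
  "glue u v e x y \<longleftrightarrow> e x y \<or> e x u \<and> e v y \<or> e x v \<and> e u y"

definition per :: "nat set \<Rightarrow> (nat \<Rightarrow> nat \<Rightarrow> bool) \<Rightarrow> bool" where
  "per U e \<longleftrightarrow> (\<forall>x\<in>U. e x x) \<and> (\<forall>x y. e x y \<longrightarrow> x \<in> U \<and> e y x) \<and> (\<forall>x y z. e x y \<longrightarrow> e y z \<longrightarrow> e x z)"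

definition blockwise :: "nat set set \<Rightarrow> nat \<Rightarrow> nat \<Rightarrow> bool" where
  "blockwise D x y \<longleftrightarrow> (\<exists>B\<in>D. x \<in> B \<and> y \<in> B)"

text \<open>Classes that neither reach the boundary S nor contain a dead end. With P saying that a
  position lies on an edge, these are the closed loops.\<close>

definition closed_classes ::
  "nat set \<Rightarrow> (nat \<Rightarrow> bool) \<Rightarrow> (nat \<Rightarrow> nat \<Rightarrow> bool) \<Rightarrow> nat set \<Rightarrow> nat set set" where
  "closed_classes U P e S = {Z. \<exists>x\<in>U. Z = {y. e x y} \<and> Z \<inter> S = {} \<and> (\<forall>y\<in>Z. P y)}"

lemma per_sym: "per U e \<Longrightarrow> e x y \<longleftrightarrow> e y x"
  unfolding per_def by blast

lemma per_trans: "per U e \<Longrightarrow> e x y \<Longrightarrow> e y z \<Longrightarrow> e x z"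
  unfolding per_def by blast

lemma per_refl: "per U e \<Longrightarrow> x \<in> U \<Longrightarrow> e x x"
  unfolding per_def by blast

lemma per_dom: "per U e \<Longrightarrow> e x y \<Longrightarrow> x \<in> U \<and> y \<in> U"
  unfolding per_def by blast

lemma per_glue:
  assumes "per U e" "u \<in> U" "v \<in> U"
  shows "per U (glue u v e)"
  unfolding per_def
proof (intro conjI allI impI ballI)
  show "glue u v e x x" if "x \<in> U" for x
    using that per_refl[OF assms(1)] by (simp add: glue_def)
  show "x \<in> U" if "glue u v e x y" for x y
    using that per_dom[OF assms(1)] unfolding glue_def by blast
  show "glue u v e y x" if "glue u v e x y" for x y
    using that per_sym[OF assms(1)] unfolding glue_def by blast
  show "glue u v e x z" if "glue u v e x y" "glue u v e y z" for x y z
    using that per_sym[OF assms(1)] per_trans[OF assms(1)] unfolding glue_def by meson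
qed

lemma per_blockwise:
  assumes "partition_on U D"
  shows "per U (blockwise D)"
  using assms partition_block_unique[OF assms]
  unfolding per_def blockwise_def partition_on_def by blast

lemma blockwise_block:
  assumes "partition_on S D" "B \<in> D" "x \<in> B"
  shows "B = {y. blockwise D x y}"
  using assms partition_block_unique[OF assms(1)] unfolding blockwise_def by blast

text \<open>The induction step that keeps the glued relation and the contracted matching in
  agreement on the points still present.\<close>

lemma blockwise_contract:
  assumes "partition_on S D" "per U e" "S \<subseteq> U" "u \<in> S" "v \<in> S"
    and "\<And>x y. x \<in> S \<Longrightarrow> y \<in> S \<Longrightarrow> e x y \<longleftrightarrow> blockwise D x y"
    and "x \<in> S - {u, v}" "y \<in> S - {u, v}"
  shows "glue u v e x y \<longleftrightarrow> blockwise (contract u v D) x y"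
proof -
  obtain Bu Bv where B: "Bu \<in> D" "u \<in> Bu" "Bv \<in> D" "v \<in> Bv"
    using assms unfolding partition_on_def by blast
  have Bu: "Bu = {y. blockwise D u y}" and Bv: "Bv = {y. blockwise D v y}"
    using blockwise_block[OF assms(1)] B by auto
  note P = per_blockwise[OF assms(1)]
  have *: "blockwise (contract u v D) x y \<longleftrightarrow>
      x \<in> Bu \<union> Bv \<and> y \<in> Bu \<union> Bv \<or> (\<exists>B\<in>D - {Bu, Bv}. x \<in> B \<and> y \<in> B)"
  proof -
    have "(\<exists>B\<in>insert N \<D> - {{}}. x \<in> B \<and> y \<in> B) \<longleftrightarrow> x \<in> N \<and> y \<in> N \<or> (\<exists>B\<in>\<D>. x \<in> B \<and> y \<in> B)"
      for N and \<D> :: "nat set set" by auto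
    then show ?thesis
      unfolding contract_open[OF assms(1) B(1,3,2,4)] blockwise_def using assms(7,8) by simp
  qed
  have xy: "x \<in> S" "y \<in> S" using assms(7,8) by auto
  have e: "e x y = blockwise D x y" "e x u = (x \<in> Bu)" "e x v = (x \<in> Bv)"
      "e u y = (y \<in> Bu)" "e v y = (y \<in> Bv)"
    unfolding Bu Bv mem_Collect_eq using assms(4-6) xy per_sym[OF P] by auto
  have "blockwise D x y \<longleftrightarrow> x \<in> Bu \<and> y \<in> Bu \<or> x \<in> Bv \<and> y \<in> Bv \<or> (\<exists>B\<in>D - {Bu, Bv}. x \<in> B \<and> y \<in> B)"
    unfolding blockwise_def using B by blast
  then show ?thesis unfolding * glue_def e by blast
qed

text \<open>
  The hypothesis \<open>inv\<close> says that a class meeting \<open>S\<close> is a path whose two ends lie in \<open>S\<close> iff it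
  contains no dead end.
\<close>

lemma closed_classes_glue:
  assumes "per U e" "S \<subseteq> U" "u \<in> S" "v \<in> S" "u \<noteq> v" "finite U"
    and inv: "\<And>x. x \<in> S \<Longrightarrow> (\<forall>y. e x y \<longrightarrow> P y) \<longleftrightarrow> (\<exists>y\<in>S. y \<noteq> x \<and> e x y)"
    and two: "\<And>x y z. x \<in> S \<Longrightarrow> y \<in> S \<Longrightarrow> z \<in> S \<Longrightarrow> e x y \<Longrightarrow> e x z \<Longrightarrow> x = y \<or> x = z \<or> y = z"
  shows "card (closed_classes U P (glue u v e) (S - {u, v})) =
      card (closed_classes U P e S) + (if e u v then 1 else 0)"
    and "\<And>x. x \<in> S - {u, v} \<Longrightarrow> (\<forall>y. glue u v e x y \<longrightarrow> P y) \<longleftrightarrow>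
      (\<exists>y\<in>S - {u, v}. y \<noteq> x \<and> glue u v e x y)"
proof -
  note sym = per_sym[OF assms(1)] and trans = per_trans[OF assms(1)]
    and refl = per_refl[OF assms(1)] and dom = per_dom[OF assms(1)]
  have uv: "u \<in> U" "v \<in> U" using assms by auto
  \<comment> \<open>The class that arises by joining those of u and v; by \<open>cls\<close> every
    other class stays as it is.\<close>
  define M where "M = {y. e u y} \<union> {y. e v y}"
  have cls: "{y. glue u v e x y} = (if e x u \<or> e x v then M else {y. e x y})" for x
  proof (cases "e x u \<or> e x v")
    case True
    have "glue u v e x y \<longleftrightarrow> y \<in> M" for y
      using True
    proof
      assume "e x u"
      then have "e x y \<longleftrightarrow> e u y" "e x v \<Longrightarrow> e u y \<longleftrightarrow> e v y" for y
        using sym[of x u] trans[of x u y] trans[of u x y] sym[of x v] trans[of v x y] trans[of x v y]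
        by blast+
      then show ?thesis using \<open>e x u\<close> unfolding glue_def M_def by blast
    next
      assume "e x v"
      then have "e x y \<longleftrightarrow> e v y" "e x u \<Longrightarrow> e u y \<longleftrightarrow> e v y" for y
        using sym[of x u] trans[of x u y] trans[of u x y] sym[of x v] trans[of v x y] trans[of x v y]
        by blast+
      then show ?thesis using \<open>e x v\<close> unfolding glue_def M_def by blast
    qed
    then show ?thesis using True by auto
  next
    case False
    then show ?thesis unfolding glue_def by auto
  qed
  have sub: "closed_classes U P (glue u v e) (S - {u, v}) =
    closed_classes U P e S \<union> (if M \<inter> (S - {u, v}) = {} \<and> (\<forall>y\<in>M. P y) then {M} else {})"
    (is "?L = ?R")
  proof (intro Set.set_eqI iffI)
    fix Z assume "Z \<in> ?L"
    then obtain x where x: "x \<in> U" "Z = {y. glue u v e x y}" "Z \<inter> (S - {u, v}) = {}" "\<forall>y\<in>Z. P y"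
      unfolding closed_classes_def by blast
    show "Z \<in> ?R"
    proof (cases "e x u \<or> e x v")
      case True
      then have "Z = M" using x cls by simp
      then show ?thesis using x by simp
    next
      case False
      then have Z: "Z = {y. e x y}" using x cls by simp
      then have "Z \<inter> S = {}" using x(3) False by blast
      then have "Z \<in> closed_classes U P e S" unfolding closed_classes_def using Z x by blast
      then show ?thesis by simp
    qed
  next
    fix Z assume "Z \<in> ?R"
    then consider "Z \<in> closed_classes U P e S" | "Z = M" "M \<inter> (S - {u, v}) = {}" "\<forall>y\<in>M. P y"
      by (auto split: if_splits)
    then show "Z \<in> ?L"
    proof cases
      case 1
      then obtain x where x: "x \<in> U" "Z = {y. e x y}" "Z \<inter> S = {}" "\<forall>y\<in>Z. P y"
        unfolding closed_classes_def by blast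
      then have "\<not> (e x u \<or> e x v)" using assms(3,4) by blast
      then have "Z = {y. glue u v e x y}" using cls x by simp
      then show ?thesis unfolding closed_classes_def using x by blast
    next
      case 2
      have "M = {y. glue u v e u y}" using cls[of u] refl uv by simp
      then show ?thesis unfolding closed_classes_def using 2 uv by blast
    qed
  qed
  have "u \<in> M" using refl uv unfolding M_def by blast
  then have Mn: "M \<notin> closed_classes U P e S"
    unfolding closed_classes_def using assms(3) by blast
  \<comment> \<open>The merged class closes up exactly if u and v were the two ends of one path; by
    \<open>two\<close> such a path meets S in no third point.\<close>
  have iff: "M \<inter> (S - {u, v}) = {} \<and> (\<forall>y\<in>M. P y) \<longleftrightarrow> e u v"
  proof
    assume M: "M \<inter> (S - {u, v}) = {} \<and> (\<forall>y\<in>M. P y)"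
    then obtain y where "y \<in> S" "y \<noteq> u" "e u y"
      using inv[OF assms(3)] unfolding M_def by blast
    then have "y = v" using M unfolding M_def by blast
    then show "e u v" using \<open>e u y\<close> by simp
  next
    assume e: "e u v"
    then have M: "M = {y. e u y}" unfolding M_def using sym trans by blast
    have "\<exists>y\<in>S. y \<noteq> u \<and> e u y" using e assms(4,5) by metis
    then have "\<forall>y\<in>M. P y" unfolding M using inv[OF assms(3)] by simp
    moreover have "M \<inter> (S - {u, v}) = {}"
      unfolding M using two[OF assms(3,4) _ e] assms(5) by blast
    ultimately show "M \<inter> (S - {u, v}) = {} \<and> (\<forall>y\<in>M. P y)" by simp
  qed
  have "closed_classes U P e S \<subseteq> Pow U" unfolding closed_classes_def using dom by blast
  then have "finite (closed_classes U P e S)" using assms(6) finite_subset by blast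
  then show "card (closed_classes U P (glue u v e) (S - {u, v})) =
      card (closed_classes U P e S) + (if e u v then 1 else 0)"
    unfolding sub iff using Mn by auto
  \<comment> \<open>If x is joined to a, the path from x to a has no dead end, so the lengthened
    path reaches S again iff the path starting at b does. The variables a and b stand for u and v in
    either order.\<close>
  have merged: "(\<forall>y. glue a b e x y \<longrightarrow> P y) \<longleftrightarrow> (\<exists>y\<in>S - {a, b}. y \<noteq> x \<and> glue a b e x y)"
    if a: "a \<in> S" "b \<in> S" "x \<in> S" "x \<noteq> a" "x \<noteq> b" "e x a" "a \<noteq> b" for x a b
  proof -
    have nb: "\<not> e x b" using two[of x a b] a by blast
    have g: "glue a b e x y \<longleftrightarrow> e a y \<or> e b y" for y
      unfolding glue_def using a nb sym trans by blast
    have "(\<forall>y. e a y \<longrightarrow> P y)" using inv[OF a(1)] a sym by blast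
    then have "(\<forall>y. glue a b e x y \<longrightarrow> P y) \<longleftrightarrow> (\<exists>y\<in>S. y \<noteq> b \<and> e b y)"
      unfolding g using inv[OF a(2)] by blast
    also have "\<dots> \<longleftrightarrow> (\<exists>y\<in>S - {a, b}. y \<noteq> x \<and> glue a b e x y)"
    proof
      assume "\<exists>y\<in>S. y \<noteq> b \<and> e b y"
      then obtain y where y: "y \<in> S" "y \<noteq> b" "e b y" by blast
      have "y \<noteq> a" "y \<noteq> x" using y nb a sym trans by blast+
      then show "\<exists>y\<in>S - {a, b}. y \<noteq> x \<and> glue a b e x y" using y g by blast
    next
      assume "\<exists>y\<in>S - {a, b}. y \<noteq> x \<and> glue a b e x y"
      then obtain y where y: "y \<in> S" "y \<noteq> a" "y \<noteq> b" "y \<noteq> x" "e a y \<or> e b y" using g by blast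
      have "\<not> e a y" using two[of a x y] a y sym by blast
      then show "\<exists>y\<in>S. y \<noteq> b \<and> e b y" using y by blast
    qed
    finally show ?thesis .
  qed
  have swap: "glue u v e = glue v u e" by (intro ext) (auto simp: glue_def)
  show "(\<forall>y. glue u v e x y \<longrightarrow> P y) \<longleftrightarrow> (\<exists>y\<in>S - {u, v}. y \<noteq> x \<and> glue u v e x y)"
    if x: "x \<in> S - {u, v}" for x
  proof (cases "e x u \<or> e x v")
    case True
    then show ?thesis
    proof
      assume "e x u" then show ?thesis using merged[of u v x] x assms(3-5) by blast
    next
      assume "e x v"
      then have "(\<forall>y. glue v u e x y \<longrightarrow> P y) \<longleftrightarrow> (\<exists>y\<in>S - {v, u}. y \<noteq> x \<and> glue v u e x y)"
        using merged[of v u x] x assms(3-5) by blast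
      then show ?thesis unfolding swap[symmetric] by (simp add: insert_commute)
    qed
  next
    case False
    then have g: "glue u v e x y \<longleftrightarrow> e x y" for y unfolding glue_def by blast
    have "(\<exists>y\<in>S. y \<noteq> x \<and> e x y) \<longleftrightarrow> (\<exists>y\<in>S - {u, v}. y \<noteq> x \<and> e x y)"
      using False by blast
    then show ?thesis using inv[of x] x unfolding g by blast
  qed
qed

text \<open>
  The three rows are read off as the top row, the middle row backwards, the middle row forwards and
  the lower row backwards, so that contracting \<open>2 k - j\<close> with \<open>2 k + j + 1\<close> for \<open>j = 0, \<dots>, k - 1\<close>
  always joins neighbours.
\<close>

fun row_pos :: "nat \<Rightarrow> nat \<Rightarrow> stacked" where
  "row_pos k p = (if p \<le> k then Upper p else if p \<le> 2 * k then Middle (2 * k + 1 - p)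
     else if p \<le> 3 * k then Middle (p - 2 * k) else Lower (4 * k + 1 - p))"

declare row_pos.simps [simp del]

section \<open>The stacked matching and its successive contractions\<close>

definition stack :: "nat \<Rightarrow> diagram \<Rightarrow> diagram \<Rightarrow> nat set set" where
  "stack k d1 d2 = (`) (circ k) ` d1 \<union> (`) (\<lambda>v. 2 * k + circ k v) ` d2"

primrec contracted :: "nat \<Rightarrow> diagram \<Rightarrow> diagram \<Rightarrow> nat \<Rightarrow> nat set set" where
  "contracted k d1 d2 0 = stack k d1 d2"
| "contracted k d1 d2 (Suc j) = contract (2 * k - j) (2 * k + j + 1) (contracted k d1 d2 j)"

text \<open>Contraction forgets positions, so closed loops vanish from \<open>contracted\<close>.
  This parallel record keeps the connections among all 4 k positions, from which the loops can be
  counted.\<close>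

primrec glued :: "nat \<Rightarrow> diagram \<Rightarrow> diagram \<Rightarrow> nat \<Rightarrow> nat \<Rightarrow> nat \<Rightarrow> bool" where
  "glued k d1 d2 0 = blockwise (stack k d1 d2)"
| "glued k d1 d2 (Suc j) = glue (2 * k - j) (2 * k + j + 1) (glued k d1 d2 j)"

text \<open>The positions still present after j contractions; for j = k they are those of the two
  outer rows.\<close>

definition open_pos :: "nat \<Rightarrow> nat \<Rightarrow> nat set" where
  "open_pos k j = {1..2 * k - j} \<union> {2 * k + j + 1..4 * k}"

lemma open_pos_0: "open_pos k 0 = {1..4 * k}"
  by (auto simp: open_pos_def)

lemma open_pos_Suc: "open_pos k (Suc j) = open_pos k j - {2 * k - j, 2 * k + j + 1}"
  by (auto simp: open_pos_def)

lemma open_pos_mem: "j < k \<Longrightarrow> 2 * k - j \<in> open_pos k j" "j < k \<Longrightarrow> 2 * k + j + 1 \<in> open_pos k j"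
  by (auto simp: open_pos_def)

lemma open_pos_subset: "open_pos k j \<subseteq> {1..4 * k}"
  by (auto simp: open_pos_def)

section \<open>Motzkin diagrams as planar matchings of boundary positions\<close>

lemma circ_image_vertices: "circ k ` vertices k = {1..2 * k}"
proof -
  have "circ k ` Bot ` {1..k} = {k + 1..2 * k}"
  proof -
    have "p \<in> circ k ` Bot ` {1..k}" if "p \<in> {k + 1..2 * k}" for p
    proof (rule image_eqI)
      show "p = circ k (Bot (2 * k + 1 - p))" using that by auto
      show "Bot (2 * k + 1 - p) \<in> Bot ` {1..k}" using that by (intro imageI) auto
    qed
    then show ?thesis by auto
  qed
  moreover have "circ k ` Top ` {1..k} = {1..k}" by (auto simp: image_image)
  ultimately show ?thesis unfolding vertices_def image_Un by auto
qed

lemma vertices_cases: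
  assumes "v \<in> vertices k"
  obtains i where "v = Top i" "1 \<le> i" "i \<le> k" | i where "v = Bot i" "1 \<le> i" "i \<le> k"
  using assms unfolding vertices_def by auto

lemma inj_on_circ: "inj_on (circ k) (vertices k)"
  by (rule inj_onI) (elim vertices_cases; auto)

lemma circ_bounds: "v \<in> vertices k \<Longrightarrow> 1 \<le> circ k v \<and> circ k v \<le> 2 * k"
  using circ_image_vertices[of k] by auto

lemma inj_on_circ_blocks: "partition_on (vertices k) d \<Longrightarrow> inj_on ((`) (circ k)) d"
  using inj_on_circ[of k] unfolding partition_on_def
  by (intro inj_on_image) auto

lemma partition_on_image:
  assumes "partition_on A P" "inj_on f A"
  shows "partition_on (f ` A) ((`) f ` P)"
proof (rule partition_onI)
  show "\<Union>((`) f ` P) = f ` A" using assms unfolding partition_on_def by auto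
  show "{} \<notin> (`) f ` P" using assms unfolding partition_on_def by auto
  fix p q assume "p \<in> (`) f ` P" "q \<in> (`) f ` P" "p \<noteq> q"
  then obtain a b where ab: "a \<in> P" "b \<in> P" "p = f ` a" "q = f ` b" by auto
  then have "a \<inter> b = {}" using \<open>p \<noteq> q\<close> assms(1) disjointD[of P a b] unfolding partition_on_def by auto
  moreover have "a \<subseteq> A" "b \<subseteq> A" using ab assms unfolding partition_on_def by auto
  ultimately show "disjnt p q" using ab assms(2) unfolding disjnt_def by (metis image_empty inj_on_image_Int)
qed

text \<open>The eight excluded orders are all the ways in which the pairs a, b and c, e can
  interleave.\<close>

lemma not_interleaved:
  fixes a b c e :: nat
  assumes "\<not> (a < c \<and> c < b \<and> b < e)" "\<not> (b < c \<and> c < a \<and> a < e)"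
      "\<not> (a < e \<and> e < b \<and> b < c)" "\<not> (b < e \<and> e < a \<and> a < c)"
      "\<not> (c < a \<and> a < e \<and> e < b)" "\<not> (c < b \<and> b < e \<and> e < a)"
      "\<not> (e < a \<and> a < c \<and> c < b)" "\<not> (e < b \<and> b < c \<and> c < a)"
    "a \<noteq> c" "a \<noteq> e" "b \<noteq> c" "b \<noteq> e"
  shows "((a < c) = (b < c)) = ((a < e) = (b < e))"
proof -
  have "(c < a) = (\<not> a < c)" "(e < a) = (\<not> a < e)" "(c < b) = (\<not> b < c)" "(e < b) = (\<not> b < e)"
    using assms(9-12) by linarith+
  then show ?thesis using assms(1-8) by metis
qed

text \<open>\<open>noncrossing\<close> forbids one order of the named ends of two arcs. Renaming the
  ends of each arc and exchanging the arcs yields all eight forbidden orders, which is planarity;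
  injectivity of \<open>circ\<close> keeps the blocks disjoint.\<close>

lemma motzkin_planar:
  assumes "d \<in> motzkin_diagrams k"
  shows "planar_matching {1..2 * k} ((`) (circ k) ` d)"
proof -
  have d: "partition_on (vertices k) d" "\<And>B. B \<in> d \<Longrightarrow> card B \<le> 2" "noncrossing k d"
    using assms unfolding motzkin_diagrams_def by auto
  have V: "B \<subseteq> vertices k" if "B \<in> d" for B using that d unfolding partition_on_def by auto
  have fin: "finite B" if "B \<in> d" for B
    using V[OF that] by (rule finite_subset) (simp add: vertices_def)
  have pair: "B = {a, b}" if B: "B \<in> d" "a \<in> B" "b \<in> B" "a \<noteq> b" for B a b
  proof -
    have "card {a, b} = card B" using that d(2)[OF B(1)] card_mono[OF fin[OF B(1)], of "{a, b}"] by auto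
    then show ?thesis using card_subset_eq[OF fin[OF B(1)], of "{a, b}"] B by auto
  qed
  have no: False if "B \<in> d" "B' \<in> d" "B \<noteq> B'" "a \<in> B" "b \<in> B" "c \<in> B'" "e \<in> B'"
      "circ k a < circ k c" "circ k c < circ k b" "circ k b < circ k e" for B B' a b c e
  proof -
    have "a \<noteq> b" "c \<noteq> e" using that by auto
    then have "{a, b} \<in> d" "{c, e} \<in> d" using pair that by metis+
    then show False using d(3) that unfolding noncrossing_def by blast
  qed
  have "planar ((`) (circ k) ` d)"
    unfolding planar_def
  proof (intro ballI impI)
    fix B B' a b c e
    assume "B \<in> (`) (circ k) ` d" "B' \<in> (`) (circ k) ` d" "B \<noteq> B'" "a \<in> B" "b \<in> B" "c \<in> B'" "e \<in> B'"
    then obtain C C' where CC: "C \<in> d" "C' \<in> d" "C \<noteq> C'" "B = circ k ` C" "B' = circ k ` C'"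
      by (elim imageE) blast
    obtain a' where a': "a = circ k a'" "a' \<in> C" using \<open>a \<in> B\<close> unfolding CC(4) by (rule imageE)
    obtain b' where b': "b = circ k b'" "b' \<in> C" using \<open>b \<in> B\<close> unfolding CC(4) by (rule imageE)
    obtain c' where c': "c = circ k c'" "c' \<in> C'" using \<open>c \<in> B'\<close> unfolding CC(5) by (rule imageE)
    obtain e' where e': "e = circ k e'" "e' \<in> C'" using \<open>e \<in> B'\<close> unfolding CC(5) by (rule imageE)
    note C = CC(1-3) a'(2) b'(2) c'(2) e'(2) and eq = a'(1) b'(1) c'(1) e'(1)
    have "C \<inter> C' = {}" using C d(1) disjointD[of d C C'] unfolding partition_on_def by auto
    then have ne: "a \<noteq> c" "a \<noteq> e" "b \<noteq> c" "b \<noteq> e"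
      using inj_onD[OF inj_on_circ[of k]] C V eq by blast+
    have "\<not> (a < c \<and> c < b \<and> b < e)" "\<not> (b < c \<and> c < a \<and> a < e)"
      "\<not> (a < e \<and> e < b \<and> b < c)" "\<not> (b < e \<and> e < a \<and> a < c)"
      "\<not> (c < a \<and> a < e \<and> e < b)" "\<not> (c < b \<and> b < e \<and> e < a)"
      "\<not> (e < a \<and> a < c \<and> c < b)" "\<not> (e < b \<and> b < c \<and> c < a)"
      using no[of C C' a' b' c' e'] no[of C C' b' a' c' e'] no[of C C' a' b' e' c'] no[of C C' b' a' e' c']
        no[of C' C c' e' a' b'] no[of C' C c' e' b' a'] no[of C' C e' c' a' b'] no[of C' C e' c' b' a'] C
      unfolding eq by blast+
    then show "((a < c) = (b < c)) = ((a < e) = (b < e))" using ne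
      by (rule not_interleaved)
  qed
  moreover have "card B \<le> 2" if "B \<in> (`) (circ k) ` d" for B
    using that d(2) card_image_le fin by (metis (no_types, lifting) image_iff le_trans)
  moreover have "partition_on {1..2 * k} ((`) (circ k) ` d)"
    using partition_on_image[OF d(1) inj_on_circ] circ_image_vertices by simp
  ultimately show ?thesis unfolding planar_matching_def by auto
qed

lemma motzkinI:
  assumes "partition_on (vertices k) d" "planar_matching {1..2 * k} ((`) (circ k) ` d)"
  shows "d \<in> motzkin_diagrams k"
proof -
  have V: "B \<subseteq> vertices k" if "B \<in> d" for B using that assms unfolding partition_on_def by auto
  have "card B \<le> 2" if "B \<in> d" for B
  proof -
    have "card (circ k ` B) = card B"
      using V[OF that] inj_on_circ by (metis card_image inj_on_subset)
    then show ?thesis using assms(2) that unfolding planar_matching_def by (metis imageI)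
  qed
  moreover have "noncrossing k d"
    unfolding noncrossing_def
  proof clarify
    fix u v x y assume *: "{u, v} \<in> d" "{x, y} \<in> d" "circ k u < circ k x" "circ k x < circ k v" "circ k v < circ k y"
    have pl: "planar ((`) (circ k) ` d)" using assms(2) unfolding planar_matching_def by auto
    have "circ k x \<noteq> circ k u" "circ k x \<noteq> circ k v" using *(3-5) by simp_all
    then have "{circ k u, circ k v} \<noteq> {circ k x, circ k y}" by (metis insertCI insertE singletonD)
    moreover have "{circ k u, circ k v} \<in> (`) (circ k) ` d" "{circ k x, circ k y} \<in> (`) (circ k) ` d"
      using imageI[OF *(1), of "(`) (circ k)"] imageI[OF *(2), of "(`) (circ k)"] by simp_all
    ultimately have "((circ k u < circ k x) = (circ k v < circ k x)) = ((circ k u < circ k y) = (circ k v < circ k y))"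
      by (intro planarD[OF pl, of "{circ k u, circ k v}" "{circ k x, circ k y}"]) simp_all
    moreover have "\<not> circ k v < circ k x" "circ k u < circ k y" using *(3-5) by linarith+
    ultimately show False using *(3,5) by simp
  qed
  ultimately show ?thesis unfolding motzkin_diagrams_def using assms by auto
qed

lemma partition_on_Un:
  assumes "partition_on A P" "partition_on B Q" "A \<inter> B = {}"
  shows "partition_on (A \<union> B) (P \<union> Q)"
proof (rule partition_onI)
  show "{} \<notin> P \<union> Q" using assms unfolding partition_on_def by auto
  show "\<Union> (P \<union> Q) = A \<union> B" using assms unfolding partition_on_def by auto
  fix p q assume pq: "p \<in> P \<union> Q" "q \<in> P \<union> Q" "p \<noteq> q"
  have "\<Union>P = A" "\<Union>Q = B" using assms unfolding partition_on_def by auto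
  then show "disjnt p q"
    using pq assms disjointD[of P p q] disjointD[of Q p q] unfolding partition_on_def disjnt_def by blast
qed

text \<open>The two rectangles occupy the disjoint intervals 1..2k and 2k+1..4k, so a block of one
  never separates points of a block of the other.\<close>

lemma stack_planar:
  assumes "d1 \<in> motzkin_diagrams k" "d2 \<in> motzkin_diagrams k"
  shows "planar_matching {1..4 * k} (stack k d1 d2)"
proof -
  let ?A = "(`) (circ k) ` d1" and ?B = "(`) (\<lambda>v. 2 * k + circ k v) ` d2"
  have B: "?B = (`) (\<lambda>p. 2 * k + p) ` (`) (circ k) ` d2" by (simp add: image_image)
  have p1: "planar_matching {1..2 * k} ?A" and p2: "planar_matching {1..2 * k} ((`) (circ k) ` d2)"
    using motzkin_planar assms by auto
  have im: "(\<lambda>p. 2 * k + p) ` {1..2 * k} = {2 * k + 1..4 * k}"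
    by (simp add: image_add_atLeastAtMost[of "2 * k" 1 "2 * k"])
  have "partition_on {2 * k + 1..4 * k} ?B"
    unfolding B im[symmetric] using p2 unfolding planar_matching_def
    by (intro partition_on_image) (auto simp: inj_on_def)
  moreover have "{1..4 * k} = {1..2 * k} \<union> {2 * k + 1..4 * k}" by auto
  ultimately have part: "partition_on {1..4 * k} (?A \<union> ?B)"
    using partition_on_Un[of "{1..2 * k}" ?A "{2 * k + 1..4 * k}" ?B] p1 unfolding planar_matching_def
    by auto
  have plA: "planar ?A" using p1 unfolding planar_matching_def by auto
  have plB: "planar ?B"
    unfolding planar_def
  proof (intro ballI impI)
    fix B B' a b c d
    assume BB: "B \<in> ?B" "B' \<in> ?B" "B \<noteq> B'" and el: "a \<in> B" "b \<in> B" "c \<in> B'" "d \<in> B'"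
    obtain C where C1: "B = (+) (2 * k) ` C" "C \<in> (`) (circ k) ` d2"
      using BB(1) unfolding B by (rule imageE)
    obtain C' where C2: "B' = (+) (2 * k) ` C'" "C' \<in> (`) (circ k) ` d2"
      using BB(2) unfolding B by (rule imageE)
    note C = C1(2) C2(2) C1(1) C2(1)
    obtain a' where a': "a = 2 * k + a'" "a' \<in> C" using el(1) unfolding C(3) by (rule imageE)
    obtain b' where b': "b = 2 * k + b'" "b' \<in> C" using el(2) unfolding C(3) by (rule imageE)
    obtain c' where c': "c = 2 * k + c'" "c' \<in> C'" using el(3) unfolding C(4) by (rule imageE)
    obtain d' where d': "d = 2 * k + d'" "d' \<in> C'" using el(4) unfolding C(4) by (rule imageE)
    note e = a'(2) b'(2) c'(2) d'(2) a'(1) b'(1) c'(1) d'(1)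
    have "C \<noteq> C'" using BB(3) C(3,4) by metis
    then show "((a < c) = (b < c)) = ((a < d) = (b < d))"
      using planarD[OF _ C(1,2) _ e(1-4)] p2 e(5-8) unfolding planar_matching_def by auto
  qed
  have bA: "a \<le> 2 * k" if "B \<in> ?A" "a \<in> B" for a B
    using matching_finite(4)[OF p1 that(1)] that(2) by auto
  have bB: "a > 2 * k" if Ba: "B \<in> ?B" "a \<in> B" for a B
  proof -
    obtain C where C: "B = (+) (2 * k) ` C" "C \<in> (`) (circ k) ` d2"
      using Ba(1) unfolding B by (rule imageE)
    then have "C \<subseteq> {1..2 * k}" using matching_finite(4)[OF p2] by blast
    then show ?thesis using Ba(2) unfolding C(1) by auto
  qed
  have "planar (?A \<union> ?B)"
    unfolding planar_def
  proof (intro ballI impI)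
    fix B B' a b c d
    assume BB: "B \<in> ?A \<union> ?B" "B' \<in> ?A \<union> ?B" "B \<noteq> B'" and el: "a \<in> B" "b \<in> B" "c \<in> B'" "d \<in> B'"
    consider "B \<in> ?A" "B' \<in> ?A" | "B \<in> ?B" "B' \<in> ?B" | "B \<in> ?A" "B' \<in> ?B" | "B \<in> ?B" "B' \<in> ?A"
      using BB by blast
    then show "((a < c) = (b < c)) = ((a < d) = (b < d))"
    proof cases
      case 1 then show ?thesis using planarD[OF plA 1 BB(3) el] by blast
    next
      case 2 then show ?thesis using planarD[OF plB 2 BB(3) el] by blast
    next
      case 3
      then show ?thesis using bA[OF 3(1) el(1)] bA[OF 3(1) el(2)] bB[OF 3(2) el(3)] bB[OF 3(2) el(4)] by auto
    next
      case 4
      then show ?thesis using bB[OF 4(1) el(1)] bB[OF 4(1) el(2)] bA[OF 4(2) el(3)] bA[OF 4(2) el(4)] by auto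
    qed
  qed
  moreover have "card B \<le> 2" if B': "B \<in> ?A \<union> ?B" for B
  proof (cases "B \<in> ?A")
    case True then show ?thesis using p1 unfolding planar_matching_def by auto
  next
    case False
    then obtain C where "C \<in> (`) (circ k) ` d2" "B = (+) (2 * k) ` C" using B' B by auto
    then show ?thesis using p2 card_image[of "(+) (2 * k)" C] unfolding planar_matching_def by auto
  qed
  ultimately show ?thesis unfolding stack_def planar_matching_def using part by auto
qed

lemma contracted_planar:
  assumes "d1 \<in> motzkin_diagrams k" "d2 \<in> motzkin_diagrams k" "j \<le> k"
  shows "planar_matching (open_pos k j) (contracted k d1 d2 j)"
  using assms(3)
proof (induction j)
  case 0
  then show ?case using stack_planar[OF assms(1,2)] by (simp add: open_pos_0)
next
  case (Suc j)
  then show ?case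
    unfolding open_pos_Suc contracted.simps
    by (intro planar_matching_contract open_pos_mem) (auto simp: open_pos_def)
qed

lemma glued_contracted_aux:
  assumes "d1 \<in> motzkin_diagrams k" "d2 \<in> motzkin_diagrams k" "j \<le> k"
  shows "per {1..4 * k} (glued k d1 d2 j) \<and> (\<forall>x\<in>open_pos k j. \<forall>y\<in>open_pos k j.
      glued k d1 d2 j x y \<longleftrightarrow> blockwise (contracted k d1 d2 j) x y)"
  using assms(3)
proof (induction j)
  case 0
  show ?case
    using stack_planar[OF assms(1,2)] unfolding planar_matching_def by (auto intro: per_blockwise)
next
  case (Suc j)
  have j: "j < k" using Suc.prems by simp
  then have per: "per {1..4 * k} (glued k d1 d2 j)" and IH: "\<And>x y. x \<in> open_pos k j \<Longrightarrow> y \<in> open_pos k j \<Longrightarrow>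
      glued k d1 d2 j x y \<longleftrightarrow> blockwise (contracted k d1 d2 j) x y"
    using Suc by auto
  have pm: "partition_on (open_pos k j) (contracted k d1 d2 j)"
    using contracted_planar[OF assms(1,2), of j] j unfolding planar_matching_def by auto
  have "per {1..4 * k} (glued k d1 d2 (Suc j))"
    unfolding glued.simps using open_pos_mem[OF j] open_pos_subset[of k j]
    by (intro per_glue per) auto
  moreover have "glued k d1 d2 (Suc j) x y \<longleftrightarrow> blockwise (contracted k d1 d2 (Suc j)) x y"
    if "x \<in> open_pos k (Suc j)" "y \<in> open_pos k (Suc j)" for x y
    using blockwise_contract[OF pm per open_pos_subset open_pos_mem[OF j] IH] that
    unfolding open_pos_Suc glued.simps contracted.simps by blast
  ultimately show ?case by blast
qed

lemma per_glued:
  assumes "d1 \<in> motzkin_diagrams k" "d2 \<in> motzkin_diagrams k" "j \<le> k"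
  shows "per {1..4 * k} (glued k d1 d2 j)"
  using glued_contracted_aux[OF assms] by blast

lemma glued_contracted:
  assumes "d1 \<in> motzkin_diagrams k" "d2 \<in> motzkin_diagrams k" "j \<le> k"
    and "x \<in> open_pos k j" "y \<in> open_pos k j"
  shows "glued k d1 d2 j x y \<longleftrightarrow> blockwise (contracted k d1 d2 j) x y"
  using glued_contracted_aux[OF assms(1-3)] assms(4,5) by blast

section \<open>Comparison with the components of the stacked graph\<close>

fun outer_pos :: "nat \<Rightarrow> vertex \<Rightarrow> nat" where
  "outer_pos k (Top i) = i"
| "outer_pos k (Bot i) = 4 * k + 1 - i"

lemma row_pos_upper: "v \<in> vertices k \<Longrightarrow> row_pos k (circ k v) = in_upper v"
  by (elim vertices_cases) (auto simp: row_pos.simps)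

lemma row_pos_lower: "v \<in> vertices k \<Longrightarrow> row_pos k (2 * k + circ k v) = in_lower v"
  by (elim vertices_cases) (auto simp: row_pos.simps)

lemma row_pos_outer: "v \<in> vertices k \<Longrightarrow> row_pos k (outer_pos k v) = outer v"
  by (elim vertices_cases) (auto simp: row_pos.simps)

lemma inj_on_outer_pos: "inj_on (outer_pos k) (vertices k)"
  by (rule inj_onI) (elim vertices_cases; auto)

lemma outer_pos_image: "outer_pos k ` vertices k = open_pos k k"
proof -
  have "outer_pos k ` Bot ` {1..k} = {2 * k + k + 1..4 * k}"
  proof -
    have "p \<in> outer_pos k ` Bot ` {1..k}" if "p \<in> {2 * k + k + 1..4 * k}" for p
    proof (rule image_eqI)
      show "p = outer_pos k (Bot (4 * k + 1 - p))" using that by auto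
      show "Bot (4 * k + 1 - p) \<in> Bot ` {1..k}" using that by (intro imageI) auto
    qed
    then show ?thesis by auto
  qed
  moreover have "outer_pos k ` Top ` {1..k} = {1..2 * k - k}" by (auto simp: image_image)
  ultimately show ?thesis unfolding vertices_def image_Un open_pos_def by auto
qed

text \<open>Only vertices of the middle row have two positions, and these form the pair joined in
  one of the k contractions.\<close>

lemma row_pos_eq:
  assumes "x \<in> {1..4 * k}" "y \<in> {1..4 * k}" "row_pos k x = row_pos k y" "x < y"
  obtains j where "j < k" "x = 2 * k - j" "y = 2 * k + j + 1"
proof -
  have "k < x" "x \<le> 2 * k" "2 * k < y" "y \<le> 3 * k" "2 * k + 1 - x = y - 2 * k"
    using assms by (auto simp: row_pos.simps split: if_splits)
  then show ?thesis using that[of "2 * k - x"] by auto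
qed

lemma row_pos_pair: "j < k \<Longrightarrow> row_pos k (2 * k - j) = row_pos k (2 * k + j + 1)"
  by (auto simp: row_pos.simps)

lemma middle_iff_not_open: "x \<in> {1..4 * k} \<Longrightarrow> row_pos k x \<in> range Middle \<longleftrightarrow> x \<notin> open_pos k k"
  by (auto simp: row_pos.simps open_pos_def)

lemma blockwise_stack_iff:
  "blockwise (stack k d1 d2) x y \<longleftrightarrow>
     (\<exists>B\<in>d1. \<exists>v\<in>B. \<exists>w\<in>B. x = circ k v \<and> y = circ k w) \<or>
     (\<exists>B\<in>d2. \<exists>v\<in>B. \<exists>w\<in>B. x = 2 * k + circ k v \<and> y = 2 * k + circ k w)"
  unfolding blockwise_def stack_def by (simp add: bex_Un image_iff Bex_def conj_commute) blast

lemma glued_mono: "i \<le> j \<Longrightarrow> glued k d1 d2 i x y \<Longrightarrow> glued k d1 d2 j x y"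
  by (induction rule: dec_induct) (auto simp: glue_def)

context
  fixes k :: nat and d1 d2 :: diagram
  assumes d1: "d1 \<in> motzkin_diagrams k" and d2: "d2 \<in> motzkin_diagrams k"
begin

lemma block_vertices: "B \<in> d1 \<Longrightarrow> B \<subseteq> vertices k" "B \<in> d2 \<Longrightarrow> B \<subseteq> vertices k"
  using d1 d2 unfolding motzkin_diagrams_def partition_on_def by auto

lemma glued_pair:
  assumes "i < k"
  shows "glued k d1 d2 k (2 * k - i) (2 * k + i + 1)"
proof (rule glued_mono)
  show "Suc i \<le> k" using assms by simp
  have "2 * k - i \<in> {1..4 * k}" "2 * k + i + 1 \<in> {1..4 * k}"
    using open_pos_mem[OF assms] open_pos_subset[of k i] by blast+
  moreover have "per {1..4 * k} (glued k d1 d2 i)" using per_glued[OF d1 d2, of i] assms by simp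
  ultimately
  have "glued k d1 d2 i (2 * k - i) (2 * k - i)" "glued k d1 d2 i (2 * k + i + 1) (2 * k + i + 1)"
    using per_refl by blast+
  then show "glued k d1 d2 (Suc i) (2 * k - i) (2 * k + i + 1)"
    by (simp add: glue_def)
qed

lemma glued_same_row:
  assumes "x \<in> {1..4 * k}" "y \<in> {1..4 * k}" "row_pos k x = row_pos k y"
  shows "glued k d1 d2 k x y"
proof -
  note P = per_glued[OF d1 d2 order_refl]
  consider "x = y" | "x < y" | "y < x" by linarith
  then show ?thesis
  proof cases
    case 1 then show ?thesis using per_refl[OF P] assms by simp
  next
    case 2 then show ?thesis using row_pos_eq[OF assms] glued_pair by metis
  next
    case 3 then show ?thesis using row_pos_eq[OF assms(2,1) assms(3)[symmetric]] glued_pair per_sym[OF P] by metis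
  qed
qed

lemma linked_glued0: "blockwise (stack k d1 d2) x y \<Longrightarrow> (row_pos k x, row_pos k y) \<in> linked d1 d2"
proof -
  have "(in_upper v, in_upper w) \<in> linked d1 d2" if "B \<in> d1" "v \<in> B" "w \<in> B" for B v w
    using that unfolding linked_def by blast
  moreover have "(in_lower v, in_lower w) \<in> linked d1 d2" if "B \<in> d2" "v \<in> B" "w \<in> B" for B v w
    using that unfolding linked_def by blast
  moreover assume "blockwise (stack k d1 d2) x y"
  ultimately show ?thesis
    unfolding blockwise_stack_iff using row_pos_upper row_pos_lower block_vertices by (metis subsetD)
qed

lemma linked_cases:
  assumes "(a, b) \<in> linked d1 d2"
  obtains x y where "blockwise (stack k d1 d2) x y" "a = row_pos k x" "b = row_pos k y"
proof -
  from assms consider B v w where "B \<in> d1" "v \<in> B" "w \<in> B" "a = in_upper v" "b = in_upper w"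
    | B v w where "B \<in> d2" "v \<in> B" "w \<in> B" "a = in_lower v" "b = in_lower w"
    unfolding linked_def by auto
  then show ?thesis
  proof cases
    case 1
    then have "v \<in> vertices k" "w \<in> vertices k" using block_vertices by auto
    then show ?thesis using that[of "circ k v" "circ k w"] 1 row_pos_upper
      unfolding blockwise_stack_iff by auto
  next
    case 2
    then have "v \<in> vertices k" "w \<in> vertices k" using block_vertices by auto
    then show ?thesis using that[of "2 * k + circ k v" "2 * k + circ k w"] 2 row_pos_lower
      unfolding blockwise_stack_iff by auto
  qed
qed

text \<open>The two positions joined in a step represent the same vertex, so gluing them adds
  nothing to connectivity in the graph \<open>linked\<close>.\<close>

lemma glued_linked:
  assumes "j \<le> k" "glued k d1 d2 j x y"
  shows "(row_pos k x, row_pos k y) \<in> (linked d1 d2)\<^sup>+"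
  using assms
proof (induction j arbitrary: x y)
  case 0
  then show ?case using linked_glued0 by auto
next
  case (Suc j)
  have e: "row_pos k (2 * k - j) = row_pos k (2 * k + j + 1)" using row_pos_pair Suc.prems by simp
  have "glue (2 * k - j) (2 * k + j + 1) (glued k d1 d2 j) x y" using Suc.prems by simp
  then show ?case
    unfolding glue_def using Suc.IH[of x y] Suc.IH[of x "2 * k - j"] Suc.IH[of x "2 * k + j + 1"]
      Suc.IH[of "2 * k - j" y] Suc.IH[of "2 * k + j + 1" y] Suc.prems(1) e trancl_trans[of "row_pos k x"]
    by (metis Suc_leD)
qed

text \<open>Along a path the positions representing a vertex may change from one edge to the next;
  \<open>glued_same_row\<close> bridges such a change. Hence x and y may be any positions of the end
  vertices.\<close>

lemma linked_glued:
  assumes "(a, b) \<in> (linked d1 d2)\<^sup>+"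
  shows "x \<in> {1..4 * k} \<Longrightarrow> y \<in> {1..4 * k} \<Longrightarrow> row_pos k x = a \<Longrightarrow> row_pos k y = b \<Longrightarrow> glued k d1 d2 k x y"
  using assms
proof (induction arbitrary: y rule: trancl_induct)
  case (base b)
  note P = per_glued[OF d1 d2 order_refl]
  obtain x' y' where xy: "blockwise (stack k d1 d2) x' y'" "a = row_pos k x'" "b = row_pos k y'"
    using linked_cases[OF base(1)] .
  then have g: "glued k d1 d2 k x' y'" using glued_mono[of 0 k k d1 d2 x' y'] by simp
  then have "glued k d1 d2 k x x'" "glued k d1 d2 k y' y"
    using glued_same_row per_dom[OF P g] xy base by auto
  then show ?case using g per_trans[OF P] by blast
next
  case (step b c)
  note P = per_glued[OF d1 d2 order_refl]
  obtain x' y' where xy: "blockwise (stack k d1 d2) x' y'" "b = row_pos k x'" "c = row_pos k y'"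
    using linked_cases[OF step(2)] .
  then have g: "glued k d1 d2 k x' y'" using glued_mono[of 0 k k d1 d2 x' y'] by simp
  have "glued k d1 d2 k x x'" using step.IH[of x'] step.prems xy per_dom[OF P g] by simp
  moreover have "glued k d1 d2 k y' y" using glued_same_row[of y' y] step.prems xy per_dom[OF P g] by simp
  ultimately show ?case using g per_trans[OF P] by blast
qed

lemma glued_iff_linked:
  assumes "x \<in> {1..4 * k}" "y \<in> {1..4 * k}"
  shows "glued k d1 d2 k x y \<longleftrightarrow> (row_pos k x, row_pos k y) \<in> (linked d1 d2)\<^sup>+"
  using glued_linked[OF order_refl] linked_glued[OF _ assms] by blast

lemma trancl_linked_row:
  assumes "(a, b) \<in> (linked d1 d2)\<^sup>+"
  shows "a \<in> row_pos k ` {1..4 * k}" "b \<in> row_pos k ` {1..4 * k}"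
proof -
  note P = per_glued[OF d1 d2 le0]
  have "a \<in> row_pos k ` {1..4 * k} \<and> b \<in> row_pos k ` {1..4 * k}" if "(a, b) \<in> linked d1 d2" for a b
    using linked_cases[OF that] per_dom[OF P] by (metis glued.simps(1) imageI)
  then show "a \<in> row_pos k ` {1..4 * k}" "b \<in> row_pos k ` {1..4 * k}"
    using assms by (metis tranclD tranclD2)+
qed

lemma Field_linked: "Field (linked d1 d2) = row_pos k ` {1..4 * k}"
proof
  show "Field (linked d1 d2) \<subseteq> row_pos k ` {1..4 * k}"
    using trancl_linked_row unfolding Field_def by blast
  show "row_pos k ` {1..4 * k} \<subseteq> Field (linked d1 d2)"
  proof
    fix a assume "a \<in> row_pos k ` {1..4 * k}"
    then obtain x where x: "x \<in> {1..4 * k}" "a = row_pos k x" by auto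
    have "(a, a) \<in> linked d1 d2"
      using linked_glued0[of x x] per_refl[OF per_glued[OF d1 d2 le0] x(1)] x by simp
    then show "a \<in> Field (linked d1 d2)" unfolding Field_def by auto
  qed
qed

lemma components_eq:
  "components d1 d2 = (\<lambda>x. row_pos k ` {y. glued k d1 d2 k x y}) ` {1..4 * k}"
proof -
  have "(linked d1 d2)\<^sup>+ `` {row_pos k x} = row_pos k ` {y. glued k d1 d2 k x y}" if x: "x \<in> {1..4 * k}" for x
  proof (intro Set.set_eqI iffI)
    fix b assume "b \<in> (linked d1 d2)\<^sup>+ `` {row_pos k x}"
    then have b: "(row_pos k x, b) \<in> (linked d1 d2)\<^sup>+" by simp
    then obtain y where "y \<in> {1..4 * k}" "b = row_pos k y" using trancl_linked_row(2)[OF b] by auto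
    then show "b \<in> row_pos k ` {y. glued k d1 d2 k x y}" using b glued_iff_linked[OF x] by auto
  next
    fix b assume "b \<in> row_pos k ` {y. glued k d1 d2 k x y}"
    then show "b \<in> (linked d1 d2)\<^sup>+ `` {row_pos k x}" using glued_linked[OF order_refl] by auto
  qed
  then show ?thesis
    unfolding components_def Field_linked quotient_def by auto
qed

lemma outer_vimage:
  assumes "x \<in> {1..4 * k}"
  shows "outer -` row_pos k ` {y. glued k d1 d2 k x y} = {v \<in> vertices k. glued k d1 d2 k x (outer_pos k v)}"
proof (intro Set.set_eqI iffI)
  note P = per_glued[OF d1 d2 order_refl]
  fix v assume "v \<in> outer -` row_pos k ` {y. glued k d1 d2 k x y}"
  then obtain y where y: "outer v = row_pos k y" "glued k d1 d2 k x y" by auto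
  then have yU: "y \<in> {1..4 * k}" using per_dom[OF P] by blast
  then have v: "v \<in> vertices k"
  proof (cases v)
    case (Top i)
    then show ?thesis using y(1) yU by (auto simp: row_pos.simps vertices_def split: if_splits)
  next
    case (Bot i)
    then have "i = 4 * k + 1 - y" "3 * k < y" using y(1) by (auto simp: row_pos.simps split: if_splits)
    then have "i \<in> {1..k}" using yU by auto
    then show ?thesis using Bot by (simp add: vertices_def)
  qed
  then have "outer_pos k v \<in> {1..4 * k}" using outer_pos_image open_pos_subset[of k k] by blast
  then have "glued k d1 d2 k y (outer_pos k v)"
    using glued_same_row[OF yU, of "outer_pos k v"] row_pos_outer[OF v] y by auto
  then show "v \<in> {v \<in> vertices k. glued k d1 d2 k x (outer_pos k v)}" using v y per_trans[OF P] by blast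
next
  fix v assume "v \<in> {v \<in> vertices k. glued k d1 d2 k x (outer_pos k v)}"
  then show "v \<in> outer -` row_pos k ` {y. glued k d1 d2 k x y}"
    using row_pos_outer[of v k, symmetric] by (simp add: image_iff) blast
qed

text \<open>Components inside the middle row have empty outer part and are removed in
  \<open>diagram_comp\<close>; every other component contains an outer vertex w and is the class of
  w.\<close>

lemma diagram_comp_eq:
  "diagram_comp d1 d2 = (\<lambda>w. {v \<in> vertices k. glued k d1 d2 k (outer_pos k w) (outer_pos k v)}) ` vertices k"
    (is "_ = ?c ` _")
proof (intro Set.set_eqI iffI)
  note P = per_glued[OF d1 d2 order_refl]
  have oU: "outer_pos k w \<in> {1..4 * k}" if "w \<in> vertices k" for w
    using that outer_pos_image open_pos_subset[of k k] by blast
  fix B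
  {
    assume "B \<in> diagram_comp d1 d2"
    then obtain x where x0: "x \<in> {1..4 * k}" "B = outer -` row_pos k ` {y. glued k d1 d2 k x y}" "B \<noteq> {}"
      unfolding diagram_comp_def components_eq by blast
    note x = x0(1) x0(2)[unfolded outer_vimage[OF x0(1)]] x0(3)
    then obtain w where w: "w \<in> vertices k" "glued k d1 d2 k x (outer_pos k w)" by auto
    have "B = ?c w" unfolding x(2) using w(2) per_trans[OF P] per_sym[OF P] by blast
    then show "B \<in> ?c ` vertices k" using w by blast
  next
    assume "B \<in> ?c ` vertices k"
    then obtain w where w: "w \<in> vertices k" "B = ?c w" by auto
    have "w \<in> B" using w per_refl[OF P oU] by simp
    then show "B \<in> diagram_comp d1 d2"
      unfolding diagram_comp_def components_eq using outer_vimage[OF oU[OF w(1)]] oU[OF w(1)] w(2)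
      by (intro DiffI image_eqI[of _ _ "row_pos k ` {y. glued k d1 d2 k (outer_pos k w) y}"]) auto
  }
qed

text \<open>After k steps only outer positions are left, and on these the contracted matching agrees
  with the glued relation, that is, with the connectivity of the outer rows.\<close>

lemma contracted_eq: "contracted k d1 d2 k = (`) (outer_pos k) ` diagram_comp d1 d2"
proof -
  have pm: "partition_on (open_pos k k) (contracted k d1 d2 k)"
    using contracted_planar[OF d1 d2 order_refl] unfolding planar_matching_def by auto
  have blk: "outer_pos k ` {v \<in> vertices k. glued k d1 d2 k (outer_pos k w) (outer_pos k v)} =
      {y. blockwise (contracted k d1 d2 k) (outer_pos k w) y}" if w: "w \<in> vertices k" for w
  proof -
    have "outer_pos k w \<in> open_pos k k" using w outer_pos_image by blast
    then have "{y. blockwise (contracted k d1 d2 k) (outer_pos k w) y} =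
        {y \<in> outer_pos k ` vertices k. glued k d1 d2 k (outer_pos k w) y}"
      using glued_contracted[OF d1 d2 order_refl] outer_pos_image[of k] per_dom[OF per_blockwise[OF pm]] by blast
    then show ?thesis by auto
  qed
  have "contracted k d1 d2 k = (\<lambda>x. {y. blockwise (contracted k d1 d2 k) x y}) ` open_pos k k" (is "_ = ?g ` _")
  proof (intro Set.set_eqI iffI)
    fix B assume B: "B \<in> contracted k d1 d2 k"
    then obtain x where x: "x \<in> B" using pm unfolding partition_on_def by fastforce
    then have "x \<in> open_pos k k" using pm B unfolding partition_on_def by auto
    then show "B \<in> ?g ` open_pos k k" using blockwise_block[OF pm B x] by blast
  next
    fix B assume "B \<in> ?g ` open_pos k k"
    then obtain x where x: "x \<in> open_pos k k" "B = ?g x" by auto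
    then obtain B' where "B' \<in> contracted k d1 d2 k" "x \<in> B'" using pm unfolding partition_on_def by auto
    then show "B \<in> contracted k d1 d2 k" using x blockwise_block[OF pm] by metis
  qed
  also have "\<dots> = (\<lambda>w. ?g (outer_pos k w)) ` vertices k"
    unfolding outer_pos_image[symmetric] by (simp add: image_image)
  also have "\<dots> = (`) (outer_pos k) ` diagram_comp d1 d2"
    unfolding diagram_comp_eq image_image using blk by (intro image_cong) auto
  finally show ?thesis .
qed

text \<open>Transported back from the contracted matching along the injection
  \<open>outer_pos\<close>, so no separate argument about paths is needed.\<close>

lemma diagram_comp_partition: "partition_on (vertices k) (diagram_comp d1 d2)"
proof -
  have pm: "partition_on (outer_pos k ` vertices k) ((`) (outer_pos k) ` diagram_comp d1 d2)"
    using contracted_planar[OF d1 d2 order_refl] unfolding planar_matching_def contracted_eq outer_pos_image by auto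
  have V: "B \<subseteq> vertices k" if "B \<in> diagram_comp d1 d2" for B using that unfolding diagram_comp_eq by auto
  have "(`) (the_inv_into (vertices k) (outer_pos k)) ` (`) (outer_pos k) ` diagram_comp d1 d2 = diagram_comp d1 d2"
  proof -
    have "the_inv_into (vertices k) (outer_pos k) ` outer_pos k ` B = B" if "B \<in> diagram_comp d1 d2" for B
    proof -
      have "\<And>v. v \<in> B \<Longrightarrow> the_inv_into (vertices k) (outer_pos k) (outer_pos k v) = v"
        using V[OF that] the_inv_into_f_f[OF inj_on_outer_pos[of k]] by blast
      then show ?thesis by (simp add: image_image)
    qed
    then show ?thesis by (simp add: image_image)
  qed
  moreover have "the_inv_into (vertices k) (outer_pos k) ` outer_pos k ` vertices k = vertices k"
    using the_inv_into_f_f[OF inj_on_outer_pos[of k]] by (simp add: image_image)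
  ultimately show ?thesis
    using partition_on_image[OF pm inj_on_the_inv_into[OF inj_on_outer_pos]] by simp
qed

text \<open>A middle vertex has one position in each rectangle, so the two edge conditions in
  \<open>loops\<close> become the single condition that every position of the class lies on an
  edge.\<close>

lemma loops_eq:
  "loops d1 d2 = card (closed_classes {1..4 * k} (\<lambda>x. \<exists>B\<in>stack k d1 d2. x \<in> B \<and> card B = 2)
     (glued k d1 d2 k) (open_pos k k))"
    (is "_ = card (closed_classes ?U ?P ?e ?S)")
proof -
  note P = per_glued[OF d1 d2 order_refl]
  have P1: "?P (circ k v) \<longleftrightarrow> (\<exists>B\<in>d1. v \<in> B \<and> card B = 2)" if v: "v \<in> vertices k" for v
  proof
    assume "?P (circ k v)"
    then obtain B where B: "B \<in> stack k d1 d2" "circ k v \<in> B" "card B = 2" by blast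
    have "B \<notin> (`) (\<lambda>v. 2 * k + circ k v) ` d2"
      using B(2) circ_bounds[OF v] block_vertices(2) circ_bounds by fastforce
    then obtain C where C: "C \<in> d1" "B = circ k ` C" using B(1) unfolding stack_def by auto
    then have "v \<in> C" "card C = 2"
      using B v block_vertices(1)[OF C(1)] inj_on_circ[of k]
      by (auto simp: inj_on_image_mem_iff card_image inj_on_subset)
    then show "\<exists>B\<in>d1. v \<in> B \<and> card B = 2" using C by blast
  next
    assume "\<exists>B\<in>d1. v \<in> B \<and> card B = 2"
    then obtain C where C: "C \<in> d1" "v \<in> C" "card C = 2" by blast
    then have "card (circ k ` C) = 2" using block_vertices(1)[OF C(1)] inj_on_circ[of k]
      by (auto simp: card_image inj_on_subset)
    then show "?P (circ k v)" using C unfolding stack_def by auto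
  qed
  have P2: "?P (2 * k + circ k v) \<longleftrightarrow> (\<exists>B\<in>d2. v \<in> B \<and> card B = 2)" if v: "v \<in> vertices k" for v
  proof -
    have inj: "inj_on (\<lambda>v. 2 * k + circ k v) (vertices k)" using inj_on_circ[of k] by (auto simp: inj_on_def)
    show ?thesis
  proof
    assume "?P (2 * k + circ k v)"
    then obtain B where B: "B \<in> stack k d1 d2" "2 * k + circ k v \<in> B" "card B = 2" by blast
    have "B \<notin> (`) (circ k) ` d1"
      using B(2) circ_bounds[OF v] block_vertices(1) circ_bounds by fastforce
    then obtain C where C: "C \<in> d2" "B = (\<lambda>v. 2 * k + circ k v) ` C" using B(1) unfolding stack_def by auto
    then have "v \<in> C"
      using B v block_vertices(2)[OF C(1)] inj_on_image_mem_iff[OF inj v block_vertices(2)[OF C(1)]] by auto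
    moreover have "card C = 2" using B C card_image[OF inj_on_subset[OF inj block_vertices(2)[OF C(1)]]] by auto
    ultimately show "\<exists>B\<in>d2. v \<in> B \<and> card B = 2" using C by blast
  next
    assume "\<exists>B\<in>d2. v \<in> B \<and> card B = 2"
    then obtain C where C: "C \<in> d2" "v \<in> C" "card C = 2" by blast
    then have "card ((\<lambda>v. 2 * k + circ k v) ` C) = 2"
      using card_image[OF inj_on_subset[OF inj block_vertices(2)[OF C(1)]]] by auto
    then show "?P (2 * k + circ k v)" using C unfolding stack_def by auto
  qed
  qed
  have mid: "(\<exists>B\<in>d1. Bot i \<in> B \<and> card B = 2) \<longleftrightarrow> ?P (2 * k + 1 - i)"
    "(\<exists>B\<in>d2. Top i \<in> B \<and> card B = 2) \<longleftrightarrow> ?P (2 * k + i)" if "1 \<le> i" "i \<le> k" for i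
    using P1[of "Bot i"] P2[of "Top i"] that by (auto simp: vertices_def)
  have cond: "row_pos k ` Z \<subseteq> range Middle \<and>
      (\<forall>i. Middle i \<in> row_pos k ` Z \<longrightarrow> (\<exists>B\<in>d1. Bot i \<in> B \<and> card B = 2) \<and> (\<exists>B\<in>d2. Top i \<in> B \<and> card B = 2))
    \<longleftrightarrow> Z \<inter> ?S = {} \<and> (\<forall>y\<in>Z. ?P y)" if x: "x \<in> ?U" and Z: "Z = {y. ?e x y}" for x Z
  proof -
    have ZU: "Z \<subseteq> ?U" using per_dom[OF P] Z by blast
    have a: "row_pos k ` Z \<subseteq> range Middle \<longleftrightarrow> Z \<inter> ?S = {}"
      using ZU middle_iff_not_open[of _ k] by blast
    \<comment> \<open>A class contains all positions of each of its vertices, in particular both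
      positions of a middle vertex.\<close>
    have sat: "y \<in> Z" if "y' \<in> Z" "y \<in> ?U" "row_pos k y = row_pos k y'" for y y'
      using that glued_same_row[of y' y] ZU per_trans[OF P] unfolding Z by auto
    have "(\<forall>i. Middle i \<in> row_pos k ` Z \<longrightarrow> (\<exists>B\<in>d1. Bot i \<in> B \<and> card B = 2) \<and> (\<exists>B\<in>d2. Top i \<in> B \<and> card B = 2))
        \<longleftrightarrow> (\<forall>y\<in>Z. ?P y)" if no: "Z \<inter> ?S = {}"
    proof
      assume L: "\<forall>i. Middle i \<in> row_pos k ` Z \<longrightarrow> (\<exists>B\<in>d1. Bot i \<in> B \<and> card B = 2) \<and> (\<exists>B\<in>d2. Top i \<in> B \<and> card B = 2)"
      show "\<forall>y\<in>Z. ?P y"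
      proof
        fix y assume y: "y \<in> Z"
        then have yk: "k < y" "y \<le> 3 * k" 
          using disjoint_iff[THEN iffD1, OF no, rule_format, OF y] subsetD[OF ZU y] unfolding open_pos_def by auto
        show "?P y"
        proof (cases "y \<le> 2 * k")
          case True
          then have "row_pos k y = Middle (2 * k + 1 - y)" using yk by (simp add: row_pos.simps)
          then have "Middle (2 * k + 1 - y) \<in> row_pos k ` Z" using y by (metis imageI)
          then have "?P (2 * k + 1 - (2 * k + 1 - y))" using L mid(1)[of "2 * k + 1 - y"] True yk by auto
          moreover have "2 * k + 1 - (2 * k + 1 - y) = y" using True by simp
          ultimately show ?thesis by simp
        next
          case False
          then have "row_pos k y = Middle (y - 2 * k)" using yk by (simp add: row_pos.simps)
          then have "Middle (y - 2 * k) \<in> row_pos k ` Z" using y by (metis imageI)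
          then have "?P (2 * k + (y - 2 * k))" using L mid(2)[of "y - 2 * k"] False yk by auto
          moreover have "2 * k + (y - 2 * k) = y" using False by simp
          ultimately show ?thesis by simp
        qed
      qed
    next
      assume R: "\<forall>y\<in>Z. ?P y"
      show "\<forall>i. Middle i \<in> row_pos k ` Z \<longrightarrow> (\<exists>B\<in>d1. Bot i \<in> B \<and> card B = 2) \<and> (\<exists>B\<in>d2. Top i \<in> B \<and> card B = 2)"
      proof (intro allI impI)
        fix i assume "Middle i \<in> row_pos k ` Z"
        then obtain y where y: "y \<in> Z" "row_pos k y = Middle i" by force
        then have i: "1 \<le> i" "i \<le> k" using ZU by (auto simp: row_pos.simps split: if_splits)
        have "row_pos k (2 * k + 1 - i) = Middle i" "row_pos k (2 * k + i) = Middle i"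
          using i by (auto simp: row_pos.simps)
        moreover have "2 * k + 1 - i \<in> ?U" "2 * k + i \<in> ?U" using i by auto
        ultimately have "2 * k + 1 - i \<in> Z" "2 * k + i \<in> Z" using sat[OF y(1)] y(2) by metis+
        then have "?P (2 * k + 1 - i)" "?P (2 * k + i)" using R by blast+
        then show "(\<exists>B\<in>d1. Bot i \<in> B \<and> card B = 2) \<and> (\<exists>B\<in>d2. Top i \<in> B \<and> card B = 2)"
          using mid[OF i] by blast
      qed
    qed
    then show ?thesis using a by blast
  qed
  have "{C \<in> components d1 d2. C \<subseteq> range Middle \<and>
     (\<forall>i. Middle i \<in> C \<longrightarrow> (\<exists>B\<in>d1. Bot i \<in> B \<and> card B = 2) \<and> (\<exists>B\<in>d2. Top i \<in> B \<and> card B = 2))} =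
    (`) (row_pos k) ` closed_classes ?U ?P ?e ?S"
  proof (intro Set.set_eqI iffI, goal_cases)
    case (1 C)
    then obtain x where x: "x \<in> ?U" "C = row_pos k ` {y. ?e x y}" unfolding components_eq by blast
    then have "{y. ?e x y} \<in> closed_classes ?U ?P ?e ?S"
      unfolding closed_classes_def using cond[OF x(1) refl] 1 by blast
    then show ?case using x by blast
  next
    case (2 C)
    then obtain x where x: "x \<in> ?U" "C = row_pos k ` {y. ?e x y}" "{y. ?e x y} \<inter> ?S = {} \<and> (\<forall>y\<in>{y. ?e x y}. ?P y)"
      unfolding closed_classes_def by blast
    then show ?case using cond[OF x(1) refl] unfolding components_eq by blast
  qed
  moreover have "inj_on ((`) (row_pos k)) (closed_classes ?U ?P ?e ?S)"
  proof (rule inj_onI)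
    fix Z Z' assume Z: "Z \<in> closed_classes ?U ?P ?e ?S" "Z' \<in> closed_classes ?U ?P ?e ?S" "row_pos k ` Z = row_pos k ` Z'"
    then obtain x x' where x: "x \<in> ?U" "Z = {y. ?e x y}" "x' \<in> ?U" "Z' = {y. ?e x' y}"
      unfolding closed_classes_def by blast
    have "row_pos k x \<in> row_pos k ` Z'" unfolding Z(3)[symmetric] using x per_refl[OF P] by auto
    then obtain y where y: "?e x' y" "row_pos k x = row_pos k y" using x by auto
    then have "?e x y" using glued_same_row x(1) per_dom[OF P] by blast
    then have "?e x x'" using y per_sym[OF P] per_trans[OF P] by blast
    then show "Z = Z'" unfolding x using per_sym[OF P] per_trans[OF P] by blast
  qed
  ultimately show ?thesis unfolding loops_def by (simp add: card_image)
qed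

end

section \<open>Multiplicativity of the diagram matrices\<close>

definition words :: "nat \<Rightarrow> basis list set" where
  "words n = {w. length w = n}"

definition dual :: "basis list \<Rightarrow> basis list" where
  "dual w = rev (map neg w)"

definition fold_wts :: "'a::field \<Rightarrow> basis list \<Rightarrow> 'a" where
  "fold_wts t w = prod_list (map (fold_wt t) w)"

definition label :: "basis list \<Rightarrow> nat \<Rightarrow> basis" where
  "label w p = w ! (p - 1)"

text \<open>
  The bottom row is folded around to the right of the top row, in the order of \<open>circ\<close>; under the
  identification of \<open>V\<close> with its dual its letters are negated and weighted by \<open>fold_wt\<close>.
\<close>

definition diagram_mat :: "'a::field \<Rightarrow> nat \<Rightarrow> diagram \<Rightarrow> basis list \<Rightarrow> basis list \<Rightarrow> 'a" where
  "diagram_mat t k d w' w =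
     fold_wts t (dual w) * matching_wt t ((`) (circ k) ` d) (label (w' @ dual w))"

lemma length_dual [simp]: "length (dual w) = length w"
  by (simp add: dual_def)

lemma dual_dual [simp]: "dual (dual w) = w"
  by (simp add: dual_def rev_map comp_def)

lemma dual_Cons [simp]: "dual (a # w) = dual w @ [neg a]"
  by (simp add: dual_def)

lemma dual_Nil [simp]: "dual [] = []"
  by (simp add: dual_def)

lemma dual_snoc [simp]: "dual (w @ [a]) = neg a # dual w"
  by (simp add: dual_def)

lemma nth_dual: "i < length w \<Longrightarrow> dual w ! i = neg (w ! (length w - 1 - i))"
  by (simp add: dual_def rev_nth)

lemma fold_wts_Nil [simp]: "fold_wts t [] = 1"
  by (simp add: fold_wts_def)

lemma fold_wts_Cons [simp]: "fold_wts t (a # w) = fold_wt t a * fold_wts t w"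
  by (simp add: fold_wts_def)

lemma fold_wts_append [simp]: "fold_wts t (v @ w) = fold_wts t v * fold_wts t w"
  by (simp add: fold_wts_def)

lemma finite_words [simp]: "finite (words n)"
  using finite_lists_length_eq[of "UNIV :: basis set" n] by (simp add: words_def)

lemma words_0 [simp]: "words 0 = {[]}"
  by (auto simp: words_def)

lemma mem_words [simp]: "w \<in> words n \<longleftrightarrow> length w = n"
  by (simp add: words_def)

lemma sum_words_Suc: "(\<Sum>w\<in>words (Suc n). g w) = (\<Sum>a\<in>UNIV. \<Sum>w\<in>words n. g (a # w))"
  for g :: "basis list \<Rightarrow> 'b::comm_monoid_add"
proof -
  have "words (Suc n) = (\<lambda>(a, w). a # w) ` (UNIV \<times> words n)"
    by (auto simp: words_def length_Suc_conv image_iff)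
  moreover have "inj_on (\<lambda>(a, w). a # w) (UNIV \<times> words n)" by (auto simp: inj_on_def)
  ultimately show ?thesis
    unfolding sum.cartesian_product by (simp add: sum.reindex) (auto intro!: sum.cong)
qed

lemma sum_words_snoc: "(\<Sum>w\<in>words (Suc n). g w) = (\<Sum>a\<in>UNIV. \<Sum>w\<in>words n. g (w @ [a]))"
  for g :: "basis list \<Rightarrow> 'b::comm_monoid_add"
proof -
  have "words (Suc n) = (\<lambda>(a, w). w @ [a]) ` (UNIV \<times> words n)"
    by (auto simp: words_def length_Suc_conv_rev image_iff)
  moreover have "inj_on (\<lambda>(a, w). w @ [a]) (UNIV \<times> words n)" by (auto simp: inj_on_def)
  ultimately show ?thesis
    unfolding sum.cartesian_product by (simp add: sum.reindex) (auto intro!: sum.cong)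
qed

lemma sum_neg: "(\<Sum>c\<in>UNIV. g (neg c)) = (\<Sum>c\<in>UNIV. g c)"
  for g :: "basis \<Rightarrow> 'b::comm_monoid_add"
  by (simp add: sum_basis add_ac)

lemma block_wt_image:
  assumes "strict_mono f" "finite B" "B \<noteq> {}"
  shows "block_wt t x (f ` B) = block_wt t (x \<circ> f) B"
proof -
  have "mono f" using assms(1) strict_mono_mono by blast
  then have "Min (f ` B) = f (Min B)" "Max (f ` B) = f (Max B)"
    using assms(2,3) mono_Min_commute mono_Max_commute by metis+
  then show ?thesis
    unfolding block_wt_def using strict_mono_eq[OF assms(1)] by simp
qed

lemma matching_wt_image:
  assumes "strict_mono f" "planar_matching S D"
  shows "matching_wt t ((`) f ` D) x = matching_wt t D (x \<circ> f)"
proof -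
  have "inj_on ((`) f) D"
    using inj_image_eq_iff[OF strict_mono_imp_inj_on[OF assms(1)]] by (auto simp: inj_on_def)
  moreover have "block_wt t x (f ` B) = block_wt t (x \<circ> f) B" if "B \<in> D" for B
    using block_wt_image[OF assms(1) matching_finite(2,3)[OF assms(2) that]] .
  ultimately show ?thesis
    unfolding matching_wt_def by (simp add: prod.reindex)
qed

context
  fixes k :: nat and d1 d2 :: diagram
  assumes d1: "d1 \<in> motzkin_diagrams k" and d2: "d2 \<in> motzkin_diagrams k"
begin

section \<open>Counting loops and summing over the middle row\<close>

definition on_edge :: "nat \<Rightarrow> bool" where
  "on_edge x \<longleftrightarrow> (\<exists>B\<in>stack k d1 d2. x \<in> B \<and> card B = 2)"

text \<open>A class meets the open positions within one block of the contracted matching, and blocks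
  have at most two points.\<close>

lemma glued_two:
  assumes "j \<le> k" "x \<in> open_pos k j" "y \<in> open_pos k j" "z \<in> open_pos k j"
    "glued k d1 d2 j x y" "glued k d1 d2 j x z"
  shows "x = y \<or> x = z \<or> y = z"
proof (rule ccontr)
  assume "\<not> ?thesis"
  then have c: "card {x, y, z} = 3" by auto
  have pm: "planar_matching (open_pos k j) (contracted k d1 d2 j)"
    using contracted_planar[OF d1 d2 assms(1)] .
  then have part: "partition_on (open_pos k j) (contracted k d1 d2 j)"
    unfolding planar_matching_def by auto
  have "blockwise (contracted k d1 d2 j) x y" "blockwise (contracted k d1 d2 j) x z"
    using glued_contracted[OF d1 d2 assms(1)] assms by auto
  then obtain B where B: "B \<in> contracted k d1 d2 j" "{x, y, z} \<subseteq> B"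
    unfolding blockwise_def using partition_block_unique[OF part] by blast
  then have "card {x, y, z} \<le> card B" using matching_finite(2)[OF pm] by (intro card_mono) auto
  then show False using B c pm unfolding planar_matching_def by force
qed

lemma glued_iff_block:
  assumes "j < k"
  shows "glued k d1 d2 j (2 * k - j) (2 * k + j + 1) \<longleftrightarrow> {2 * k - j, 2 * k + j + 1} \<in> contracted k d1 d2 j"
proof -
  have pm: "planar_matching (open_pos k j) (contracted k d1 d2 j)"
    using contracted_planar[OF d1 d2] assms by simp
  have "glued k d1 d2 j (2 * k - j) (2 * k + j + 1) \<longleftrightarrow> blockwise (contracted k d1 d2 j) (2 * k - j) (2 * k + j + 1)"
    using glued_contracted[OF d1 d2 _ open_pos_mem[OF assms]] assms by simp
  also have "\<dots> \<longleftrightarrow> {2 * k - j, 2 * k + j + 1} \<in> contracted k d1 d2 j"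
  proof
    assume "blockwise (contracted k d1 d2 j) (2 * k - j) (2 * k + j + 1)"
    then obtain B where B: "B \<in> contracted k d1 d2 j" "2 * k - j \<in> B" "2 * k + j + 1 \<in> B"
      unfolding blockwise_def by blast
    have "card B \<le> 2" using B(1) pm unfolding planar_matching_def by blast
    then have "B = {2 * k - j, 2 * k + j + 1}"
      by (rule card_le_2_cases[OF matching_finite(2)[OF pm B(1)] B(2)]) (use B(3) in auto)
    then show "{2 * k - j, 2 * k + j + 1} \<in> contracted k d1 d2 j" using B by simp
  next
    assume "{2 * k - j, 2 * k + j + 1} \<in> contracted k d1 d2 j"
    then show "blockwise (contracted k d1 d2 j) (2 * k - j) (2 * k + j + 1)"
      unfolding blockwise_def by blast
  qed
  finally show ?thesis .
qed

text \<open>Supplies the hypothesis \<open>inv\<close> of \<open>closed_classes_glue\<close> at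
  every stage. Initially classes are blocks, and the points of a block lie on an edge iff the block
  has a second point; later stages inherit the property from the gluing lemma itself.\<close>

lemma glued_ends:
  assumes "j \<le> k" "x \<in> open_pos k j"
  shows "(\<forall>y. glued k d1 d2 j x y \<longrightarrow> on_edge y) \<longleftrightarrow> (\<exists>y\<in>open_pos k j. y \<noteq> x \<and> glued k d1 d2 j x y)"
  using assms
proof (induction j arbitrary: x)
  case 0
  have pm: "planar_matching {1..4 * k} (stack k d1 d2)" using stack_planar[OF d1 d2] .
  then have part: "partition_on {1..4 * k} (stack k d1 d2)" unfolding planar_matching_def by auto
  have "x \<in> {1..4 * k}" using 0 open_pos_0 by simp
  then obtain B where B: "B \<in> stack k d1 d2" "x \<in> B" using part unfolding partition_on_def by blast
  have g: "glued k d1 d2 0 x y \<longleftrightarrow> y \<in> B" for y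
    using blockwise_block[OF part B] by auto
  have oe: "on_edge y \<longleftrightarrow> card B = 2" if "y \<in> B" for y
    unfolding on_edge_def using partition_block_unique[OF part B(1)] that B by blast
  have "card B \<le> 2" using B pm unfolding planar_matching_def by auto
  then have "card B = 2 \<longleftrightarrow> (\<exists>y\<in>B. y \<noteq> x)"
    by (rule card_le_2_cases[OF matching_finite(2)[OF pm B(1)] B(2)]) auto
  moreover have "B \<subseteq> open_pos k 0" using matching_finite(4)[OF pm B(1)] open_pos_0 by simp
  ultimately show ?case unfolding g using oe B(2) by blast
next
  case (Suc j)
  then have j: "j < k" "j \<le> k" by simp_all
  show ?case
    using closed_classes_glue(2)[OF per_glued[OF d1 d2 j(2)] open_pos_subset open_pos_mem[OF j(1)] _ _ Suc.IH[OF j(2)] glued_two[OF j(2)]]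
      Suc.prems(2) j(1) unfolding open_pos_Suc glued.simps by simp
qed

lemma card_closed_Suc:
  assumes "j < k"
  shows "card (closed_classes {1..4 * k} on_edge (glued k d1 d2 (Suc j)) (open_pos k (Suc j))) =
    card (closed_classes {1..4 * k} on_edge (glued k d1 d2 j) (open_pos k j)) +
    (if {2 * k - j, 2 * k + j + 1} \<in> contracted k d1 d2 j then 1 else 0)"
proof -
  have j: "j \<le> k" using assms by simp
  show ?thesis
    using closed_classes_glue(1)[OF per_glued[OF d1 d2 j] open_pos_subset open_pos_mem[OF assms] _ _ glued_ends[OF j] glued_two[OF j]]
      assms unfolding open_pos_Suc glued.simps glued_iff_block[OF assms] by simp
qed

text \<open>The letters of u stand on the right-hand positions of the contracted pairs, in the order
  of contraction, and their negatives on the left-hand ones, as the copairing demands. All other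
  positions keep their label from x.\<close>

definition cut :: "(nat \<Rightarrow> basis) \<Rightarrow> basis list \<Rightarrow> nat \<Rightarrow> basis" where
  "cut x u p = (if 2 * k - length u < p \<and> p \<le> 2 * k then neg (u ! (2 * k - p))
     else if 2 * k < p \<and> p \<le> 2 * k + length u then u ! (p - 2 * k - 1) else x p)"

lemma cut_snoc:
  assumes "length u < k"
  shows "cut x (u @ [c]) = cut (x(2 * k - length u := neg c, 2 * k + length u + 1 := c)) u"
proof
  fix p
  consider "2 * k - length u < p \<and> p \<le> 2 * k" | "p = 2 * k - length u" | "2 * k < p \<and> p \<le> 2 * k + length u"
    | "p = 2 * k + length u + 1" | "p < 2 * k - length u \<or> p > 2 * k + length u + 1" by linarith
  then show "cut x (u @ [c]) p = cut (x(2 * k - length u := neg c, 2 * k + length u + 1 := c)) u p"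
  proof cases
    case 1
    then have "2 * k - p < length u" "2 * k - Suc (length u) < p" by linarith+
    then show ?thesis using 1 assms by (simp add: cut_def nth_append)
  next
    case 2
    then have "2 * k - p = length u" "p \<le> 2 * k" "2 * k - Suc (length u) < p" using assms by linarith+
    then show ?thesis using 2 assms by (auto simp: cut_def nth_append)
  next
    case 3
    then have "p - 2 * k - 1 < length u" "\<not> p \<le> 2 * k" by linarith+
    then show ?thesis using 3 assms by (simp add: cut_def nth_append)
  next
    case 4
    then show ?thesis using assms by (simp add: cut_def nth_append)
  next
    case 5
    then show ?thesis using assms by (auto simp: cut_def nth_append)
  qed
qed

text \<open>The last letter of u labels the pair contracted last. With this letter fixed, the
  induction hypothesis for an x changed at that pair performs the other contractions; the sum over
  the letter is then one instance of \<open>matching_wt_contract\<close>. The exponent counts the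
  closed classes met so far.\<close>

lemma sum_cut:
  assumes "t \<noteq> 0" "j \<le> k"
  shows "(\<Sum>u\<in>words j. fold_wts t (dual u) * matching_wt t (stack k d1 d2) (cut x u)) =
    (1 - t - inverse t) ^ card (closed_classes {1..4 * k} on_edge (glued k d1 d2 j) (open_pos k j)) *
    matching_wt t (contracted k d1 d2 j) x"
  using assms(2)
proof (induction j arbitrary: x)
  case 0
  have "cut x [] = x" by (intro ext) (auto simp: cut_def)
  moreover have "closed_classes {1..4 * k} on_edge (glued k d1 d2 0) (open_pos k 0) = {}"
    using per_refl[OF per_glued[OF d1 d2 le0]] unfolding closed_classes_def open_pos_0 by blast
  ultimately show ?case by simp
next
  case (Suc j)
  then have j: "j < k" "j \<le> k" by simp_all
  let ?n = "card (closed_classes {1..4 * k} on_edge (glued k d1 d2 j) (open_pos k j))"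
  let ?\<delta> = "1 - t - inverse t" and ?u = "2 * k - j" and ?v = "2 * k + j + 1"
  have "(\<Sum>u\<in>words (Suc j). fold_wts t (dual u) * matching_wt t (stack k d1 d2) (cut x u)) =
    (\<Sum>c\<in>UNIV. fold_wt t (neg c) * (\<Sum>u\<in>words j. fold_wts t (dual u) *
        matching_wt t (stack k d1 d2) (cut (x(?u := neg c, ?v := c)) u)))"
    unfolding sum_words_snoc sum_distrib_left
    by (intro sum.cong refl) (use j in \<open>simp add: cut_snoc mult.assoc\<close>)
  also have "\<dots> = (\<Sum>c\<in>UNIV. fold_wt t (neg c) * (?\<delta> ^ ?n * matching_wt t (contracted k d1 d2 j) (x(?u := neg c, ?v := c))))"
    by (simp only: Suc.IH[OF j(2)])
  \<comment> \<open>\<open>matching_wt_contract\<close> sums over the label of the left position,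
    which is the negative of the letter of u.\<close>
  also have "\<dots> = (\<Sum>c\<in>UNIV. fold_wt t c * (?\<delta> ^ ?n * matching_wt t (contracted k d1 d2 j) (x(?u := c, ?v := neg c))))"
    using sum_neg[of "\<lambda>c. fold_wt t c * (?\<delta> ^ ?n * matching_wt t (contracted k d1 d2 j) (x(?u := c, ?v := neg c)))"] by simp
  also have "\<dots> = ?\<delta> ^ ?n * (\<Sum>c\<in>UNIV. fold_wt t c * matching_wt t (contracted k d1 d2 j) (x(?u := c, ?v := neg c)))"
    by (simp add: sum_distrib_left mult_ac)
  also have "\<dots> = ?\<delta> ^ ?n * ((if {?u, ?v} \<in> contracted k d1 d2 j then ?\<delta> else 1) * matching_wt t (contracted k d1 d2 (Suc j)) x)"
    unfolding contracted.simps
    by (subst matching_wt_contract[OF assms(1) contracted_planar[OF d1 d2 j(2)] open_pos_mem[OF j(1)]])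
      (auto simp: open_pos_def)
  finally show ?case unfolding card_closed_Suc[OF j(1)] by (simp add: power_add)
qed

text \<open>The increasing map from the boundary positions of a single rectangle to the outer
  positions of the stack; it jumps over the 2 k positions of the middle row.\<close>

definition spread :: "nat \<Rightarrow> nat" where
  "spread p = (if p \<le> k then p else p + 2 * k)"

lemma strict_mono_spread: "strict_mono spread"
  unfolding strict_mono_def spread_def by auto

lemma contracted_spread: "contracted k d1 d2 k = (`) spread ` (`) (circ k) ` diagram_comp d1 d2"
proof -
  have "outer_pos k v = spread (circ k v)" if "v \<in> vertices k" for v
    using that by (elim vertices_cases) (auto simp: spread_def)
  moreover have "B \<subseteq> vertices k" if "B \<in> diagram_comp d1 d2" for B
    using that diagram_comp_partition[OF d1 d2] unfolding partition_on_def by auto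
  ultimately show ?thesis
    unfolding contracted_eq[OF d1 d2] image_image by (intro image_cong refl) blast
qed

lemma diagram_comp_motzkin: "diagram_comp d1 d2 \<in> motzkin_diagrams k"
proof (rule motzkinI[OF diagram_comp_partition[OF d1 d2]])
  let ?D = "(`) (circ k) ` diagram_comp d1 d2"
  have part: "partition_on {1..2 * k} ?D"
    using partition_on_image[OF diagram_comp_partition[OF d1 d2] inj_on_circ] circ_image_vertices by simp
  have pm: "planar_matching (open_pos k k) ((`) spread ` ?D)"
    using contracted_planar[OF d1 d2 order_refl] contracted_spread by simp
  have inj: "inj spread" using strict_mono_imp_inj_on[OF strict_mono_spread] .
  have "card B \<le> 2" if "B \<in> ?D" for B
  proof -
    have "card (spread ` B) = card B" using inj card_image inj_on_subset by blast
    then show ?thesis using that pm unfolding planar_matching_def by (metis imageI)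
  qed
  moreover have "planar ?D"
    unfolding planar_def
  proof (intro ballI impI)
    fix B B' a b c d assume B: "B \<in> ?D" "B' \<in> ?D" "B \<noteq> B'" "a \<in> B" "b \<in> B" "c \<in> B'" "d \<in> B'"
    have "spread ` B \<noteq> spread ` B'" using B(3) inj_image_eq_iff[OF inj] by blast
    moreover have "planar ((`) spread ` ?D)" using pm unfolding planar_matching_def by blast
    ultimately have "((spread a < spread c) = (spread b < spread c)) = ((spread a < spread d) = (spread b < spread d))"
      using B by (intro planarD[of "(`) spread ` ?D" "spread ` B" "spread ` B'"] imageI)
    then show "((a < c) = (b < c)) = ((a < d) = (b < d))"
      unfolding strict_mono_less[OF strict_mono_spread] .
  qed
  ultimately show "planar_matching {1..2 * k} ?D" unfolding planar_matching_def using part by auto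
qed

text \<open>Writing u on the middle row of both factors is the labelling \<open>cut x u\<close>, and
  the weight \<open>fold_wts t (dual u)\<close> comes from the left factor. Summing over u contracts
  all k pairs, which leaves the composed diagram and one loop value for each closed class.\<close>

lemma diagram_mat_mult:
  assumes "t \<noteq> 0" "length w' = k" "length w = k"
  shows "(\<Sum>u\<in>words k. diagram_mat t k d1 w' u * diagram_mat t k d2 u w) =
    (1 - t - inverse t) ^ loops d1 d2 * diagram_mat t k (diagram_comp d1 d2) w' w"
proof -
  define x where "x = (\<lambda>p. if p \<le> k then w' ! (p - 1) else dual w ! (p - 3 * k - 1))"
  have p1: "planar_matching {1..2 * k} ((`) (circ k) ` d1)" and p2: "planar_matching {1..2 * k} ((`) (circ k) ` d2)"
    using motzkin_planar d1 d2 by auto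
  have st: "stack k d1 d2 = (`) (circ k) ` d1 \<union> (`) ((+) (2 * k)) ` (`) (circ k) ` d2"
    unfolding stack_def by (simp add: image_image)
  have disj: "(`) (circ k) ` d1 \<inter> (`) ((+) (2 * k)) ` (`) (circ k) ` d2 = {}"
  proof -
    have False if B: "B \<in> (`) (circ k) ` d1" and C: "C \<in> (`) (circ k) ` d2" "B = (+) (2 * k) ` C" for B C
    proof -
      obtain c where c: "c \<in> C" using matching_finite(3)[OF p2 C(1)] by blast
      then have "c \<in> {1..2 * k}" using matching_finite(4)[OF p2 C(1)] by blast
      moreover have "2 * k + c \<in> {1..2 * k}" using c C(2) matching_finite(4)[OF p1 B] by auto
      ultimately show False by auto
    qed
    then show ?thesis by blast
  qed
  have split: "matching_wt t (stack k d1 d2) y =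
      matching_wt t ((`) (circ k) ` d1) y * matching_wt t ((`) (circ k) ` d2) (\<lambda>p. y (2 * k + p))" for y
  proof -
    have "matching_wt t (stack k d1 d2) y =
        matching_wt t ((`) (circ k) ` d1) y * matching_wt t ((`) ((+) (2 * k)) ` (`) (circ k) ` d2) y"
      unfolding st matching_wt_def
      using matching_finite(1)[OF p1] matching_finite(1)[OF p2] disj by (intro prod.union_disjoint) auto
    moreover have "strict_mono ((+) (2 * k))" by (simp add: strict_mono_def)
    ultimately show ?thesis 
      using matching_wt_image[OF _ p2, of "(+) (2 * k)" t y] by (simp add: comp_def)
  qed
  have prod_eq: "diagram_mat t k d1 w' u * diagram_mat t k d2 u w =
     fold_wts t (dual w) * (fold_wts t (dual u) * matching_wt t (stack k d1 d2) (cut x u))" if u: "length u = k" for u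
  proof -
    have "matching_wt t ((`) (circ k) ` d1) (label (w' @ dual u)) = matching_wt t ((`) (circ k) ` d1) (cut x u)"
    proof (rule matching_wt_cong[OF p1])
      fix p assume p: "p \<in> {1..2 * k}"
      show "label (w' @ dual u) p = cut x u p"
      proof (cases "p \<le> k")
        case True
        then show ?thesis using p assms u by (auto simp: label_def cut_def x_def nth_append)
      next
        case False
        then have "k - Suc (p - Suc k) = 2 * k - p" "p - Suc k < k" using p by auto
        then show ?thesis using p assms u False by (auto simp: label_def cut_def nth_append nth_dual)
      qed
    qed
    moreover have "matching_wt t ((`) (circ k) ` d2) (label (u @ dual w)) = matching_wt t ((`) (circ k) ` d2) (\<lambda>p. cut x u (2 * k + p))"
    proof (rule matching_wt_cong[OF p2])
      fix p assume p: "p \<in> {1..2 * k}"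
      show "label (u @ dual w) p = cut x u (2 * k + p)"
      proof (cases "p \<le> k")
        case True
        then show ?thesis using p assms u by (auto simp: label_def cut_def x_def nth_append)
      next
        case False
        then have "p - Suc k = 2 * k + p - 3 * k - 1" by simp
        then show ?thesis using p assms u False by (auto simp: label_def cut_def x_def nth_append)
      qed
    qed
    ultimately show ?thesis unfolding diagram_mat_def split by simp
  qed
  have cl: "card (closed_classes {1..4 * k} on_edge (glued k d1 d2 k) (open_pos k k)) = loops d1 d2"
    unfolding loops_eq[OF d1 d2] on_edge_def[abs_def] ..
  have "(\<Sum>u\<in>words k. diagram_mat t k d1 w' u * diagram_mat t k d2 u w) =
      fold_wts t (dual w) * (\<Sum>u\<in>words k. fold_wts t (dual u) * matching_wt t (stack k d1 d2) (cut x u))"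
    unfolding sum_distrib_left using prod_eq by (intro sum.cong) auto
  also have "\<dots> = fold_wts t (dual w) * ((1 - t - inverse t) ^ loops d1 d2 * matching_wt t (contracted k d1 d2 k) x)"
    unfolding sum_cut[OF assms(1) order_refl] cl ..
  also have "matching_wt t (contracted k d1 d2 k) x = matching_wt t ((`) (circ k) ` diagram_comp d1 d2) (x \<circ> spread)"
    unfolding contracted_spread using matching_wt_image[OF strict_mono_spread motzkin_planar[OF diagram_comp_motzkin]] .
  also have "\<dots> = matching_wt t ((`) (circ k) ` diagram_comp d1 d2) (label (w' @ dual w))"
  proof (rule matching_wt_cong[OF motzkin_planar[OF diagram_comp_motzkin]])
    fix p assume p: "p \<in> {1..2 * k}"
    show "(x \<circ> spread) p = label (w' @ dual w) p"
    proof (cases "p \<le> k")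
      case True
      then show ?thesis using p assms by (auto simp: label_def x_def spread_def nth_append)
    next
      case False
      then have "p + 2 * k - 3 * k - 1 = p - Suc k" by simp
      then show ?thesis using p assms False by (auto simp: label_def x_def spread_def nth_append)
    qed
  qed
  finally show ?thesis unfolding diagram_mat_def by (simp add: mult_ac)
qed

end

section \<open>Raising and lowering operators\<close>

fun k_wt :: "'a::field \<Rightarrow> basis \<Rightarrow> 'a" where
  "k_wt t Pos = t" | "k_wt t Nul = 1" | "k_wt t Neg = inverse t"

definition k_wts :: "'a::field \<Rightarrow> basis list \<Rightarrow> 'a" where
  "k_wts t w = prod_list (map (k_wt t) w)"

fun letter_weight :: "basis \<Rightarrow> int" where
  "letter_weight Pos = 1" | "letter_weight Nul = 0" | "letter_weight Neg = -1"

definition weight :: "basis list \<Rightarrow> int" where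
  "weight w = sum_list (map letter_weight w)"

text \<open>E in coordinates: v is the coefficient function of a vector, and the recursion on the
  first letter is Delta(E) = E \<otimes> K + 1 \<otimes> E. The parameter is kept free because both
  q and - s q are substituted.\<close>

fun raising :: "'a::field \<Rightarrow> (basis list \<Rightarrow> 'a) \<Rightarrow> basis list \<Rightarrow> 'a" where
  "raising t v [] = 0"
| "raising t v (a # x) = (if a = Pos then k_wts t x * v (Neg # x) else 0) + raising t (\<lambda>y. v (a # y)) x"

text \<open>F in coordinates, from Delta(F) = F \<otimes> 1 + 1/K \<otimes> F.\<close>

fun lowering :: "'a::field \<Rightarrow> (basis list \<Rightarrow> 'a) \<Rightarrow> basis list \<Rightarrow> 'a" where
  "lowering t v [] = 0"
| "lowering t v (a # x) = (if a = Neg then v (Pos # x) else 0) + inverse (k_wt t a) * lowering t (\<lambda>y. v (a # y)) x"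

text \<open>The transposes of the two operators.\<close>

fun coraising :: "'a::field \<Rightarrow> (basis list \<Rightarrow> 'a) \<Rightarrow> basis list \<Rightarrow> 'a" where
  "coraising t g [] = 0"
| "coraising t g (b # y) = (if b = Neg then k_wts t y * g (Pos # y) else 0) + coraising t (\<lambda>u. g (b # u)) y"

fun colowering :: "'a::field \<Rightarrow> (basis list \<Rightarrow> 'a) \<Rightarrow> basis list \<Rightarrow> 'a" where
  "colowering t g [] = 0"
| "colowering t g (b # y) = (if b = Pos then g (Neg # y) else 0) + inverse (k_wt t b) * colowering t (\<lambda>u. g (b # u)) y"

lemma k_wts_simps [simp]:
  "k_wts t [] = 1" "k_wts t (a # w) = k_wt t a * k_wts t w" "k_wts t (v @ w) = k_wts t v * k_wts t w"
  by (simp_all add: k_wts_def)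

lemma weight_simps [simp]:
  "weight [] = 0" "weight (a # w) = letter_weight a + weight w" "weight (v @ w) = weight v + weight w"
  by (simp_all add: weight_def)

lemma k_wt_nonzero [simp]: "t \<noteq> 0 \<Longrightarrow> k_wt t a \<noteq> 0"
  by (cases a) auto

lemma k_wts_nonzero [simp]: "t \<noteq> 0 \<Longrightarrow> k_wts t w \<noteq> 0"
  by (induction w) auto

lemma fold_wts_nonzero [simp]: "t \<noteq> 0 \<Longrightarrow> fold_wts t w \<noteq> 0"
proof (induction w)
  case (Cons a w) then show ?case by (cases a) auto
qed simp

lemma k_wts_powi: "t \<noteq> 0 \<Longrightarrow> k_wts t w = t powi weight w"
proof (induction w)
  case (Cons a w) then show ?case by (cases a) (auto simp: power_int_add power_int_diff divide_inverse mult.commute)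
qed simp

lemma abs_weight_le: "\<bar>weight w\<bar> \<le> int (length w)"
proof (induction w)
  case (Cons a w) then show ?case by (cases a) auto
qed simp

lemma raise_cong: "(\<And>y. length y = length x \<Longrightarrow> u y = v y) \<Longrightarrow> raising t u x = raising t v x"
proof (induction x arbitrary: u v)
  case (Cons a x)
  have "raising t (\<lambda>y. u (a # y)) x = raising t (\<lambda>y. v (a # y)) x" using Cons.prems by (intro Cons.IH) auto
  then show ?case using Cons.prems[of "Neg # x"] by simp
qed simp

lemma lower_cong: "(\<And>y. length y = length x \<Longrightarrow> u y = v y) \<Longrightarrow> lowering t u x = lowering t v x"
proof (induction x arbitrary: u v)
  case (Cons a x)
  have "lowering t (\<lambda>y. u (a # y)) x = lowering t (\<lambda>y. v (a # y)) x" using Cons.prems by (intro Cons.IH) auto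
  then show ?case using Cons.prems[of "Pos # x"] by simp
qed simp

lemma coraise_cong: "(\<And>y. length y = length x \<Longrightarrow> u y = v y) \<Longrightarrow> coraising t u x = coraising t v x"
proof (induction x arbitrary: u v)
  case (Cons a x)
  have "coraising t (\<lambda>y. u (a # y)) x = coraising t (\<lambda>y. v (a # y)) x" using Cons.prems by (intro Cons.IH) auto
  then show ?case using Cons.prems[of "Pos # x"] by simp
qed simp

lemma raise_add: "raising t (\<lambda>x. u x + v x) x = raising t u x + raising t v x"
  by (induction x arbitrary: u v) (auto simp: algebra_simps)

lemma raise_scale: "raising t (\<lambda>x. c * v x) x = c * raising t v x"
  by (induction x arbitrary: v) (auto simp: algebra_simps)

lemma raise_zero [simp]: "raising t (\<lambda>x. 0) x = 0"
  by (induction x) auto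

lemma raise_sum: "raising t (\<lambda>x. \<Sum>i\<in>I. v i x) x = (\<Sum>i\<in>I. raising t (v i) x)"
  by (induction I rule: infinite_finite_induct) (auto simp: raise_add)

lemma lower_add: "lowering t (\<lambda>x. u x + v x) x = lowering t u x + lowering t v x"
  by (induction x arbitrary: u v) (auto simp: algebra_simps)

lemma lower_scale: "lowering t (\<lambda>x. c * v x) x = c * lowering t v x"
  by (induction x arbitrary: v) (auto simp: algebra_simps)

lemma lower_zero [simp]: "lowering t (\<lambda>x. 0) x = 0"
  by (induction x) auto

lemma lower_sum: "lowering t (\<lambda>x. \<Sum>i\<in>I. v i x) x = (\<Sum>i\<in>I. lowering t (v i) x)"
  by (induction I rule: infinite_finite_induct) (auto simp: lower_add)

lemma coraise_add: "coraising t (\<lambda>x. u x + v x) x = coraising t u x + coraising t v x"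
  by (induction x arbitrary: u v) (auto simp: algebra_simps)

lemma coraise_scale: "coraising t (\<lambda>x. c * v x) x = c * coraising t v x"
  by (induction x arbitrary: v) (auto simp: algebra_simps)

lemma coraise_zero [simp]: "coraising t (\<lambda>x. 0) x = 0"
  by (induction x) auto

lemma coraise_sum: "coraising t (\<lambda>x. \<Sum>i\<in>I. v i x) x = (\<Sum>i\<in>I. coraising t (v i) x)"
  by (induction I rule: infinite_finite_induct) (auto simp: coraise_add)

lemma lower_k_wts:
  "t \<noteq> 0 \<Longrightarrow> lowering t (\<lambda>y. k_wts t y * v y) x = t ^ 2 * k_wts t x * lowering t v x"
proof (induction x arbitrary: v)
  case (Cons a x)
  have "lowering t (\<lambda>y. k_wts t (a # y) * v (a # y)) x = k_wt t a * lowering t (\<lambda>y. k_wts t y * v (a # y)) x"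
    by (simp add: lower_scale[symmetric] mult.assoc)
  then show ?case
    using Cons.IH[OF Cons.prems, of "\<lambda>y. v (a # y)"] Cons.prems
    by (cases a) (simp_all add: field_simps power2_eq_square)
qed simp

text \<open>The commutator relation of E and F. In the induction over the tensor factors the mixed
  terms cancel by F K = t^2 K F (\<open>lower_k_wts\<close>), and the diagonal terms combine by the
  scalar identities \<open>c1\<close> and \<open>c2\<close>.\<close>

lemma raise_lower:
  assumes "t \<noteq> 0" "t \<noteq> inverse t"
  shows "raising t (lowering t v) x = lowering t (raising t v) x +
    (k_wts t x - inverse (k_wts t x)) / (t - inverse t) * v x"
proof (induction x arbitrary: v)
  case Nil show ?case by simp
next
  case (Cons a x)
  have t: "t - inverse t \<noteq> 0" using assms by simp
  let ?c = "\<lambda>k. (k - inverse k) / (t - inverse t)"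
  have r: "raising t (\<lambda>y. lowering t v (a # y)) x =
      (if a = Neg then raising t (\<lambda>y. v (Pos # y)) x else 0) +
      inverse (k_wt t a) * raising t (lowering t (\<lambda>y. v (a # y))) x"
    by (simp add: raise_add raise_scale)
  have l: "lowering t (\<lambda>y. raising t v (a # y)) x =
      (if a = Pos then lowering t (\<lambda>y. k_wts t y * v (Neg # y)) x else 0) +
      lowering t (raising t (\<lambda>y. v (a # y))) x"
    by (simp add: lower_add)
  let ?k = "k_wts t x"
  have kx: "?k \<noteq> 0" using assms by simp
  have c1: "?k + inverse t * ?c ?k = ?c (t * ?k)" and c2: "t * ?c ?k - ?k = ?c (inverse t * ?k)"
    using t assms(1) kx by (simp_all add: divide_simps) (simp_all add: algebra_simps)
  show ?case
  proof (cases a)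
    case Pos
    have "raising t (lowering t v) (a # x) - lowering t (raising t v) (a # x) = (?k + inverse t * ?c ?k) * v (a # x)"
      using r l Cons[of "\<lambda>y. v (a # y)"] Pos assms(1)
      by (simp add: lower_k_wts power2_eq_square algebra_simps)
    then show ?thesis unfolding c1 using Pos by (simp add: algebra_simps)
  next
    case Nul
    then show ?thesis using r l Cons[of "\<lambda>y. v (a # y)"] by (simp add: algebra_simps)
  next
    case Neg
    have "raising t (lowering t v) (a # x) - lowering t (raising t v) (a # x) = (t * ?c ?k - ?k) * v (a # x)"
      using r l Cons[of "\<lambda>y. v (a # y)"] Neg assms(1)
      by (simp add: algebra_simps)
    then show ?thesis unfolding c2 using Neg by (simp add: algebra_simps)
  qed
qed

definition homog :: "nat \<Rightarrow> int \<Rightarrow> (basis list \<Rightarrow> 'a::field) \<Rightarrow> bool" where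
  "homog n m v \<longleftrightarrow> (\<forall>x. v x \<noteq> 0 \<longrightarrow> length x = n \<and> weight x = m)"

lemma raise_nonzero:
  "raising t v x \<noteq> 0 \<Longrightarrow> \<exists>y. length y = length x \<and> v y \<noteq> 0 \<and> weight x = weight y + 2"
proof (induction x arbitrary: v)
  case (Cons a x)
  show ?case
  proof (cases "raising t (\<lambda>y. v (a # y)) x = 0")
    case True
    then have "a = Pos" "v (Neg # x) \<noteq> 0" using Cons.prems by (auto split: if_splits)
    then show ?thesis by (intro exI[of _ "Neg # x"]) auto
  next
    case False
    from Cons.IH[OF this] obtain y where "length y = length x" "v (a # y) \<noteq> 0" "weight x = weight y + 2" by blast
    then show ?thesis by (intro exI[of _ "a # y"]) auto
  qed
qed simp

lemma lower_nonzero: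
  "lowering t v x \<noteq> 0 \<Longrightarrow> \<exists>y. length y = length x \<and> v y \<noteq> 0 \<and> weight x = weight y - 2"
proof (induction x arbitrary: v)
  case (Cons a x)
  show ?case
  proof (cases "lowering t (\<lambda>y. v (a # y)) x = 0")
    case True
    then have "a = Neg" "v (Pos # x) \<noteq> 0" using Cons.prems by (auto split: if_splits)
    then show ?thesis by (intro exI[of _ "Pos # x"]) auto
  next
    case False
    from Cons.IH[OF this] obtain y where "length y = length x" "v (a # y) \<noteq> 0" "weight x = weight y - 2" by blast
    then show ?thesis by (intro exI[of _ "a # y"]) auto
  qed
qed simp

lemma homog_raise: "homog n m v \<Longrightarrow> homog n (m + 2) (raising t v)"
  unfolding homog_def using raise_nonzero by metis

lemma homog_lower: "homog n m v \<Longrightarrow> homog n (m - 2) (lowering t v)"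
  unfolding homog_def using lower_nonzero by metis

lemma homog_lower_pow: "homog n m v \<Longrightarrow> homog n (m - 2 * int i) ((lowering t ^^ i) v)"
proof (induction i)
  case (Suc i)
  then show ?case using homog_lower[of n "m - 2 * int i" "(lowering t ^^ i) v" t] by (simp add: algebra_simps)
qed simp

section \<open>Quantum integers and powers of the lowering operator\<close>

definition qbracket :: "'a::field \<Rightarrow> int \<Rightarrow> 'a" where
  "qbracket t n = (t powi n - t powi (- n)) / (t - inverse t)"

definition generic :: "'a::field \<Rightarrow> bool" where
  "generic t \<longleftrightarrow> t \<noteq> 0 \<and> (\<forall>n>0. t ^ n \<noteq> 1)"

lemma generic_powi: "generic t \<Longrightarrow> n \<noteq> 0 \<Longrightarrow> t powi n \<noteq> 1"
  unfolding generic_def power_int_def by (auto simp: power_inverse)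

lemma generic_inverse: "generic t \<Longrightarrow> t \<noteq> inverse t"
proof
  assume g: "generic t" and e: "t = inverse t"
  have "t ^ 2 = t * t" by (rule power2_eq_square)
  also have "\<dots> = t * inverse t" using e by simp
  also have "\<dots> = 1" using g unfolding generic_def by simp
  finally show False using g unfolding generic_def by auto
qed

lemma qbracket_nonzero:
  assumes "generic t" "n \<noteq> 0"
  shows "qbracket t n \<noteq> 0"
proof
  assume "qbracket t n = 0"
  then have "t powi n = t powi (- n)"
    using generic_inverse[OF assms(1)] unfolding qbracket_def by simp
  moreover have "t \<noteq> 0" using assms unfolding generic_def by simp
  ultimately have "t powi (n - (- n)) = 1" by (subst power_int_diff) auto
  then show False using generic_powi[OF assms(1), of "n - (- n)"] assms(2) by simp
qed

text \<open>The recursion for the scalar of E F along the powers of F: one step further down adds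
  [m - 2 i], by which E F and F E differ in that weight.\<close>

lemma qbracket_step:
  assumes "t \<noteq> 0" "t \<noteq> inverse t"
  shows "qbracket t (i + 1) * qbracket t (m - i) = qbracket t i * qbracket t (m - i + 1) + qbracket t (m - 2 * i)"
proof -
  define x y where "x = t powi i" and "y = t powi m"
  have nz: "x \<noteq> 0" "y \<noteq> 0" using assms(1) by (simp_all add: x_def y_def)
  have e: "t powi (i + 1) = x * t" "t powi (- (i + 1)) = inverse (x * t)"
    "t powi (m - i) = y * inverse x" "t powi (- (m - i)) = inverse y * x"
    "t powi i = x" "t powi (- i) = inverse x"
    "t powi (m - i + 1) = y * inverse x * t" "t powi (- (m - i + 1)) = inverse y * x * inverse t"
    "t powi (m - 2 * i) = y * inverse (x * x)" "t powi (- (m - 2 * i)) = inverse y * (x * x)"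
    using assms(1) unfolding x_def y_def
    by (simp_all add: power_int_add power_int_diff power_int_minus power_int_mult field_simps power2_eq_square)
  have d: "t - inverse t \<noteq> 0" using assms by simp
  have key: "(x * t - inverse (x * t)) * (y * inverse x - inverse y * x) =
    (x - inverse x) * (y * inverse x * t - inverse y * x * inverse t) +
    (y * inverse (x * x) - inverse y * (x * x)) * (t - inverse t)"
    using nz assms(1) by (simp add: field_simps)
  show ?thesis
    unfolding qbracket_def e using d key by (simp add: add_divide_distrib[symmetric] divide_simps)
qed

lemma homog_raise_lower:
  assumes "generic t" "homog n m v"
  shows "raising t (lowering t v) = (\<lambda>x. lowering t (raising t v) x + qbracket t m * v x)"
proof
  fix x
  have t: "t \<noteq> 0" "t \<noteq> inverse t" using assms generic_inverse unfolding generic_def by auto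
  have "(k_wts t x - inverse (k_wts t x)) / (t - inverse t) * v x = qbracket t m * v x"
  proof (cases "v x = 0")
    case False
    then have "weight x = m" using assms(2) unfolding homog_def by blast
    then show ?thesis using t by (simp add: qbracket_def k_wts_powi power_int_minus)
  qed simp
  then show "raising t (lowering t v) x = lowering t (raising t v) x + qbracket t m * v x"
    using raise_lower[OF t, of v x] by simp
qed

text \<open>Moving E past one more F adds the quantum integer of the current weight, and
  \<open>qbracket_step\<close> sums these up. The hypothesis F E v = 0, weaker than E v = 0, is the
  form that the ladder decomposition can supply.\<close>

lemma raise_lower_pow:
  assumes "generic t" "homog n m v" "lowering t (raising t v) = (\<lambda>x. 0)"
  shows "raising t ((lowering t ^^ Suc i) v) = (\<lambda>x. qbracket t (int i + 1) * qbracket t (m - int i) * (lowering t ^^ i) v x)"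
proof (induction i)
  case 0
  have "qbracket t 1 = 1" using generic_inverse[OF assms(1)] by (simp add: qbracket_def power_int_minus)
  then show ?case using homog_raise_lower[OF assms(1,2)] assms(3) by (simp add: fun_eq_iff)
next
  case (Suc i)
  have t: "t \<noteq> 0" "t \<noteq> inverse t" using assms generic_inverse unfolding generic_def by auto
  let ?c = "qbracket t (int i + 1) * qbracket t (m - int i)"
  have c: "?c + qbracket t (m - 2 * int (Suc i)) = qbracket t (int (Suc i) + 1) * qbracket t (m - int (Suc i))"
    using qbracket_step[OF t, of "int i + 1" m] by (simp add: algebra_simps)
  show ?case
  proof
    fix x
    have "raising t ((lowering t ^^ Suc (Suc i)) v) x =
      lowering t (raising t ((lowering t ^^ Suc i) v)) x + qbracket t (m - 2 * int (Suc i)) * (lowering t ^^ Suc i) v x"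
      using fun_cong[OF homog_raise_lower[OF assms(1) homog_lower_pow[OF assms(2), of "Suc i"]]] by simp
    also have "\<dots> = (?c + qbracket t (m - 2 * int (Suc i))) * (lowering t ^^ Suc i) v x"
      unfolding Suc.IH lower_scale by (simp add: algebra_simps)
    finally show "raising t ((lowering t ^^ Suc (Suc i)) v) x =
        qbracket t (int (Suc i) + 1) * qbracket t (m - int (Suc i)) * (lowering t ^^ Suc i) v x"
      unfolding c .
  qed
qed

text \<open>For m < 0 no factor [i + 1] [m - i] vanishes, so a nonzero v would have nonzero F^i v
  for all i; but the weight of a word of length n is at least - n.\<close>

lemma negative_weight_zero:
  assumes "generic t" "homog n m v" "lowering t (raising t v) = (\<lambda>x. 0)" "m < 0"
  shows "v = (\<lambda>x. 0)"
proof (rule ccontr)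
  assume v: "v \<noteq> (\<lambda>x. 0)"
  have "(lowering t ^^ i) v \<noteq> (\<lambda>x. 0)" for i
  proof (induction i)
    case 0 then show ?case using v by simp
  next
    case (Suc i)
    have "qbracket t (int i + 1) \<noteq> 0" "qbracket t (m - int i) \<noteq> 0"
      using qbracket_nonzero[OF assms(1)] assms(4) by auto
    moreover obtain x where "(lowering t ^^ i) v x \<noteq> 0" using Suc by blast
    ultimately have "raising t ((lowering t ^^ Suc i) v) x \<noteq> 0"
      unfolding raise_lower_pow[OF assms(1-3), of i] by simp
    moreover have "raising t (\<lambda>x. 0) x = 0" by simp
    ultimately show ?case by metis
  qed
  then obtain x where "(lowering t ^^ n) v x \<noteq> 0" by blast
  then have "length x = n" "weight x = m - 2 * int n"
    using homog_lower_pow[OF assms(2), of n] unfolding homog_def by blast+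
  then show False using abs_weight_le[of x] assms(4) by linarith
qed

section \<open>Highest weight vectors and ballot words\<close>

fun suffix_ballot :: "basis list \<Rightarrow> bool" where
  "suffix_ballot [] \<longleftrightarrow> True"
| "suffix_ballot (a # x) \<longleftrightarrow> suffix_ballot x \<and> weight (a # x) \<ge> 0"

lemma suffix_ballot_weight: "suffix_ballot x \<Longrightarrow> weight x \<ge> 0"
  by (cases x) auto

text \<open>Induction on the first letter. The slices after \<open>Neg\<close> and
  \<open>Nul\<close> are again highest weight vectors, and the slice after \<open>Pos\<close> is one
  as soon as the slice after \<open>Neg\<close> is known to vanish. Suffixes are tested because
  letters are split off on the left.\<close>

lemma highest_weight_unique:
  assumes "generic t" "homog n m v" "raising t v = (\<lambda>x. 0)" "\<And>x. suffix_ballot x \<Longrightarrow> v x = 0"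
  shows "v = (\<lambda>x. 0)"
  using assms(2-4)
proof (induction n arbitrary: m v)
  case 0
  have "v x = 0" for x
    using 0(1) 0(3)[of "[]"] unfolding homog_def by (cases x) auto
  then show ?case by auto
next
  case (Suc n)
  show ?case
  proof (cases "m < 0")
    case True
    have "lowering t (raising t v) = (\<lambda>x. 0)" unfolding Suc.prems(2) by auto
    then show ?thesis using negative_weight_zero[OF assms(1) Suc.prems(1)] True by blast
  next
    case False
    have h: "homog n (m - letter_weight a) (\<lambda>y. v (a # y))" for a
      using Suc.prems(1) unfolding homog_def by fastforce
    have e: "raising t v (a # y) = 0" for a y using Suc.prems(2) by simp
    have neg0: "(\<lambda>y. v (Neg # y)) = (\<lambda>x. 0)"
    proof (rule Suc.IH[OF h])
      show "raising t (\<lambda>y. v (Neg # y)) = (\<lambda>x. 0)" using e[of Neg] by (simp add: fun_eq_iff)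
      \<comment> \<open>For a ballot word y, \<open>Neg # y\<close> is one too unless its weight is
        negative, and that is excluded because v has weight m \<ge> 0.\<close>
      fix y assume y: "suffix_ballot y"
      show "v (Neg # y) = 0"
      proof (rule ccontr)
        assume nz: "v (Neg # y) \<noteq> 0"
        then have "weight (Neg # y) = m" using Suc.prems(1) unfolding homog_def by blast
        then show False using Suc.prems(3)[of "Neg # y"] y False nz by simp
      qed
    qed
    have nul0: "(\<lambda>y. v (Nul # y)) = (\<lambda>x. 0)"
    proof (rule Suc.IH[OF h])
      show "raising t (\<lambda>y. v (Nul # y)) = (\<lambda>x. 0)" using e[of Nul] by (simp add: fun_eq_iff)
      show "v (Nul # y) = 0" if "suffix_ballot y" for y
        using Suc.prems(3)[of "Nul # y"] that suffix_ballot_weight[OF that] by simp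
    qed
    have pos0: "(\<lambda>y. v (Pos # y)) = (\<lambda>x. 0)"
    proof (rule Suc.IH[OF h])
      show "raising t (\<lambda>y. v (Pos # y)) = (\<lambda>x. 0)"
        using e[of Pos] fun_cong[OF neg0] by (simp add: fun_eq_iff)
      show "v (Pos # y) = 0" if "suffix_ballot y" for y
        using Suc.prems(3)[of "Pos # y"] that suffix_ballot_weight[OF that] by simp
    qed
    have "v [] = 0" using Suc.prems(1) unfolding homog_def by force
    then have "v x = 0" for x
      using fun_cong[OF neg0] fun_cong[OF nul0] fun_cong[OF pos0]
      by (cases x) (simp, metis basis.exhaust)
    then show ?thesis by auto
  qed
qed

section \<open>Diagram matrices commute with the raising operator\<close>

definition commutes_raising :: "'a::field \<Rightarrow> nat \<Rightarrow> (basis list \<Rightarrow> basis list \<Rightarrow> 'a) \<Rightarrow> bool" where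
  "commutes_raising t k T \<longleftrightarrow> (\<forall>x w. length x = k \<longrightarrow> length w = k \<longrightarrow>
     raising t (\<lambda>u. T u w) x = coraising t (T x) w)"

text \<open>The matrix as a vector in 2 k tensor factors. Dividing by \<open>fold_wts\<close> undoes
  the weights in \<open>diagram_mat\<close>, so that a diagram bends to its bare matching
  weight.\<close>

definition bend :: "'a::field \<Rightarrow> nat \<Rightarrow> (basis list \<Rightarrow> basis list \<Rightarrow> 'a) \<Rightarrow> basis list \<Rightarrow> 'a" where
  "bend t k T z = (if length z = 2 * k then T (take k z) (dual (drop k z)) / fold_wts t (drop k z) else 0)"

lemma weight_dual [simp]: "weight (dual w) = - weight w"
proof (induction w)
  case (Cons a w) then show ?case by (cases a) auto
qed simp

lemma raise_append:
  "raising t v (x @ y) = k_wts t y * raising t (\<lambda>u. v (u @ y)) x + raising t (\<lambda>u. v (x @ u)) y"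
  by (induction x arbitrary: v) (auto simp: algebra_simps)

lemma coraise_snoc:
  "coraising t g (z @ [b]) = k_wt t b * coraising t (\<lambda>u. g (u @ [b])) z + (if b = Neg then g (z @ [Pos]) else 0)"
  by (induction z arbitrary: g) (auto simp: algebra_simps)

text \<open>On the folded half E acts by its transpose through the antipode, whence the sign and the
  factor K; \<open>fold_wts\<close> belongs to the identification of V with its dual.\<close>

lemma raise_dual:
  assumes "t \<noteq> 0"
  shows "raising t (\<lambda>u. g (dual u) / fold_wts t u) y = - (k_wts t y / fold_wts t y) * coraising t g (dual y)"
proof (induction y arbitrary: g)
  case Nil show ?case by simp
next
  case (Cons a y)
  define c where "c = coraising t (\<lambda>z. g (z @ [neg a])) (dual y)"
  have "raising t (\<lambda>u. g (dual u @ [neg a]) / (fold_wt t a * fold_wts t u)) y =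
      raising t (\<lambda>u. inverse (fold_wt t a) * (g (dual u @ [neg a]) / fold_wts t u)) y"
    by (intro raise_cong) (simp add: divide_simps)
  also have "\<dots> = inverse (fold_wt t a) * (- (k_wts t y / fold_wts t y) * c)"
    unfolding raise_scale c_def using Cons[of "\<lambda>z. g (z @ [neg a])"] by simp
  finally have 1: "raising t (\<lambda>u. g (dual u) / fold_wts t u) (a # y) =
      (if a = Pos then k_wts t y * (g (dual y @ [Pos]) / fold_wts t y) else 0) +
      inverse (fold_wt t a) * (- (k_wts t y / fold_wts t y) * c)"
    by simp
  have 2: "coraising t g (dual (a # y)) = k_wt t (neg a) * c + (if a = Pos then g (dual y @ [Pos]) else 0)"
    unfolding c_def by (cases a) (simp_all add: coraise_snoc)
  show ?case
    unfolding 1 2 using assms by (cases a) (simp_all add: field_simps)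
qed

text \<open>By the coproduct rule for the two halves of the word, E acts on the bent matrix as the
  commutator of E with T, up to an invertible factor.\<close>

lemma raise_bend:
  assumes "t \<noteq> 0" "length x = k" "length w = k"
  shows "raising t (bend t k T) (x @ dual w) =
    k_wts t (dual w) / fold_wts t (dual w) * (raising t (\<lambda>u. T u w) x - coraising t (T x) w)"
proof -
  have 1: "raising t (\<lambda>u. bend t k T (u @ dual w)) x = raising t (\<lambda>u. inverse (fold_wts t (dual w)) * T u w) x"
    using assms by (intro raise_cong) (simp add: bend_def divide_inverse)
  have 2: "raising t (\<lambda>u. bend t k T (x @ u)) (dual w) = raising t (\<lambda>u. T x (dual u) / fold_wts t u) (dual w)"
    using assms by (intro raise_cong) (simp add: bend_def)
  show ?thesis
    unfolding raise_append 1 2 raise_scale raise_dual[OF assms(1)] by (simp add: divide_inverse algebra_simps)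
qed

lemma raise_length: "(\<And>y. length y = length x \<Longrightarrow> v y = 0) \<Longrightarrow> raising t v x = 0"
  using raise_nonzero by metis

lemma raise_bend_eq_0_iff:
  assumes "t \<noteq> 0"
  shows "raising t (bend t k T) = (\<lambda>x. 0) \<longleftrightarrow> commutes_raising t k T"
proof
  assume L: "raising t (bend t k T) = (\<lambda>x. 0)"
  show "commutes_raising t k T"
    unfolding commutes_raising_def
  proof (intro allI impI)
    fix x w :: "basis list" assume xw: "length x = k" "length w = k"
    show "raising t (\<lambda>u. T u w) x = coraising t (T x) w"
      using raise_bend[OF assms xw, of T] fun_cong[OF L, of "x @ dual w"] assms by simp
  qed
next
  assume R: "commutes_raising t k T"
  show "raising t (bend t k T) = (\<lambda>x. 0)"
  proof
    fix z
    show "raising t (bend t k T) z = 0"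
    proof (cases "length z = 2 * k")
      case True
      have "z = take k z @ dual (dual (drop k z))" by simp
      moreover have "raising t (bend t k T) (take k z @ dual (dual (drop k z))) = 0"
        using R True assms by (subst raise_bend) (auto simp: commutes_raising_def)
      ultimately show ?thesis by simp
    next
      case False
      then show ?thesis by (intro raise_length) (simp add: bend_def)
    qed
  qed
qed

lemma raise_positions:
  "raising t v x = (\<Sum>j<length x. if x ! j = Pos then k_wts t (drop (Suc j) x) * v (x[j := Neg]) else 0)"
proof (induction x arbitrary: v)
  case (Cons a x)
  have "(\<Sum>j<Suc (length x). if (a # x) ! j = Pos then k_wts t (drop (Suc j) (a # x)) * v ((a # x)[j := Neg]) else 0) =
    (if a = Pos then k_wts t x * v (Neg # x) else 0) +
    (\<Sum>j<length x. if x ! j = Pos then k_wts t (drop (Suc j) x) * v (a # x[j := Neg]) else 0)"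
    by (subst sum.lessThan_Suc_shift) (auto intro!: sum.cong)
  then show ?case using Cons[of "\<lambda>y. v (a # y)"] by simp
qed simp

lemma k_wts_drop: "k_wts t (drop j x) = (\<Prod>p\<in>{j..<length x}. k_wt t (x ! p))"
proof (cases "j \<le> length x")
  case True
  have "drop j x = map ((!) x) [j..<length x]"
    by (metis True append_take_drop_id drop_map drop_upt map_nth diff_zero add_0)
  then have "k_wts t (drop j x) = prod_list (map (\<lambda>p. k_wt t (x ! p)) [j..<length x])"
    unfolding k_wts_def by (simp add: comp_def)
  also have "\<dots> = (\<Prod>p\<in>{j..<length x}. k_wt t (x ! p))"
    by (simp add: interv_sum_list_conv_sum_set_nat prod.distinct_set_conv_list[symmetric])
  finally show ?thesis .
qed simp

text \<open>The labels on an arc of nonzero weight are opposite, and an isolated point carries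
  \<open>Nul\<close>; so K acts trivially on every block.\<close>

lemma block_wt_k_wt:
  assumes "t \<noteq> 0" "finite B" "B \<noteq> {}" "card B \<le> 2" "block_wt t x B \<noteq> 0"
  shows "(\<Prod>p\<in>B. k_wt t (x p)) = 1"
proof -
  obtain a where "a \<in> B" using assms by blast
  then show ?thesis
  proof (rule card_le_2_cases[OF assms(2) _ assms(4)])
    assume "B = {a}" then show ?thesis using assms(5) by (auto split: if_splits)
  next
    fix b assume b: "b \<noteq> a" "B = {a, b}"
    show ?thesis
    proof (cases "a < b")
      case True
      then show ?thesis using assms b by (cases "x a"; cases "x b") (auto simp: block_wt_pair)
    next
      case False
      then have "b < a" using b by simp
      then show ?thesis using assms b by (cases "x a"; cases "x b") (auto simp: block_wt_pair')
    qed
  qed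
qed

text \<open>
  A nonzero term changes the end of an arc both of whose ends carry \<open>Pos\<close>, and then this is the
  only such arc.  The two terms coming from its ends cancel, because the arcs between them have
  weight zero.
\<close>

lemma raise_matching:
  fixes t :: "'a::field"
  assumes t: "t \<noteq> 0" and pm: "planar_matching {1..n} D"
  shows "raising t (\<lambda>x. if length x = n then matching_wt t D (label x) else 0) x = 0"
proof (cases "length x = n")
  case False
  then show ?thesis by (intro raise_length) auto
next
  case len: True
  note fin = matching_finite[OF pm]
  have part: "partition_on {1..n} D" and two: "\<And>B. B \<in> D \<Longrightarrow> card B \<le> 2" and pl: "planar D"
    using pm unfolding planar_matching_def by auto
  define y where "y = label x"
  define v where "v = (\<lambda>p. matching_wt t D (y(p := Neg)))"
  define r where "r = (\<lambda>p. \<Prod>i\<in>{p<..n}. k_wt t (y i))"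
  have lab: "matching_wt t D (label (x[j := Neg])) = v (Suc j)" if "j < n" for j
    unfolding v_def y_def using that len
    by (intro matching_wt_cong[OF pm]) (auto simp: label_def nth_list_update)
  have kw: "k_wts t (drop (Suc j) x) = r (Suc j)" if "j < n" for j
  proof -
    have "(\<Prod>p\<in>{Suc j..<n}. k_wt t (x ! p)) = (\<Prod>i\<in>Suc ` {Suc j..<n}. k_wt t (y i))"
      unfolding y_def label_def by (subst prod.reindex) auto
    also have "Suc ` {Suc j..<n} = {Suc j<..n}" by (auto simp: image_Suc_atLeastLessThan)
    finally show ?thesis unfolding k_wts_drop len r_def .
  qed
  have "raising t (\<lambda>x. if length x = n then matching_wt t D (label x) else 0) x =
      (\<Sum>j<n. if y (Suc j) = Pos then r (Suc j) * v (Suc j) else 0)"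
    unfolding raise_positions using len lab kw by (intro sum.cong) (auto simp: y_def label_def)
  also have "\<dots> = (\<Sum>p\<in>{1..n}. if y p = Pos then r p * v p else 0)"
    by (rule sum.reindex_bij_witness[of _ "\<lambda>p. p - 1" Suc]) auto
  finally have eq: "raising t (\<lambda>x. if length x = n then matching_wt t D (label x) else 0) x =
      (\<Sum>p\<in>{1..n}. if y p = Pos then r p * v p else 0)" .
  show ?thesis
  proof (cases "\<exists>p\<in>{1..n}. y p = Pos \<and> v p \<noteq> 0")
    case False
    then show ?thesis unfolding eq by (intro sum.neutral) auto
  next
    case True
    then obtain p where p: "p \<in> {1..n}" "y p = Pos" "v p \<noteq> 0" by blast
    then obtain B where B: "B \<in> D" "p \<in> B" using part unfolding partition_on_def by blast
    have bnz: "block_wt t (y(i := Neg)) C \<noteq> 0" if "v i \<noteq> 0" "C \<in> D" for i C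
      using that fin(1) unfolding v_def matching_wt_def by (auto simp: prod_zero_iff)
    have "B \<noteq> {p}" using bnz[OF p(3) B(1)] by auto
    then obtain p' where p': "p' \<noteq> p" "B = {p, p'}"
      using card_le_2_cases[OF fin(2)[OF B(1)] B(2) two[OF B(1)]] by metis
    have yp': "y p' = Pos"
    proof -
      have "block_wt t (y(p := Neg)) {p, p'} \<noteq> 0" using bnz[OF p(3) B(1)] p' by simp
      then show ?thesis using p'(1)
        by (cases "p < p'"; cases "y p'") (auto simp: block_wt_pair block_wt_pair')
    qed
    define a b where "a = min p p'" and "b = max p p'"
    have ab: "a < b" "B = {a, b}" "y a = Pos" "y b = Pos" "a \<in> {1..n}" "b \<in> {1..n}"
      using p' p(1,2) yp' fin(4)[OF B(1)] unfolding a_def b_def by (auto simp: min_def max_def)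
    \<comment> \<open>A change elsewhere leaves \<open>Pos\<close> at both ends of the arc, and such
      an arc has weight zero.\<close>
    have zero: "v i = 0" if "i \<in> {1..n}" "i \<noteq> a" "i \<noteq> b" for i
    proof (rule ccontr)
      assume "v i \<noteq> 0"
      then have "block_wt t (y(i := Neg)) {a, b} \<noteq> 0" using bnz B ab by blast
      then show False using that ab by (simp add: block_wt_pair)
    qed
    define W where "W = (\<Prod>C\<in>D - {B}. block_wt t y C)"
    have vv: "v i = block_wt t (y(i := Neg)) {a, b} * W" if "i \<in> B" for i
    proof -
      have "D = insert B (D - {B})" using B by auto
      moreover have "(\<Prod>C\<in>D - {B}. block_wt t (y(i := Neg)) C) = W"
        unfolding W_def
      proof (rule prod.cong[OF refl])
        fix C assume C: "C \<in> D - {B}"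
        then have "i \<notin> C" using that B partition_block_unique[OF part] by auto
        then show "block_wt t (y(i := Neg)) C = block_wt t y C"
          using C fin by (intro block_wt_cong) auto
      qed
      ultimately show ?thesis
        unfolding v_def matching_wt_def using fin(1) ab(2) by (metis DiffE finite_Diff insertI1 prod.insert)
    qed
    have va: "v a = - inverse t * W" and vb: "v b = W"
      using vv[of a] vv[of b] ab by (simp_all add: block_wt_pair)
    have "v p = v a \<or> v p = v b" unfolding a_def b_def by (auto simp: min_def max_def)
    then have "W \<noteq> 0" using p(3) va vb by auto
    then have ok: "block_wt t y C \<noteq> 0" if "C \<in> D" "C \<noteq> B" for C
      using that fin(1) unfolding W_def by (auto simp: prod_zero_iff)
    \<comment> \<open>By planarity the interior of the arc is a union of blocks, so the K-weights of
      the letters inside multiply to 1.\<close>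
    have "{a<..<b} = \<Union>{C \<in> D. C \<subseteq> {a<..<b}}"
    proof
      show "{a<..<b} \<subseteq> \<Union>{C \<in> D. C \<subseteq> {a<..<b}}"
      proof
        fix i assume i: "i \<in> {a<..<b}"
        then have "i \<in> {1..n}" using ab by auto
        then obtain C where C: "C \<in> D" "i \<in> C" using part unfolding partition_on_def by blast
        have "C \<noteq> B" using C i ab by auto
        have "j \<in> {a<..<b}" if j: "j \<in> C" for j
        proof -
          have "((a < i) = (b < i)) = ((a < j) = (b < j))"
            using planarD[OF pl B(1) C(1) _ _ _ C(2) j] \<open>C \<noteq> B\<close> ab(2) by blast
          moreover have "j \<noteq> a" "j \<noteq> b" using j C(1) B(1) \<open>C \<noteq> B\<close> ab(2) partition_block_unique[OF part] by blast+
          ultimately show ?thesis using i by auto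
        qed
        then show "i \<in> \<Union>{C \<in> D. C \<subseteq> {a<..<b}}" using C by blast
      qed
    qed auto
    moreover have "(\<Prod>i\<in>\<Union>{C \<in> D. C \<subseteq> {a<..<b}}. k_wt t (y i)) =
        (\<Prod>C\<in>{C \<in> D. C \<subseteq> {a<..<b}}. \<Prod>i\<in>C. k_wt t (y i))"
    proof -
      have "\<forall>A\<in>{C \<in> D. C \<subseteq> {a<..<b}}. finite A" using fin(2) by blast
      moreover have "\<forall>A\<in>{C \<in> D. C \<subseteq> {a<..<b}}. \<forall>A'\<in>{C \<in> D. C \<subseteq> {a<..<b}}. A \<noteq> A' \<longrightarrow> A \<inter> A' = {}"
        using partition_block_unique[OF part] by blast
      ultimately show ?thesis by (subst prod.Union_disjoint) (auto simp: comp_def)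
    qed
    moreover have "(\<Prod>i\<in>C. k_wt t (y i)) = 1" if "C \<in> D" "C \<subseteq> {a<..<b}" for C
      using that ab(1,2) by (intro block_wt_k_wt[OF t fin(2,3) two ok]) auto
    ultimately have mid: "(\<Prod>i\<in>{a<..<b}. k_wt t (y i)) = 1" by simp
    have "{a<..n} = {a<..<b} \<union> insert b {b<..n}" using ab by auto
    then have "r a = (\<Prod>i\<in>{a<..<b}. k_wt t (y i)) * (\<Prod>i\<in>insert b {b<..n}. k_wt t (y i))"
      unfolding r_def by (simp only:, subst prod.union_disjoint) auto
    \<comment> \<open>The factor t comes from the letter \<open>Pos\<close> at b. It cancels the
      ratio - 1/t of the two arc weights, so the terms from a and b add up to zero.\<close>
    then have ra: "r a = t * r b" using mid ab(4) unfolding r_def by simp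
    have "(\<Sum>p\<in>{1..n}. if y p = Pos then r p * v p else 0) = (\<Sum>p\<in>{a, b}. if y p = Pos then r p * v p else 0)"
      using ab zero by (intro sum.mono_neutral_right) auto
    also have "\<dots> = 0" using ab ra va vb t by simp
    finally show ?thesis unfolding eq .
  qed
qed

lemma bend_diagram_mat:
  assumes "t \<noteq> 0"
  shows "bend t k (diagram_mat t k d) =
    (\<lambda>z. if length z = 2 * k then matching_wt t ((`) (circ k) ` d) (label z) else 0)"
  using assms by (auto simp: bend_def diagram_mat_def fun_eq_iff)

lemma diagram_mat_commutes_raising:
  assumes "t \<noteq> 0" "d \<in> motzkin_diagrams k"
  shows "commutes_raising t k (diagram_mat t k d)"
  unfolding raise_bend_eq_0_iff[OF assms(1), symmetric] bend_diagram_mat[OF assms(1)]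
  using raise_matching[OF assms(1) motzkin_planar[OF assms(2)]] by (auto simp: mult_2)

section \<open>Ballot words and planar matchings\<close>

text \<open>Among the labellings of nonzero weight this is the one of largest \<open>height\<close>.
  Read from left to right, \<open>Neg\<close> opens an arc and \<open>Pos\<close> closes it.\<close>

definition arc_letter :: "nat set set \<Rightarrow> nat \<Rightarrow> basis" where
  "arc_letter D p = (if \<exists>q>p. {p, q} \<in> D then Neg else if \<exists>q<p. {p, q} \<in> D then Pos else Nul)"

lemma doubleton_unique:
  assumes "partition_on S D" "{p, q} \<in> D" "{p, q'} \<in> D"
  shows "q = q'"
  using partition_block_unique[OF assms, of p] by (auto simp: doubleton_eq_iff)

lemma arc_letter_pair:
  assumes "partition_on S D" "{p, q} \<in> D" "p < q"
  shows "arc_letter D p = Neg" "arc_letter D q = Pos"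
proof -
  show "arc_letter D p = Neg" using assms unfolding arc_letter_def by auto
  have "{q, p} \<in> D" using assms(2) by (simp add: insert_commute)
  then have "\<not> (\<exists>r>q. {q, r} \<in> D)" using doubleton_unique[OF assms(1)] assms(3) by (metis less_asym)
  then show "arc_letter D q = Pos" using \<open>{q, p} \<in> D\<close> assms(3) unfolding arc_letter_def by auto
qed

lemma arc_letter_single:
  assumes "planar_matching S D" "p \<in> S"
  shows "arc_letter D p = Nul \<longleftrightarrow> {p} \<in> D"
proof -
  have part: "partition_on S D" and two: "\<And>B. B \<in> D \<Longrightarrow> card B \<le> 2"
    using assms unfolding planar_matching_def by auto
  obtain B where B: "B \<in> D" "p \<in> B" using part assms unfolding partition_on_def by blast
  consider "B = {p}" | q where "q \<noteq> p" "B = {p, q}"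
    using card_le_2_cases[OF matching_finite(2)[OF assms(1) B(1)] B(2) two[OF B(1)]] by metis
  then show ?thesis
  proof cases
    case 1
    have "{p, q} \<notin> D" if "q \<noteq> p" for q
      using that B 1 partition_block_unique[OF part, of "{p, q}" B p] by auto
    then have "arc_letter D p = Nul" unfolding arc_letter_def by auto
    then show ?thesis using 1 B by simp
  next
    case 2
    have "{p} \<notin> D" using partition_block_unique[OF part B(1) _ B(2), of "{p}"] 2 by auto
    moreover have "arc_letter D p \<noteq> Nul" using B 2 unfolding arc_letter_def by (auto simp: neq_iff)
    ultimately show ?thesis by simp
  qed
qed

lemma arc_letter_cases:
  assumes "planar_matching S D" "p \<in> S"
  shows "arc_letter D p = Neg \<Longrightarrow> \<exists>q>p. {p, q} \<in> D" "arc_letter D p = Pos \<Longrightarrow> \<exists>q<p. {q, p} \<in> D"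
  unfolding arc_letter_def by (auto split: if_splits simp: insert_commute)

lemma planar_matching_remove:
  assumes "planar_matching S D" "B \<in> D"
  shows "planar_matching (S - B) (D - {B})"
proof -
  have part: "partition_on S D" using assms unfolding planar_matching_def by auto
  have "partition_on (S - B) (D - {B})"
  proof (rule partition_onI)
    have "z \<notin> B" if "z \<in> C" "C \<in> D" "C \<noteq> B" for z C
      using partition_block_unique[OF part that(2) assms(2) that(1)] that(3) by metis
    moreover have "\<Union>D = S" using part unfolding partition_on_def by auto
    ultimately show "\<Union>(D - {B}) = S - B" by blast
    show "{} \<notin> D - {B}" using part unfolding partition_on_def by auto
    show "disjnt p q" if "p \<in> D - {B}" "q \<in> D - {B}" "p \<noteq> q" for p q
      using that part disjointD[of D p q] unfolding partition_on_def disjnt_def by blast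
  qed
  moreover have "planar (D - {B})"
    using assms(1) planarD[of D] unfolding planar_matching_def planar_def[of "D - {B}"] by (meson DiffD1)
  moreover have "finite (S - B)" "\<forall>C\<in>D - {B}. card C \<le> 2" using assms(1) unfolding planar_matching_def by simp_all
  ultimately show ?thesis unfolding planar_matching_def by simp
qed

lemma arc_letter_remove:
  assumes "partition_on S D" "p \<notin> B"
  shows "arc_letter (D - {B}) p = arc_letter D p"
proof -
  have "{p, q} \<in> D - {B} \<longleftrightarrow> {p, q} \<in> D" for q using assms(2) by auto
  then show ?thesis unfolding arc_letter_def by simp
qed

text \<open>An arc ending strictly between i and j would by planarity have both ends there, and
  would be shorter.\<close>

lemma shortest_arc:
  assumes "planar_matching S D" "{i, j} \<in> D" "i < j"
    "\<And>i' j'. {i', j'} \<in> D \<Longrightarrow> i' < j' \<Longrightarrow> j - i \<le> j' - i'" "p \<in> S" "i < p" "p < j"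
  shows "arc_letter D p = Nul"
proof (rule ccontr)
  assume "arc_letter D p \<noteq> Nul"
  then obtain q where q: "q \<noteq> p" "{p, q} \<in> D"
    unfolding arc_letter_def by (metis less_irrefl)
  have part: "partition_on S D" and pl: "planar D" using assms unfolding planar_matching_def by auto
  have ne: "{p, q} \<noteq> {i, j}" using assms(6,7) by (auto simp: doubleton_eq_iff)
  have qq: "q \<noteq> i" "q \<noteq> j"
    using partition_block_unique[OF part q(2) assms(2), of q] ne by auto
  have "((i < p) = (j < p)) = ((i < q) = (j < q))"
    using planarD[OF pl assms(2) q(2) ne[symmetric], of i j p q] by simp
  then have "i < q" "q < j" using assms(6,7) qq by linarith+
  then show False
    using assms(4)[of p q] assms(4)[of q p] q assms(6,7) by (cases "p < q") (auto simp: insert_commute)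
qed

text \<open>A shortest arc of D is forced to be an arc of D' as well; removing it from both gives a
  smaller instance.\<close>

lemma arc_letter_inject:
  assumes "planar_matching S D" "planar_matching S D'" "\<And>p. p \<in> S \<Longrightarrow> arc_letter D p = arc_letter D' p"
  shows "D = D'"
  using assms
proof (induction "card S" arbitrary: S D D' rule: less_induct)
  case less
  have part: "partition_on S D" "partition_on S D'" and pl': "planar D'" and finS: "finite S"
    using less.prems unfolding planar_matching_def by auto
  have sing: "A = {{p} |p. p \<in> S}" if A: "planar_matching S A" "\<And>p. p \<in> S \<Longrightarrow> arc_letter A p = Nul" for A
  proof
    have pA: "partition_on S A" using A unfolding planar_matching_def by auto
    show "A \<subseteq> {{p} |p. p \<in> S}"
    proof
      fix B assume B: "B \<in> A"
      then obtain p where p: "p \<in> B" "p \<in> S" using matching_finite(3,4)[OF A(1) B] by blast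
      then have "{p} \<in> A" using arc_letter_single[OF A(1)] A(2) by blast
      then show "B \<in> {{p} |p. p \<in> S}" using partition_block_unique[OF pA B, of "{p}" p] p by auto
    qed
    show "{{p} |p. p \<in> S} \<subseteq> A" using arc_letter_single[OF A(1)] A(2) by blast
  qed
  show ?case
  proof (cases "\<forall>p\<in>S. arc_letter D p = Nul")
    case True
    then show ?thesis using sing[OF less.prems(1)] sing[OF less.prems(2)] less.prems(3) by simp
  next
    case False
    then obtain p where p: "p \<in> S" "arc_letter D p \<noteq> Nul" by blast
    then have ex: "\<exists>e. \<exists>i j. e = j - i \<and> {i, j} \<in> D \<and> i < j"
      using arc_letter_cases[OF less.prems(1) p(1)] by (cases "arc_letter D p") blast+
    define e where "e = (LEAST e. \<exists>i j. e = j - i \<and> {i, j} \<in> D \<and> i < j)"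
    obtain i j where ij: "e = j - i" "{i, j} \<in> D" "i < j"
      using LeastI_ex[OF ex] unfolding e_def by blast
    have min: "j - i \<le> j' - i'" if "{i', j'} \<in> D" "i' < j'" for i' j'
      using that unfolding ij(1)[symmetric] e_def by (intro Least_le) blast
    have nul: "arc_letter D p = Nul" if "p \<in> S" "i < p" "p < j" for p
      using shortest_arc[OF less.prems(1) ij(2,3) min that] .
    have ijS: "i \<in> S" "j \<in> S" using matching_finite(4)[OF less.prems(1) ij(2)] by auto
    have let': "arc_letter D' i = Neg" "arc_letter D' j = Pos"
      using arc_letter_pair[OF part(1) ij(2,3)] less.prems(3) ijS by auto
    obtain q where q: "i < q" "{i, q} \<in> D'" using arc_letter_cases(1)[OF less.prems(2) ijS(1) let'(1)] by blast
    obtain l where l: "l < j" "{l, j} \<in> D'" using arc_letter_cases(2)[OF less.prems(2) ijS(2) let'(2)] by blast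
    have qS: "q \<in> S" "l \<in> S" using matching_finite(4)[OF less.prems(2)] q l by auto
    \<comment> \<open>The points between i and j are isolated in D' too, so the partner q of i is at
      or beyond j and the partner l of j is at or before i. Unless these are j and i themselves, the
      two arcs cross.\<close>
    have "q = j"
    proof (rule ccontr)
      assume "q \<noteq> j"
      have "\<not> q < j"
        using nul[OF qS(1) q(1)] arc_letter_pair(2)[OF part(2) q(2,1)] less.prems(3)[OF qS(1)] by auto
      then have "j < q" using \<open>q \<noteq> j\<close> by simp
      have ne: "{i, q} \<noteq> {l, j}" using l(1) \<open>j < q\<close> ij(3) by (auto simp: doubleton_eq_iff)
      have "l \<noteq> i" using ne doubleton_unique[OF part(2), of i q j] q l by auto
      have "\<not> i < l"
        using nul[OF qS(2) _ l(1)] arc_letter_pair(1)[OF part(2) l(2,1)] less.prems(3)[OF qS(2)] by auto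
      then have "l < i" using \<open>l \<noteq> i\<close> by simp
      moreover have "((i < l) = (q < l)) = ((i < j) = (q < j))"
        using planarD[OF pl' q(2) l(2) ne, of i q l j] by simp
      ultimately show False using \<open>j < q\<close> ij(3) by linarith
    qed
    then have ij': "{i, j} \<in> D'" using q by simp
    have "D - {{i, j}} = D' - {{i, j}}"
    proof (rule less.hyps)
      show "card (S - {i, j}) < card S" using finS ijS by (intro psubset_card_mono) auto
      show "planar_matching (S - {i, j}) (D - {{i, j}})" "planar_matching (S - {i, j}) (D' - {{i, j}})"
        using planar_matching_remove less.prems(1,2) ij(2) ij' by auto
      fix p assume "p \<in> S - {i, j}"
      then show "arc_letter (D - {{i, j}}) p = arc_letter (D' - {{i, j}}) p"
        using arc_letter_remove part less.prems(3) by (metis Diff_iff)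
    qed
    then show ?thesis using ij(2) ij' by blast
  qed
qed

text \<open>Matching of brackets: the first \<open>Pos\<close> is joined to the last
  \<open>Neg\<close> before it. Only \<open>Nul\<close> letters lie between them, so removing the
  pair leaves a sequence with the same properties.\<close>

lemma ballot_matching_exists:
  fixes y :: "nat \<Rightarrow> basis"
  assumes "finite S" "(\<Sum>p\<in>S. letter_weight (y p)) = 0"
    "\<And>r. (\<Sum>p\<in>{p \<in> S. r \<le> p}. letter_weight (y p)) \<ge> 0"
  shows "\<exists>D. planar_matching S D \<and> (\<forall>p\<in>S. arc_letter D p = y p)"
  using assms
proof (induction "card S" arbitrary: S rule: less_induct)
  case less
  show ?case
  proof (cases "\<forall>p\<in>S. y p = Nul")
    case True
    define D where "D = (\<lambda>p. {p}) ` S"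
    have "planar_matching S D"
      unfolding planar_matching_def planar_def partition_on_def disjoint_def D_def using less.prems(1) by auto
    moreover have "arc_letter D p = y p" if "p \<in> S" for p
      using True that arc_letter_single[OF calculation that] unfolding D_def by auto
    ultimately show ?thesis by blast
  next
    case False
    let ?A = "{p \<in> S. y p \<noteq> Nul}"
    have fin: "finite ?A" "?A \<noteq> {}" using False less.prems(1) by auto
    define m where "m = Min ?A"
    have m: "m \<in> S" "y m \<noteq> Nul" "\<And>p. p \<in> S \<Longrightarrow> y p \<noteq> Nul \<Longrightarrow> m \<le> p"
      using Min_in[OF fin] Min_le[OF fin(1)] unfolding m_def by auto
    have tot: "(\<Sum>p\<in>{p \<in> S. m \<le> p}. letter_weight (y p)) = 0"
    proof -
      have "(\<Sum>p\<in>S. letter_weight (y p)) = (\<Sum>p\<in>{p \<in> S. m \<le> p}. letter_weight (y p))"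
        using less.prems(1) m(3) by (intro sum.mono_neutral_right) force+
      then show ?thesis using less.prems(2) by simp
    qed
    have insm: "{p \<in> S. m \<le> p} = insert m {p \<in> S. Suc m \<le> p}" using m(1) by auto
    \<comment> \<open>At the leftmost active letter: the total is zero and the part behind it is
      nonnegative, which excludes \<open>Pos\<close>.\<close>
    have ym: "y m = Neg"
    proof -
      have "letter_weight (y m) + (\<Sum>p\<in>{p \<in> S. Suc m \<le> p}. letter_weight (y p)) = 0"
        using tot unfolding insm using less.prems(1) by simp
      then show ?thesis using less.prems(3)[of "Suc m"] m(2) by (cases "y m") auto
    qed
    let ?P = "{p \<in> S. y p = Pos}"
    have "?P \<noteq> {}"
    proof
      assume "?P = {}"
      then have "letter_weight (y p) \<le> 0" if "p \<in> S" for p using that by (cases "y p") auto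
      then have "(\<Sum>p\<in>S. letter_weight (y p)) < (\<Sum>p\<in>S. 0)"
        using less.prems(1) m(1) ym by (intro sum_strict_mono_ex1 bexI[of _ m]) auto
      then show False using less.prems(2) by simp
    qed
    moreover have finP: "finite ?P" using less.prems(1) by auto
    ultimately have j0: "Min ?P \<in> ?P" by (intro Min_in)
    define j where "j = Min ?P"
    have j: "j \<in> S" "y j = Pos" "\<And>p. p \<in> S \<Longrightarrow> y p = Pos \<Longrightarrow> j \<le> p"
      using j0 Min_le[OF finP] unfolding j_def by auto
    let ?N = "{p \<in> S. p < j \<and> y p = Neg}"
    have "m \<noteq> j" using ym j(2) by auto
    moreover have "m \<le> j" using m(3)[OF j(1)] j(2) by simp
    ultimately have "m \<in> ?N" using m(1) ym by simp
    moreover have finN: "finite ?N" using less.prems(1) by auto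
    ultimately have i0: "Max ?N \<in> ?N" by (intro Max_in) auto
    define i where "i = Max ?N"
    have i: "i \<in> S" "y i = Neg" "i < j" "\<And>p. p \<in> S \<Longrightarrow> p < j \<Longrightarrow> y p = Neg \<Longrightarrow> p \<le> i"
      using i0 Max_ge[OF finN] unfolding i_def by auto
    have nul: "y p = Nul" if "p \<in> S" "i < p" "p < j" for p
      using that i(4)[of p] j(3)[of p] by (cases "y p") auto
    let ?S = "S - {i, j}"
    have "\<exists>D. planar_matching ?S D \<and> (\<forall>p\<in>?S. arc_letter D p = y p)"
    proof (rule less.hyps)
      show "card ?S < card S" using less.prems(1) i(1) by (intro psubset_card_mono) auto
      show "finite ?S" using less.prems(1) by simp
      have "(\<Sum>p\<in>S. letter_weight (y p)) = (\<Sum>p\<in>?S. letter_weight (y p)) + (\<Sum>p\<in>{i, j}. letter_weight (y p))"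
        using less.prems(1) i(1) j(1) by (intro sum.subset_diff) auto
      then show "(\<Sum>p\<in>?S. letter_weight (y p)) = 0" using less.prems(2) i j by simp
      fix r
      show "(\<Sum>p\<in>{p \<in> ?S. r \<le> p}. letter_weight (y p)) \<ge> 0"
      proof -
        have spl: "(\<Sum>p\<in>{p \<in> S. r \<le> p}. letter_weight (y p)) =
            (\<Sum>p\<in>{p \<in> ?S. r \<le> p}. letter_weight (y p)) + (\<Sum>p\<in>{p \<in> {i, j}. r \<le> p}. letter_weight (y p))"
        proof -
          have "{p \<in> S. r \<le> p} = {p \<in> ?S. r \<le> p} \<union> {p \<in> {i, j}. r \<le> p}" using i(1) j(1) by auto
          then show ?thesis using less.prems(1) by (simp only:, intro sum.union_disjoint) auto
        qed
        consider "r \<le> i" | "i < r" "r \<le> j" | "j < r" by linarith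
        then show ?thesis
        proof cases
          case 1
          then have "{p \<in> {i, j}. r \<le> p} = {i, j}" using i(3) by auto
          then show ?thesis using spl less.prems(3)[of r] i j by simp
        next
          \<comment> \<open>The suffix from r contains j but not i. All letters from r up to j are
            \<open>Nul\<close>, so after the removal it has the sum of the suffix that starts behind
            j.\<close>
          case 2
          then have "{p \<in> {i, j}. r \<le> p} = {j}" using i(3) by auto
          moreover have "(\<Sum>p\<in>{p \<in> S. r \<le> p}. letter_weight (y p)) = (\<Sum>p\<in>{p \<in> S. j \<le> p}. letter_weight (y p))"
          proof (rule sum.mono_neutral_right)
            show "\<forall>p\<in>{p \<in> S. r \<le> p} - {p \<in> S. j \<le> p}. letter_weight (y p) = 0"
              using 2(1) nul by (simp add: not_le)
          qed (use less.prems(1) 2(2) in auto)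
          moreover have "{p \<in> S. j \<le> p} = insert j {p \<in> S. Suc j \<le> p}" using j(1) by auto
          ultimately have "(\<Sum>p\<in>{p \<in> ?S. r \<le> p}. letter_weight (y p)) = (\<Sum>p\<in>{p \<in> S. Suc j \<le> p}. letter_weight (y p))"
            using spl less.prems(1) j(2) by simp
          then show ?thesis using less.prems(3)[of "Suc j"] by simp
        next
          case 3
          then have e: "{p \<in> {i, j}. r \<le> p} = {}" using i(3) by auto
          show ?thesis using less.prems(3)[of r] unfolding spl e by simp
        qed
      qed
    qed
    then obtain D where D: "planar_matching ?S D" "\<And>p. p \<in> ?S \<Longrightarrow> arc_letter D p = y p" by blast
    have pD: "partition_on ?S D" and plD: "planar D" using D(1) unfolding planar_matching_def by auto
    have ijD: "i \<notin> B" "j \<notin> B" if "B \<in> D" for B using matching_finite(4)[OF D(1) that] by auto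
    define D' where "D' = insert {i, j} D"
    have part': "partition_on S D'"
    proof (rule partition_onI)
      show "\<Union>D' = S" using pD i(1) j(1) unfolding D'_def partition_on_def by auto
      show "{} \<notin> D'" using pD unfolding D'_def partition_on_def by auto
      show "disjnt p q" if "p \<in> D'" "q \<in> D'" "p \<noteq> q" for p q
        using that ijD pD disjointD[of D p q] unfolding D'_def partition_on_def disjnt_def by auto
    qed
    \<comment> \<open>Points below the new arc are isolated, so its ends separate no two points of a
      block; this gives both halves of \<open>sep\<close>.\<close>
    have same: "a = b" if "B \<in> D" "a \<in> B" "b \<in> B" "i < a" "a < j" for B a b
    proof -
      have a: "a \<in> ?S" using matching_finite(4)[OF D(1) that(1)] that by auto
      then have "{a} \<in> D" using arc_letter_single[OF D(1) a] D(2)[OF a] nul that by auto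
      then show ?thesis using partition_block_unique[OF pD that(1) _ that(2), of "{a}"] that(3) by auto
    qed
    have sep: "((x < a) = (x' < a)) = ((x < b) = (x' < b))"
      "((a < x) = (b < x)) = ((a < x') = (b < x'))"
      if B: "B \<in> D" "a \<in> B" "b \<in> B" and x: "x \<in> {i, j}" "x' \<in> {i, j}" for B a b x x'
    proof -
      have "a \<noteq> i" "a \<noteq> j" "b \<noteq> i" "b \<noteq> j" using ijD B by blast+
      moreover have "i < a \<and> a < j \<Longrightarrow> a = b" "i < b \<and> b < j \<Longrightarrow> a = b"
        using same[OF B] same[OF B(1,3,2)] by blast+
      ultimately have "a = b \<or> (a < i \<or> j < a) \<and> (b < i \<or> j < b)"
        by (metis linorder_neqE_nat)
      then show "((x < a) = (x' < a)) = ((x < b) = (x' < b))" "((a < x) = (b < x)) = ((a < x') = (b < x'))"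
        using x i(3) by auto
    qed
    have "planar D'"
      unfolding planar_def
    proof (intro ballI impI)
      fix B B' a b c d
      assume BB: "B \<in> D'" "B' \<in> D'" "B \<noteq> B'" and el: "a \<in> B" "b \<in> B" "c \<in> B'" "d \<in> B'"
      consider "B \<in> D" "B' \<in> D" | "B = {i, j}" "B' \<in> D" | "B \<in> D" "B' = {i, j}"
        using BB unfolding D'_def by blast
      then show "((a < c) = (b < c)) = ((a < d) = (b < d))"
      proof cases
        case 1 then show ?thesis using planarD[OF plD _ _ BB(3) el] by blast
      next
        case 2 then show ?thesis using sep(1)[OF 2(2) el(3,4)] el(1,2) by blast
      next
        case 3 then show ?thesis using sep(2)[OF 3(1) el(1,2)] el(3,4) by blast
      qed
    qed
    then have "planar_matching S D'"
      using part' D(1) less.prems(1) unfolding planar_matching_def D'_def by (auto simp: card_insert_if)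
    moreover have "arc_letter D' p = y p" if p: "p \<in> S" for p
    proof (cases "p \<in> {i, j}")
      case True
      then show ?thesis using arc_letter_pair[OF part', of i j] i j unfolding D'_def by auto
    next
      case False
      then have "arc_letter (D' - {{i, j}}) p = arc_letter D' p" by (rule arc_letter_remove[OF part'])
      moreover have "{i, j} \<notin> D" using ijD(1)[of "{i, j}"] by auto
      then have "D' - {{i, j}} = D" unfolding D'_def by simp
      ultimately show ?thesis using D(2)[of p] p False by simp
    qed
    ultimately show ?thesis by blast
  qed
qed

section \<open>Triangularity of the matching weights\<close>

definition height :: "nat set \<Rightarrow> (nat \<Rightarrow> basis) \<Rightarrow> nat" where
  "height S y = (\<Sum>p\<in>S. if y p = Pos then p else 0)"

lemma block_wt_arc_letter:
  assumes "t \<noteq> 0" "planar_matching S D" "B \<in> D"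
  shows "block_wt t (arc_letter D) B \<noteq> 0"
    and "block_wt t y B \<noteq> 0 \<Longrightarrow> (\<forall>p\<in>B. y p = arc_letter D p) \<or>
      (\<Sum>p\<in>B. if y p = Pos then p else 0) < (\<Sum>p\<in>B. if arc_letter D p = Pos then p else 0)"
proof -
  have part: "partition_on S D" and two: "card B \<le> 2" using assms unfolding planar_matching_def by auto
  obtain a where a: "a \<in> B" using matching_finite(3)[OF assms(2,3)] by blast
  consider "B = {a}" | b where "b \<noteq> a" "B = {a, b}"
    using card_le_2_cases[OF matching_finite(2)[OF assms(2,3)] a two] by metis
  then have "block_wt t (arc_letter D) B \<noteq> 0 \<and> (block_wt t y B \<noteq> 0 \<longrightarrow> (\<forall>p\<in>B. y p = arc_letter D p) \<or>
      (\<Sum>p\<in>B. if y p = Pos then p else 0) < (\<Sum>p\<in>B. if arc_letter D p = Pos then p else 0))"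
  proof cases
    case 1
    then have "arc_letter D a = Nul" using arc_letter_single[OF assms(2), of a] assms(3) matching_finite(4)[OF assms(2,3)] a by auto
    then show ?thesis using 1 by (auto split: if_splits)
  next
    case 2
    define i j where "i = min a b" and "j = max a b"
    have ij: "i < j" "B = {i, j}" using 2 unfolding i_def j_def by (auto simp: min_def max_def)
    have l: "arc_letter D i = Neg" "arc_letter D j = Pos" using arc_letter_pair[OF part _ ij(1)] assms(3) ij(2) by auto
    show ?thesis using assms(1) ij l by (cases "y i"; cases "y j") (auto simp: block_wt_pair)
  qed
  then show "block_wt t (arc_letter D) B \<noteq> 0"
    "block_wt t y B \<noteq> 0 \<Longrightarrow> (\<forall>p\<in>B. y p = arc_letter D p) \<or>
      (\<Sum>p\<in>B. if y p = Pos then p else 0) < (\<Sum>p\<in>B. if arc_letter D p = Pos then p else 0)" by auto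
qed

lemma matching_wt_arc_letter:
  assumes "t \<noteq> 0" "planar_matching S D"
  shows "matching_wt t D (arc_letter D) \<noteq> 0"
  unfolding matching_wt_def using block_wt_arc_letter(1)[OF assms] matching_finite(1)[OF assms(2)] by simp

text \<open>The labels of nonzero weight on an arc are \<open>Neg Pos\<close>,
  \<open>Pos Neg\<close> and \<open>Nul Nul\<close>. The first is the choice of
  \<open>arc_letter\<close> and has its \<open>Pos\<close> furthest to the right; either of the
  others on some arc makes the sum strictly smaller.\<close>

lemma matching_wt_height:
  assumes "t \<noteq> 0" "planar_matching S D" "matching_wt t D y \<noteq> 0"
  shows "(\<forall>p\<in>S. y p = arc_letter D p) \<or> height S y < height S (arc_letter D)"
proof -
  note fin = matching_finite[OF assms(2)]
  have part: "partition_on S D" using assms unfolding planar_matching_def by auto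
  then have S: "S = \<Union>D" unfolding partition_on_def by simp
  have nz: "block_wt t y B \<noteq> 0" if "B \<in> D" for B
    using assms(3) that fin(1) unfolding matching_wt_def by auto
  have h: "height S z = (\<Sum>B\<in>D. \<Sum>p\<in>B. if z p = Pos then p else 0)" for z
  proof -
    have "\<forall>A\<in>D. \<forall>A'\<in>D. A \<noteq> A' \<longrightarrow> A \<inter> A' = {}" using partition_block_unique[OF part] by blast
    then show ?thesis
      unfolding height_def S using fin(2) by (subst sum.Union_disjoint) (auto simp: comp_def)
  qed
  show ?thesis
  proof (cases "\<forall>p\<in>S. y p = arc_letter D p")
    case False
    then obtain B where B: "B \<in> D" "\<not> (\<forall>p\<in>B. y p = arc_letter D p)" unfolding S by blast
    have "(\<Sum>p\<in>C. if y p = Pos then p else 0) \<le> (\<Sum>p\<in>C. if arc_letter D p = Pos then p else 0)" if C: "C \<in> D" for C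
      using block_wt_arc_letter(2)[OF assms(1,2) C nz[OF C]]
    proof
      assume "\<forall>p\<in>C. y p = arc_letter D p"
      then show ?thesis by (intro eq_refl sum.cong) auto
    qed simp
    moreover have "(\<Sum>p\<in>B. if y p = Pos then p else 0) < (\<Sum>p\<in>B. if arc_letter D p = Pos then p else 0)"
      using block_wt_arc_letter(2)[OF assms(1,2) B(1) nz[OF B(1)]] B(2) by blast
    ultimately show ?thesis unfolding h using fin(1) B(1) by (auto intro!: sum_strict_mono_ex1)
  qed simp
qed

lemma weight_drop: "weight (drop r x) = (\<Sum>p\<in>{p \<in> {1..length x}. Suc r \<le> p}. letter_weight (label x p))"
proof (cases "r \<le> length x")
  case True
  have "drop r x = map ((!) x) [r..<length x]"
    by (metis True append_take_drop_id drop_map drop_upt map_nth diff_zero add_0)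
  then have "weight (drop r x) = (\<Sum>p\<in>{r..<length x}. letter_weight (x ! p))"
    unfolding weight_def by (simp add: comp_def interv_sum_list_conv_sum_set_nat)
  also have "\<dots> = (\<Sum>p\<in>{p \<in> {1..length x}. Suc r \<le> p}. letter_weight (label x p))"
    by (rule sum.reindex_bij_witness[of _ "\<lambda>p. p - 1" Suc]) (auto simp: label_def)
  finally show ?thesis .
next
  case False
  then have "{p \<in> {1..length x}. Suc r \<le> p} = {}" "drop r x = []" by auto
  then show ?thesis by (simp only: sum.empty weight_simps)
qed

lemma suffix_ballot_drop: "suffix_ballot x \<Longrightarrow> weight (drop r x) \<ge> 0"
proof (induction x arbitrary: r)
  case (Cons a x)
  then show ?case by (cases r) auto
qed simp

lemma suffix_ballot_matching:
  assumes "suffix_ballot x" "weight x = 0"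
  shows "\<exists>D. planar_matching {1..length x} D \<and> (\<forall>p\<in>{1..length x}. arc_letter D p = label x p)"
proof (rule ballot_matching_exists)
  have "{p \<in> {1..length x}. Suc 0 \<le> p} = {1..length x}" by auto
  then show "(\<Sum>p\<in>{1..length x}. letter_weight (label x p)) = 0"
    using weight_drop[of 0 x] assms(2) by simp
  fix r
  show "0 \<le> (\<Sum>p\<in>{p \<in> {1..length x}. r \<le> p}. letter_weight (label x p))"
  proof (cases r)
    case 0
    have "{p \<in> {1..length x}. r \<le> p} = {p \<in> {1..length x}. Suc 0 \<le> p}" using 0 by auto
    then show ?thesis using weight_drop[of 0 x] assms(2) by simp
  next
    case (Suc r')
    then show ?thesis using weight_drop[of r' x] suffix_ballot_drop[OF assms(1), of r'] by simp
  qed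
qed simp

section \<open>The action of the quantum group in coordinates\<close>

text \<open>The scalar-valued counterpart of \<open>lin_ext\<close>: the linear functional with
  value f on the basis.\<close>

definition lsum :: "('b \<Rightarrow> 'a::field) \<Rightarrow> ('b \<Rightarrow>\<^sub>0 'a) \<Rightarrow> 'a" where
  "lsum f x = (\<Sum>b\<in>Poly_Mapping.keys x. Poly_Mapping.lookup x b * f b)"

lemma lsum_superset:
  "finite A \<Longrightarrow> Poly_Mapping.keys x \<subseteq> A \<Longrightarrow> lsum f x = (\<Sum>b\<in>A. Poly_Mapping.lookup x b * f b)"
  unfolding lsum_def by (rule sum.mono_neutral_left) (auto simp: in_keys_iff)

lemma lsum_zero [simp]: "lsum f 0 = 0"
  by (simp add: lsum_def)

lemma lsum_single [simp]: "lsum f (Poly_Mapping.single b c) = c * f b"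
  by (simp add: lsum_def)

lemma lsum_add: "lsum f (x + y) = lsum f x + lsum f y"
proof -
  let ?A = "Poly_Mapping.keys x \<union> Poly_Mapping.keys y"
  have "Poly_Mapping.keys (x + y) \<subseteq> ?A" by (rule keys_add)
  then show ?thesis
    by (subst (1 2 3) lsum_superset[of ?A]) (auto simp: lookup_add sum.distrib algebra_simps)
qed

lemma lsum_uminus: "lsum f (- x) = - lsum f x"
  unfolding lsum_def by (simp add: sum_negf)

lemma lsum_diff: "lsum f (x - y) = lsum f x - lsum f y"
  using lsum_add[of f x "- y"] by (simp add: lsum_uminus)

lemma lsum_sum: "lsum f (\<Sum>i\<in>I. x i) = (\<Sum>i\<in>I. lsum f (x i))"
  by (induction I rule: infinite_finite_induct) (auto simp: lsum_add)

lemma lookup_scale [simp]: "Poly_Mapping.lookup (scale c x) b = c * Poly_Mapping.lookup x b"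
  by (simp add: scale_def Poly_Mapping.map.rep_eq when_def)

lemma keys_scale: "Poly_Mapping.keys (scale c x) \<subseteq> Poly_Mapping.keys x"
  by (auto simp: in_keys_iff)

lemma lsum_scale: "lsum f (scale c x) = c * lsum f x"
  by (subst (1 2) lsum_superset[of "Poly_Mapping.keys x"]) (auto simp: keys_scale[THEN subsetD] sum_distrib_left mult.assoc)

lemma lsum_fun_scale: "lsum (\<lambda>b. c * f b) x = c * lsum f x"
  by (simp add: lsum_def sum_distrib_left mult_ac)

lemma lsum_cong: "(\<And>b. b \<in> Poly_Mapping.keys x \<Longrightarrow> f b = g b) \<Longrightarrow> lsum f x = lsum g x"
  by (simp add: lsum_def)

lemma lookup_sum': "Poly_Mapping.lookup (\<Sum>i\<in>I. x i) b = (\<Sum>i\<in>I. Poly_Mapping.lookup (x i) b)"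
  by (induction I rule: infinite_finite_induct) (auto simp: lookup_add)

lemma lookup_lin_ext: "Poly_Mapping.lookup (lin_ext f x) c = lsum (\<lambda>b. Poly_Mapping.lookup (f b) c) x"
  by (simp add: lin_ext_def lsum_def lookup_sum')

lemma sum_singles: "(\<Sum>b\<in>Poly_Mapping.keys x. Poly_Mapping.single b (Poly_Mapping.lookup x b)) = x"
  by (rule poly_mapping_eqI) (auto simp: lookup_sum' lookup_single when_def in_keys_iff sum.delta' sum.delta)

lemma lsum_mult:
  "lsum f (x * y) = lsum (\<lambda>a. lsum (\<lambda>b. f (a + b)) y) x"
  for x y :: "'b::monoid_add \<Rightarrow>\<^sub>0 'a::field"
proof -
  have "x * y = (\<Sum>a\<in>Poly_Mapping.keys x. Poly_Mapping.single a (Poly_Mapping.lookup x a)) *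
      (\<Sum>b\<in>Poly_Mapping.keys y. Poly_Mapping.single b (Poly_Mapping.lookup y b))"
    by (simp add: sum_singles)
  also have "\<dots> = (\<Sum>a\<in>Poly_Mapping.keys x. \<Sum>b\<in>Poly_Mapping.keys y.
      Poly_Mapping.single (a + b) (Poly_Mapping.lookup x a * Poly_Mapping.lookup y b))"
    by (simp add: sum_product mult_single)
  finally show ?thesis
    by (simp add: lsum_sum) (simp add: lsum_def sum_distrib_left mult.assoc)
qed

section \<open>The generators as operators on coefficient functions\<close>

fun letter_wt :: "'a::field \<Rightarrow> gen \<Rightarrow> basis \<Rightarrow> 'a" where
  "letter_wt q K1 Pos = q"
| "letter_wt q K1i Pos = inverse q"
| "letter_wt q K2 Neg = q"
| "letter_wt q K2i Neg = inverse q"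
| "letter_wt q _ _ = 1"

definition word_wt :: "'a::field \<Rightarrow> gen \<Rightarrow> basis list \<Rightarrow> 'a" where
  "word_wt q a w = prod_list (map (letter_wt q a) w)"

lemma word_wt_simps [simp]:
  "word_wt q a [] = 1" "word_wt q a (h # w) = letter_wt q a h * word_wt q a w"
  by (simp_all add: word_wt_def)

text \<open>These operators act on functions on words of all lengths at once. They preserve length,
  so the k-th tensor power is recovered by restricting to words of length k.\<close>

fun gen_op :: "'a::field \<Rightarrow> gen \<Rightarrow> (basis list \<Rightarrow> 'a) \<Rightarrow> basis list \<Rightarrow> 'a" where
  "gen_op q E v = raising q v"
| "gen_op q F v = lowering q v"
| "gen_op q a v = (\<lambda>w. word_wt q a w * v w)"

definition word_op :: "'a::field \<Rightarrow> gen list \<Rightarrow> (basis list \<Rightarrow> 'a) \<Rightarrow> basis list \<Rightarrow> 'a" where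
  "word_op q g v = foldr (gen_op q) g v"

definition free_op :: "'a::field \<Rightarrow> 'a free_alg \<Rightarrow> (basis list \<Rightarrow> 'a) \<Rightarrow> basis list \<Rightarrow> 'a" where
  "free_op q u v w = lsum (\<lambda>g. word_op q g v w) u"

lemma gen_op_cases: "gen_op q a = raising q \<or> gen_op q a = lowering q \<or> gen_op q a = (\<lambda>v w. word_wt q a w * v w)"
  by (cases a) (auto simp: fun_eq_iff)

lemma word_op_simps [simp]: "word_op q [] v = v" "word_op q (a # g) v = gen_op q a (word_op q g v)"
  by (simp_all add: word_op_def)

lemma word_op_append: "word_op q (g @ h) v = word_op q g (word_op q h v)"
  by (simp add: word_op_def)

lemma gen_op_cong: "(\<And>y. length y = length x \<Longrightarrow> u y = v y) \<Longrightarrow> gen_op q a u x = gen_op q a v x"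
  using gen_op_cases[of q a] raise_cong[of x u v q] lower_cong[of x u v q] by auto

lemma word_op_cong: "(\<And>y. length y = length x \<Longrightarrow> u y = v y) \<Longrightarrow> word_op q g u x = word_op q g v x"
proof (induction g arbitrary: x)
  case (Cons a g)
  then show ?case by (auto intro!: gen_op_cong)
qed simp

lemma gen_op_sum: "gen_op q a (\<lambda>w. \<Sum>i\<in>I. c i * v i w) = (\<lambda>w. \<Sum>i\<in>I. c i * gen_op q a (v i) w)"
proof -
  consider "gen_op q a = raising q" | "gen_op q a = lowering q" | "gen_op q a = (\<lambda>v w. word_wt q a w * v w)"
    using gen_op_cases by blast
  then show ?thesis
    by cases (simp_all add: fun_eq_iff raise_sum raise_scale lower_sum lower_scale sum_distrib_left mult_ac)
qed

lemma word_op_sum: "word_op q g (\<lambda>w. \<Sum>i\<in>I. c i * v i w) = (\<lambda>w. \<Sum>i\<in>I. c i * word_op q g (v i) w)"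
  by (induction g) (simp_all add: gen_op_sum)

lemma gen_op_zero: "gen_op q a (\<lambda>w. 0) = (\<lambda>w. 0)"
  using gen_op_sum[of q a "\<lambda>_. 0" "\<lambda>_ _. 0" "{} :: nat set"] by simp

lemma word_op_zero: "word_op q g (\<lambda>w. 0) = (\<lambda>w. 0)"
  by (induction g) (simp_all add: gen_op_zero)

lemma free_op_add: "free_op q (u + u') v w = free_op q u v w + free_op q u' v w"
  by (simp add: free_op_def lsum_add)

lemma free_op_diff: "free_op q (u - u') v w = free_op q u v w - free_op q u' v w"
  by (simp add: free_op_def lsum_diff)

lemma free_op_single: "free_op q (Poly_Mapping.single g c) v w = c * word_op q g v w"
  by (simp add: free_op_def)

lemma free_op_mult: "free_op q (u * u') v = free_op q u (free_op q u' v)"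
proof
  fix w
  have "lsum (\<lambda>h. word_op q (g + h) v w) u' = word_op q g (free_op q u' v) w" for g
    unfolding free_op_def lsum_def plus_list_def word_op_append word_op_sum ..
  then show "free_op q (u * u') v w = free_op q u (free_op q u' v) w"
    unfolding free_op_def[of q "u * u'"] free_op_def[of q u] lsum_mult by simp
qed

lemma free_op_one: "free_op q 1 v = v"
  by (simp add: fun_eq_iff free_op_def single_one[symmetric] zero_list_def del: single_one)

lemma free_op_cong: "(\<And>y. length y = length x \<Longrightarrow> v y = v' y) \<Longrightarrow> free_op q u v x = free_op q u v' x"
  unfolding free_op_def by (intro lsum_cong word_op_cong)

lemma free_op_sum: "free_op q u (\<lambda>w. \<Sum>i\<in>I. c i * v i w) = (\<lambda>w. \<Sum>i\<in>I. c i * free_op q u (v i) w)"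
proof
  fix w
  show "free_op q u (\<lambda>w. \<Sum>i\<in>I. c i * v i w) w = (\<Sum>i\<in>I. c i * free_op q u (v i) w)"
    unfolding free_op_def word_op_sum lsum_def sum_distrib_left
    by (subst sum.swap) (simp add: mult_ac)
qed

lemma free_op_length: "(\<And>y. length y = length x \<Longrightarrow> v y = 0) \<Longrightarrow> free_op q u v x = 0"
proof -
  assume "\<And>y. length y = length x \<Longrightarrow> v y = 0"
  then have "word_op q g v x = 0" for g
    using word_op_cong[of x v "\<lambda>_. 0"] by (simp add: word_op_zero)
  then show ?thesis by (simp add: free_op_def lsum_def)
qed

lemma free_op_gen: "free_op q (free_gen a) v = gen_op q a v"
  by (simp add: fun_eq_iff free_gen_def free_op_single)

lemma free_op_const: "free_op q (free_const c) v = (\<lambda>w. c * v w)"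
  by (simp add: fun_eq_iff free_const_def free_op_single)

lemma word_wt_inverse:
  assumes "q \<noteq> 0"
  shows "word_wt q K1 w * word_wt q K1i w = 1" "word_wt q K2 w * word_wt q K2i w = 1"
    "word_wt q K1 w * word_wt q K2i w = k_wts q w" "word_wt q K2 w * word_wt q K1i w = inverse (k_wts q w)"
proof -
  have "word_wt q K1 w * word_wt q K1i w = 1 \<and> word_wt q K2 w * word_wt q K2i w = 1 \<and>
    word_wt q K1 w * word_wt q K2i w = k_wts q w \<and> word_wt q K2 w * word_wt q K1i w = inverse (k_wts q w)"
  proof (induction w)
    case (Cons a w)
    then show ?case using assms by (cases a) (auto simp: field_simps)
  qed simp
  then show "word_wt q K1 w * word_wt q K1i w = 1" "word_wt q K2 w * word_wt q K2i w = 1"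
    "word_wt q K1 w * word_wt q K2i w = k_wts q w" "word_wt q K2 w * word_wt q K1i w = inverse (k_wts q w)" by auto
qed

lemma raise_word_wt:
  assumes "q \<noteq> 0"
  shows "raising q (\<lambda>y. word_wt q K1i y * v y) x = q * word_wt q K1i x * raising q v x"
    "raising q (\<lambda>y. word_wt q K2i y * v y) x = inverse q * word_wt q K2i x * raising q v x"
proof (induction x arbitrary: v)
  case (Cons a x)
  case 1
  have "raising q (\<lambda>y. word_wt q K1i (a # y) * v (a # y)) x = letter_wt q K1i a * raising q (\<lambda>y. word_wt q K1i y * v (a # y)) x"
    by (simp add: raise_scale[symmetric] mult.assoc)
  then show ?case using Cons(1)[of "\<lambda>y. v (a # y)"] assms by (cases a) (simp_all add: field_simps)
  case 2
  have "raising q (\<lambda>y. word_wt q K2i (a # y) * v (a # y)) x = letter_wt q K2i a * raising q (\<lambda>y. word_wt q K2i y * v (a # y)) x"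
    by (simp add: raise_scale[symmetric] mult.assoc)
  then show ?case using Cons(2)[of "\<lambda>y. v (a # y)"] assms by (cases a) (simp_all add: field_simps)
qed simp_all

lemma lower_word_wt:
  assumes "q \<noteq> 0"
  shows "lowering q (\<lambda>y. word_wt q K1i y * v y) x = inverse q * word_wt q K1i x * lowering q v x"
    "lowering q (\<lambda>y. word_wt q K2i y * v y) x = q * word_wt q K2i x * lowering q v x"
proof (induction x arbitrary: v)
  case (Cons a x)
  case 1
  have "lowering q (\<lambda>y. word_wt q K1i (a # y) * v (a # y)) x = letter_wt q K1i a * lowering q (\<lambda>y. word_wt q K1i y * v (a # y)) x"
    by (simp add: lower_scale[symmetric] mult.assoc)
  then show ?case using Cons(1)[of "\<lambda>y. v (a # y)"] assms by (cases a) (simp_all add: field_simps)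
  case 2
  have "lowering q (\<lambda>y. word_wt q K2i (a # y) * v (a # y)) x = letter_wt q K2i a * lowering q (\<lambda>y. word_wt q K2i y * v (a # y)) x"
    by (simp add: lower_scale[symmetric] mult.assoc)
  then show ?case using Cons(2)[of "\<lambda>y. v (a # y)"] assms by (cases a) (simp_all add: field_simps)
qed simp_all

text \<open>The commutator of E and F is \<open>raise_lower\<close>; the other relations say that
  the diagonal operators are inverse to each other, commute, or are scaled when moved past E or
  F.\<close>

lemma free_op_relators:
  assumes "q \<noteq> 0" "q \<noteq> inverse q" "r \<in> Uq_relators q"
  shows "free_op q r v = (\<lambda>w. 0)"
proof
  fix w
  have K: "word_wt q K1i w * word_wt q K1 w = 1" "word_wt q K2i w * word_wt q K2 w = 1"
    "word_wt q K1 w * word_wt q K1i w = 1" "word_wt q K2 w * word_wt q K2i w = 1"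
    using word_wt_inverse(1,2)[OF assms(1), of w] by (simp_all add: mult.commute)
  \<comment> \<open>\<open>c\<close>, \<open>d\<close> and \<open>s\<close> serve as rewrite rules
    that cancel or combine diagonal factors standing inside a product.\<close>
  have c: "a * (b * x) = x" if "a * b = 1" for a b x :: 'a
    using that by (simp flip: mult.assoc)
  have d: "a * (b * x) = y * x" if "a * b = y" for a b x y :: 'a
    using that by (simp flip: mult.assoc)
  have s: "a * (z * b * x) = z * x" if "a * b = 1" for a b x z :: 'a
  proof -
    have "a * (z * b * x) = (a * b) * (z * x)" by (simp add: mult_ac)
    then show ?thesis using that by simp
  qed
  note simps = free_op_add free_op_diff free_op_mult free_op_gen free_op_const free_op_one
  note w = word_wt_inverse[OF assms(1), of w]
  from assms(3) show "free_op q r v w = 0"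
    unfolding Uq_relators_def
    by (elim insertE emptyE; hypsubst; simp only: simps gen_op.simps raise_word_wt[OF assms(1)]
        lower_word_wt[OF assms(1)] raise_lower[OF assms(1,2)] c[OF K(1)] c[OF K(2)] c[OF K(3)] c[OF K(4)]
        s[OF K(3)] s[OF K(4)] d[OF w(3)] d[OF w(4)];
      simp add: diff_divide_distrib algebra_simps)
qed

lemma lookup_eq_lsum: "Poly_Mapping.lookup x w = lsum (\<lambda>y. of_bool (y = w)) x"
proof (cases "w \<in> Poly_Mapping.keys x")
  case True
  then show ?thesis by (simp add: lsum_def of_bool_def if_distrib[of "\<lambda>z. _ * z"] sum.delta cong: if_cong)
next
  case False
  then show ?thesis by (simp add: lsum_def of_bool_def if_distrib[of "\<lambda>z. _ * z"] sum.delta in_keys_iff cong: if_cong)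
qed

lemma lsum_lin_ext: "lsum f (lin_ext g u) = lsum (\<lambda>b. lsum f (g b)) u"
  by (simp add: lin_ext_def lsum_sum lsum_scale) (simp add: lsum_def)

lemma lsum_zero_fun [simp]: "lsum (\<lambda>b. 0) x = 0"
  by (simp add: lsum_def)

lemma lsum_UNIV: "lsum f x = (\<Sum>b\<in>UNIV. Poly_Mapping.lookup x b * f b)" for x :: "'b::finite \<Rightarrow>\<^sub>0 'a::field"
  by (rule lsum_superset) auto

lemma lsum_swap: "lsum (\<lambda>a. lsum (\<lambda>b. f a b) y) x = lsum (\<lambda>b. lsum (\<lambda>a. f a b) x) y"
  unfolding lsum_def sum_distrib_left by (subst sum.swap) (simp add: mult_ac)

lemma lookup_V_to_tensor_mult:
  "Poly_Mapping.lookup (V_to_tensor y * z) [] = 0"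
  "Poly_Mapping.lookup (V_to_tensor y * z) (h # t) = Poly_Mapping.lookup y h * Poly_Mapping.lookup z t"
proof -
  have *: "Poly_Mapping.lookup (V_to_tensor y * z) w = lsum (\<lambda>b. lsum (\<lambda>u. of_bool (b # u = w)) z) y" for w
    unfolding lookup_eq_lsum[of _ w] lsum_mult V_to_tensor_def lsum_lin_ext
    by (simp add: plus_list_def)
  show "Poly_Mapping.lookup (V_to_tensor y * z) [] = 0" unfolding * by simp
  have "lsum (\<lambda>u. of_bool (b # u = h # t)) z = of_bool (b = h) * Poly_Mapping.lookup z t" for b
    by (cases "b = h") (simp_all add: lookup_eq_lsum[of z t])
  then show "Poly_Mapping.lookup (V_to_tensor y * z) (h # t) = Poly_Mapping.lookup y h * Poly_Mapping.lookup z t"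
    unfolding * by (simp add: lookup_eq_lsum[of y h] mult.commute[of _ "Poly_Mapping.lookup z t"] lsum_fun_scale)
qed

lemma lookup_V_act:
  "Poly_Mapping.lookup (V_act q a y) h =
    (\<Sum>b\<in>UNIV. Poly_Mapping.lookup (V_act q a (Poly_Mapping.single b 1)) h * Poly_Mapping.lookup y b)"
proof (induction a arbitrary: h)
  case Nil
  show ?case by (simp add: V_act_def lookup_single when_def if_distrib[of "\<lambda>z. z * _"] sum.delta cong: if_cong)
next
  case (Cons a as)
  have step: "Poly_Mapping.lookup (V_act q (a # as) z) h =
      (\<Sum>c\<in>UNIV. Poly_Mapping.lookup (V_act q as z) c * Poly_Mapping.lookup (V_gen q a c) h)" for z
    by (simp add: V_act_def lookup_lin_ext lsum_UNIV)
  have "Poly_Mapping.lookup (V_act q (a # as) y) h = (\<Sum>c\<in>UNIV. (\<Sum>b\<in>UNIV.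
      Poly_Mapping.lookup (V_act q as (Poly_Mapping.single b 1)) c * Poly_Mapping.lookup y b) * Poly_Mapping.lookup (V_gen q a c) h)"
    unfolding step using Cons by (intro sum.cong refl arg_cong2[of _ _ _ _ "(*)"])
  also have "\<dots> = (\<Sum>b\<in>UNIV. Poly_Mapping.lookup (V_act q (a # as) (Poly_Mapping.single b 1)) h * Poly_Mapping.lookup y b)"
    unfolding step sum_distrib_right by (subst sum.swap) (simp add: mult_ac)
  finally show ?case .
qed

lemma V_act_append: "V_act q (a @ b) y = V_act q a (V_act q b y)"
  by (simp add: V_act_def)

section \<open>Compatibility with the coproduct\<close>

fun pair_op :: "'a::field \<Rightarrow> gen list \<times> gen list \<Rightarrow> (basis list \<Rightarrow> 'a) \<Rightarrow> basis list \<Rightarrow> 'a" where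
  "pair_op q (a, b) v [] = 0"
| "pair_op q (a, b) v (h # t) =
    (\<Sum>c\<in>UNIV. Poly_Mapping.lookup (V_act q a (Poly_Mapping.single c 1)) h * word_op q b (\<lambda>y. v (c # y)) t)"

text \<open>In a \<otimes> b the component a acts on the first letter and b on the rest, so the
  product of the tensor square acts by composition. The value 0 of \<open>pair_op\<close> on the
  empty word is a mere default; the laws concern nonempty words.\<close>

lemma pair_op_plus: "pair_op q (p + r) v (h # t) = pair_op q p (pair_op q r v) (h # t)"
proof -
  obtain a b a' b' where p: "p = (a, b)" "r = (a', b')" by (metis surj_pair)
  have "pair_op q p (pair_op q r v) (h # t) =
     (\<Sum>c\<in>UNIV. \<Sum>e\<in>UNIV. Poly_Mapping.lookup (V_act q a (Poly_Mapping.single c 1)) h *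
       (Poly_Mapping.lookup (V_act q a' (Poly_Mapping.single e 1)) c * word_op q b (word_op q b' (\<lambda>y. v (e # y))) t))"
    unfolding p pair_op.simps word_op_sum sum_distrib_left ..
  also have "\<dots> = (\<Sum>e\<in>UNIV. (\<Sum>c\<in>UNIV. Poly_Mapping.lookup (V_act q a (Poly_Mapping.single c 1)) h *
       Poly_Mapping.lookup (V_act q a' (Poly_Mapping.single e 1)) c) * word_op q (b @ b') (\<lambda>y. v (e # y)) t)"
    unfolding word_op_append by (subst sum.swap) (simp add: sum_distrib_right mult.assoc)
  also have "\<dots> = pair_op q (p + r) v (h # t)"
    unfolding p plus_prod_def plus_list_def by (simp add: V_act_append lookup_V_act[of q a "V_act q a' _"])
  finally show ?thesis ..
qed

lemma pair_op_lsum: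
  "pair_op q p (\<lambda>w. lsum (\<lambda>r. f r w) z) (h # t) = lsum (\<lambda>r. pair_op q p (f r) (h # t)) z"
proof -
  obtain a b where p: "p = (a, b)" by (metis surj_pair)
  show ?thesis
    unfolding p pair_op.simps lsum_def word_op_sum sum_distrib_left
    by (subst sum.swap) (simp add: mult_ac)
qed

lemma pair_op_cong:
  "(\<And>h t. v (h # t) = v' (h # t)) \<Longrightarrow> pair_op q p v (h # t) = pair_op q p v' (h # t)"
  by (cases p) simp

lemma V_act_single:
  "V_act q [a] (Poly_Mapping.single c 1) = V_gen q a c"
  by (rule poly_mapping_eqI) (simp add: V_act_def lookup_lin_ext)

lemma V_act_Nil: "V_act q [] y = y"
  by (simp add: V_act_def)

lemma lin_ext_single: "lin_ext f (Poly_Mapping.single b c) = scale c (f b)"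
  by (rule poly_mapping_eqI) (simp add: lookup_lin_ext)

lemma V_act_two: "V_act q [a, b] (Poly_Mapping.single c 1) = lin_ext (V_gen q a) (V_gen q b c)"
  using V_act_append[of q "[a]" "[b]"] V_act_single[of q b c] by (simp add: V_act_def)

lemma tensor_power_lookup: "x \<in> tensor_power k \<Longrightarrow> length w \<noteq> k \<Longrightarrow> Poly_Mapping.lookup x w = 0"
  using in_keys_iff[of w x] by (auto simp: tensor_power_def)

text \<open>The recursions of \<open>raising\<close>, \<open>lowering\<close> and
  \<open>word_wt\<close> on the first letter are the coproducts of the generators; K1 K2i and K2 K1i
  act by K and its inverse through \<open>word_wt_inverse\<close>.\<close>

lemma coproduct_gen_op:
  assumes "q \<noteq> 0"
  shows "lsum (\<lambda>p. pair_op q p v (h # t)) (coproduct_gen a) = gen_op q a v (h # t)"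
proof -
  have K: "word_wt q K1 t * (word_wt q K2i t * x) = k_wts q t * x"
    "word_wt q K2 t * (word_wt q K1i t * x) = inverse (k_wts q t) * x" for x
    using word_wt_inverse(3,4)[OF assms, of t] by (simp_all flip: mult.assoc)
  show ?thesis
    by (cases a; cases h)
      (simp_all add: lsum_add V_act_single V_act_two V_act_Nil lin_ext_single sum_basis lookup_single K word_wt_simps lower_scale raise_scale)
qed

lemma coproduct_word_op:
  assumes "q \<noteq> 0"
  shows "lsum (\<lambda>p. pair_op q p v (h # t)) (prod_list (map coproduct_gen g)) = word_op q g v (h # t)"
proof (induction g arbitrary: h t)
  case Nil
  have one: "prod_list (map coproduct_gen []) = (Poly_Mapping.single ([], []) 1 :: _ \<Rightarrow>\<^sub>0 'a)"
    by (simp add: single_one[symmetric] zero_prod_def zero_list_def del: single_one)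
  show ?case
    unfolding one by (simp add: V_act_Nil lookup_single when_def if_distrib[of "\<lambda>z. z * _"] sum.delta cong: if_cong)
next
  case (Cons a g)
  have "lsum (\<lambda>p. pair_op q p v (h # t)) (prod_list (map coproduct_gen (a # g))) =
      lsum (\<lambda>p. pair_op q p (\<lambda>w. lsum (\<lambda>r. pair_op q r v w) (prod_list (map coproduct_gen g))) (h # t)) (coproduct_gen a)"
    by (simp add: lsum_mult pair_op_plus pair_op_lsum)
  also have "\<dots> = lsum (\<lambda>p. pair_op q p (word_op q g v) (h # t)) (coproduct_gen a)"
    by (intro lsum_cong pair_op_cong) (simp add: Cons)
  also have "\<dots> = word_op q (a # g) v (h # t)"
    by (simp add: coproduct_gen_op[OF assms])
  finally show ?case .
qed

text \<open>Links the action by iterated coproduct to the recursive operators. Both peel off the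
  first tensor factor, so induction on k with \<open>coproduct_word_op\<close> applies; for k = 0
  both reduce to the counit.\<close>

lemma lookup_free_act:
  assumes "q \<noteq> 0" "x \<in> tensor_power k"
  shows "Poly_Mapping.lookup (free_act q k u x) w = free_op q u (Poly_Mapping.lookup x) w"
  using assms(2)
proof (induction k arbitrary: u x w)
  case 0
  show ?case
  proof (cases w)
    case Nil
    have "word_op q g v [] = prod_list (map counit_gen g) * v []" for g v
    proof (induction g)
      case (Cons a g) then show ?case by (cases a) auto
    qed simp
    then show ?thesis
      using Nil by (simp add: counit_def free_op_def lsum_def sum_distrib_right mult.assoc)
  next
    case (Cons h t)
    have "Poly_Mapping.lookup x y = 0" if "length y = length w" for y
      using tensor_power_lookup[OF 0, of y] that Cons by simp
    then show ?thesis by (simp add: free_op_length)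
  qed
next
  case (Suc k)
  have keys: "length y = Suc k" if "y \<in> Poly_Mapping.keys x" for y
    using Suc.prems that unfolding tensor_power_def by blast
  have expand: "Poly_Mapping.lookup (free_act q (Suc k) u x) w =
      lsum (\<lambda>y. lsum (\<lambda>p. Poly_Mapping.lookup (case p of (a, b) \<Rightarrow>
         V_to_tensor (V_act q a (Poly_Mapping.single (hd y) 1)) *
         free_act q k (Poly_Mapping.single b 1) (Poly_Mapping.single (tl y) 1)) w) (coproduct u)) x"
    by (simp add: lookup_lin_ext)
  show ?case
  proof (cases w)
    case Nil
    have "Poly_Mapping.lookup x y = 0" if "length y = length w" for y
      using tensor_power_lookup[OF Suc.prems, of y] that Nil by simp
    then have "free_op q u (Poly_Mapping.lookup x) w = 0" by (rule free_op_length)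
    then show ?thesis unfolding expand using Nil
      by (simp add: lookup_V_to_tensor_mult case_prod_beta)
  next
    case (Cons h t)
    have "lsum (\<lambda>y. Poly_Mapping.lookup (V_to_tensor (V_act q a (Poly_Mapping.single (hd y) 1)) *
         free_act q k (Poly_Mapping.single b 1) (Poly_Mapping.single (tl y) 1)) w) x =
      pair_op q (a, b) (Poly_Mapping.lookup x) w" for a b
    proof -
      let ?M = "\<lambda>c. Poly_Mapping.lookup (V_act q a (Poly_Mapping.single c 1)) h"
      have "(\<lambda>z. Poly_Mapping.lookup x (c # z)) = (\<lambda>z. \<Sum>y\<in>Poly_Mapping.keys x.
          (Poly_Mapping.lookup x y * of_bool (hd y = c)) * Poly_Mapping.lookup (Poly_Mapping.single (tl y) 1) z)" for c
      proof
        fix z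
        have "Poly_Mapping.lookup x (c # z) = (\<Sum>y\<in>Poly_Mapping.keys x. Poly_Mapping.lookup x y * of_bool (y = c # z))"
          using lookup_eq_lsum[of x "c # z"] unfolding lsum_def .
        also have "\<dots> = (\<Sum>y\<in>Poly_Mapping.keys x.
          (Poly_Mapping.lookup x y * of_bool (hd y = c)) * Poly_Mapping.lookup (Poly_Mapping.single (tl y) 1) z)"
        proof (rule sum.cong[OF refl])
          fix y assume "y \<in> Poly_Mapping.keys x"
          then obtain c' z' where "y = c' # z'" using keys by (metis length_Suc_conv)
          then show "Poly_Mapping.lookup x y * of_bool (y = c # z) =
            (Poly_Mapping.lookup x y * of_bool (hd y = c)) * Poly_Mapping.lookup (Poly_Mapping.single (tl y) 1) z"
            by (auto simp: lookup_single when_def)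
        qed
        finally show "Poly_Mapping.lookup x (c # z) = (\<Sum>y\<in>Poly_Mapping.keys x.
          (Poly_Mapping.lookup x y * of_bool (hd y = c)) * Poly_Mapping.lookup (Poly_Mapping.single (tl y) 1) z)" .
      qed
      then have "pair_op q (a, b) (Poly_Mapping.lookup x) w = (\<Sum>c\<in>UNIV. \<Sum>y\<in>Poly_Mapping.keys x. ?M c *
          ((Poly_Mapping.lookup x y * of_bool (hd y = c)) * word_op q b (Poly_Mapping.lookup (Poly_Mapping.single (tl y) 1)) t))"
        unfolding Cons by (simp add: word_op_sum sum_distrib_left)
      also have "\<dots> = (\<Sum>y\<in>Poly_Mapping.keys x. \<Sum>c\<in>UNIV. if hd y = c then
          ?M c * (Poly_Mapping.lookup x y * word_op q b (Poly_Mapping.lookup (Poly_Mapping.single (tl y) 1)) t) else 0)"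
        by (subst sum.swap) (intro sum.cong refl, simp)
      also have "\<dots> = lsum (\<lambda>y. ?M (hd y) * word_op q b (Poly_Mapping.lookup (Poly_Mapping.single (tl y) 1)) t) x"
        unfolding lsum_def by (intro sum.cong refl) (simp add: sum.delta sum.delta' mult_ac)
      also have "\<dots> = lsum (\<lambda>y. Poly_Mapping.lookup (V_to_tensor (V_act q a (Poly_Mapping.single (hd y) 1)) *
         free_act q k (Poly_Mapping.single b 1) (Poly_Mapping.single (tl y) 1)) w) x"
      proof (rule lsum_cong)
        fix y assume "y \<in> Poly_Mapping.keys x"
        then have "Poly_Mapping.single (tl y) (1 :: 'a) \<in> tensor_power k" using keys unfolding tensor_power_def by simp
        then show "?M (hd y) * word_op q b (Poly_Mapping.lookup (Poly_Mapping.single (tl y) 1)) t =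
          Poly_Mapping.lookup (V_to_tensor (V_act q a (Poly_Mapping.single (hd y) 1)) *
         free_act q k (Poly_Mapping.single b 1) (Poly_Mapping.single (tl y) 1)) w"
          unfolding Cons lookup_V_to_tensor_mult by (simp add: Suc.IH free_op_single)
      qed
      finally show ?thesis ..
    qed
    then have "Poly_Mapping.lookup (free_act q (Suc k) u x) w = lsum (\<lambda>p. pair_op q p (Poly_Mapping.lookup x) w) (coproduct u)"
      unfolding expand by (subst lsum_swap) (intro lsum_cong, simp add: case_prod_beta)
    also have "\<dots> = lsum (\<lambda>g. word_op q g (Poly_Mapping.lookup x) w) u"
      unfolding coproduct_def lsum_lin_ext Cons coproduct_word_op[OF assms(1)] ..
    finally show ?thesis unfolding free_op_def .
  qed
qed

lemma free_act_tensor_power: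
  assumes "q \<noteq> 0" "x \<in> tensor_power k"
  shows "free_act q k u x \<in> tensor_power k"
proof -
  have "length w = k" if "Poly_Mapping.lookup (free_act q k u x) w \<noteq> 0" for w
  proof (rule ccontr)
    assume "length w \<noteq> k"
    then have "Poly_Mapping.lookup x y = 0" if "length y = length w" for y
      using tensor_power_lookup[OF assms(2), of y] that by simp
    then show False using that lookup_free_act[OF assms] free_op_length by metis
  qed
  then show ?thesis unfolding tensor_power_def by (auto simp: in_keys_iff)
qed

section \<open>Passage to the quotient ring\<close>

lemma ring_free_ring: "ring (free_ring :: 'a::field free_alg ring)"
proof (rule ringI)
  show "abelian_group (free_ring :: 'a free_alg ring)"
  proof (rule abelian_groupI)
    fix x :: "'a free_alg"
    assume "x \<in> carrier free_ring"
    show "\<exists>y\<in>carrier free_ring. y \<oplus>\<^bsub>free_ring\<^esub> x = \<zero>\<^bsub>free_ring\<^esub>"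
      by (rule bexI[of _ "- x"]) (auto simp: free_ring_def)
  qed (auto simp: free_ring_def add_ac)
  show "Group.monoid (free_ring :: 'a free_alg ring)"
    by (rule monoidI) (auto simp: free_ring_def mult.assoc)
qed (auto simp: free_ring_def algebra_simps)

text \<open>Since the elements acting as zero form an ideal, it is enough to test the
  relators.\<close>

lemma kernel_ideal: "ideal {u. \<forall>v. free_op q u v = (\<lambda>w. 0)} free_ring"
proof (rule idealI[OF ring_free_ring])
  let ?I = "{u. \<forall>v. free_op q u v = (\<lambda>w. 0)}"
  interpret ring free_ring by (rule ring_free_ring)
  have inv: "inv\<^bsub>add_monoid free_ring\<^esub> u = - u" for u :: "'a free_alg"
    by (rule group.inv_equality[OF add.is_group]) (auto simp: free_ring_def)
  show "subgroup ?I (add_monoid free_ring)"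
  proof (rule subgroup.intro)
    show "inv\<^bsub>add_monoid free_ring\<^esub> u \<in> ?I" if "u \<in> ?I" for u
      unfolding inv using that free_op_diff[of q 0 u] free_op_diff[of q u u]
      by (auto simp: fun_eq_iff free_op_def lsum_uminus)
    show "\<one>\<^bsub>add_monoid free_ring\<^esub> \<in> ?I" by (auto simp: free_ring_def free_op_def fun_eq_iff)
  qed (auto simp: free_ring_def free_op_add fun_eq_iff)
  have z: "free_op q u (\<lambda>w. 0) = (\<lambda>w. 0)" for u
    by (intro ext free_op_length) simp
  show "x \<otimes>\<^bsub>free_ring\<^esub> a \<in> ?I" "a \<otimes>\<^bsub>free_ring\<^esub> x \<in> ?I" if "a \<in> ?I" "x \<in> carrier free_ring" for a x
    using that z by (simp_all add: free_ring_def free_op_mult)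
qed

lemma Uq_ideal_acts_zero:
  assumes "q \<noteq> 0" "q \<noteq> inverse q" "u \<in> Idl\<^bsub>free_ring\<^esub> (Uq_relators q)"
  shows "free_op q u v = (\<lambda>w. 0)"
proof -
  have "Idl\<^bsub>free_ring\<^esub> (Uq_relators q) \<subseteq> {u. \<forall>v. free_op q u v = (\<lambda>w. 0)}"
    using free_op_relators[OF assms(1,2)] by (intro ring.genideal_minimal[OF ring_free_ring kernel_ideal]) auto
  then show ?thesis using assms(3) by blast
qed

definition act_on :: "'a::field \<Rightarrow> nat \<Rightarrow> 'a free_alg \<Rightarrow> 'a tensor \<Rightarrow> 'a tensor" where
  "act_on q k u = (\<lambda>x\<in>tensor_power k. free_act q k u x)"

text \<open>All members of a coset act alike, so \<open>the_elem\<close> in \<open>Uq_rep\<close>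
  returns their common operator, and every element of the free algebra lies in some coset.\<close>

lemma Uq_rep_image:
  assumes "q \<noteq> 0" "q \<noteq> inverse q"
  shows "Uq_rep q k ` carrier (Uq q) = range (act_on q k)"
proof -
  let ?I = "Idl\<^bsub>free_ring\<^esub> (Uq_relators q)"
  interpret ring free_ring by (rule ring_free_ring)
  have idl: "ideal ?I free_ring" by (rule genideal_ideal) (simp add: free_ring_def)
  have zero: "(0 :: 'a free_alg) \<in> ?I"
    using additive_subgroup.zero_closed[OF ideal.axioms(1)[OF idl]] by (simp add: free_ring_def)
  have rep: "Uq_rep q k (?I +>\<^bsub>free_ring\<^esub> u) = act_on q k u" for u
  proof -
    have C: "?I +>\<^bsub>free_ring\<^esub> u = (\<lambda>i. i + u) ` ?I"
      unfolding a_r_coset_def r_coset_def by (auto simp: free_ring_def)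
    have eq: "(\<lambda>x\<in>tensor_power k. free_act q k (i + u) x) = act_on q k u" if "i \<in> ?I" for i
      unfolding act_on_def
    proof (rule restrict_ext)
      fix x :: "'a tensor" assume x: "x \<in> tensor_power k"
      show "free_act q k (i + u) x = free_act q k u x"
        by (rule poly_mapping_eqI)
          (simp add: lookup_free_act[OF assms(1) x] free_op_add Uq_ideal_acts_zero[OF assms that])
    qed
    have "(\<lambda>c. \<lambda>x\<in>tensor_power k. free_act q k c x) ` (?I +>\<^bsub>free_ring\<^esub> u) = {act_on q k u}"
      unfolding C image_image using eq zero by auto
    then show ?thesis unfolding Uq_rep_def by simp
  qed
  have "carrier (Uq q) = range (\<lambda>u. ?I +>\<^bsub>free_ring\<^esub> u)"
    unfolding Uq_def FactRing_def A_RCOSETS_def' by (auto simp: free_ring_def)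
  then show ?thesis using rep by (simp add: image_image)
qed

section \<open>Operators and matrices\<close>

text \<open>Set to zero on words of other lengths, so that it can be compared with
  \<open>raising\<close> and \<open>free_op\<close>, which are functions on all words.\<close>

definition mat_vec :: "nat \<Rightarrow> (basis list \<Rightarrow> basis list \<Rightarrow> 'a::field) \<Rightarrow> (basis list \<Rightarrow> 'a) \<Rightarrow> basis list \<Rightarrow> 'a" where
  "mat_vec k T v w' = (if length w' = k then \<Sum>w\<in>words k. T w' w * v w else 0)"

definition vec_tensor :: "nat \<Rightarrow> (basis list \<Rightarrow> 'a::field) \<Rightarrow> 'a tensor" where
  "vec_tensor k v = (\<Sum>w\<in>words k. Poly_Mapping.single w (v w))"

definition mat_op :: "nat \<Rightarrow> (basis list \<Rightarrow> basis list \<Rightarrow> 'a::field) \<Rightarrow> 'a tensor \<Rightarrow> 'a tensor" where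
  "mat_op k T = (\<lambda>x\<in>tensor_power k. vec_tensor k (mat_vec k T (Poly_Mapping.lookup x)))"

definition op_mat :: "('a::field tensor \<Rightarrow> 'a tensor) \<Rightarrow> basis list \<Rightarrow> basis list \<Rightarrow> 'a" where
  "op_mat S w' w = Poly_Mapping.lookup (S (Poly_Mapping.single w 1)) w'"

lemma sum_if_eq_words: "length w = k \<Longrightarrow> (\<Sum>u\<in>words k. if u = w then g u else 0) = g w"
  "length w = k \<Longrightarrow> (\<Sum>u\<in>words k. if w = u then g u else 0) = g w"
  by (simp_all add: sum.delta sum.delta')

lemma lookup_vec_tensor [simp]:
  "Poly_Mapping.lookup (vec_tensor k v) w = (if length w = k then v w else 0)"
  by (auto simp: vec_tensor_def lookup_sum' lookup_single when_def sum.delta sum.delta')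

lemma vec_tensor_tensor_power [simp]: "vec_tensor k v \<in> tensor_power k"
  unfolding tensor_power_def by (auto simp: in_keys_iff split: if_splits)

lemma single_tensor_power: "length w = k \<Longrightarrow> Poly_Mapping.single w c \<in> tensor_power k"
  unfolding tensor_power_def by simp

lemma tensor_power_add: "x \<in> tensor_power k \<Longrightarrow> y \<in> tensor_power k \<Longrightarrow> x + y \<in> tensor_power k"
  unfolding tensor_power_def using keys_add[of x y] by blast

lemma tensor_power_scale: "x \<in> tensor_power k \<Longrightarrow> scale c x \<in> tensor_power k"
  unfolding tensor_power_def using keys_scale[of c x] by blast

lemma tensor_power_zero: "0 \<in> tensor_power k"
  unfolding tensor_power_def by simp

lemma tensor_power_eqI:
  assumes "x \<in> tensor_power k" "y \<in> tensor_power k"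
    "\<And>w. length w = k \<Longrightarrow> Poly_Mapping.lookup x w = Poly_Mapping.lookup y w"
  shows "x = y"
proof (rule poly_mapping_eqI)
  fix w
  show "Poly_Mapping.lookup x w = Poly_Mapping.lookup y w"
    using assms(3) tensor_power_lookup[OF assms(1)] tensor_power_lookup[OF assms(2)] by (cases "length w = k") auto
qed

lemma lookup_mat_op:
  "x \<in> tensor_power k \<Longrightarrow> Poly_Mapping.lookup (mat_op k T x) = mat_vec k T (Poly_Mapping.lookup x)"
  by (auto simp: mat_op_def mat_vec_def fun_eq_iff)

lemma mat_vec_add: "mat_vec k T (\<lambda>w. u w + v w) = (\<lambda>w. mat_vec k T u w + mat_vec k T v w)"
  by (auto simp: mat_vec_def fun_eq_iff algebra_simps sum.distrib)

lemma mat_vec_scale: "mat_vec k T (\<lambda>w. c * v w) = (\<lambda>w. c * mat_vec k T v w)"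
  by (auto simp: mat_vec_def fun_eq_iff sum_distrib_left mult_ac)

lemma mat_vec_cong: "(\<And>w. length w = k \<Longrightarrow> u w = v w) \<Longrightarrow> mat_vec k T u = mat_vec k T v"
  by (auto simp: mat_vec_def fun_eq_iff intro!: sum.cong)

lemma mat_vec_single: "length w = k \<Longrightarrow> length w' = k \<Longrightarrow> mat_vec k T (\<lambda>u. if u = w then 1 else 0) w' = T w' w"
  by (simp add: mat_vec_def if_distrib[of "\<lambda>z. _ * z"] sum_if_eq_words cong: if_cong)

lemma mat_op_End: "mat_op k T \<in> End_space k"
  unfolding End_space_def
proof (intro CollectI conjI ballI allI)
  show "mat_op k T \<in> tensor_power k \<rightarrow>\<^sub>E tensor_power k" by (auto simp: mat_op_def)
  show "mat_op k T (x + y) = mat_op k T x + mat_op k T y" if "x \<in> tensor_power k" "y \<in> tensor_power k" for x y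
  proof -
    have "Poly_Mapping.lookup (x + y) = (\<lambda>w. Poly_Mapping.lookup x w + Poly_Mapping.lookup y w)"
      by (simp add: fun_eq_iff lookup_add)
    then show ?thesis
      using that tensor_power_add[OF that] by (intro poly_mapping_eqI) (simp add: lookup_mat_op lookup_add mat_vec_add)
  qed
  show "mat_op k T (scale c x) = scale c (mat_op k T x)" if "x \<in> tensor_power k" for c x
  proof -
    have "Poly_Mapping.lookup (scale c x) = (\<lambda>w. c * Poly_Mapping.lookup x w)" by (simp add: fun_eq_iff)
    then show ?thesis
      using that tensor_power_scale[OF that] by (intro poly_mapping_eqI) (simp add: lookup_mat_op mat_vec_scale)
  qed
qed

lemma End_maps: "S \<in> End_space k \<Longrightarrow> x \<in> tensor_power k \<Longrightarrow> S x \<in> tensor_power k"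
  unfolding End_space_def by auto

lemma tensor_expand: "x \<in> tensor_power k \<Longrightarrow> x = (\<Sum>w\<in>words k. scale (Poly_Mapping.lookup x w) (Poly_Mapping.single w 1))"
proof (rule poly_mapping_eqI)
  fix w assume x: "x \<in> tensor_power k"
  have "(\<Sum>u\<in>words k. Poly_Mapping.lookup x u * (if u = w then 1 else 0)) = Poly_Mapping.lookup x w"
    using tensor_power_lookup[OF x, of w] by (cases "length w = k") (auto simp: if_distrib[of "\<lambda>z. _ * z"] sum.delta cong: if_cong)
  then show "Poly_Mapping.lookup x w = Poly_Mapping.lookup (\<Sum>w\<in>words k. scale (Poly_Mapping.lookup x w) (Poly_Mapping.single w 1)) w"
    by (simp add: lookup_sum' lookup_single when_def)
qed

lemma End_sum:
  assumes "S \<in> End_space k" "finite I" "\<And>i. i \<in> I \<Longrightarrow> y i \<in> tensor_power k"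
  shows "S (\<Sum>i\<in>I. scale (c i) (y i)) = (\<Sum>i\<in>I. scale (c i) (S (y i))) \<and> (\<Sum>i\<in>I. scale (c i) (y i)) \<in> tensor_power k"
  using assms(2,3)
proof (induction I rule: finite_induct)
  case empty
  have "S (scale 0 0) = scale 0 (S 0)" using assms(1) tensor_power_zero unfolding End_space_def by blast
  moreover have "scale 0 z = 0" for z :: "'a tensor" by (intro poly_mapping_eqI) simp
  ultimately show ?case using tensor_power_zero by simp
next
  case (insert i I)
  then have I: "S (\<Sum>i\<in>I. scale (c i) (y i)) = (\<Sum>i\<in>I. scale (c i) (S (y i)))" "(\<Sum>i\<in>I. scale (c i) (y i)) \<in> tensor_power k"
    and y: "y i \<in> tensor_power k" "scale (c i) (y i) \<in> tensor_power k"
    using tensor_power_scale by auto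
  have "S (scale (c i) (y i) + (\<Sum>i\<in>I. scale (c i) (y i))) = S (scale (c i) (y i)) + S (\<Sum>i\<in>I. scale (c i) (y i))"
    using assms(1) I(2) y(2) unfolding End_space_def by blast
  also have "S (scale (c i) (y i)) = scale (c i) (S (y i))"
    using assms(1) y(1) unfolding End_space_def by blast
  finally show ?case using insert(1,2) I y tensor_power_add by simp
qed

lemma mat_op_op_mat:
  assumes "S \<in> End_space k"
  shows "mat_op k (op_mat S) = S"
proof
  fix x
  show "mat_op k (op_mat S) x = S x"
  proof (cases "x \<in> tensor_power k")
    case True
    have "S x = (\<Sum>w\<in>words k. scale (Poly_Mapping.lookup x w) (S (Poly_Mapping.single w 1)))"
      using End_sum[OF assms, of "words k" "\<lambda>w. Poly_Mapping.single w 1" "Poly_Mapping.lookup x"]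
        tensor_expand[OF True] by (simp add: single_tensor_power)
    then show ?thesis
      using True End_maps[OF assms True] lookup_mat_op[OF True, of "op_mat S"]
      by (intro tensor_power_eqI[of _ k]) (auto simp: mat_op_def lookup_sum' op_mat_def mat_vec_def mult.commute)
  next
    case False
    then show ?thesis using assms unfolding mat_op_def End_space_def by (auto simp: PiE_def extensional_def)
  qed
qed

lemma mat_op_cong:
  "(\<And>w' w. length w' = k \<Longrightarrow> length w = k \<Longrightarrow> S w' w = T w' w) \<Longrightarrow> mat_op k S = mat_op k T"
  unfolding mat_op_def by (intro restrict_ext arg_cong[of _ _ "vec_tensor k"] ext) (simp add: mat_vec_def)

lemma mat_op_inject:
  assumes "mat_op k S = mat_op k T" "length w' = k" "length w = k"
  shows "S w' w = T w' w"
proof -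
  have x: "(Poly_Mapping.single w 1 :: 'a tensor) \<in> tensor_power k" using assms(3) by (rule single_tensor_power)
  have l: "Poly_Mapping.lookup (Poly_Mapping.single w (1 :: 'a)) = (\<lambda>u. if u = w then 1 else 0)"
    by (auto simp: lookup_single when_def)
  have "mat_vec k S (\<lambda>u. if u = w then 1 else 0) w' = mat_vec k T (\<lambda>u. if u = w then 1 else 0) w'"
    using lookup_mat_op[OF x, of S] lookup_mat_op[OF x, of T] assms(1) unfolding l by metis
  then show ?thesis using assms(2,3) by (simp add: mat_vec_single)
qed

lemma mat_vec_mult:
  "mat_vec k S (mat_vec k T v) = mat_vec k (\<lambda>w' w. \<Sum>u\<in>words k. S w' u * T u w) v"
proof
  fix x
  have "(\<Sum>u\<in>words k. S x u * (\<Sum>w\<in>words k. T u w * v w)) = (\<Sum>w\<in>words k. (\<Sum>u\<in>words k. S x u * T u w) * v w)"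
    unfolding sum_distrib_left sum_distrib_right by (subst sum.swap) (simp add: mult.assoc)
  moreover have "(\<Sum>u\<in>words k. S x u * mat_vec k T v u) = (\<Sum>u\<in>words k. S x u * (\<Sum>w\<in>words k. T u w * v w))"
    by (intro sum.cong refl) (simp add: mat_vec_def)
  ultimately show "mat_vec k S (mat_vec k T v) x = mat_vec k (\<lambda>w' w. \<Sum>u\<in>words k. S w' u * T u w) v x"
    by (simp add: mat_vec_def[of k S] mat_vec_def[of k "\<lambda>w' w. \<Sum>u\<in>words k. S w' u * T u w"])
qed

lemma compose_mat_op:
  "compose (tensor_power k) (mat_op k S) (mat_op k T) = mat_op k (\<lambda>w' w. \<Sum>u\<in>words k. S w' u * T u w)"
proof
  fix x
  show "compose (tensor_power k) (mat_op k S) (mat_op k T) x = mat_op k (\<lambda>w' w. \<Sum>u\<in>words k. S w' u * T u w) x"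
  proof (cases "x \<in> tensor_power k")
    case True
    then have "mat_op k T x \<in> tensor_power k" using End_maps[OF mat_op_End] by blast
    then have "Poly_Mapping.lookup (compose (tensor_power k) (mat_op k S) (mat_op k T) x) =
        Poly_Mapping.lookup (mat_op k (\<lambda>w' w. \<Sum>u\<in>words k. S w' u * T u w) x)"
      using True by (simp add: compose_eq lookup_mat_op mat_vec_mult)
    then show ?thesis by (intro poly_mapping_eqI) (rule fun_cong)
  next
    case False then show ?thesis by (simp add: compose_def mat_op_def)
  qed
qed

section \<open>Commutation of matrices with raising and lowering\<close>

lemma raise_pairing:
  "(\<Sum>w\<in>words n. g w * raising t v w) = (\<Sum>w\<in>words n. coraising t g w * v w)"
proof (induction n arbitrary: g v)
  case (Suc n)
  then show ?case
    by (simp add: sum_words_Suc sum_basis algebra_simps sum.distrib)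
qed simp

lemma lower_pairing:
  "(\<Sum>w\<in>words n. g w * lowering t v w) = (\<Sum>w\<in>words n. colowering t g w * v w)"
proof (induction n arbitrary: g v)
  case (Suc n)
  have "(\<Sum>w\<in>words n. g w * (c * lowering t v w)) = c * (\<Sum>w\<in>words n. colowering t g w * v w)" for c g v
    unfolding Suc[symmetric] by (simp add: sum_distrib_left mult_ac)
  then show ?case
    by (simp add: sum_words_Suc sum_basis algebra_simps sum.distrib sum_distrib_left)
qed simp

lemma raise_mat_vec:
  "length x = k \<Longrightarrow> raising t (mat_vec k T v) x = (\<Sum>w\<in>words k. raising t (\<lambda>u. T u w) x * v w)"
proof -
  assume x: "length x = k"
  have "raising t (mat_vec k T v) x = raising t (\<lambda>u. \<Sum>w\<in>words k. v w * T u w) x"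
    using x by (intro raise_cong) (simp add: mat_vec_def mult.commute)
  then show ?thesis by (simp add: raise_sum raise_scale mult.commute)
qed

lemma lower_mat_vec:
  "length x = k \<Longrightarrow> lowering t (mat_vec k T v) x = (\<Sum>w\<in>words k. lowering t (\<lambda>u. T u w) x * v w)"
proof -
  assume x: "length x = k"
  have "lowering t (mat_vec k T v) x = lowering t (\<lambda>u. \<Sum>w\<in>words k. v w * T u w) x"
    using x by (intro lower_cong) (simp add: mat_vec_def mult.commute)
  then show ?thesis by (simp add: lower_sum lower_scale mult.commute)
qed

lemma commutes_raising_iff:
  "commutes_raising t k T \<longleftrightarrow> (\<forall>v. raising t (mat_vec k T v) = mat_vec k T (raising t v))"
proof
  assume L: "commutes_raising t k T"
  show "\<forall>v. raising t (mat_vec k T v) = mat_vec k T (raising t v)"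
  proof (intro allI ext)
    fix v x
    show "raising t (mat_vec k T v) x = mat_vec k T (raising t v) x"
    proof (cases "length x = k")
      case True
      then show ?thesis
        using L unfolding raise_mat_vec[OF True] commutes_raising_def mat_vec_def by (simp add: raise_pairing)
    next
      case False
      then show ?thesis by (simp add: raise_length mat_vec_def)
    qed
  qed
next
  assume R: "\<forall>v. raising t (mat_vec k T v) = mat_vec k T (raising t v)"
  show "commutes_raising t k T"
    unfolding commutes_raising_def
  proof (intro allI impI)
    fix x w :: "basis list" assume xw: "length x = k" "length w = k"
    let ?v = "\<lambda>u. if u = w then (1 :: 'a) else 0"
    have "raising t (mat_vec k T ?v) x = mat_vec k T (raising t ?v) x" using R by simp
    then show "raising t (\<lambda>u. T u w) x = coraising t (T x) w"
      unfolding raise_mat_vec[OF xw(1)] using xw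
      by (simp add: mat_vec_def raise_pairing if_distrib[of "\<lambda>z. _ * z"] sum_if_eq_words cong: if_cong)
  qed
qed

lemma lower_length: "(\<And>y. length y = length x \<Longrightarrow> v y = 0) \<Longrightarrow> lowering t v x = 0"
  using lower_nonzero by metis

definition weight_preserving :: "nat \<Rightarrow> (basis list \<Rightarrow> basis list \<Rightarrow> 'a::field) \<Rightarrow> bool" where
  "weight_preserving k T \<longleftrightarrow> (\<forall>x w. length x = k \<longrightarrow> length w = k \<longrightarrow> T x w \<noteq> 0 \<longrightarrow> weight x = weight w)"

lemma colower_nonzero:
  "colowering t g y \<noteq> 0 \<Longrightarrow> \<exists>x. length x = length y \<and> g x \<noteq> 0 \<and> weight x = weight y - 2"
proof (induction y arbitrary: g)
  case (Cons b y)
  show ?case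
  proof (cases "colowering t (\<lambda>u. g (b # u)) y = 0")
    case True
    then have "b = Pos" "g (Neg # y) \<noteq> 0" using Cons.prems by (auto split: if_splits)
    then show ?thesis by (intro exI[of _ "Neg # y"]) auto
  next
    case False
    from Cons.IH[OF this] obtain x where "length x = length y" "g (b # x) \<noteq> 0" "weight x = weight y - 2" by blast
    then show ?thesis by (intro exI[of _ "b # x"]) auto
  qed
qed simp

text \<open>
  The commutator with the lowering operator commutes with the raising operator and lowers weights
  by 2; bent, it becomes a highest weight vector of weight \<open>-2\<close>.
\<close>

lemma commutes_lowering:
  assumes "generic t" "commutes_raising t k T" "weight_preserving k T"
  shows "lowering t (mat_vec k T v) = mat_vec k T (lowering t v)"
proof -
  have t: "t \<noteq> 0" "t \<noteq> inverse t" using assms generic_inverse unfolding generic_def by auto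
  \<comment> \<open>The matrix of the commutator of F and T.\<close>
  define S where "S = (\<lambda>x w. lowering t (\<lambda>u. T u w) x - colowering t (T x) w)"
  have S: "mat_vec k S v = (\<lambda>x. lowering t (mat_vec k T v) x - mat_vec k T (lowering t v) x)" for v
  proof
    fix x
    show "mat_vec k S v x = lowering t (mat_vec k T v) x - mat_vec k T (lowering t v) x"
    proof (cases "length x = k")
      case True
      then show ?thesis
        unfolding lower_mat_vec[OF True] S_def mat_vec_def
        by (simp add: lower_pairing algebra_simps sum_subtractf)
    next
      case False
      have "lowering t (mat_vec k T v) x = 0"
        using False by (intro lower_length) (simp add: mat_vec_def)
      then show ?thesis using False by (simp add: mat_vec_def)
    qed
  qed
  let ?c = "\<lambda>x. (k_wts t x - inverse (k_wts t x)) / (t - inverse t)"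
  \<comment> \<open>T preserves weights, hence commutes with the diagonal operator (K - 1/K)/(t -
    1/t).\<close>
  have c: "?c x * mat_vec k T v x = mat_vec k T (\<lambda>w. ?c w * v w) x" for v x
  proof (cases "length x = k")
    case True
    have p: "?c x * (T x w * v w) = T x w * (?c w * v w)" if "w \<in> words k" for w
    proof (cases "T x w = 0")
      case False
      then have "weight x = weight w" using assms(3) True that unfolding weight_preserving_def by simp
      then show ?thesis using t(1) by (simp add: k_wts_powi)
    qed simp
    show ?thesis
      unfolding mat_vec_def if_P[OF True] sum_distrib_left by (intro sum.cong refl p)
  qed (simp add: mat_vec_def)
  have com: "raising t (mat_vec k T v) = mat_vec k T (raising t v)" for v
    using assms(2) commutes_raising_iff by blast
  \<comment> \<open>Moving E past F produces the diagonal operator on either side of T; the two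
    contributions agree by \<open>c\<close> and cancel, and T commutes with E by assumption.\<close>
  have "raising t (mat_vec k S v) = mat_vec k S (raising t v)" for v
  proof
    fix x
    have "raising t (mat_vec k S v) x = raising t (lowering t (mat_vec k T v)) x - raising t (mat_vec k T (lowering t v)) x"
      unfolding S using raise_add[of t "lowering t (mat_vec k T v)" "\<lambda>x. - 1 * mat_vec k T (lowering t v) x" x]
      by (simp only: raise_scale) simp
    also have "\<dots> = lowering t (mat_vec k T (raising t v)) x + ?c x * mat_vec k T v x - mat_vec k T (raising t (lowering t v)) x"
      unfolding raise_lower[OF t] com ..
    also have "raising t (lowering t v) = (\<lambda>x. lowering t (raising t v) x + ?c x * v x)"
      by (rule ext) (rule raise_lower[OF t])
    also have "mat_vec k T (\<lambda>x. lowering t (raising t v) x + ?c x * v x) x =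
        mat_vec k T (lowering t (raising t v)) x + ?c x * mat_vec k T v x"
      unfolding mat_vec_add c ..
    finally show "raising t (mat_vec k S v) x = mat_vec k S (raising t v) x"
      unfolding S by simp
  qed
  then have "commutes_raising t k S" unfolding commutes_raising_iff by blast
  then have rb: "raising t (bend t k S) = (\<lambda>x. 0)" using raise_bend_eq_0_iff[OF t(1)] by blast
  have Sw: "weight x = weight w - 2" if xw: "length x = k" "length w = k" "S x w \<noteq> 0" for x w
  proof -
    have "lowering t (\<lambda>u. T u w) x \<noteq> 0 \<or> colowering t (T x) w \<noteq> 0" using xw unfolding S_def by auto
    then show ?thesis
    proof
      assume "lowering t (\<lambda>u. T u w) x \<noteq> 0"
      then obtain y where "length y = length x" "T y w \<noteq> 0" "weight x = weight y - 2" using lower_nonzero by blast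
      then show ?thesis using assms(3) xw unfolding weight_preserving_def by metis
    next
      assume "colowering t (T x) w \<noteq> 0"
      then obtain y where "length y = length w" "T x y \<noteq> 0" "weight y = weight w - 2" using colower_nonzero by blast
      then show ?thesis using assms(3) xw unfolding weight_preserving_def by metis
    qed
  qed
  have "homog (2 * k) (- 2) (bend t k S)"
    unfolding homog_def
  proof (intro allI impI)
    fix z assume z: "bend t k S z \<noteq> 0"
    then have len: "length z = 2 * k" unfolding bend_def by (auto split: if_splits)
    then have "S (take k z) (dual (drop k z)) \<noteq> 0" using z unfolding bend_def by auto
    then have "weight (take k z) = weight (dual (drop k z)) - 2"
      using Sw[of "take k z" "dual (drop k z)"] len by simp
    moreover have "weight z = weight (take k z) + weight (drop k z)"
      using weight_simps(3)[of "take k z" "drop k z"] by simp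
    ultimately show "length z = 2 * k \<and> weight z = - 2" using len by simp
  qed
  moreover have "lowering t (raising t (bend t k S)) = (\<lambda>x. 0)" unfolding rb by auto
  ultimately have b0: "bend t k S = (\<lambda>x. 0)" by (rule negative_weight_zero[OF assms(1)]) simp
  have "S x w = 0" if xw: "length x = k" "length w = k" for x w
    using fun_cong[OF b0, of "x @ dual w"] xw t by (simp add: bend_def)
  then have "mat_vec k S v = (\<lambda>x. 0)" for v by (simp add: mat_vec_def fun_eq_iff)
  then show ?thesis using S[of v] by (simp add: fun_eq_iff)
qed

section \<open>The matrices of the partial Temperley--Lieb algebra\<close>

text \<open>Distributes the global factor \<open>fold_wts\<close> over the bottom vertices, so that
  a matrix entry becomes a product over the blocks of the diagram.\<close>

fun fold_vertex :: "'a::field \<Rightarrow> basis list \<Rightarrow> vertex \<Rightarrow> 'a" where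
  "fold_vertex t w (Top i) = 1"
| "fold_vertex t w (Bot i) = fold_wt t (neg (w ! (i - 1)))"

definition edge_wt :: "'a::field \<Rightarrow> nat \<Rightarrow> basis list \<Rightarrow> basis list \<Rightarrow> vertex set \<Rightarrow> 'a" where
  "edge_wt t k w' w B = block_wt t (label (w' @ dual w)) (circ k ` B) * (\<Prod>v\<in>B. fold_vertex t w v)"

text \<open>The value of a cap on two letters of the bottom word: they are negated and met in
  reverse order when the row is folded, and each brings its weight \<open>fold_wt\<close>.\<close>

definition coarc :: "'a::field \<Rightarrow> basis \<Rightarrow> basis \<Rightarrow> 'a" where
  "coarc t a b = arc t (neg b) (neg a) * (fold_wt t (neg a) * fold_wt t (neg b))"

lemma finite_vertices: "finite (vertices k)"
  by (simp add: vertices_def)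

lemma prod_partition:
  assumes "partition_on S D" "finite S"
  shows "(\<Prod>B\<in>D. \<Prod>v\<in>B. g v) = (\<Prod>v\<in>S. g v)"
proof -
  have S: "S = \<Union>D" using assms unfolding partition_on_def by simp
  have "\<forall>A\<in>D. \<forall>A'\<in>D. A \<noteq> A' \<longrightarrow> A \<inter> A' = {}"
    using assms disjointD[of D] unfolding partition_on_def by blast
  moreover have "\<forall>A\<in>D. finite A" using assms S by (auto intro: finite_subset)
  ultimately show ?thesis unfolding S by (subst prod.Union_disjoint) (auto simp: comp_def)
qed

lemma sum_partition:
  assumes "partition_on S D" "finite S"
  shows "(\<Sum>B\<in>D. \<Sum>v\<in>B. g v) = (\<Sum>v\<in>S. g v)"
proof -
  have S: "S = \<Union>D" using assms unfolding partition_on_def by simp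
  have "\<forall>A\<in>D. \<forall>A'\<in>D. A \<noteq> A' \<longrightarrow> A \<inter> A' = {}"
    using assms disjointD[of D] unfolding partition_on_def by blast
  moreover have "\<forall>A\<in>D. finite A" using assms S by (auto intro: finite_subset)
  ultimately show ?thesis unfolding S by (subst sum.Union_disjoint) (auto simp: comp_def)
qed

lemma prod_vertices: "(\<Prod>v\<in>vertices k. g v) = (\<Prod>i\<in>{1..k}. g (Top i)) * (\<Prod>i\<in>{1..k}. g (Bot i))"
proof -
  have "(\<Prod>v\<in>vertices k. g v) = (\<Prod>v\<in>Top ` {1..k}. g v) * (\<Prod>v\<in>Bot ` {1..k}. g v)"
    unfolding vertices_def by (intro prod.union_disjoint) auto
  also have "\<dots> = (\<Prod>i\<in>{1..k}. g (Top i)) * (\<Prod>i\<in>{1..k}. g (Bot i))"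
    by (simp add: prod.reindex inj_on_def)
  finally show ?thesis .
qed

lemma sum_vertices: "(\<Sum>v\<in>vertices k. g v) = (\<Sum>i\<in>{1..k}. g (Top i)) + (\<Sum>i\<in>{1..k}. g (Bot i))"
proof -
  have "(\<Sum>v\<in>vertices k. g v) = (\<Sum>v\<in>Top ` {1..k}. g v) + (\<Sum>v\<in>Bot ` {1..k}. g v)"
    unfolding vertices_def by (intro sum.union_disjoint) auto
  also have "\<dots> = (\<Sum>i\<in>{1..k}. g (Top i)) + (\<Sum>i\<in>{1..k}. g (Bot i))"
    by (simp add: sum.reindex inj_on_def)
  finally show ?thesis .
qed

lemma fold_wts_dual:
  assumes "length w = k"
  shows "fold_wts t (dual w) = (\<Prod>v\<in>vertices k. fold_vertex t w v)"
proof -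
  have "fold_wts t (dual w) = prod_list (map (\<lambda>b. fold_wt t (neg b)) w)"
    by (induction w) (auto simp: mult.commute)
  also have "\<dots> = (\<Prod>i<length w. fold_wt t (neg (w ! i)))"
    by (induction w) (auto simp: prod.lessThan_Suc_shift simp del: prod.lessThan_Suc)
  also have "\<dots> = (\<Prod>i\<in>{1..k}. fold_vertex t w (Bot i))"
    by (rule prod.reindex_bij_witness[of _ "\<lambda>p. p - 1" Suc]) (auto simp: assms)
  finally show ?thesis unfolding prod_vertices by simp
qed

lemma diagram_mat_prod:
  assumes "partition_on (vertices k) d" "length w = k"
  shows "diagram_mat t k d w' w = (\<Prod>B\<in>d. edge_wt t k w' w B)"
proof -
  have "matching_wt t ((`) (circ k) ` d) x = (\<Prod>B\<in>d. block_wt t x (circ k ` B))" for x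
    unfolding matching_wt_def using inj_on_circ_blocks[OF assms(1)] by (simp add: prod.reindex)
  then show ?thesis
    unfolding diagram_mat_def edge_wt_def fold_wts_dual[OF assms(2)] prod_partition[OF assms(1) finite_vertices, symmetric]
    by (simp add: prod.distrib mult.commute)
qed

lemma label_vertices:
  assumes "length w' = k" "length w = k" "1 \<le> i" "i \<le> k"
  shows "label (w' @ dual w) (circ k (Top i)) = w' ! (i - 1)"
    "label (w' @ dual w) (circ k (Bot i)) = neg (w ! (i - 1))"
proof -
  show "label (w' @ dual w) (circ k (Top i)) = w' ! (i - 1)"
    using assms by (auto simp: label_def nth_append)
  have "2 * k + 1 - i - 1 - k = k - i" "k - 1 - (k - i) = i - 1" "\<not> 2 * k + 1 - i - 1 < k" using assms by auto
  then show "label (w' @ dual w) (circ k (Bot i)) = neg (w ! (i - 1))"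
    using assms by (simp add: label_def nth_append nth_dual)
qed

text \<open>On equal letters the weight \<open>fold_wt\<close> of the bottom end cancels the value
  of \<open>arc\<close>, which makes a vertical edge a Kronecker delta.\<close>

lemma edge_wts:
  assumes "t \<noteq> 0" "length w' = k" "length w = k" "1 \<le> i" "i \<le> k"
  shows "edge_wt t k w' w {Top i} = of_bool (w' ! (i - 1) = Nul)"
    "edge_wt t k w' w {Bot i} = of_bool (w ! (i - 1) = Nul)"
    "1 \<le> j \<Longrightarrow> j \<le> k \<Longrightarrow> edge_wt t k w' w {Top i, Bot j} = of_bool (w' ! (i - 1) = w ! (j - 1))"
    "i < j \<Longrightarrow> j \<le> k \<Longrightarrow> edge_wt t k w' w {Top i, Top j} = arc t (w' ! (i - 1)) (w' ! (j - 1))"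
    "i < j \<Longrightarrow> j \<le> k \<Longrightarrow> edge_wt t k w' w {Bot i, Bot j} = coarc t (w ! (i - 1)) (w ! (j - 1))"
proof -
  note lab = label_vertices[OF assms(2,3)]
  show "edge_wt t k w' w {Top i} = of_bool (w' ! (i - 1) = Nul)"
    unfolding edge_wt_def using lab(1)[OF assms(4,5)] by simp
  show "edge_wt t k w' w {Bot i} = of_bool (w ! (i - 1) = Nul)"
    unfolding edge_wt_def image_insert image_empty block_wt_single lab(2)[OF assms(4,5)]
    by (cases "w ! (i - 1)") auto
  show "edge_wt t k w' w {Top i, Bot j} = of_bool (w' ! (i - 1) = w ! (j - 1))" if j: "1 \<le> j" "j \<le> k"
  proof -
    have "circ k (Top i) < circ k (Bot j)" using assms j by simp
    then show ?thesis
      unfolding edge_wt_def image_insert image_empty using assms(1)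
      by (subst block_wt_pair, simp, subst lab(1)[OF assms(4,5)], subst lab(2)[OF j])
        (cases "w ! (j - 1)"; cases "w' ! (i - 1)"; simp)
  qed
  show "edge_wt t k w' w {Top i, Top j} = arc t (w' ! (i - 1)) (w' ! (j - 1))" if j: "i < j" "j \<le> k"
  proof -
    have "circ k (Top i) < circ k (Top j)" using j by simp
    then show ?thesis
      unfolding edge_wt_def image_insert image_empty using j assms
      by (subst block_wt_pair, simp, subst lab(1)[OF assms(4,5)], subst lab(1)) simp_all
  qed
  show "edge_wt t k w' w {Bot i, Bot j} = coarc t (w ! (i - 1)) (w ! (j - 1))" if j: "i < j" "j \<le> k"
  proof -
    have "circ k (Bot j) < circ k (Bot i)" using j by simp
    then show ?thesis
      unfolding edge_wt_def image_insert image_empty coarc_def using j assms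
      by (subst block_wt_pair', simp, subst lab(2)[OF assms(4,5)], subst lab(2)) simp_all
  qed
qed

section \<open>Matrices of the generating diagrams\<close>

abbreviation verticals :: "nat set \<Rightarrow> diagram" where
  "verticals A \<equiv> (\<lambda>i. {Top i, Bot i}) ` A"

lemma partition_verticals: "partition_on (Top ` A \<union> Bot ` A) (verticals A)"
  by (rule partition_onI) (auto simp: disjnt_def)

lemma partition_generators:
  "partition_on (vertices k) (id_diagram k)"
  "j \<in> {1..k} \<Longrightarrow> partition_on (vertices k) (p_diagram k j)"
  "i \<in> {1..<k} \<Longrightarrow> partition_on (vertices k) (e_diagram k i)"
  "i \<in> {1..<k} \<Longrightarrow> partition_on (vertices k) (r_diagram k i)"
  "i \<in> {1..<k} \<Longrightarrow> partition_on (vertices k) (l_diagram k i)"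
proof -
  show "partition_on (vertices k) (id_diagram k)"
    unfolding id_diagram_def vertices_def by (rule partition_verticals)
  show "partition_on (vertices k) (p_diagram k j)" if j: "j \<in> {1..k}"
  proof -
    have V: "vertices k = (Top ` ({1..k} - {j}) \<union> Bot ` ({1..k} - {j})) \<union> {Top j, Bot j}"
      unfolding vertices_def using j by auto
    show ?thesis unfolding V p_diagram_def
      by (intro partition_on_Un partition_verticals partition_onI) (auto simp: disjnt_def)
  qed
  have V: "vertices k = (Top ` ({1..k} - {i, i + 1}) \<union> Bot ` ({1..k} - {i, i + 1})) \<union> {Top i, Top (i + 1), Bot i, Bot (i + 1)}"
    if i: "i \<in> {1..<k}"
    unfolding vertices_def using i by auto
  show "partition_on (vertices k) (e_diagram k i)" if i: "i \<in> {1..<k}"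
    unfolding V[OF i] e_diagram_def by (intro partition_on_Un partition_verticals partition_onI) (auto simp: disjnt_def)
  show "partition_on (vertices k) (r_diagram k i)" if i: "i \<in> {1..<k}"
    unfolding V[OF i] r_diagram_def by (intro partition_on_Un partition_verticals partition_onI) (auto simp: disjnt_def)
  show "partition_on (vertices k) (l_diagram k i)" if i: "i \<in> {1..<k}"
    unfolding V[OF i] l_diagram_def by (intro partition_on_Un partition_verticals partition_onI) (auto simp: disjnt_def)
qed

text \<open>A vertical edge joins positions with sum 2 k + 1 and a horizontal one joins neighbours;
  such chords cannot interleave.\<close>

lemma noncrossing_simple:
  assumes "\<And>B. B \<in> d \<Longrightarrow> (\<exists>a\<in>{1..k}. B = {Top a, Bot a}) \<or> (\<exists>v. B = {v}) \<or>
    (\<exists>i\<in>{1..<k}. B = {Top i, Top (i + 1)}) \<or> (\<exists>i\<in>{1..<k}. B = {Bot i, Bot (i + 1)})"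
  shows "noncrossing k d"
proof -
  have chord: "circ k u + circ k v = 2 * k + 1 \<or> circ k v = circ k u + 1" if "{u, v} \<in> d" "circ k u < circ k v" for u v
    using assms[OF that(1)]
  proof (elim disjE bexE exE)
    fix a assume "a \<in> {1..k}" "{u, v} = {Top a, Bot a}"
    then show ?thesis using that(2) by (auto simp: doubleton_eq_iff)
  next
    fix x assume "{u, v} = {x}"
    then show ?thesis using that(2) by (auto simp: doubleton_eq_iff)
  next
    fix i assume "i \<in> {1..<k}" "{u, v} = {Top i, Top (i + 1)}"
    then show ?thesis using that(2) by (auto simp: doubleton_eq_iff)
  next
    fix i assume "i \<in> {1..<k}" "{u, v} = {Bot i, Bot (i + 1)}"
    then show ?thesis using that(2) by (auto simp: doubleton_eq_iff)
  qed
  show ?thesis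
    unfolding noncrossing_def
  proof clarify
    fix u v x y
    assume "{u, v} \<in> d" "{x, y} \<in> d" "circ k u < circ k x" "circ k x < circ k v" "circ k v < circ k y"
    then show False using chord[of u v] chord[of x y] by linarith
  qed
qed

lemma motzkin_generators:
  "id_diagram k \<in> motzkin_diagrams k"
  "j \<in> {1..k} \<Longrightarrow> p_diagram k j \<in> motzkin_diagrams k"
  "i \<in> {1..<k} \<Longrightarrow> e_diagram k i \<in> motzkin_diagrams k"
proof -
  show "id_diagram k \<in> motzkin_diagrams k"
    unfolding motzkin_diagrams_def using partition_generators(1)[of k]
    by (auto intro!: noncrossing_simple simp: id_diagram_def card_insert_if)
  show "p_diagram k j \<in> motzkin_diagrams k" if "j \<in> {1..k}"
    unfolding motzkin_diagrams_def using partition_generators(2)[OF that]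
    by (auto intro!: noncrossing_simple simp: p_diagram_def card_insert_if)
  show "e_diagram k i \<in> motzkin_diagrams k" if i: "i \<in> {1..<k}"
  proof -
    have "noncrossing k (e_diagram k i)"
      by (rule noncrossing_simple) (use i in \<open>auto simp: e_diagram_def\<close>)
    then show ?thesis
      unfolding motzkin_diagrams_def using partition_generators(3)[OF i]
      by (auto simp: e_diagram_def card_insert_if)
  qed
qed

lemma prod_verticals:
  assumes "t \<noteq> 0" "length w' = k" "length w = k" "A \<subseteq> {1..k}"
  shows "(\<Prod>B\<in>verticals A. edge_wt t k w' w B) = of_bool (\<forall>a\<in>A. w' ! (a - 1) = w ! (a - 1))"
proof -
  have fin: "finite A" using assms(4) finite_subset by blast
  have "(\<Prod>B\<in>verticals A. edge_wt t k w' w B) = (\<Prod>a\<in>A. edge_wt t k w' w {Top a, Bot a})"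
    by (subst prod.reindex) (auto simp: inj_on_def doubleton_eq_iff)
  also have "\<dots> = (\<Prod>a\<in>A. of_bool (w' ! (a - 1) = w ! (a - 1)))"
    using assms by (intro prod.cong edge_wts(3)) auto
  also have "\<dots> = of_bool (\<forall>a\<in>A. w' ! (a - 1) = w ! (a - 1))"
    using fin by (induction A rule: finite_induct) auto
  finally show ?thesis .
qed

lemma prod_verticals_Un:
  assumes "t \<noteq> 0" "length w' = k" "length w = k" "A \<subseteq> {1..k}" "finite R" "\<And>a. a \<in> A \<Longrightarrow> {Top a, Bot a} \<notin> R"
  shows "(\<Prod>B\<in>verticals A \<union> R. edge_wt t k w' w B) =
    of_bool (\<forall>a\<in>A. w' ! (a - 1) = w ! (a - 1)) * (\<Prod>B\<in>R. edge_wt t k w' w B)"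
proof -
  have "finite A" using assms(4) finite_subset by blast
  then show ?thesis
    unfolding prod_verticals[OF assms(1-4), symmetric] using assms(5,6) by (intro prod.union_disjoint) auto
qed

lemma diagram_mat_id:
  assumes "t \<noteq> 0" "length w' = k" "length w = k"
  shows "diagram_mat t k (id_diagram k) w' w = of_bool (w' = w)"
proof -
  have "diagram_mat t k (id_diagram k) w' w = of_bool (\<forall>a\<in>{1..k}. w' ! (a - 1) = w ! (a - 1))"
    unfolding diagram_mat_prod[OF partition_generators(1) assms(3)] unfolding id_diagram_def
    using prod_verticals[OF assms order_refl] .
  also have "(\<forall>a\<in>{1..k}. w' ! (a - 1) = w ! (a - 1)) \<longleftrightarrow> w' = w"
  proof
    assume eq: "\<forall>a\<in>{1..k}. w' ! (a - 1) = w ! (a - 1)"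
    show "w' = w"
    proof (rule nth_equalityI)
      show "w' ! i = w ! i" if "i < length w'" for i using eq[rule_format, of "Suc i"] that assms by auto
    qed (use assms in auto)
  qed simp
  finally show ?thesis .
qed

lemma diagram_mat_p:
  assumes "t \<noteq> 0" "length w' = k" "length w = k" "j \<in> {1..k}"
  shows "diagram_mat t k (p_diagram k j) w' w = of_bool (w' = w \<and> w ! (j - 1) = Nul)"
proof -
  have "diagram_mat t k (p_diagram k j) w' w = of_bool (\<forall>a\<in>{1..k} - {j}. w' ! (a - 1) = w ! (a - 1)) *
      (\<Prod>B\<in>{{Top j}, {Bot j}}. edge_wt t k w' w B)"
    unfolding diagram_mat_prod[OF partition_generators(2)[OF assms(4)] assms(3)] unfolding p_diagram_def
    by (rule prod_verticals_Un[OF assms(1-3)]) auto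
  also have "(\<Prod>B\<in>{{Top j}, {Bot j}}. edge_wt t k w' w B) = of_bool (w' ! (j - 1) = Nul \<and> w ! (j - 1) = Nul)"
    using edge_wts(1,2)[OF assms(1-3), of j] assms(4) by simp
  also have "of_bool (\<forall>a\<in>{1..k} - {j}. w' ! (a - 1) = w ! (a - 1)) * of_bool (w' ! (j - 1) = Nul \<and> w ! (j - 1) = Nul) =
      (of_bool ((\<forall>a\<in>{1..k}. w' ! (a - 1) = w ! (a - 1)) \<and> w ! (j - 1) = Nul) :: 'a)"
    using assms(4) by auto
  also have "(\<forall>a\<in>{1..k}. w' ! (a - 1) = w ! (a - 1)) \<longleftrightarrow> w' = w"
  proof
    assume eq: "\<forall>a\<in>{1..k}. w' ! (a - 1) = w ! (a - 1)"
    show "w' = w"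
    proof (rule nth_equalityI)
      show "w' ! i = w ! i" if "i < length w'" for i using eq[rule_format, of "Suc i"] that assms by auto
    qed (use assms in auto)
  qed simp
  finally show ?thesis .
qed

text \<open>Translates between diagrams, which compare letters position by position, and local
  operators, which replace the two letters at positions i and i + 1.\<close>

lemma splice_iff:
  assumes "length w' = k" "length w = k" "i \<in> {1..<k}"
  shows "w' = take (i - 1) w @ [a, b] @ drop (i + 1) w \<longleftrightarrow>
    (\<forall>p\<in>{1..k} - {i, i + 1}. w' ! (p - 1) = w ! (p - 1)) \<and> w' ! (i - 1) = a \<and> w' ! i = b"
proof -
  let ?z = "take (i - 1) w @ [a, b] @ drop (i + 1) w"
  have len: "length ?z = k" using assms by auto
  have nth: "?z ! p = (if p = i - 1 then a else if p = i then b else w ! p)" if "p < k" for p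
  proof -
    consider "p < i - 1" | "p = i - 1" | "p = i" | "p > i" using assms(3) by force
    then show ?thesis
    proof cases
      case 1
      then have "p \<noteq> i" "p \<noteq> i - 1" by auto
      then show ?thesis using 1 assms that by (simp add: nth_append)
    next
      case 2 then show ?thesis using assms that by (simp add: nth_append)
    next
      case 3 then show ?thesis using assms that by (auto simp: nth_append)
    next
      case 4
      then have "p - (i - 1) = Suc (Suc (p - (i + 1)))" "i + 1 + (p - (i + 1)) = p" "p \<noteq> i - 1" using assms(3) by auto
      then show ?thesis using 4 assms that by (auto simp: nth_append)
    qed
  qed
  have "w' = ?z \<longleftrightarrow> (\<forall>p<k. w' ! p = ?z ! p)"
    using len assms(1) by (auto intro: nth_equalityI)
  also have "\<dots> \<longleftrightarrow> (\<forall>p<k. w' ! p = (if p = i - 1 then a else if p = i then b else w ! p))"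
    using nth by auto
  also have "\<dots> \<longleftrightarrow> (\<forall>p\<in>{1..k} - {i, i + 1}. w' ! (p - 1) = w ! (p - 1)) \<and> w' ! (i - 1) = a \<and> w' ! i = b"
  proof
    assume L: "\<forall>p<k. w' ! p = (if p = i - 1 then a else if p = i then b else w ! p)"
    have "w' ! (p - 1) = w ! (p - 1)" if "p \<in> {1..k} - {i, i + 1}" for p
      using L[rule_format, of "p - 1"] that assms(3) by auto
    moreover have "w' ! (i - 1) = a" "w' ! i = b"
      using L[rule_format, of "i - 1"] L[rule_format, of i] assms(3) by auto
    ultimately show "(\<forall>p\<in>{1..k} - {i, i + 1}. w' ! (p - 1) = w ! (p - 1)) \<and> w' ! (i - 1) = a \<and> w' ! i = b" by blast
  next
    assume R: "(\<forall>p\<in>{1..k} - {i, i + 1}. w' ! (p - 1) = w ! (p - 1)) \<and> w' ! (i - 1) = a \<and> w' ! i = b"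
    show "\<forall>p<k. w' ! p = (if p = i - 1 then a else if p = i then b else w ! p)"
    proof (intro allI impI)
      fix p assume "p < k"
      then show "w' ! p = (if p = i - 1 then a else if p = i then b else w ! p)"
        using R[THEN conjunct1, rule_format, of "Suc p"] R[THEN conjunct2] by (cases "p = i - 1"; cases "p = i") auto
    qed
  qed
  finally show ?thesis .
qed

lemma diagram_mat_r:
  assumes "t \<noteq> 0" "length w' = k" "length w = k" "i \<in> {1..<k}"
  shows "diagram_mat t k (r_diagram k i) w' w =
    of_bool (w ! i = Nul \<and> w' = take (i - 1) w @ [Nul, w ! (i - 1)] @ drop (i + 1) w)"
proof -
  have i: "1 \<le> i" "i \<le> k" "1 \<le> i + 1" "i + 1 \<le> k" using assms(4) by auto
  have "diagram_mat t k (r_diagram k i) w' w = of_bool (\<forall>a\<in>{1..k} - {i, i + 1}. w' ! (a - 1) = w ! (a - 1)) *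
      (\<Prod>B\<in>{{Top (i + 1), Bot i}, {Top i}, {Bot (i + 1)}}. edge_wt t k w' w B)"
    unfolding diagram_mat_prod[OF partition_generators(4)[OF assms(4)] assms(3)] unfolding r_diagram_def
    by (rule prod_verticals_Un[OF assms(1-3)]) (auto simp: doubleton_eq_iff)
  also have "(\<Prod>B\<in>{{Top (i + 1), Bot i}, {Top i}, {Bot (i + 1)}}. edge_wt t k w' w B) =
      of_bool (w' ! i = w ! (i - 1) \<and> w' ! (i - 1) = Nul \<and> w ! i = Nul)"
    using edge_wts(1)[OF assms(1-3) i(1,2)] edge_wts(2)[OF assms(1-3) i(3,4)] edge_wts(3)[OF assms(1-3) i(3,4) i(1,2)]
    by (simp add: doubleton_eq_iff)
  finally show ?thesis
    unfolding splice_iff[OF assms(2-4)] by auto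
qed

lemma diagram_mat_l:
  assumes "t \<noteq> 0" "length w' = k" "length w = k" "i \<in> {1..<k}"
  shows "diagram_mat t k (l_diagram k i) w' w =
    of_bool (w ! (i - 1) = Nul \<and> w' = take (i - 1) w @ [w ! i, Nul] @ drop (i + 1) w)"
proof -
  have i: "1 \<le> i" "i \<le> k" "1 \<le> i + 1" "i + 1 \<le> k" using assms(4) by auto
  have "diagram_mat t k (l_diagram k i) w' w = of_bool (\<forall>a\<in>{1..k} - {i, i + 1}. w' ! (a - 1) = w ! (a - 1)) *
      (\<Prod>B\<in>{{Top i, Bot (i + 1)}, {Top (i + 1)}, {Bot i}}. edge_wt t k w' w B)"
    unfolding diagram_mat_prod[OF partition_generators(5)[OF assms(4)] assms(3)] unfolding l_diagram_def
    by (rule prod_verticals_Un[OF assms(1-3)]) (auto simp: doubleton_eq_iff)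
  also have "(\<Prod>B\<in>{{Top i, Bot (i + 1)}, {Top (i + 1)}, {Bot i}}. edge_wt t k w' w B) =
      of_bool (w' ! (i - 1) = w ! i \<and> w' ! i = Nul \<and> w ! (i - 1) = Nul)"
    using edge_wts(1)[OF assms(1-3) i(3,4)] edge_wts(2)[OF assms(1-3) i(1,2)] edge_wts(3)[OF assms(1-3) i(1,2) i(3,4)]
    by (simp add: doubleton_eq_iff)
  finally show ?thesis
    unfolding splice_iff[OF assms(2-4)] by auto
qed

lemma diagram_mat_e:
  assumes "t \<noteq> 0" "length w' = k" "length w = k" "i \<in> {1..<k}"
  shows "diagram_mat t k (e_diagram k i) w' w =
    of_bool (\<forall>a\<in>{1..k} - {i, i + 1}. w' ! (a - 1) = w ! (a - 1)) *
    (arc t (w' ! (i - 1)) (w' ! i) * coarc t (w ! (i - 1)) (w ! i))"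
proof -
  have i: "1 \<le> i" "i \<le> k" "i < i + 1" "i + 1 \<le> k" using assms(4) by auto
  have "diagram_mat t k (e_diagram k i) w' w = of_bool (\<forall>a\<in>{1..k} - {i, i + 1}. w' ! (a - 1) = w ! (a - 1)) *
      (\<Prod>B\<in>{{Top i, Top (i + 1)}, {Bot i, Bot (i + 1)}}. edge_wt t k w' w B)"
    unfolding diagram_mat_prod[OF partition_generators(3)[OF assms(4)] assms(3)] unfolding e_diagram_def
    by (rule prod_verticals_Un[OF assms(1-3)]) (auto simp: doubleton_eq_iff)
  also have "(\<Prod>B\<in>{{Top i, Top (i + 1)}, {Bot i, Bot (i + 1)}}. edge_wt t k w' w B) =
      arc t (w' ! (i - 1)) (w' ! i) * coarc t (w ! (i - 1)) (w ! i)"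
    using edge_wts(4)[OF assms(1-3) i] edge_wts(5)[OF assms(1-3) i] by (simp add: doubleton_eq_iff)
  finally show ?thesis .
qed

section \<open>Matrices of algebra elements\<close>

definition elt_mat :: "'a::field \<Rightarrow> nat \<Rightarrow> (diagram \<Rightarrow>\<^sub>0 'a) \<Rightarrow> basis list \<Rightarrow> basis list \<Rightarrow> 'a" where
  "elt_mat t k x w' w = lsum (\<lambda>d. diagram_mat t k d w' w) x"

lemma keys_lin_ext: "c \<in> Poly_Mapping.keys (lin_ext f x) \<Longrightarrow> \<exists>b\<in>Poly_Mapping.keys x. c \<in> Poly_Mapping.keys (f b)"
proof (rule ccontr)
  assume c: "c \<in> Poly_Mapping.keys (lin_ext f x)" and n: "\<not> (\<exists>b\<in>Poly_Mapping.keys x. c \<in> Poly_Mapping.keys (f b))"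
  have "Poly_Mapping.lookup (f b) c = 0" if "b \<in> Poly_Mapping.keys x" for b
    using n that in_keys_iff by metis
  then have "Poly_Mapping.lookup (lin_ext f x) c = 0" by (simp add: lookup_lin_ext lsum_def)
  then show False using c by (simp add: in_keys_iff)
qed

lemma keys_motzkin_mult:
  assumes "Poly_Mapping.keys x \<subseteq> motzkin_diagrams k" "Poly_Mapping.keys y \<subseteq> motzkin_diagrams k"
  shows "Poly_Mapping.keys (motzkin_mult \<delta> x y) \<subseteq> motzkin_diagrams k"
proof
  fix d assume "d \<in> Poly_Mapping.keys (motzkin_mult \<delta> x y)"
  then obtain d1 where d1: "d1 \<in> Poly_Mapping.keys x"
    "d \<in> Poly_Mapping.keys (lin_ext (\<lambda>d2. Poly_Mapping.single (diagram_comp d1 d2) (\<delta> ^ loops d1 d2)) y)"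
    unfolding motzkin_mult_def by (meson keys_lin_ext)
  then obtain d2 where d2: "d2 \<in> Poly_Mapping.keys y"
    "d \<in> Poly_Mapping.keys (Poly_Mapping.single (diagram_comp d1 d2) (\<delta> ^ loops d1 d2))"
    by (meson keys_lin_ext)
  have m: "d1 \<in> motzkin_diagrams k" "d2 \<in> motzkin_diagrams k" using assms d1(1) d2(1) by auto
  have e: "d = diagram_comp d1 d2" using d2(2) by (auto split: if_splits)
  show "d \<in> motzkin_diagrams k" unfolding e by (rule diagram_comp_motzkin[OF m])
qed

text \<open>Bilinear extension of \<open>diagram_mat_mult\<close>; the loop parameter of the Motzkin
  algebra has to be 1 - t - 1/t here.\<close>

lemma elt_mat_mult:
  assumes "t \<noteq> 0" "Poly_Mapping.keys x \<subseteq> motzkin_diagrams k" "Poly_Mapping.keys y \<subseteq> motzkin_diagrams k"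
    "length w' = k" "length w = k"
  shows "elt_mat t k (motzkin_mult (1 - t - inverse t) x y) w' w =
    (\<Sum>u\<in>words k. elt_mat t k x w' u * elt_mat t k y u w)"
proof -
  have "elt_mat t k (motzkin_mult (1 - t - inverse t) x y) w' w =
      lsum (\<lambda>d1. lsum (\<lambda>d2. (1 - t - inverse t) ^ loops d1 d2 * diagram_mat t k (diagram_comp d1 d2) w' w) y) x"
    unfolding elt_mat_def motzkin_mult_def lsum_lin_ext lsum_single ..
  also have "\<dots> = lsum (\<lambda>d1. lsum (\<lambda>d2. \<Sum>u\<in>words k. diagram_mat t k d1 w' u * diagram_mat t k d2 u w) y) x"
  proof (intro lsum_cong)
    fix d1 d2 assume "d1 \<in> Poly_Mapping.keys x" "d2 \<in> Poly_Mapping.keys y"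
    then have d: "d1 \<in> motzkin_diagrams k" "d2 \<in> motzkin_diagrams k" using assms by auto
    show "(1 - t - inverse t) ^ loops d1 d2 * diagram_mat t k (diagram_comp d1 d2) w' w =
        (\<Sum>u\<in>words k. diagram_mat t k d1 w' u * diagram_mat t k d2 u w)"
      using diagram_mat_mult[OF d assms(1,4,5)] by simp
  qed
  also have "\<dots> = (\<Sum>u\<in>words k. elt_mat t k x w' u * elt_mat t k y u w)"
  proof -
    have inner: "lsum (\<lambda>d2. \<Sum>u\<in>words k. a u * f d2 u) y = (\<Sum>u\<in>words k. a u * lsum (\<lambda>d2. f d2 u) y)"
      for a :: "basis list \<Rightarrow> 'a" and f
      unfolding lsum_def sum_distrib_left by (subst sum.swap) (simp add: mult_ac)
    have outer: "lsum (\<lambda>d1. \<Sum>u\<in>words k. f d1 u * a u) x = (\<Sum>u\<in>words k. lsum (\<lambda>d1. f d1 u) x * a u)"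
      for a :: "basis list \<Rightarrow> 'a" and f
      unfolding lsum_def sum_distrib_left sum_distrib_right by (subst sum.swap) (simp add: mult_ac)
    show ?thesis unfolding inner outer elt_mat_def ..
  qed
  finally show ?thesis .
qed

lemma keys_one_minus_p: "j \<in> {1..k} \<Longrightarrow> Poly_Mapping.keys (one_minus_p k j :: diagram \<Rightarrow>\<^sub>0 'a::field) \<subseteq> motzkin_diagrams k"
  unfolding one_minus_p_def using motzkin_generators(1)[of k] motzkin_generators(2)[of j k]
    keys_diff[of "Poly_Mapping.single (id_diagram k) (1 :: 'a)" "Poly_Mapping.single (p_diagram k j) 1"]
  by (auto split: if_splits)

lemma elt_mat_one_minus_p:
  assumes "t \<noteq> 0" "length w' = k" "length w = k" "j \<in> {1..k}"
  shows "elt_mat t k (one_minus_p k j) w' w = of_bool (w' = w \<and> w ! (j - 1) \<noteq> Nul)"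
  unfolding elt_mat_def one_minus_p_def lsum_diff lsum_single
    diagram_mat_id[OF assms(1-3)] diagram_mat_p[OF assms] by auto

text \<open>Each factor 1 - p_i projects to words with a letter of V(1) in place i, so a horizontal
  edge keeps only its part in V(1).\<close>

definition tilde_mat :: "'a::field \<Rightarrow> nat \<Rightarrow> diagram \<Rightarrow> basis list \<Rightarrow> basis list \<Rightarrow> 'a" where
  "tilde_mat t k d w' w = of_bool (\<forall>i\<in>{1..k}. Top i \<in> \<Union>(cups d) \<longrightarrow> w' ! (i - 1) \<noteq> Nul) *
     diagram_mat t k d w' w * of_bool (\<forall>j\<in>{1..k}. Bot j \<in> \<Union>(caps d) \<longrightarrow> w ! (j - 1) \<noteq> Nul)"

text \<open>Every factor is a diagonal matrix with entries 0 and 1. \<open>right\<close> and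
  \<open>left\<close> follow the two folds in \<open>tilde\<close>; the bound on the keys is carried
  along because multiplicativity is known for combinations of Motzkin diagrams.\<close>

lemma tilde_keys_mat:
  fixes t :: "'a::field"
  assumes "t \<noteq> 0" "d \<in> motzkin_diagrams k" and \<delta>: "\<delta> = 1 - t - inverse t"
  shows "Poly_Mapping.keys (tilde \<delta> k d) \<subseteq> motzkin_diagrams k"
    and "\<And>w' w. length w' = k \<Longrightarrow> length w = k \<Longrightarrow> elt_mat t k (tilde \<delta> k d) w' w = tilde_mat t k d w' w"
proof -
  have right: "Poly_Mapping.keys (foldr (\<lambda>i x. one_minus_p k i \<otimes>\<^bsub>Motzkin \<delta> k\<^esub> x) is x) \<subseteq> motzkin_diagrams k \<and>
    (\<forall>w' w. length w' = k \<longrightarrow> length w = k \<longrightarrow>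
      elt_mat t k (foldr (\<lambda>i x. one_minus_p k i \<otimes>\<^bsub>Motzkin \<delta> k\<^esub> x) is x) w' w =
      of_bool (\<forall>i\<in>set is. w' ! (i - 1) \<noteq> Nul) * elt_mat t k x w' w)"
    if "set is \<subseteq> {1..k}" "Poly_Mapping.keys x \<subseteq> motzkin_diagrams k" for "is" x
    using that
  proof (induction "is")
    case (Cons i "is")
    let ?y = "foldr (\<lambda>i x. one_minus_p k i \<otimes>\<^bsub>Motzkin \<delta> k\<^esub> x) is x"
    have y: "Poly_Mapping.keys ?y \<subseteq> motzkin_diagrams k" and i: "i \<in> {1..k}" using Cons by auto
    have IH: "elt_mat t k ?y w' w = of_bool (\<forall>i\<in>set is. w' ! (i - 1) \<noteq> Nul) * elt_mat t k x w' w"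
      if "length w' = k" "length w = k" for w' w using Cons that by auto
    have m: "foldr (\<lambda>i x. one_minus_p k i \<otimes>\<^bsub>Motzkin \<delta> k\<^esub> x) (i # is) x = motzkin_mult \<delta> (one_minus_p k i) ?y"
      by (simp add: Motzkin_def)
    have "elt_mat t k (motzkin_mult \<delta> (one_minus_p k i) ?y) w' w =
        of_bool (\<forall>i\<in>set (i # is). w' ! (i - 1) \<noteq> Nul) * elt_mat t k x w' w"
      if w: "length w' = k" "length w = k" for w' w
    proof -
      have "elt_mat t k (motzkin_mult \<delta> (one_minus_p k i) ?y) w' w =
          (\<Sum>u\<in>words k. elt_mat t k (one_minus_p k i) w' u * elt_mat t k ?y u w)"
        unfolding \<delta> using elt_mat_mult[OF assms(1) keys_one_minus_p[OF i] y w] \<delta> by simp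
      also have "\<dots> = (\<Sum>u\<in>words k. if w' = u then of_bool (u ! (i - 1) \<noteq> Nul) * elt_mat t k ?y u w else 0)"
        using elt_mat_one_minus_p[OF assms(1) w(1) _ i] by (intro sum.cong) auto
      also have "\<dots> = of_bool (w' ! (i - 1) \<noteq> Nul) * elt_mat t k ?y w' w"
        by (rule sum_if_eq_words(2)[OF w(1)])
      finally show ?thesis using IH[OF w] by auto
    qed
    then show ?case unfolding m using keys_motzkin_mult[OF keys_one_minus_p[OF i] y] by blast
  qed simp
  have left: "Poly_Mapping.keys (foldl (\<lambda>x j. x \<otimes>\<^bsub>Motzkin \<delta> k\<^esub> one_minus_p k j) x js) \<subseteq> motzkin_diagrams k \<and>
    (\<forall>w' w. length w' = k \<longrightarrow> length w = k \<longrightarrow>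
      elt_mat t k (foldl (\<lambda>x j. x \<otimes>\<^bsub>Motzkin \<delta> k\<^esub> one_minus_p k j) x js) w' w =
      elt_mat t k x w' w * of_bool (\<forall>j\<in>set js. w ! (j - 1) \<noteq> Nul))"
    if "set js \<subseteq> {1..k}" "Poly_Mapping.keys x \<subseteq> motzkin_diagrams k" for js x
    using that
  proof (induction js rule: rev_induct)
    case (snoc j js)
    let ?y = "foldl (\<lambda>x j. x \<otimes>\<^bsub>Motzkin \<delta> k\<^esub> one_minus_p k j) x js"
    have y: "Poly_Mapping.keys ?y \<subseteq> motzkin_diagrams k" and j: "j \<in> {1..k}" using snoc by auto
    have IH: "elt_mat t k ?y w' w = elt_mat t k x w' w * of_bool (\<forall>j\<in>set js. w ! (j - 1) \<noteq> Nul)"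
      if "length w' = k" "length w = k" for w' w using snoc that by auto
    have m: "foldl (\<lambda>x j. x \<otimes>\<^bsub>Motzkin \<delta> k\<^esub> one_minus_p k j) x (js @ [j]) = motzkin_mult \<delta> ?y (one_minus_p k j)"
      by (simp add: Motzkin_def)
    have "elt_mat t k (motzkin_mult \<delta> ?y (one_minus_p k j)) w' w =
        elt_mat t k x w' w * of_bool (\<forall>j\<in>set (js @ [j]). w ! (j - 1) \<noteq> Nul)"
      if w: "length w' = k" "length w = k" for w' w
    proof -
      have "elt_mat t k (motzkin_mult \<delta> ?y (one_minus_p k j)) w' w =
          (\<Sum>u\<in>words k. elt_mat t k ?y w' u * elt_mat t k (one_minus_p k j) u w)"
        using elt_mat_mult[OF assms(1) y keys_one_minus_p[OF j] w] \<delta> by simp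
      also have "\<dots> = (\<Sum>u\<in>words k. if u = w then elt_mat t k ?y w' u * of_bool (u ! (j - 1) \<noteq> Nul) else 0)"
        using elt_mat_one_minus_p[OF assms(1) _ w(2) j] by (intro sum.cong) auto
      also have "\<dots> = elt_mat t k ?y w' w * of_bool (w ! (j - 1) \<noteq> Nul)"
        by (rule sum_if_eq_words(1)[OF w(2)])
      finally show ?thesis using IH[OF w] by auto
    qed
    then show ?case unfolding m using keys_motzkin_mult[OF y keys_one_minus_p[OF j]] by blast
  qed simp
  let ?is = "filter (\<lambda>i. Top i \<in> \<Union>(cups d)) [1..<k + 1]" and ?js = "filter (\<lambda>j. Bot j \<in> \<Union>(caps d)) [1..<k + 1]"
  let ?x = "foldr (\<lambda>i x. one_minus_p k i \<otimes>\<^bsub>Motzkin \<delta> k\<^esub> x) ?is (Poly_Mapping.single d 1)"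
  have sets: "set ?is \<subseteq> {1..k}" "set ?js \<subseteq> {1..k}" by auto
  have "Poly_Mapping.keys (Poly_Mapping.single d (1 :: 'a)) \<subseteq> motzkin_diagrams k" using assms(2) by simp
  note R = right[OF sets(1) this]
  note L = left[OF sets(2) conjunct1[OF R]]
  show "Poly_Mapping.keys (tilde \<delta> k d) \<subseteq> motzkin_diagrams k" unfolding tilde_def using L by blast
  fix w' w :: "basis list" assume w: "length w' = k" "length w = k"
  have "elt_mat t k (tilde \<delta> k d) w' w = elt_mat t k ?x w' w * of_bool (\<forall>j\<in>set ?js. w ! (j - 1) \<noteq> Nul)"
    unfolding tilde_def using L w by blast
  also have "elt_mat t k ?x w' w = of_bool (\<forall>i\<in>set ?is. w' ! (i - 1) \<noteq> Nul) * diagram_mat t k d w' w"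
    using R w by (simp add: elt_mat_def)
  also have "(\<forall>i\<in>set ?is. w' ! (i - 1) \<noteq> Nul) \<longleftrightarrow> (\<forall>i\<in>{1..k}. Top i \<in> \<Union>(cups d) \<longrightarrow> w' ! (i - 1) \<noteq> Nul)" by auto
  also have "(\<forall>j\<in>set ?js. w ! (j - 1) \<noteq> Nul) \<longleftrightarrow> (\<forall>j\<in>{1..k}. Bot j \<in> \<Union>(caps d) \<longrightarrow> w ! (j - 1) \<noteq> Nul)" by auto
  finally show "elt_mat t k (tilde \<delta> k d) w' w = tilde_mat t k d w' w" unfolding tilde_mat_def .
qed

section \<open>Positions of \<open>Nul\<close> and the number of active letters\<close>

abbreviation nul_pattern :: "basis list \<Rightarrow> bool list" where
  "nul_pattern w \<equiv> map (\<lambda>b. b = Nul) w"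

text \<open>V(0) is a direct summand of V, so E does not move the letters \<open>Nul\<close> and
  commutes with any function of their positions.\<close>

lemma raise_pattern: "raising t (\<lambda>y. \<phi> (nul_pattern y) * v y) x = \<phi> (nul_pattern x) * raising t v x"
proof (induction x arbitrary: \<phi> v)
  case (Cons a x)
  show ?case
    using Cons[of "\<lambda>p. \<phi> ((a = Nul) # p)" "\<lambda>y. v (a # y)"] by (auto simp: algebra_simps)
qed simp

lemma coraise_pattern: "coraising t (\<lambda>y. \<phi> (nul_pattern y) * g y) x = \<phi> (nul_pattern x) * coraising t g x"
proof (induction x arbitrary: \<phi> g)
  case (Cons a x)
  show ?case
    using Cons[of "\<lambda>p. \<phi> ((a = Nul) # p)" "\<lambda>y. g (a # y)"] by (auto simp: algebra_simps)
qed simp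

lemma commutes_raising_pattern:
  assumes "commutes_raising t k T"
  shows "commutes_raising t k (\<lambda>w' w. \<phi> (nul_pattern w') * T w' w * \<psi> (nul_pattern w))"
  unfolding commutes_raising_def
proof (intro allI impI)
  fix x w :: "basis list" assume xw: "length x = k" "length w = k"
  have "raising t (\<lambda>u. \<phi> (nul_pattern u) * T u w * \<psi> (nul_pattern w)) x =
      \<psi> (nul_pattern w) * (\<phi> (nul_pattern x) * raising t (\<lambda>u. T u w) x)"
    unfolding raise_pattern[symmetric] raise_scale[symmetric] by (simp add: mult_ac)
  also have "\<dots> = \<phi> (nul_pattern x) * (\<psi> (nul_pattern w) * coraising t (T x) w)"
    using assms xw unfolding commutes_raising_def by simp
  also have "\<dots> = coraising t (\<lambda>u. \<phi> (nul_pattern x) * T x u * \<psi> (nul_pattern u)) w"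
    unfolding coraise_pattern[symmetric] coraise_scale[symmetric] by (simp add: mult_ac)
  finally show "raising t (\<lambda>u. \<phi> (nul_pattern u) * T u w * \<psi> (nul_pattern w)) x =
      coraising t (\<lambda>u. \<phi> (nul_pattern x) * T x u * \<psi> (nul_pattern u)) w" .
qed

lemma commutes_raising_cong:
  assumes "\<And>w' w. length w' = k \<Longrightarrow> length w = k \<Longrightarrow> S w' w = T w' w"
  shows "commutes_raising t k S \<longleftrightarrow> commutes_raising t k T"
proof -
  have "raising t (\<lambda>u. S u w) x = raising t (\<lambda>u. T u w) x" "coraising t (S x) w = coraising t (T x) w"
    if "length x = k" "length w = k" for x w
    using assms that by (auto intro: raise_cong coraise_cong)
  then show ?thesis unfolding commutes_raising_def by auto
qed

text \<open>The truncations on both sides depend only on the positions of \<open>Nul\<close>, hence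
  are covered by \<open>commutes_raising_pattern\<close>.\<close>

lemma tilde_mat_commutes_raising:
  assumes "t \<noteq> 0" "d \<in> motzkin_diagrams k"
  shows "commutes_raising t k (tilde_mat t k d)"
proof -
  let ?\<phi> = "\<lambda>p. of_bool (\<forall>i\<in>{1..k}. Top i \<in> \<Union>(cups d) \<longrightarrow> \<not> p ! (i - 1)) :: 'a"
  let ?\<psi> = "\<lambda>p. of_bool (\<forall>j\<in>{1..k}. Bot j \<in> \<Union>(caps d) \<longrightarrow> \<not> p ! (j - 1)) :: 'a"
  have "commutes_raising t k (\<lambda>w' w. ?\<phi> (nul_pattern w') * diagram_mat t k d w' w * ?\<psi> (nul_pattern w))"
    by (rule commutes_raising_pattern[OF diagram_mat_commutes_raising[OF assms]])
  moreover have "?\<phi> (nul_pattern w') * diagram_mat t k d w' w * ?\<psi> (nul_pattern w) = tilde_mat t k d w' w"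
    if len: "length w' = k" "length w = k" for w' w
  proof -
    have "?\<phi> (nul_pattern w') = of_bool (\<forall>i\<in>{1..k}. Top i \<in> \<Union>(cups d) \<longrightarrow> w' ! (i - 1) \<noteq> Nul)"
      using len by (intro arg_cong[of _ _ of_bool] ball_cong refl) auto
    moreover have "?\<psi> (nul_pattern w) = of_bool (\<forall>j\<in>{1..k}. Bot j \<in> \<Union>(caps d) \<longrightarrow> w ! (j - 1) \<noteq> Nul)"
      using len by (intro arg_cong[of _ _ of_bool] ball_cong refl) auto
    ultimately show ?thesis unfolding tilde_mat_def by simp
  qed
  then have "commutes_raising t k (\<lambda>w' w. ?\<phi> (nul_pattern w') * diagram_mat t k d w' w * ?\<psi> (nul_pattern w))
      \<longleftrightarrow> commutes_raising t k (tilde_mat t k d)"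
    by (rule commutes_raising_cong)
  ultimately show ?thesis by simp
qed

definition active :: "basis list \<Rightarrow> nat" where
  "active w = length (filter (\<lambda>b. b \<noteq> Nul) w)"

lemma active_simps [simp]:
  "active [] = 0" "active (b # w) = (if b = Nul then active w else Suc (active w))"
  "active (v @ w) = active v + active w"
  by (simp_all add: active_def)

lemma active_dual [simp]: "active (dual w) = active w"
proof (induction w)
  case (Cons a w) then show ?case by (cases a) auto
qed simp

lemma active_sum: "length w = k \<Longrightarrow> int (active w) = (\<Sum>i\<in>{1..k}. of_bool (w ! (i - 1) \<noteq> Nul))"
proof -
  assume k: "length w = k"
  have "int (active w) = (\<Sum>i<length w. of_bool (w ! i \<noteq> Nul))"
    by (induction w) (auto simp: sum.lessThan_Suc_shift simp del: sum.lessThan_Suc)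
  also have "\<dots> = (\<Sum>i\<in>{1..k}. of_bool (w ! (i - 1) \<noteq> Nul))"
    by (rule sum.reindex_bij_witness[of _ "\<lambda>p. p - 1" Suc]) (auto simp: k)
  finally show ?thesis .
qed

lemma weight_sum: "length w = k \<Longrightarrow> weight w = (\<Sum>i\<in>{1..k}. letter_weight (w ! (i - 1)))"
proof -
  assume k: "length w = k"
  have "weight w = (\<Sum>i<length w. letter_weight (w ! i))"
    by (induction w) (auto simp: sum.lessThan_Suc_shift simp del: sum.lessThan_Suc)
  also have "\<dots> = (\<Sum>i\<in>{1..k}. letter_weight (w ! (i - 1)))"
    by (rule sum.reindex_bij_witness[of _ "\<lambda>p. p - 1" Suc]) (auto simp: k)
  finally show ?thesis .
qed

lemma motzkin_block_cases:
  assumes "d \<in> motzkin_diagrams k" "B \<in> d"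
  obtains i where "B = {Top i}" "1 \<le> i" "i \<le> k"
  | i where "B = {Bot i}" "1 \<le> i" "i \<le> k"
  | i j where "B = {Top i, Bot j}" "1 \<le> i" "i \<le> k" "1 \<le> j" "j \<le> k"
  | i j where "B = {Top i, Top j}" "1 \<le> i" "i < j" "j \<le> k"
  | i j where "B = {Bot i, Bot j}" "1 \<le> i" "i < j" "j \<le> k"
proof -
  have part: "partition_on (vertices k) d" and two: "card B \<le> 2" using assms unfolding motzkin_diagrams_def by auto
  have BV: "B \<subseteq> vertices k" "B \<noteq> {}" using part assms(2) unfolding partition_on_def by auto
  then have fin: "finite B" using finite_vertices finite_subset by blast
  obtain u where u: "u \<in> B" using BV by blast
  show ?thesis
  proof (rule card_le_2_cases[OF fin u two])
    assume "B = {u}"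
    moreover have "u \<in> vertices k" using u BV by blast
    ultimately show ?thesis using that(1,2) by (elim vertices_cases) auto
  next
    fix v assume v: "v \<noteq> u" "B = {u, v}"
    then have "u \<in> vertices k" "v \<in> vertices k" using BV by auto
    then show ?thesis
    proof (elim vertices_cases)
      fix i j assume "u = Top i" "1 \<le> i" "i \<le> k" "v = Top j" "1 \<le> j" "j \<le> k"
      then show ?thesis using v that(4)[of i j] that(4)[of j i] by (cases "i < j") (auto simp: insert_commute)
    next
      fix i j assume "u = Top i" "1 \<le> i" "i \<le> k" "v = Bot j" "1 \<le> j" "j \<le> k"
      then show ?thesis using v that(3)[of i j] by auto
    next
      fix i j assume "u = Bot i" "1 \<le> i" "i \<le> k" "v = Top j" "1 \<le> j" "j \<le> k"
      then show ?thesis using v that(3)[of j i] by (auto simp: insert_commute)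
    next
      fix i j assume "u = Bot i" "1 \<le> i" "i \<le> k" "v = Bot j" "1 \<le> j" "j \<le> k"
      then show ?thesis using v that(5)[of i j] that(5)[of j i] by (cases "i < j") (auto simp: insert_commute)
    qed
  qed
qed

lemma finite_motzkin_diagram: "d \<in> motzkin_diagrams k \<Longrightarrow> finite d"
  unfolding motzkin_diagrams_def using finite_elements[OF finite_vertices] by blast

lemma arc_nonzero: "arc t a b \<noteq> 0 \<Longrightarrow> letter_weight a + letter_weight b = 0 \<and> (a = Nul \<longleftrightarrow> b = Nul)"
  by (cases a; cases b) auto

lemma coarc_nonzero: "coarc t a b \<noteq> 0 \<Longrightarrow> letter_weight a + letter_weight b = 0 \<and> (a = Nul \<longleftrightarrow> b = Nul)"
  by (cases a; cases b) (auto simp: coarc_def)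

text \<open>Both identities are summed over blocks: no block changes the weight, and each cup adds
  two active letters above, each cap two below. For balanced diagrams the number of active letters,
  the exponent of q in the action of K1 K2, is therefore preserved.\<close>

lemma tilde_mat_nonzero:
  assumes "t \<noteq> 0" "d \<in> motzkin_diagrams k" "length w' = k" "length w = k" "tilde_mat t k d w' w \<noteq> 0"
  shows "weight w' = weight w"
    and "int (active w') - int (active w) = 2 * int (card (cups d)) - 2 * int (card (caps d))"
proof -
  have part: "partition_on (vertices k) d" using assms(2) unfolding motzkin_diagrams_def by auto
  have fin: "finite d" using finite_motzkin_diagram[OF assms(2)] .
  have nz: "edge_wt t k w' w B \<noteq> 0" if "B \<in> d" for B
    using assms(5) that fin unfolding tilde_mat_def diagram_mat_prod[OF part assms(4)] by auto
  have strictT: "w' ! (i - 1) \<noteq> Nul" if "i \<in> {1..k}" "Top i \<in> \<Union>(cups d)" for i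
    using assms(5) that unfolding tilde_mat_def by auto
  have strictB: "w ! (i - 1) \<noteq> Nul" if "i \<in> {1..k}" "Bot i \<in> \<Union>(caps d)" for i
    using assms(5) that unfolding tilde_mat_def by auto
  \<comment> \<open>Top letters count positively and bottom letters negatively, so that the sum over
    all vertices is the difference to be computed.\<close>
  define a where "a = (\<lambda>v. case v of Top i \<Rightarrow> letter_weight (w' ! (i - 1)) | Bot i \<Rightarrow> - letter_weight (w ! (i - 1)))"
  define b where "b = (\<lambda>v. case v of Top i \<Rightarrow> (of_bool (w' ! (i - 1) \<noteq> Nul) :: int) | Bot i \<Rightarrow> - of_bool (w ! (i - 1) \<noteq> Nul))"
  note ew = edge_wts[OF assms(1,3,4)]
  have blocks: "(\<Sum>v\<in>B. a v) = 0 \<and> (\<Sum>v\<in>B. b v) = (if B \<in> cups d then 2 else if B \<in> caps d then - 2 else 0)"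
    if B: "B \<in> d" for B
    using motzkin_block_cases[OF assms(2) B]
  proof cases
    case (1 i)
    then have "w' ! (i - 1) = Nul" using nz[OF B] ew(1)[of i] by auto
    then show ?thesis unfolding 1 a_def b_def by (simp add: cups_def caps_def)
  next
    case (2 i)
    then have "w ! (i - 1) = Nul" using nz[OF B] ew(2)[of i] by auto
    then show ?thesis unfolding 2 a_def b_def by (simp add: cups_def caps_def)
  next
    case (3 i j)
    then have "w' ! (i - 1) = w ! (j - 1)" using nz[OF B] ew(3)[of i j] by auto
    then show ?thesis unfolding 3 a_def b_def by (auto simp: cups_def caps_def)
  next
    case (4 i j)
    then have n: "letter_weight (w' ! (i - 1)) + letter_weight (w' ! (j - 1)) = 0"
      using nz[OF B] ew(4)[of i j] arc_nonzero by auto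
    have c: "B \<in> cups d" using 4 B by (auto simp: cups_def card_insert_if)
    then have "w' ! (i - 1) \<noteq> Nul" "w' ! (j - 1) \<noteq> Nul" using strictT[of i] strictT[of j] 4 by auto
    then show ?thesis using n c 4 unfolding a_def b_def by simp
  next
    case (5 i j)
    then have n: "letter_weight (w ! (i - 1)) + letter_weight (w ! (j - 1)) = 0"
      using nz[OF B] ew(5)[of i j] coarc_nonzero by auto
    have c: "B \<in> caps d" "B \<notin> cups d" using 5 B by (auto simp: cups_def caps_def card_insert_if)
    then have "w ! (i - 1) \<noteq> Nul" "w ! (j - 1) \<noteq> Nul" using strictB[of i] strictB[of j] 5 by auto
    then show ?thesis using n c 5 unfolding a_def b_def by simp
  qed
  have "(\<Sum>v\<in>vertices k. a v) = (\<Sum>B\<in>d. \<Sum>v\<in>B. a v)" using sum_partition[OF part finite_vertices] by metis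
  also have "\<dots> = 0" using blocks by (intro sum.neutral) blast
  finally show "weight w' = weight w"
    unfolding sum_vertices weight_sum[OF assms(3)] weight_sum[OF assms(4)] a_def by (simp add: sum_negf)
  have sub: "cups d \<subseteq> d" "caps d \<subseteq> d" "cups d \<inter> caps d = {}"
  proof -
    have False if "B \<subseteq> range Top" "B \<subseteq> range Bot" "card B = 2" for B :: "vertex set"
    proof -
      have "B = {}" using that by fast
      then show False using that(3) by simp
    qed
    then show "cups d \<inter> caps d = {}" unfolding cups_def caps_def by blast
  qed (auto simp: cups_def caps_def)
  have "int (active w') - int (active w) = (\<Sum>v\<in>vertices k. b v)"
    unfolding sum_vertices active_sum[OF assms(3)] active_sum[OF assms(4)] b_def by (simp add: sum_negf)
  also have "\<dots> = (\<Sum>B\<in>d. \<Sum>v\<in>B. b v)" using sum_partition[OF part finite_vertices] by metis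
  also have "\<dots> = (\<Sum>B\<in>d. (if B \<in> cups d then 2 else 0) + (if B \<in> caps d then - 2 else 0))"
    using blocks sub(3) by (intro sum.cong refl) auto
  also have "\<dots> = (\<Sum>B\<in>d. if B \<in> cups d then 2 else 0) + (\<Sum>B\<in>d. if B \<in> caps d then - 2 else 0)"
    by (rule sum.distrib)
  also have "\<dots> = (\<Sum>B\<in>cups d. 2) + (\<Sum>B\<in>caps d. - 2)"
    using sub fin by (simp only: sum.inter_restrict[symmetric] inf.absorb2)
  finally show "int (active w') - int (active w) = 2 * int (card (cups d)) - 2 * int (card (caps d))"
    by simp
qed

section \<open>Spanning and independence\<close>

text \<open>Elimination of an index a with h largest: no other row meets the column a, so the
  equation at a determines c a, and a smaller triangular system remains.\<close>

lemma triangular_solvable: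
  fixes M :: "'i \<Rightarrow> 'i \<Rightarrow> 'a::field" and h :: "'i \<Rightarrow> nat"
  assumes "finite I" "\<And>i. i \<in> I \<Longrightarrow> M i i \<noteq> 0"
    "\<And>i j. i \<in> I \<Longrightarrow> j \<in> I \<Longrightarrow> M i j \<noteq> 0 \<Longrightarrow> i = j \<or> h j < h i"
  shows "\<exists>c. \<forall>j\<in>I. (\<Sum>i\<in>I. c i * M i j) = g j"
    and "(\<forall>j\<in>I. (\<Sum>i\<in>I. c i * M i j) = 0) \<Longrightarrow> \<forall>i\<in>I. c i = 0"
proof -
  have "(\<exists>c. \<forall>j\<in>I. (\<Sum>i\<in>I. c i * M i j) = g j) \<and>
    (\<forall>c. (\<forall>j\<in>I. (\<Sum>i\<in>I. c i * M i j) = 0) \<longrightarrow> (\<forall>i\<in>I. c i = 0))" for g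
    using assms
  proof (induction "card I" arbitrary: I g rule: less_induct)
    case less
    show ?case
    proof (cases "I = {}")
      case False
      define m where "m = Max (h ` I)"
      have "m \<in> h ` I" unfolding m_def using False less.prems(1) by (intro Max_in) auto
      then obtain a where a: "a \<in> I" "h a = m" by auto
      have le: "h i \<le> h a" if "i \<in> I" for i unfolding a(2) m_def using that less.prems(1) by (intro Max_ge) auto
      have col: "(\<Sum>i\<in>I. c i * M i a) = c a * M a a" for c
      proof -
        have "(\<Sum>i\<in>I. c i * M i a) = (\<Sum>i\<in>{a}. c i * M i a)"
        proof (rule sum.mono_neutral_right)
          show "\<forall>i\<in>I - {a}. c i * M i a = 0"
          proof
            fix i assume "i \<in> I - {a}"
            then show "c i * M i a = 0" using less.prems(3)[of i a] le[of i] a(1) by auto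
          qed
        qed (use a less.prems(1) in auto)
        then show ?thesis by simp
      qed
      let ?J = "I - {a}"
      have split: "(\<Sum>i\<in>I. c i * M i j) = c a * M a j + (\<Sum>i\<in>?J. c i * M i j)" for c j
        using less.prems(1) a(1) by (rule sum.remove)
      have IH: "(\<exists>c. \<forall>j\<in>?J. (\<Sum>i\<in>?J. c i * M i j) = g' j) \<and>
          (\<forall>c. (\<forall>j\<in>?J. (\<Sum>i\<in>?J. c i * M i j) = 0) \<longrightarrow> (\<forall>i\<in>?J. c i = 0))" for g'
        using less.prems card_Diff1_less[OF less.prems(1) a(1)] by (intro less.hyps) auto
      define ca where "ca = g a / M a a"
      obtain c where c: "\<forall>j\<in>?J. (\<Sum>i\<in>?J. c i * M i j) = g j - ca * M a j"
        using IH[of "\<lambda>j. g j - ca * M a j"] by blast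
      have "(\<Sum>i\<in>I. (c(a := ca)) i * M i j) = g j" if j: "j \<in> I" for j
      proof (cases "j = a")
        case True
        then show ?thesis using col[of "c(a := ca)"] less.prems(2)[OF a(1)] by (simp add: ca_def)
      next
        case False
        have "(\<Sum>i\<in>?J. (c(a := ca)) i * M i j) = (\<Sum>i\<in>?J. c i * M i j)" by (intro sum.cong) auto
        then show ?thesis using split[of "c(a := ca)" j] c j False by simp
      qed
      moreover have "\<forall>i\<in>I. e i = 0" if e: "\<forall>j\<in>I. (\<Sum>i\<in>I. e i * M i j) = 0" for e
      proof -
        have "e a = 0" using e a(1) col[of e] less.prems(2)[OF a(1)] by auto
        then have "\<forall>j\<in>?J. (\<Sum>i\<in>?J. e i * M i j) = 0" using e split[of e] by simp
        then show ?thesis using IH \<open>e a = 0\<close> by blast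
      qed
      ultimately show ?thesis by blast
    qed simp
  qed
  then show "\<exists>c. \<forall>j\<in>I. (\<Sum>i\<in>I. c i * M i j) = g j"
    "(\<forall>j\<in>I. (\<Sum>i\<in>I. c i * M i j) = 0) \<Longrightarrow> \<forall>i\<in>I. c i = 0" by blast+
qed

text \<open>
  The word obtained from a diagram by labelling every edge, drawn as an arc over the row
  \<open>1, \<dots>, k, k', \<dots>, 1'\<close>, with \<open>Neg\<close> at its left and \<open>Pos\<close> at its right end.
\<close>

definition arc_word :: "nat \<Rightarrow> diagram \<Rightarrow> basis list" where
  "arc_word k d = map (arc_letter ((`) (circ k) ` d)) [1..<2 * k + 1]"

lemma length_arc_word [simp]: "length (arc_word k d) = 2 * k"
  by (simp add: arc_word_def)

lemma label_arc_word: "p \<in> {1..2 * k} \<Longrightarrow> label (arc_word k d) p = arc_letter ((`) (circ k) ` d) p"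
  by (auto simp: label_def arc_word_def simp del: upt_Suc)

lemma label_eq_imp_eq:
  assumes "length z = n" "length z' = n" "\<And>p. p \<in> {1..n} \<Longrightarrow> label z p = label z' p"
  shows "z = z'"
proof (rule nth_equalityI)
  fix i assume "i < length z"
  then show "z ! i = z' ! i" using assms(3)[of "Suc i"] assms(1) by (simp add: label_def)
qed (use assms in simp)

lemma motzkin_eqI:
  assumes "d \<in> motzkin_diagrams k" "d' \<in> motzkin_diagrams k" "(`) (circ k) ` d = (`) (circ k) ` d'"
  shows "d = d'"
proof -
  have V: "B \<subseteq> vertices k" if "B \<in> d \<union> d'" for B
    using that assms(1,2) unfolding motzkin_diagrams_def partition_on_def by auto
  have inj: "B = B'" if "B \<in> d \<union> d'" "B' \<in> d \<union> d'" "circ k ` B = circ k ` B'" for B B'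
    using inj_on_image_eq_iff[OF inj_on_circ V V] that by blast
  have "B \<in> d'" if "B \<in> d" for B
  proof -
    have "circ k ` B \<in> (`) (circ k) ` d'" using that assms(3) by blast
    then show ?thesis using inj that by blast
  qed
  moreover have "B \<in> d" if "B \<in> d'" for B
  proof -
    have "circ k ` B \<in> (`) (circ k) ` d" using that assms(3) by blast
    then show ?thesis using inj that by blast
  qed
  ultimately show ?thesis by blast
qed

lemma arc_word_inject:
  assumes "d \<in> motzkin_diagrams k" "d' \<in> motzkin_diagrams k" "arc_word k d = arc_word k d'"
  shows "d = d'"
proof (rule motzkin_eqI[OF assms(1,2)])
  show "(`) (circ k) ` d = (`) (circ k) ` d'"
    using arc_letter_inject[OF motzkin_planar[OF assms(1)] motzkin_planar[OF assms(2)]] label_arc_word assms(3)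
    by metis
qed

text \<open>A ballot word of weight zero is a bracket sequence; its matching is pulled back to a
  diagram along the inverse of \<open>circ\<close>.\<close>

lemma arc_word_surj:
  assumes "suffix_ballot z" "weight z = 0" "length z = 2 * k"
  shows "\<exists>d\<in>motzkin_diagrams k. arc_word k d = z"
proof -
  obtain D where D: "planar_matching {1..2 * k} D" "\<And>p. p \<in> {1..2 * k} \<Longrightarrow> arc_letter D p = label z p"
    using suffix_ballot_matching[OF assms(1,2)] unfolding assms(3) by blast
  define f where "f = the_inv_into (vertices k) (circ k)"
  have f: "inj_on f {1..2 * k}" "f ` {1..2 * k} = vertices k" "\<And>p. p \<in> {1..2 * k} \<Longrightarrow> circ k (f p) = p"
    unfolding f_def using inj_on_the_inv_into[OF inj_on_circ[of k]] the_inv_into_onto[OF inj_on_circ[of k]]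
      f_the_inv_into_f[OF inj_on_circ[of k]] circ_image_vertices[of k] by auto
  define d where "d = (`) f ` D"
  have part: "partition_on {1..2 * k} D" using D(1) unfolding planar_matching_def by simp
  have img: "(`) (circ k) ` d = D"
  proof -
    have "circ k ` f ` B = B" if B: "B \<in> D" for B
    proof -
      have "\<And>p. p \<in> B \<Longrightarrow> circ k (f p) = p" using matching_finite(4)[OF D(1) B] f(3) by blast
      then show ?thesis by (simp add: image_image)
    qed
    then show ?thesis unfolding d_def by (simp add: image_image)
  qed
  have "partition_on (vertices k) d"
    unfolding d_def f(2)[symmetric] by (rule partition_on_image[OF part f(1)])
  then have m: "d \<in> motzkin_diagrams k" using motzkinI D(1) img by metis
  have "arc_word k d = z"
    by (rule label_eq_imp_eq[of _ "2 * k"]) (use assms(3) D(2) img label_arc_word in auto)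
  then show ?thesis using m by blast
qed

text \<open>Unlike \<open>bend\<close> it omits the division by \<open>fold_wts\<close>; this is
  enough for triangularity, where only the vanishing of entries counts, and for solving linear
  systems.\<close>

definition bent :: "nat \<Rightarrow> (basis list \<Rightarrow> basis list \<Rightarrow> 'a) \<Rightarrow> basis list \<Rightarrow> 'a" where
  "bent k T z = T (take k z) (dual (drop k z))"

lemma bent_diagram_mat:
  "length z = 2 * k \<Longrightarrow> bent k (diagram_mat t k d) z = fold_wts t (drop k z) * matching_wt t ((`) (circ k) ` d) (label z)"
  by (simp add: bent_def diagram_mat_def)

lemma label_halves:
  assumes "length z = 2 * k" "i \<in> {1..k}"
  shows "take k z ! (i - 1) = label z (circ k (Top i))" "dual (drop k z) ! (i - 1) = neg (label z (circ k (Bot i)))"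
proof -
  show "take k z ! (i - 1) = label z (circ k (Top i))" using assms by (auto simp: label_def)
  have "k + (k - 1 - (i - 1)) = 2 * k + 1 - i - 1" "i - 1 < k" using assms by auto
  then show "dual (drop k z) ! (i - 1) = neg (label z (circ k (Bot i)))"
    using assms by (simp add: label_def nth_dual)
qed

text \<open>An end of a horizontal edge gets an active letter, so the truncations in
  \<open>tilde_mat\<close> do not kill the diagonal entry at the arc word.\<close>

lemma arc_word_strict:
  assumes "d \<in> motzkin_diagrams k" "v \<in> \<Union>(cups d \<union> caps d)" "v \<in> vertices k"
  shows "label (arc_word k d) (circ k v) \<noteq> Nul"
proof -
  obtain B where B: "B \<in> d" "card B = 2" "v \<in> B" using assms(2) unfolding cups_def caps_def by auto
  have V: "B \<subseteq> vertices k" using B(1) assms(1) unfolding motzkin_diagrams_def partition_on_def by auto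
  have pm: "planar_matching {1..2 * k} ((`) (circ k) ` d)" using motzkin_planar[OF assms(1)] .
  then have part: "partition_on {1..2 * k} ((`) (circ k) ` d)" unfolding planar_matching_def by simp
  have p: "circ k v \<in> {1..2 * k}" using circ_image_vertices assms(3) by blast
  have c2: "card (circ k ` B) = 2" using B(2) V inj_on_circ by (metis card_image inj_on_subset)
  have "{circ k v} \<notin> (`) (circ k) ` d"
  proof
    assume "{circ k v} \<in> (`) (circ k) ` d"
    then have "{circ k v} = circ k ` B"
      using partition_block_unique[OF part, of "{circ k v}" "circ k ` B" "circ k v"] B by auto
    then show False using c2 by (metis card.empty card_insert_disjoint empty_iff finite.emptyI numeral_eq_one_iff One_nat_def semiring_norm(85))
  qed
  then show ?thesis using arc_letter_single[OF pm p] label_arc_word[OF p] by simp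
qed

lemma bent_tilde_mat_diag:
  assumes "t \<noteq> 0" "d \<in> motzkin_diagrams k"
  shows "bent k (tilde_mat t k d) (arc_word k d) \<noteq> 0"
proof -
  let ?z = "arc_word k d"
  have pm: "planar_matching {1..2 * k} ((`) (circ k) ` d)" using motzkin_planar[OF assms(2)] .
  have "matching_wt t ((`) (circ k) ` d) (label ?z) = matching_wt t ((`) (circ k) ` d) (arc_letter ((`) (circ k) ` d))"
    by (rule matching_wt_cong[OF pm label_arc_word])
  then have "bent k (diagram_mat t k d) ?z \<noteq> 0"
    unfolding bent_diagram_mat[OF length_arc_word] using matching_wt_arc_letter[OF assms(1) pm] assms(1) by simp
  moreover have "take k ?z ! (i - 1) \<noteq> Nul" if "i \<in> {1..k}" "Top i \<in> \<Union>(cups d)" for i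
    using arc_word_strict[OF assms(2), of "Top i"] that
    unfolding label_halves(1)[OF length_arc_word that(1)] by (auto simp: vertices_def)
  moreover have "dual (drop k ?z) ! (i - 1) \<noteq> Nul" if "i \<in> {1..k}" "Bot i \<in> \<Union>(caps d)" for i
  proof -
    have "label ?z (circ k (Bot i)) \<noteq> Nul"
      using arc_word_strict[OF assms(2), of "Bot i"] that by (auto simp: vertices_def)
    then show ?thesis unfolding label_halves(2)[OF length_arc_word that(1)] by (metis neg.simps(2) neg_neg)
  qed
  ultimately show ?thesis unfolding bent_def tilde_mat_def by auto
qed

lemma bent_tilde_mat_height:
  assumes "t \<noteq> 0" "d \<in> motzkin_diagrams k" "length z = 2 * k" "bent k (tilde_mat t k d) z \<noteq> 0"
  shows "z = arc_word k d \<or> height {1..2 * k} (label z) < height {1..2 * k} (label (arc_word k d))"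
proof -
  have pm: "planar_matching {1..2 * k} ((`) (circ k) ` d)" using motzkin_planar[OF assms(2)] .
  have "bent k (diagram_mat t k d) z \<noteq> 0" using assms(4) unfolding bent_def tilde_mat_def by auto
  then have "matching_wt t ((`) (circ k) ` d) (label z) \<noteq> 0" unfolding bent_diagram_mat[OF assms(3)] by auto
  from matching_wt_height[OF assms(1) pm this] show ?thesis
  proof
    assume "\<forall>p\<in>{1..2 * k}. label z p = arc_letter ((`) (circ k) ` d) p"
    then have "z = arc_word k d" by (intro label_eq_imp_eq[OF assms(3)]) (auto simp: label_arc_word)
    then show ?thesis ..
  next
    assume "height {1..2 * k} (label z) < height {1..2 * k} (arc_letter ((`) (circ k) ` d))"
    moreover have "height {1..2 * k} (label (arc_word k d)) = height {1..2 * k} (arc_letter ((`) (circ k) ` d))"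
      unfolding height_def by (intro sum.cong) (auto simp: label_arc_word)
    ultimately show ?thesis by simp
  qed
qed

lemma finite_motzkin_diagrams: "finite (motzkin_diagrams k)"
proof (rule finite_subset)
  show "motzkin_diagrams k \<subseteq> Pow (Pow (vertices k))"
    unfolding motzkin_diagrams_def partition_on_def by auto
qed (simp add: finite_vertices)

lemma finite_balanced: "finite (balanced_diagrams k)"
  unfolding balanced_diagrams_def using finite_motzkin_diagrams by simp

lemma balanced_triangular:
  assumes "t \<noteq> 0"
  shows "\<And>d. d \<in> balanced_diagrams k \<Longrightarrow> bent k (tilde_mat t k d) (arc_word k d) \<noteq> 0"
    and "\<And>d e. d \<in> balanced_diagrams k \<Longrightarrow> e \<in> balanced_diagrams k \<Longrightarrow>
      bent k (tilde_mat t k d) (arc_word k e) \<noteq> 0 \<Longrightarrow>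
      d = e \<or> height {1..2 * k} (label (arc_word k e)) < height {1..2 * k} (label (arc_word k d))"
proof -
  show "bent k (tilde_mat t k d) (arc_word k d) \<noteq> 0" if "d \<in> balanced_diagrams k" for d
    using bent_tilde_mat_diag[OF assms] that unfolding balanced_diagrams_def by auto
  show "d = e \<or> height {1..2 * k} (label (arc_word k e)) < height {1..2 * k} (label (arc_word k d))"
    if "d \<in> balanced_diagrams k" "e \<in> balanced_diagrams k" "bent k (tilde_mat t k d) (arc_word k e) \<noteq> 0" for d e
    using bent_tilde_mat_height[OF assms _ length_arc_word that(3)] arc_word_inject[of e k d] that(1,2)
    unfolding balanced_diagrams_def by auto
qed

lemma tilde_mat_independent:
  assumes "t \<noteq> 0"
    "\<And>w' w. length w' = k \<Longrightarrow> length w = k \<Longrightarrow> (\<Sum>d\<in>balanced_diagrams k. c d * tilde_mat t k d w' w) = 0"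
  shows "\<forall>d\<in>balanced_diagrams k. c d = 0"
proof (rule triangular_solvable(2)[OF finite_balanced])
  show "\<forall>e\<in>balanced_diagrams k. (\<Sum>d\<in>balanced_diagrams k. c d * bent k (tilde_mat t k d) (arc_word k e)) = 0"
    using assms(2) unfolding bent_def by simp
qed (fact balanced_triangular[OF assms(1)])+

text \<open>
  Subtracting a combination of the \<open>tilde_mat t k d\<close> that agrees with \<open>T\<close> on all arc words leaves,
  after bending, a highest weight vector that vanishes on all suffix ballot words.
\<close>

lemma tilde_mat_spans:
  assumes "generic t" "commutes_raising t k T"
    "\<And>w' w. length w' = k \<Longrightarrow> length w = k \<Longrightarrow> T w' w \<noteq> 0 \<Longrightarrow> weight w' = weight w \<and> active w' = active w"
  shows "\<exists>c. \<forall>w' w. length w' = k \<longrightarrow> length w = k \<longrightarrow> T w' w = (\<Sum>d\<in>balanced_diagrams k. c d * tilde_mat t k d w' w)"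
proof -
  have t: "t \<noteq> 0" using assms(1) unfolding generic_def by simp
  have "\<exists>c. \<forall>e\<in>balanced_diagrams k.
      (\<Sum>d\<in>balanced_diagrams k. c d * bent k (tilde_mat t k d) (arc_word k e)) = bent k T (arc_word k e)"
    by (rule triangular_solvable(1)[OF finite_balanced]) (fact balanced_triangular[OF t])+
  then obtain c where c: "\<forall>e\<in>balanced_diagrams k.
      (\<Sum>d\<in>balanced_diagrams k. c d * bent k (tilde_mat t k d) (arc_word k e)) = bent k T (arc_word k e)" ..
  define S where "S = (\<lambda>w' w. T w' w - (\<Sum>d\<in>balanced_diagrams k. c d * tilde_mat t k d w' w))"
  have bal: "d \<in> motzkin_diagrams k" "card (cups d) = card (caps d)" if "d \<in> balanced_diagrams k" for d
    using that unfolding balanced_diagrams_def by auto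
  have pres: "weight w' = weight w \<and> active w' = active w" if "length w' = k" "length w = k" "S w' w \<noteq> 0" for w' w
  proof (cases "T w' w = 0")
    case True
    then have "(\<Sum>d\<in>balanced_diagrams k. c d * tilde_mat t k d w' w) \<noteq> 0" using that unfolding S_def by auto
    then obtain d where d: "d \<in> balanced_diagrams k" "c d * tilde_mat t k d w' w \<noteq> 0"
      by (rule sum.not_neutral_contains_not_neutral)
    then show ?thesis using tilde_mat_nonzero[OF t bal(1)[OF d(1)] that(1,2)] bal(2)[OF d(1)] by auto
  next
    case False then show ?thesis using assms(3) that by blast
  qed
  have "commutes_raising t k S"
    unfolding commutes_raising_def
  proof (intro allI impI)
    fix x w :: "basis list" assume xw: "length x = k" "length w = k"
    have "raising t (\<lambda>u. S u w) x = raising t (\<lambda>u. T u w + (\<Sum>d\<in>balanced_diagrams k. - c d * tilde_mat t k d u w)) x"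
      unfolding S_def by (simp add: sum_negf)
    also have "\<dots> = raising t (\<lambda>u. T u w) x + (\<Sum>d\<in>balanced_diagrams k. - c d * raising t (\<lambda>u. tilde_mat t k d u w) x)"
      by (simp only: raise_add raise_sum raise_scale)
    also have "\<dots> = coraising t (T x) w + (\<Sum>d\<in>balanced_diagrams k. - c d * coraising t (tilde_mat t k d x) w)"
      using assms(2) tilde_mat_commutes_raising[OF t bal(1)] xw unfolding commutes_raising_def by simp
    also have "\<dots> = coraising t (\<lambda>u. T x u + (\<Sum>d\<in>balanced_diagrams k. - c d * tilde_mat t k d x u)) w"
      by (simp only: coraise_add coraise_sum coraise_scale)
    also have "\<dots> = coraising t (S x) w" unfolding S_def by (simp add: sum_negf)
    finally show "raising t (\<lambda>u. S u w) x = coraising t (S x) w" .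
  qed
  then have rb: "raising t (bend t k S) = (\<lambda>x. 0)" using raise_bend_eq_0_iff[OF t] by blast
  have wt: "weight z = 0 \<and> active (take k z) = active (dual (drop k z))"
    if "length z = 2 * k" "S (take k z) (dual (drop k z)) \<noteq> 0" for z
  proof -
    have "weight (take k z) = weight (dual (drop k z))" "active (take k z) = active (dual (drop k z))"
      using pres[of "take k z" "dual (drop k z)"] that by auto
    moreover have "weight z = weight (take k z) + weight (drop k z)"
      using weight_simps(3)[of "take k z" "drop k z"] by simp
    ultimately show ?thesis by simp
  qed
  have b0: "bend t k S = (\<lambda>x. 0)"
  proof (rule highest_weight_unique[OF assms(1) _ rb])
    show "homog (2 * k) 0 (bend t k S)"
      unfolding homog_def bend_def using wt by (auto split: if_splits)
    fix z assume z: "suffix_ballot z"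
    show "bend t k S z = 0"
    proof (rule ccontr)
      assume nz: "bend t k S z \<noteq> 0"
      then have len: "length z = 2 * k" and Snz: "S (take k z) (dual (drop k z)) \<noteq> 0"
        unfolding bend_def by (auto split: if_splits)
      then obtain d where d: "d \<in> motzkin_diagrams k" "arc_word k d = z"
        using arc_word_surj[OF z] wt by blast
      \<comment> \<open>At its own arc word the entry of d is nonzero, and S, which is nonzero
        there, preserves the number of active letters. Comparing both counts shows that d is
        balanced; then c was chosen so that S vanishes at z.\<close>
      have "tilde_mat t k d (take k z) (dual (drop k z)) \<noteq> 0"
        using bent_tilde_mat_diag[OF t d(1)] d(2) unfolding bent_def by simp
      then have "int (active (take k z)) - int (active (dual (drop k z))) = 2 * int (card (cups d)) - 2 * int (card (caps d))"
        using len by (intro tilde_mat_nonzero(2)[OF t d(1)]) auto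
      then have "d \<in> balanced_diagrams k" unfolding balanced_diagrams_def using d(1) wt[OF len Snz] by simp
      then have "S (take k z) (dual (drop k z)) = 0" using c d(2) unfolding S_def bent_def by auto
      then show False using Snz by simp
    qed
  qed
  have "S w' w = 0" if "length w' = k" "length w = k" for w' w
    using fun_cong[OF b0, of "w' @ dual w"] that t by (simp add: bend_def)
  then show ?thesis unfolding S_def by (intro exI[of _ c]) auto
qed

section \<open>The isomorphism\<close>

fun sgn_word :: "'a::field \<Rightarrow> basis list \<Rightarrow> 'a" where
  "sgn_word s [] = 1"
| "sgn_word s (b # w) = (if b = Pos then (- s) ^ active w else 1) * sgn_word s w"

text \<open>
  Each active letter to the right of a \<open>Pos\<close> contributes \<open>- s\<close>; conjugation with these signs turns
  the parameter \<open>- s * q\<close>, for which \<open>\<delta> = 1 - t - 1 / t\<close>, into \<open>q\<close>.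
\<close>

definition twist :: "'a::field \<Rightarrow> (basis list \<Rightarrow> basis list \<Rightarrow> 'a) \<Rightarrow> basis list \<Rightarrow> basis list \<Rightarrow> 'a" where
  "twist s T w' w = sgn_word s w' * T w' w * sgn_word s w"

lemma sign_power_square: "s * s = 1 \<Longrightarrow> (- s) ^ n * (- s) ^ n = (1 :: 'a::field)"
  by (simp flip: power_mult_distrib)

lemma sgn_word_square:
  assumes "s * s = (1 :: 'a::field)"
  shows "sgn_word s w * sgn_word s w = 1"
proof (induction w)
  case (Cons b w)
  have "sgn_word s (b # w) * sgn_word s (b # w) =
      (if b = Pos then (- s) ^ active w * (- s) ^ active w else 1) * (sgn_word s w * sgn_word s w)"
    by (simp add: mult_ac)
  then show ?case using Cons sign_power_square[OF assms] by simp
qed simp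

text \<open>A letter of the common prefix sees what follows only through its number of active
  letters, so its signs occur in squares.\<close>

lemma sgn_word_append:
  assumes "s * s = (1 :: 'a::field)" "active z = active z'"
  shows "sgn_word s (a @ z) * sgn_word s (a @ z') = sgn_word s z * sgn_word s z'"
proof (induction a)
  case (Cons b a)
  have "sgn_word s ((b # a) @ z) * sgn_word s ((b # a) @ z') =
      (if b = Pos then (- s) ^ active (a @ z) * (- s) ^ active (a @ z) else 1) * (sgn_word s (a @ z) * sgn_word s (a @ z'))"
    using assms(2) by (simp add: mult_ac)
  then show ?case using Cons sign_power_square[OF assms(1)] by simp
qed simp

lemma active_nul_pattern: "active w = length (filter Not (nul_pattern w))"
  by (induction w) auto

lemma raise_active: "raising t (\<lambda>y. \<phi> (active y) * v y) x = \<phi> (active x) * raising t v x"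
  using raise_pattern[of t "\<lambda>p. \<phi> (length (filter Not p))" v x] unfolding active_nul_pattern .

lemma coraise_active: "coraising t (\<lambda>y. \<phi> (active y) * v y) x = \<phi> (active x) * coraising t v x"
  using coraise_pattern[of t "\<lambda>p. \<phi> (length (filter Not p))" v x] unfolding active_nul_pattern .

text \<open>As s is its own inverse, passing from q to - s q multiplies the K-weight of both
  \<open>Pos\<close> and \<open>Neg\<close> by - s.\<close>

lemma k_wts_sign:
  assumes "s * s = (1 :: 'a::field)"
  shows "k_wts (- s * q) w = (- s) ^ active w * k_wts q w"
proof (induction w)
  case (Cons b w)
  have "inverse s = s" using assms by (metis inverse_unique)
  then show ?case using Cons by (cases b) (simp_all add: mult_ac)
qed simp

text \<open>Putting \<open>Pos\<close> instead of \<open>Neg\<close> in front of x changes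
  \<open>sgn_word\<close> by (- s)^(active x), which is precisely the sign between the two versions
  of K on x.\<close>

lemma raise_sgn_word:
  assumes "s * s = (1 :: 'a::field)"
  shows "raising q (\<lambda>y. sgn_word s y * v y) x = sgn_word s x * raising (- s * q) v x"
proof (induction x arbitrary: v)
  case (Cons a x)
  have "raising q (\<lambda>y. sgn_word s (a # y) * v (a # y)) x =
      raising q (\<lambda>y. (\<lambda>n. if a = Pos then (- s) ^ n else 1) (active y) * (sgn_word s y * v (a # y))) x"
    by (simp add: mult.assoc)
  also have "\<dots> = (if a = Pos then (- s) ^ active x else 1) * (sgn_word s x * raising (- s * q) (\<lambda>y. v (a # y)) x)"
    using raise_active[of q "\<lambda>n. if a = Pos then (- s) ^ n else 1" "\<lambda>y. sgn_word s y * v (a # y)" x] unfolding Cons .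
  finally have 1: "raising q (\<lambda>y. sgn_word s (a # y) * v (a # y)) x =
      sgn_word s (a # x) * raising (- s * q) (\<lambda>y. v (a # y)) x" by simp
  have sq: "(- s) ^ n * ((- s) ^ n * c) = c" for n c
    by (simp only: mult.assoc[symmetric] sign_power_square[OF assms] mult_1_left)
  have "sgn_word s (Pos # x) * k_wts (- s * q) x = (- s) ^ active x * ((- s) ^ active x * (k_wts q x * sgn_word s x))"
    unfolding k_wts_sign[OF assms] by (simp only: sgn_word.simps refl if_True mult_ac)
  then have "k_wts q x * sgn_word s (Neg # x) = sgn_word s (Pos # x) * k_wts (- s * q) x"
    unfolding sq by (simp only: sgn_word.simps basis.distinct if_False mult_1_left)
  then show ?case
    unfolding raising.simps 1 by (cases "a = Pos") (simp_all add: algebra_simps del: sgn_word.simps)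
qed simp

lemma coraise_sgn_word:
  assumes "s * s = (1 :: 'a::field)"
  shows "coraising q (\<lambda>y. sgn_word s y * v y) x = sgn_word s x * coraising (- s * q) v x"
proof (induction x arbitrary: v)
  case (Cons a x)
  have "coraising q (\<lambda>y. sgn_word s (a # y) * v (a # y)) x =
      coraising q (\<lambda>y. (\<lambda>n. if a = Pos then (- s) ^ n else 1) (active y) * (sgn_word s y * v (a # y))) x"
    by (simp add: mult.assoc)
  also have "\<dots> = (if a = Pos then (- s) ^ active x else 1) * (sgn_word s x * coraising (- s * q) (\<lambda>y. v (a # y)) x)"
    using coraise_active[of q "\<lambda>n. if a = Pos then (- s) ^ n else 1" "\<lambda>y. sgn_word s y * v (a # y)" x] unfolding Cons .
  finally have 1: "coraising q (\<lambda>y. sgn_word s (a # y) * v (a # y)) x =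
      sgn_word s (a # x) * coraising (- s * q) (\<lambda>y. v (a # y)) x" by simp
  have "k_wts q x * sgn_word s (Pos # x) = sgn_word s (Neg # x) * k_wts (- s * q) x"
    unfolding k_wts_sign[OF assms] by (simp add: mult_ac)
  then show ?case
    unfolding coraising.simps 1 by (cases "a = Neg") (simp_all add: algebra_simps del: sgn_word.simps)
qed simp

lemma sgn_word_nonzero: "s * s = (1 :: 'a::field) \<Longrightarrow> sgn_word s w \<noteq> 0"
  using sgn_word_square[of s w] by auto

lemma twist_twist: "s * s = (1 :: 'a::field) \<Longrightarrow> twist s (twist s T) = T"
proof (intro ext)
  fix w' w assume s: "s * s = 1"
  have "twist s (twist s T) w' w = (sgn_word s w' * sgn_word s w') * T w' w * (sgn_word s w * sgn_word s w)"
    by (simp add: twist_def mult_ac)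
  then show "twist s (twist s T) w' w = T w' w" using sgn_word_square[OF s] by simp
qed

text \<open>Conjugation by signs carries the raising operator at - s q to the one at q; the nonzero
  signs factor out of every matrix entry.\<close>

lemma commutes_raising_twist:
  assumes "s * s = (1 :: 'a::field)"
  shows "commutes_raising q k (twist s T) \<longleftrightarrow> commutes_raising (- s * q) k T"
proof -
  have "raising q (\<lambda>u. twist s T u w) x = sgn_word s x * sgn_word s w * raising (- s * q) (\<lambda>u. T u w) x" for x w
  proof -
    have "raising q (\<lambda>u. twist s T u w) x = raising q (\<lambda>u. sgn_word s w * (sgn_word s u * T u w)) x"
      by (simp add: twist_def mult_ac)
    then show ?thesis unfolding raise_scale raise_sgn_word[OF assms] by (simp add: mult_ac)
  qed
  moreover have "coraising q (twist s T x) w = sgn_word s x * sgn_word s w * coraising (- s * q) (T x) w" for x w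
  proof -
    have "coraising q (twist s T x) w = coraising q (\<lambda>u. sgn_word s x * (sgn_word s u * T x u)) w"
      by (simp add: twist_def[abs_def] mult_ac)
    then show ?thesis unfolding coraise_scale coraise_sgn_word[OF assms] by (simp add: mult_ac)
  qed
  ultimately show ?thesis
    unfolding commutes_raising_def using sgn_word_nonzero[OF assms] by simp
qed

section \<open>Matrices commuting with the quantum group\<close>

definition npos :: "basis list \<Rightarrow> nat" where "npos w = length (filter (\<lambda>b. b = Pos) w)"
definition nneg :: "basis list \<Rightarrow> nat" where "nneg w = length (filter (\<lambda>b. b = Neg) w)"

lemma npos_nneg: "int (active w) = int (npos w) + int (nneg w)" "weight w = int (npos w) - int (nneg w)"
proof -
  have "int (active w) = int (npos w) + int (nneg w) \<and> weight w = int (npos w) - int (nneg w)"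
  proof (induction w)
    case (Cons a w) then show ?case by (cases a) (auto simp: npos_def nneg_def)
  qed (simp add: npos_def nneg_def)
  then show "int (active w) = int (npos w) + int (nneg w)" "weight w = int (npos w) - int (nneg w)" by auto
qed

lemma word_wt_counts:
  "word_wt q K1 w = q ^ npos w" "word_wt q K1i w = inverse q ^ npos w"
  "word_wt q K2 w = q ^ nneg w" "word_wt q K2i w = inverse q ^ nneg w"
  "word_wt q E w = 1" "word_wt q F w = 1"
proof -
  have "word_wt q K1 w = q ^ npos w \<and> word_wt q K1i w = inverse q ^ npos w \<and>
     word_wt q K2 w = q ^ nneg w \<and> word_wt q K2i w = inverse q ^ nneg w \<and> word_wt q E w = 1 \<and> word_wt q F w = 1"
  proof (induction w)
    case (Cons a w) then show ?case by (cases a) (auto simp: npos_def nneg_def)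
  qed (simp add: npos_def nneg_def)
  then show "word_wt q K1 w = q ^ npos w" "word_wt q K1i w = inverse q ^ npos w"
    "word_wt q K2 w = q ^ nneg w" "word_wt q K2i w = inverse q ^ nneg w" "word_wt q E w = 1" "word_wt q F w = 1" by auto
qed

lemma generic_power_inject:
  assumes "generic q" "q ^ a = q ^ b"
  shows "a = b"
proof -
  have False if "a < b" "q ^ a = q ^ b" for a b
  proof -
    have "q ^ b = q ^ a * q ^ (b - a)" using that(1) by (simp flip: power_add)
    then have "q ^ (b - a) = 1" using that assms(1) unfolding generic_def by simp
    then show False using that assms(1) unfolding generic_def by auto
  qed
  then show ?thesis using assms(2) by (metis linorder_neqE_nat)
qed

text \<open>Weight and number of active letters together determine the numbers of \<open>Pos\<close>
  and \<open>Neg\<close>, that is, the joint eigenspace of K1 and K2.\<close>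

definition preserves_type :: "nat \<Rightarrow> (basis list \<Rightarrow> basis list \<Rightarrow> 'a::field) \<Rightarrow> bool" where
  "preserves_type k T \<longleftrightarrow> (\<forall>w' w. length w' = k \<longrightarrow> length w = k \<longrightarrow> T w' w \<noteq> 0 \<longrightarrow>
     weight w' = weight w \<and> active w' = active w)"

text \<open>The generators K1, K2 and their inverses are covered by preservation of types, E by
  assumption, and F by \<open>commutes_lowering\<close>.\<close>

lemma commutes_free_op:
  assumes "generic q" "commutes_raising q k T" "preserves_type k T"
  shows "mat_vec k T (free_op q u v) = free_op q u (mat_vec k T v)"
proof -
  have wp: "weight_preserving k T"
    using assms(3) unfolding weight_preserving_def preserves_type_def by blast
  have gen: "mat_vec k T (gen_op q a v) = gen_op q a (mat_vec k T v)" for a v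
  proof -
    consider "a = E" | "a = F" | "gen_op q a = (\<lambda>v w. word_wt q a w * v w)"
      by (cases a) (auto simp: fun_eq_iff)
    then show ?thesis
    proof cases
      case 1 then show ?thesis using assms(2) unfolding commutes_raising_iff by simp
    next
      case 2 then show ?thesis using commutes_lowering[OF assms(1,2) wp] by simp
    next
      case 3
      have "T x w * (word_wt q a w * v w) = word_wt q a x * (T x w * v w)" if "length x = k" "length w = k" for x w
      proof (cases "T x w = 0")
        case False
        then have "weight x = weight w" "active x = active w" using assms(3) that unfolding preserves_type_def by auto
        then have "npos x = npos w" "nneg x = nneg w" using npos_nneg[of x] npos_nneg[of w] by linarith+
        then have "word_wt q a x = word_wt q a w" by (cases a) (simp_all add: word_wt_counts)
        then show ?thesis by simp
      qed simp
      then show ?thesis unfolding 3 mat_vec_def by (auto simp: fun_eq_iff sum_distrib_left intro!: sum.cong)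
    qed
  qed
  have word: "mat_vec k T (word_op q g v) = word_op q g (mat_vec k T v)" for g v
    by (induction g) (simp_all add: gen)
  show ?thesis
  proof
    fix x
    have "mat_vec k T (free_op q u v) x = (\<Sum>g\<in>Poly_Mapping.keys u. Poly_Mapping.lookup u g * mat_vec k T (word_op q g v) x)"
    proof (cases "length x = k")
      case True
      then show ?thesis
        unfolding mat_vec_def free_op_def lsum_def if_P[OF True] sum_distrib_left
        by (subst sum.swap) (simp add: mult_ac)
    qed (simp add: mat_vec_def)
    then show "mat_vec k T (free_op q u v) x = free_op q u (mat_vec k T v) x"
      unfolding word free_op_def lsum_def .
  qed
qed

text \<open>A nonzero entry forces equal powers of q under K1 and K2, and as q is not a root of
  unity the exponents agree. Basis vectors serve as test vectors.\<close>

lemma free_op_commutes: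
  assumes "generic q" "\<And>u v. mat_vec k T (free_op q u v) = free_op q u (mat_vec k T v)"
  shows "commutes_raising q k T" "preserves_type k T"
proof -
  show "commutes_raising q k T"
    unfolding commutes_raising_iff using assms(2)[of "free_gen E"] by (simp add: free_op_gen)
  show "preserves_type k T"
    unfolding preserves_type_def
  proof (intro allI impI)
    fix w' w assume w: "length w' = k" "length w = k" "T w' w \<noteq> 0"
    let ?v = "\<lambda>u. if u = w then (1 :: 'a) else 0"
    have "T w' w * word_wt q a w = word_wt q a w' * T w' w" if "gen_op q a = (\<lambda>v w. word_wt q a w * v w)" for a
    proof -
      have "mat_vec k T (\<lambda>u. word_wt q a u * ?v u) w' = word_wt q a w' * mat_vec k T ?v w'"
        using assms(2)[of "free_gen a" ?v] unfolding free_op_gen that by (metis (no_types))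
      moreover have "mat_vec k T (\<lambda>u. word_wt q a u * ?v u) w' = mat_vec k T (\<lambda>u. word_wt q a w * ?v u) w'"
        by (rule fun_cong[OF mat_vec_cong]) simp
      ultimately show ?thesis unfolding mat_vec_scale mat_vec_single[OF w(2,1)] by (simp add: mult.commute)
    qed
    from this[of K1] this[of K2] have "q ^ npos w = q ^ npos w'" "q ^ nneg w = q ^ nneg w'"
      using w(3) by (simp_all add: fun_eq_iff word_wt_counts)
    then have "npos w = npos w'" "nneg w = nneg w'" using generic_power_inject[OF assms(1)] by blast+
    then show "weight w' = weight w \<and> active w' = active w"
      using npos_nneg[of w] npos_nneg[of w'] by linarith
  qed
qed

lemma act_on_maps: "q \<noteq> 0 \<Longrightarrow> x \<in> tensor_power k \<Longrightarrow> act_on q k u x \<in> tensor_power k"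
  unfolding act_on_def using free_act_tensor_power by simp

lemma lookup_act_on:
  "q \<noteq> 0 \<Longrightarrow> x \<in> tensor_power k \<Longrightarrow> Poly_Mapping.lookup (act_on q k u x) = free_op q u (Poly_Mapping.lookup x)"
  by (rule ext) (simp add: act_on_def lookup_free_act)

lemma mat_op_commutes_act_on:
  assumes "q \<noteq> 0"
  shows "(\<forall>u. \<forall>x\<in>tensor_power k. mat_op k T (act_on q k u x) = act_on q k u (mat_op k T x)) \<longleftrightarrow>
    (\<forall>u v. mat_vec k T (free_op q u v) = free_op q u (mat_vec k T v))"
proof -
  have l: "Poly_Mapping.lookup (mat_op k T (act_on q k u x)) = mat_vec k T (free_op q u (Poly_Mapping.lookup x))"
    "Poly_Mapping.lookup (act_on q k u (mat_op k T x)) = free_op q u (mat_vec k T (Poly_Mapping.lookup x))"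
    if "x \<in> tensor_power k" for u x
    using lookup_mat_op[OF act_on_maps[OF assms that]] lookup_act_on[OF assms that]
      lookup_act_on[OF assms End_maps[OF mat_op_End that]] lookup_mat_op[OF that] by metis+
  show ?thesis
  proof
    assume L: "\<forall>u. \<forall>x\<in>tensor_power k. mat_op k T (act_on q k u x) = act_on q k u (mat_op k T x)"
    show "\<forall>u v. mat_vec k T (free_op q u v) = free_op q u (mat_vec k T v)"
    proof (intro allI)
      fix u :: "'a free_alg" and v :: "basis list \<Rightarrow> 'a"
      let ?x = "vec_tensor k v"
      have "mat_vec k T (free_op q u (Poly_Mapping.lookup ?x)) = free_op q u (mat_vec k T (Poly_Mapping.lookup ?x))"
        using L l[OF vec_tensor_tensor_power, of u v] by (metis vec_tensor_tensor_power)
      moreover have "mat_vec k T (free_op q u (Poly_Mapping.lookup ?x)) = mat_vec k T (free_op q u v)"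
        by (intro mat_vec_cong free_op_cong) simp
      moreover have "mat_vec k T (Poly_Mapping.lookup ?x) = mat_vec k T v"
        by (intro mat_vec_cong) simp
      ultimately show "mat_vec k T (free_op q u v) = free_op q u (mat_vec k T v)" by simp
    qed
  next
    assume R: "\<forall>u v. mat_vec k T (free_op q u v) = free_op q u (mat_vec k T v)"
    show "\<forall>u. \<forall>x\<in>tensor_power k. mat_op k T (act_on q k u x) = act_on q k u (mat_op k T x)"
      using R l by (intro allI ballI poly_mapping_eqI) metis
  qed
qed

lemma act_on_End:
  assumes "q \<noteq> 0"
  shows "act_on q k u \<in> End_space k"
  unfolding End_space_def
proof (intro CollectI conjI ballI allI)
  show "act_on q k u \<in> tensor_power k \<rightarrow>\<^sub>E tensor_power k"
    using act_on_maps[OF assms] by (auto simp: act_on_def)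
  show "act_on q k u (x + y) = act_on q k u x + act_on q k u y" if "x \<in> tensor_power k" "y \<in> tensor_power k" for x y
  proof (rule poly_mapping_eqI)
    fix w
    have e: "Poly_Mapping.lookup (x + y) = (\<lambda>w. \<Sum>b\<in>{True, False}. 1 * (if b then Poly_Mapping.lookup x w else Poly_Mapping.lookup y w))"
      by (simp add: fun_eq_iff lookup_add)
    have "free_op q u (Poly_Mapping.lookup (x + y)) w = free_op q u (Poly_Mapping.lookup x) w + free_op q u (Poly_Mapping.lookup y) w"
      unfolding e using free_op_sum[of q u "\<lambda>_. 1" "\<lambda>b w. if b then Poly_Mapping.lookup x w else Poly_Mapping.lookup y w" "{True, False}"]
      by simp
    then show "Poly_Mapping.lookup (act_on q k u (x + y)) w = Poly_Mapping.lookup (act_on q k u x + act_on q k u y) w"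
      using that tensor_power_add[OF that] assms by (simp add: lookup_act_on lookup_add)
  qed
  show "act_on q k u (scale c x) = scale c (act_on q k u x)" if "x \<in> tensor_power k" for c x
  proof (rule poly_mapping_eqI)
    fix w
    have e: "Poly_Mapping.lookup (scale c x) = (\<lambda>w. \<Sum>b\<in>{True}. c * Poly_Mapping.lookup x w)" by (simp add: fun_eq_iff)
    have "free_op q u (Poly_Mapping.lookup (scale c x)) w = c * free_op q u (Poly_Mapping.lookup x) w"
      unfolding e using free_op_sum[of q u "\<lambda>_. c" "\<lambda>_. Poly_Mapping.lookup x" "{True}"] by simp
    then show "Poly_Mapping.lookup (act_on q k u (scale c x)) w = Poly_Mapping.lookup (scale c (act_on q k u x)) w"
      using that tensor_power_scale[OF that] assms by (simp add: lookup_act_on)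
  qed
qed

lemma centralizer_act_on:
  assumes "q \<noteq> 0"
  shows "T \<in> centralizer (End_alg k) (range (act_on q k)) \<longleftrightarrow>
    T \<in> End_space k \<and> (\<forall>u. \<forall>x\<in>tensor_power k. T (act_on q k u x) = act_on q k u (T x))"
proof -
  have "compose (tensor_power k) T (act_on q k u) = compose (tensor_power k) (act_on q k u) T \<longleftrightarrow>
      (\<forall>x\<in>tensor_power k. T (act_on q k u x) = act_on q k u (T x))" for u
    by (auto simp: compose_def restrict_def fun_eq_iff)
  then show ?thesis unfolding centralizer_def End_alg_def by auto
qed

text \<open>The matrices are formed at - s q, where loops have the value \<delta>, and then
  conjugated to the parameter q of the given action.\<close>

definition rho :: "'a::field \<Rightarrow> 'a \<Rightarrow> nat \<Rightarrow> (diagram \<Rightarrow>\<^sub>0 'a) \<Rightarrow> 'a tensor \<Rightarrow> 'a tensor" where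
  "rho s q k x = mat_op k (twist s (elt_mat (- s * q) k x))"

lemma mat_op_add:
  "(\<lambda>x\<in>tensor_power k. mat_op k S x + mat_op k T x) = mat_op k (\<lambda>w' w. S w' w + T w' w)"
proof
  fix x
  show "(\<lambda>x\<in>tensor_power k. mat_op k S x + mat_op k T x) x = mat_op k (\<lambda>w' w. S w' w + T w' w) x"
  proof (cases "x \<in> tensor_power k")
    case True
    then show ?thesis
      by (intro poly_mapping_eqI) (simp add: lookup_mat_op lookup_add mat_vec_def algebra_simps sum.distrib)
  qed (simp add: mat_op_def)
qed

lemma mat_op_scale:
  "(\<lambda>x\<in>tensor_power k. scale c (mat_op k T x)) = mat_op k (\<lambda>w' w. c * T w' w)"
proof
  fix x
  show "(\<lambda>x\<in>tensor_power k. scale c (mat_op k T x)) x = mat_op k (\<lambda>w' w. c * T w' w) x"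
  proof (cases "x \<in> tensor_power k")
    case True
    then show ?thesis
      by (intro poly_mapping_eqI) (simp add: lookup_mat_op mat_vec_def sum_distrib_left mult_ac)
  qed (simp add: mat_op_def)
qed

lemma mat_op_one: "(\<lambda>x\<in>tensor_power k. x) = mat_op k (\<lambda>w' w. of_bool (w' = w))"
proof
  fix x
  show "(\<lambda>x\<in>tensor_power k. x) x = mat_op k (\<lambda>w' w. of_bool (w' = w)) x"
  proof (cases "x \<in> tensor_power k")
    case True
    have "Poly_Mapping.lookup x w = mat_vec k (\<lambda>w' w. of_bool (w' = w)) (Poly_Mapping.lookup x) w" for w
    proof (cases "length w = k")
      case l: True
      have "(\<Sum>u\<in>words k. of_bool (w = u) * Poly_Mapping.lookup x u) = (\<Sum>u\<in>words k. if w = u then Poly_Mapping.lookup x u else 0)"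
        by (intro sum.cong) auto
      then show ?thesis using l sum_if_eq_words(2)[OF l, of "Poly_Mapping.lookup x"] by (simp add: mat_vec_def)
    next
      case False
      then show ?thesis using tensor_power_lookup[OF True] by (simp add: mat_vec_def)
    qed
    then show ?thesis using True by (intro poly_mapping_eqI) (simp add: lookup_mat_op)
  qed (simp add: mat_op_def)
qed

section \<open>Comparison with the prescribed local operators\<close>

lemma lookup_splice:
  "Poly_Mapping.lookup (Poly_Mapping.single a 1 * y * Poly_Mapping.single b 1) w' = lsum (\<lambda>u. of_bool (a @ u @ b = w')) y"
  unfolding lookup_eq_lsum[of _ w'] lsum_mult by (simp add: plus_list_def)

text \<open>Reduces the comparison with a matrix to a single column, the value of the local operator
  at a basis word.\<close>

lemma local_op_eq_mat_op:
  assumes "\<And>w' w. length w = k \<Longrightarrow>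
      lsum (\<lambda>u. of_bool (take m w @ u @ drop (m + n) w = w')) (A (take n (drop m w))) = (if length w' = k then T w' w else 0)"
  shows "local_op k m n A = mat_op k T"
proof
  fix x
  show "local_op k m n A x = mat_op k T x"
  proof (cases "x \<in> tensor_power k")
    case True
    show ?thesis
    proof (rule poly_mapping_eqI)
      fix w'
      have "Poly_Mapping.lookup (local_op k m n A x) w' =
          lsum (\<lambda>w. lsum (\<lambda>u. of_bool (take m w @ u @ drop (m + n) w = w')) (A (take n (drop m w)))) x"
        using True by (simp add: local_op_def lookup_lin_ext lookup_splice)
      also have "\<dots> = lsum (\<lambda>w. if length w' = k then T w' w else 0) x"
        using assms True unfolding tensor_power_def by (intro lsum_cong) auto
      also have "\<dots> = (\<Sum>w\<in>words k. Poly_Mapping.lookup x w * (if length w' = k then T w' w else 0))"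
        using True unfolding tensor_power_def by (intro lsum_superset) auto
      also have "\<dots> = mat_vec k T (Poly_Mapping.lookup x) w'"
        by (simp add: mat_vec_def mult.commute)
      finally show "Poly_Mapping.lookup (local_op k m n A x) w' = Poly_Mapping.lookup (mat_op k T x) w'"
        using lookup_mat_op[OF True] by simp
    qed
  qed (simp add: mat_op_def local_op_def)
qed

lemma split_word:
  assumes "length w = k" "i \<in> {1..<k}"
  shows "w = take (i - 1) w @ [w ! (i - 1), w ! i] @ drop (i + 1) w" "take 2 (drop (i - 1) w) = [w ! (i - 1), w ! i]"
    "i - 1 + 2 = i + 1"
proof -
  have "drop (i - 1) w = w ! (i - 1) # w ! i # drop (i + 1) w"
    using assms Cons_nth_drop_Suc[of "i - 1" w] Cons_nth_drop_Suc[of i w] by auto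
  then show "w = take (i - 1) w @ [w ! (i - 1), w ! i] @ drop (i + 1) w" "take 2 (drop (i - 1) w) = [w ! (i - 1), w ! i]"
    using append_take_drop_id[of "i - 1" w] by (auto simp: numeral_2_eq_2)
  show "i - 1 + 2 = i + 1" using assms by auto
qed

lemma rho_p:
  assumes "s * s = 1" "q \<noteq> 0" "j \<in> {1..k}"
  shows "rho s q k (Poly_Mapping.single (p_diagram k j) 1) = local_op k (j - 1) 1 p_op"
  unfolding rho_def
proof (rule local_op_eq_mat_op[symmetric])
  have t: "- s * q \<noteq> 0" using assms(1,2) by auto
  fix w' w :: "basis list" assume w: "length w = k"
  have d: "drop (j - 1) w = w ! (j - 1) # drop j w"
    using Cons_nth_drop_Suc[of "j - 1" w] w assms(3) by auto
  have j: "j - 1 + 1 = j" using assms(3) by simp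
  have id: "take (j - 1) w @ w ! (j - 1) # drop j w = w" using append_take_drop_id[of "j - 1" w] unfolding d .
  have "lsum (\<lambda>u. of_bool (take (j - 1) w @ u @ drop j w = w')) (p_op [w ! (j - 1)]) = of_bool (w' = w \<and> w ! (j - 1) = Nul)"
    using id by (cases "w ! (j - 1) = Nul") auto
  also have "\<dots> = (if length w' = k then twist s (elt_mat (- s * q) k (Poly_Mapping.single (p_diagram k j) 1)) w' w else 0)"
    using w diagram_mat_p[OF t _ w assms(3), of w'] sgn_word_square[OF assms(1), of w]
    by (auto simp: twist_def elt_mat_def)
  finally show "lsum (\<lambda>u. of_bool (take (j - 1) w @ u @ drop (j - 1 + 1) w = w')) (p_op (take 1 (drop (j - 1) w))) =
    (if length w' = k then twist s (elt_mat (- s * q) k (Poly_Mapping.single (p_diagram k j) 1)) w' w else 0)"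
    unfolding j d by simp
qed

lemma rho_r:
  assumes "s * s = 1" "q \<noteq> 0" "i \<in> {1..<k}"
  shows "rho s q k (Poly_Mapping.single (r_diagram k i) 1) = local_op k (i - 1) 2 r_op"
  unfolding rho_def
proof (rule local_op_eq_mat_op[symmetric])
  have t: "- s * q \<noteq> 0" using assms(1,2) by auto
  fix w' w :: "basis list" assume w: "length w = k"
  note sw = split_word[OF w assms(3)]
  let ?w = "take (i - 1) w @ [Nul, w ! (i - 1)] @ drop (i + 1) w"
  \<comment> \<open>Sliding \<open>Nul\<close> past a letter keeps the sequence of active letters,
    hence the sign.\<close>
  have "sgn_word s ?w * sgn_word s w = 1" if "w ! i = Nul"
  proof -
    have "sgn_word s ?w * sgn_word s (take (i - 1) w @ [w ! (i - 1), Nul] @ drop (i + 1) w) =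
        sgn_word s ([Nul, w ! (i - 1)] @ drop (i + 1) w) * sgn_word s ([w ! (i - 1), Nul] @ drop (i + 1) w)"
      by (rule sgn_word_append[OF assms(1)]) simp
    also have "\<dots> = sgn_word s ((w ! (i - 1)) # drop (i + 1) w) * sgn_word s ((w ! (i - 1)) # drop (i + 1) w)" by simp
    also have "\<dots> = 1" by (rule sgn_word_square[OF assms(1)])
    finally show ?thesis using sw(1) that by simp
  qed
  then have tw: "twist s (elt_mat (- s * q) k (Poly_Mapping.single (r_diagram k i) 1)) w' w = of_bool (w ! i = Nul \<and> ?w = w')"
    if "length w' = k"
    using diagram_mat_r[OF t that w assms(3)] by (auto simp: twist_def elt_mat_def)
  have len: "length ?w = k" using w assms(3) by auto
  show "lsum (\<lambda>u. of_bool (take (i - 1) w @ u @ drop (i - 1 + 2) w = w')) (r_op (take 2 (drop (i - 1) w))) =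
    (if length w' = k then twist s (elt_mat (- s * q) k (Poly_Mapping.single (r_diagram k i) 1)) w' w else 0)"
    unfolding sw(2,3) using tw len by auto
qed

lemma rho_l:
  assumes "s * s = 1" "q \<noteq> 0" "i \<in> {1..<k}"
  shows "rho s q k (Poly_Mapping.single (l_diagram k i) 1) = local_op k (i - 1) 2 l_op"
  unfolding rho_def
proof (rule local_op_eq_mat_op[symmetric])
  have t: "- s * q \<noteq> 0" using assms(1,2) by auto
  fix w' w :: "basis list" assume w: "length w = k"
  note sw = split_word[OF w assms(3)]
  let ?w = "take (i - 1) w @ [w ! i, Nul] @ drop (i + 1) w"
  have "sgn_word s ?w * sgn_word s w = 1" if "w ! (i - 1) = Nul"
  proof -
    have "sgn_word s ?w * sgn_word s (take (i - 1) w @ [Nul, w ! i] @ drop (i + 1) w) =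
        sgn_word s ([w ! i, Nul] @ drop (i + 1) w) * sgn_word s ([Nul, w ! i] @ drop (i + 1) w)"
      by (rule sgn_word_append[OF assms(1)]) simp
    also have "\<dots> = sgn_word s ((w ! i) # drop (i + 1) w) * sgn_word s ((w ! i) # drop (i + 1) w)" by simp
    also have "\<dots> = 1" by (rule sgn_word_square[OF assms(1)])
    finally show ?thesis using sw(1) that by simp
  qed
  then have tw: "twist s (elt_mat (- s * q) k (Poly_Mapping.single (l_diagram k i) 1)) w' w = of_bool (w ! (i - 1) = Nul \<and> ?w = w')"
    if "length w' = k"
    using diagram_mat_l[OF t that w assms(3)] by (auto simp: twist_def elt_mat_def)
  have len: "length ?w = k" using w assms(3) by auto
  show "lsum (\<lambda>u. of_bool (take (i - 1) w @ u @ drop (i - 1 + 2) w = w')) (l_op (take 2 (drop (i - 1) w))) =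
    (if length w' = k then twist s (elt_mat (- s * q) k (Poly_Mapping.single (l_diagram k i) 1)) w' w else 0)"
    unfolding sw(2,3) using tw len by auto
qed

lemma cups_caps_e:
  assumes "i \<in> {1..<k}"
  shows "\<Union>(cups (e_diagram k i)) = {Top i, Top (i + 1)}" "\<Union>(caps (e_diagram k i)) = {Bot i, Bot (i + 1)}"
proof -
  have "cups (e_diagram k i) = {{Top i, Top (i + 1)}}"
    unfolding cups_def e_diagram_def by (auto simp: card_insert_if)
  then show "\<Union>(cups (e_diagram k i)) = {Top i, Top (i + 1)}" by simp
  have "caps (e_diagram k i) = {{Bot i, Bot (i + 1)}}"
    unfolding caps_def e_diagram_def by (auto simp: card_insert_if)
  then show "\<Union>(caps (e_diagram k i)) = {Bot i, Bot (i + 1)}" by simp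
qed

definition strict_arc :: "'a::field \<Rightarrow> basis \<Rightarrow> basis \<Rightarrow> 'a" where
  "strict_arc t a b = (if a = Nul \<or> b = Nul then 0 else arc t a b)"

definition strict_coarc :: "'a::field \<Rightarrow> basis \<Rightarrow> basis \<Rightarrow> 'a" where
  "strict_coarc t a b = (if a = Nul \<or> b = Nul then 0 else coarc t a b)"

lemma tilde_mat_e:
  assumes "t \<noteq> 0" "length w' = k" "length w = k" "i \<in> {1..<k}"
  shows "tilde_mat t k (e_diagram k i) w' w =
    of_bool (\<forall>p\<in>{1..k} - {i, i + 1}. w' ! (p - 1) = w ! (p - 1)) *
    (strict_arc t (w' ! (i - 1)) (w' ! i) * strict_coarc t (w ! (i - 1)) (w ! i))"
proof -
  have "(\<forall>j\<in>{1..k}. Top j \<in> \<Union>(cups (e_diagram k i)) \<longrightarrow> w' ! (j - 1) \<noteq> Nul) \<longleftrightarrow> w' ! (i - 1) \<noteq> Nul \<and> w' ! i \<noteq> Nul"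
    unfolding cups_caps_e[OF assms(4)] using assms(4) by auto
  moreover have "(\<forall>j\<in>{1..k}. Bot j \<in> \<Union>(caps (e_diagram k i)) \<longrightarrow> w ! (j - 1) \<noteq> Nul) \<longleftrightarrow> w ! (i - 1) \<noteq> Nul \<and> w ! i \<noteq> Nul"
    unfolding cups_caps_e[OF assms(4)] using assms(4) by auto
  ultimately show ?thesis
    unfolding tilde_mat_def diagram_mat_e[OF assms] strict_arc_def strict_coarc_def by simp
qed

lemma rho_e:
  assumes "s * s = 1" "q \<noteq> 0" "i \<in> {1..<k}" "\<delta> = 1 - (- s * q) - inverse (- s * q)"
  shows "rho s q k (tilde \<delta> k (e_diagram k i)) = local_op k (i - 1) 2 (eps_op s q)"
  unfolding rho_def
proof (rule local_op_eq_mat_op[symmetric])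
  let ?t = "- s * q"
  have t: "?t \<noteq> 0" using assms(1,2) by auto
  have is': "inverse s = s" using assms(1) by (metis inverse_unique)
  fix w' w :: "basis list" assume w: "length w = k"
  note sw = split_word[OF w assms(3)]
  let ?z = "\<lambda>a b. take (i - 1) w @ [a, b] @ drop (i + 1) w"
  have len: "length (?z a b) = k" for a b using w assms(3) by auto
  \<comment> \<open>Exchanging adjacent \<open>Pos\<close> and \<open>Neg\<close> changes by one the
    number of active letters behind this \<open>Pos\<close>.\<close>
  have sg: "sgn_word s (?z Pos Neg) * sgn_word s (?z Neg Pos) = - s"
  proof -
    let ?y = "drop (i + 1) w"
    have "sgn_word s (?z Pos Neg) * sgn_word s (?z Neg Pos) = sgn_word s ([Pos, Neg] @ ?y) * sgn_word s ([Neg, Pos] @ ?y)"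
      by (rule sgn_word_append[OF assms(1)]) simp
    also have "\<dots> = - s * (((- s) ^ active ?y * (- s) ^ active ?y) * (sgn_word s ?y * sgn_word s ?y))"
      by (simp add: mult_ac)
    also have "\<dots> = - s" using sgn_word_square[OF assms(1)] sign_power_square[OF assms(1)] by simp
    finally show ?thesis .
  qed
  have tw: "twist s (elt_mat ?t k (tilde \<delta> k (e_diagram k i))) w' w = sgn_word s w' * sgn_word s w *
      (of_bool (\<forall>p\<in>{1..k} - {i, i + 1}. w' ! (p - 1) = w ! (p - 1)) *
      (strict_arc ?t (w' ! (i - 1)) (w' ! i) * strict_coarc ?t (w ! (i - 1)) (w ! i)))" if "length w' = k"
    unfolding twist_def tilde_keys_mat(2)[OF t motzkin_generators(3)[OF assms(3)] assms(4) that w]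
      tilde_mat_e[OF t that w assms(3)] by (simp add: mult_ac)
  have sq: "s * (s * inverse q) * q = 1"
  proof -
    have "s * (s * inverse q) * q = (s * s) * (inverse q * q)" by (simp only: mult_ac)
    then show ?thesis using assms(1,2) by simp
  qed
  \<comment> \<open>Cup times cap is a rank one matrix with diagonal entries s q and s/q and
    off-diagonal entries 1; the sign - s of \<open>sg\<close> turns the latter into the - s required
    by \<open>eps_op\<close>.\<close>
  have co: "strict_coarc ?t a b = (if a = Pos \<and> b = Neg then s * q else if a = Neg \<and> b = Pos then 1 else 0)" for a b
    using t assms(1,2) by (cases a; cases b) (auto simp: strict_coarc_def coarc_def field_simps)
  have ar: "strict_arc ?t a b = (if a = Pos \<and> b = Neg then 1 else if a = Neg \<and> b = Pos then s * inverse q else 0)" for a b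
    using is' by (cases a; cases b) (auto simp: strict_arc_def)
  have eq: "(w' = ?z a b) \<longleftrightarrow> (\<forall>p\<in>{1..k} - {i, i + 1}. w' ! (p - 1) = w ! (p - 1)) \<and> w' ! (i - 1) = a \<and> w' ! i = b"
    if "length w' = k" for a b using splice_iff[OF that w assms(3)] .
  have main: "twist s (elt_mat ?t k (tilde \<delta> k (e_diagram k i))) w' w =
      (of_bool (w' = ?z Pos Neg) * (sgn_word s (?z Pos Neg) * sgn_word s w) +
       of_bool (w' = ?z Neg Pos) * (sgn_word s (?z Neg Pos) * sgn_word s w) * (s * inverse q)) * strict_coarc ?t (w ! (i - 1)) (w ! i)"
    if "length w' = k"
  proof -
    consider "w' = ?z Pos Neg" | "w' = ?z Neg Pos" | "w' \<noteq> ?z Pos Neg" "w' \<noteq> ?z Neg Pos" by blast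
    then show ?thesis
    proof cases
      case 1
      have "?z Pos Neg \<noteq> ?z Neg Pos" by simp
      then show ?thesis unfolding tw[OF that] using eq[OF that, of Pos Neg] 1 by (simp add: ar del: mult_minus_left)
    next
      case 2
      have "?z Neg Pos \<noteq> ?z Pos Neg" by simp
      then show ?thesis unfolding tw[OF that] using eq[OF that, of Neg Pos] 2 by (simp add: ar del: mult_minus_left)
    next
      case 3
      then show ?thesis unfolding tw[OF that] using eq[OF that, of Pos Neg] eq[OF that, of Neg Pos] by (auto simp: ar simp del: mult_minus_left)
    qed
  qed
  show "lsum (\<lambda>u. of_bool (take (i - 1) w @ u @ drop (i - 1 + 2) w = w')) (eps_op s q (take 2 (drop (i - 1) w))) =
    (if length w' = k then twist s (elt_mat ?t k (tilde \<delta> k (e_diagram k i))) w' w else 0)"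
  proof (cases "length w' = k")
    case False
    then have "take (i - 1) w @ [a, b] @ drop (i + 1) w \<noteq> w'" for a b using len by blast
    then show ?thesis unfolding sw(2,3) using False
      by (cases "w ! (i - 1)"; cases "w ! i") (auto simp: lsum_scale lsum_diff lsum_add lsum_uminus)
  next
    case True
    consider "w ! (i - 1) = Pos" "w ! i = Neg" | "w ! (i - 1) = Neg" "w ! i = Pos"
      | "\<not> (w ! (i - 1) = Pos \<and> w ! i = Neg)" "\<not> (w ! (i - 1) = Neg \<and> w ! i = Pos)" by blast
    then show ?thesis
    proof cases
      case 1
      then have wz: "w = ?z Pos Neg" using sw(1) by simp
      have "sgn_word s (?z Pos Neg) * sgn_word s w = 1" "sgn_word s (?z Neg Pos) * sgn_word s w = - s"
        using sgn_word_square[OF assms(1), of w] sg wz by (simp_all add: mult.commute)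
      then show ?thesis
        unfolding main[OF True] sw(2,3) co 1 using True assms(1,2) sq
        by (auto simp: lsum_scale lsum_diff)
    next
      case 2
      then have wz: "w = ?z Neg Pos" using sw(1) by simp
      have "sgn_word s (?z Neg Pos) * sgn_word s w = 1" "sgn_word s (?z Pos Neg) * sgn_word s w = - s"
        using sgn_word_square[OF assms(1), of w] sg wz by (simp_all add: mult.commute)
      then show ?thesis
        unfolding main[OF True] sw(2,3) co 2 using True assms(1,2)
        by (auto simp: lsum_scale lsum_diff lsum_add lsum_uminus)
    next
      case 3
      then have "strict_coarc ?t (w ! (i - 1)) (w ! i) = 0" unfolding co by auto
      moreover have "eps_op s q [w ! (i - 1), w ! i] = 0" using 3 by (cases "w ! (i - 1)"; cases "w ! i") auto
      ultimately show ?thesis unfolding main[OF True] sw(2,3) by simp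
    qed
  qed
qed

lemma elt_mat_linear:
  "elt_mat t k (x + y) w' w = elt_mat t k x w' w + elt_mat t k y w' w"
  "elt_mat t k (scale c x) w' w = c * elt_mat t k x w' w"
  "elt_mat t k (\<Sum>i\<in>I. f i) w' w = (\<Sum>i\<in>I. elt_mat t k (f i) w' w)"
  by (simp_all add: elt_mat_def lsum_add lsum_scale lsum_sum)

section \<open>The isomorphism with the endomorphism algebra\<close>

context
  fixes q s \<delta> :: "'a::field" and k :: nat
  assumes gq: "generic q" and ss: "s * s = 1" and \<delta>: "\<delta> = 1 - (- s * q) - inverse (- s * q)"
begin

text \<open>The sign disappears on squaring: (- s q)^n = 1 would give q^(2 n) = 1.\<close>

lemma parameters: "q \<noteq> 0" "- s * q \<noteq> 0" "generic (- s * q)" "q \<noteq> inverse q"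
proof -
  show q: "q \<noteq> 0" using gq unfolding generic_def by simp
  then show t: "- s * q \<noteq> 0" using ss by auto
  show "q \<noteq> inverse q" using generic_inverse[OF gq] .
  have "(- s * q) ^ n \<noteq> 1" if "n > 0" for n
  proof
    assume e: "(- s * q) ^ n = 1"
    have "((- s) ^ n * (- s) ^ n) * q ^ (n + n) = (- s * q) ^ n * (- s * q) ^ n"
      by (simp only: power_mult_distrib power_add) (simp add: mult_ac)
    then have "q ^ (n + n) = 1" unfolding e sign_power_square[OF ss] by simp
    then show False using gq that unfolding generic_def by simp
  qed
  then show "generic (- s * q)" using t unfolding generic_def by blast
qed

lemma PTL_keys:
  assumes "x \<in> carrier (PTL \<delta> k)"
  shows "Poly_Mapping.keys x \<subseteq> motzkin_diagrams k"
proof -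
  obtain c where x: "x = (\<Sum>d\<in>balanced_diagrams k. scale (c d) (tilde \<delta> k d))"
    using assms unfolding PTL_def by auto
  have "Poly_Mapping.keys (tilde \<delta> k d) \<subseteq> motzkin_diagrams k" if "d \<in> balanced_diagrams k" for d
    using tilde_keys_mat(1)[OF parameters(2) _ \<delta>] that unfolding balanced_diagrams_def by auto
  then have "Poly_Mapping.lookup (tilde \<delta> k d) e = 0" if "d \<in> balanced_diagrams k" "e \<notin> motzkin_diagrams k" for d e
    using that by (metis in_keys_iff subsetD)
  then have "Poly_Mapping.lookup x e = 0" if "e \<notin> motzkin_diagrams k" for e
    unfolding x lookup_sum' using that by (intro sum.neutral) simp
  then show ?thesis by (auto simp: in_keys_iff)
qed

lemma elt_mat_PTL:
  assumes "length w' = k" "length w = k"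
  shows "elt_mat (- s * q) k (\<Sum>d\<in>balanced_diagrams k. scale (c d) (tilde \<delta> k d)) w' w =
    (\<Sum>d\<in>balanced_diagrams k. c d * tilde_mat (- s * q) k d w' w)"
  unfolding elt_mat_linear
  using tilde_keys_mat(2)[OF parameters(2) _ \<delta> assms]
  by (intro sum.cong refl) (auto simp: balanced_diagrams_def)

lemma rho_hom: "rho s q k \<in> alg_hom (PTL \<delta> k) (End_alg k)"
proof -
  have closed: "rho s q k x \<in> carrier (End_alg k)" for x unfolding rho_def End_alg_def using mat_op_End by simp
  have tadd: "twist s (elt_mat (- s * q) k (x + y)) =
      (\<lambda>w' w. twist s (elt_mat (- s * q) k x) w' w + twist s (elt_mat (- s * q) k y) w' w)" for x y
    by (simp add: fun_eq_iff twist_def elt_mat_linear algebra_simps)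
  have tscale: "twist s (elt_mat (- s * q) k (scale c x)) = (\<lambda>w' w. c * twist s (elt_mat (- s * q) k x) w' w)" for x c
    by (simp add: fun_eq_iff twist_def elt_mat_linear algebra_simps)
  have smult: "rho s q k (c \<odot>\<^bsub>PTL \<delta> k\<^esub> x) = c \<odot>\<^bsub>End_alg k\<^esub> rho s q k x" for x c
    unfolding PTL_def Motzkin_def End_alg_def rho_def by (simp add: tscale mat_op_scale del: mult_minus_left)
  have add: "rho s q k (x \<oplus>\<^bsub>PTL \<delta> k\<^esub> y) = rho s q k x \<oplus>\<^bsub>End_alg k\<^esub> rho s q k y" for x y
    unfolding PTL_def Motzkin_def End_alg_def rho_def by (simp add: tadd mat_op_add del: mult_minus_left)
  have "rho s q k (motzkin_mult \<delta> x y) = compose (tensor_power k) (rho s q k x) (rho s q k y)"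
    if x: "x \<in> carrier (PTL \<delta> k)" and y: "y \<in> carrier (PTL \<delta> k)" for x y
    unfolding rho_def compose_mat_op
  proof (rule mat_op_cong)
    fix w' w :: "basis list" assume w: "length w' = k" "length w = k"
    let ?X = "elt_mat (- s * q) k x" and ?Y = "elt_mat (- s * q) k y"
    have "twist s ?X w' u * twist s ?Y u w = sgn_word s w' * (?X w' u * ?Y u w) * sgn_word s w" for u
    proof -
      have "twist s ?X w' u * twist s ?Y u w =
          sgn_word s w' * (?X w' u * ?Y u w) * sgn_word s w * (sgn_word s u * sgn_word s u)"
        by (simp add: twist_def mult_ac)
      then show ?thesis using sgn_word_square[OF ss] by simp
    qed
    then show "twist s (elt_mat (- s * q) k (motzkin_mult \<delta> x y)) w' w = (\<Sum>u\<in>words k. twist s ?X w' u * twist s ?Y u w)"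
      unfolding twist_def[of s "elt_mat (- s * q) k (motzkin_mult \<delta> x y)"]
      unfolding \<delta> elt_mat_mult[OF parameters(2) PTL_keys[OF x] PTL_keys[OF y] w]
      by (simp add: sum_distrib_left sum_distrib_right)
  qed
  then have mult: "rho s q k (x \<otimes>\<^bsub>PTL \<delta> k\<^esub> y) = rho s q k x \<otimes>\<^bsub>End_alg k\<^esub> rho s q k y"
    if "x \<in> carrier (PTL \<delta> k)" "y \<in> carrier (PTL \<delta> k)" for x y
    using that unfolding PTL_def Motzkin_def End_alg_def by simp
  have "rho s q k (Poly_Mapping.single (id_diagram k) 1) = mat_op k (\<lambda>w' w. of_bool (w' = w))"
    unfolding rho_def
    using diagram_mat_id[OF parameters(2)] sgn_word_square[OF ss]
    by (intro mat_op_cong) (auto simp: twist_def elt_mat_def)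
  then have one: "rho s q k \<one>\<^bsub>PTL \<delta> k\<^esub> = \<one>\<^bsub>End_alg k\<^esub>"
    unfolding PTL_def Motzkin_def End_alg_def by (simp add: mat_op_one)
  show ?thesis
    unfolding alg_hom_def ring_hom_def using closed smult add mult one by blast
qed

lemma rho_action: "PTL_action \<delta> s q k (rho s q k)"
  unfolding PTL_action_def
  using rho_hom rho_p[OF ss parameters(1)] rho_r[OF ss parameters(1)] rho_l[OF ss parameters(1)]
    rho_e[OF ss parameters(1) _ \<delta>] by blast

text \<open>Equal operators have equal matrices, and after the nonzero signs are removed
  independence of the balanced \<open>tilde\<close> matrices identifies the coefficients.\<close>

lemma rho_inj: "inj_on (rho s q k) (carrier (PTL \<delta> k))"
proof (rule inj_onI)
  fix x y assume "x \<in> carrier (PTL \<delta> k)" "y \<in> carrier (PTL \<delta> k)" and eq: "rho s q k x = rho s q k y"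
  then obtain c e where x: "x = (\<Sum>d\<in>balanced_diagrams k. scale (c d) (tilde \<delta> k d))"
    and y: "y = (\<Sum>d\<in>balanced_diagrams k. scale (e d) (tilde \<delta> k d))"
    unfolding PTL_def by auto
  have "(\<Sum>d\<in>balanced_diagrams k. (c d - e d) * tilde_mat (- s * q) k d w' w) = 0" if w: "length w' = k" "length w = k" for w' w
  proof -
    have "twist s (elt_mat (- s * q) k x) w' w = twist s (elt_mat (- s * q) k y) w' w"
      using mat_op_inject[OF eq[unfolded rho_def] w] .
    then have "elt_mat (- s * q) k x w' w = elt_mat (- s * q) k y w' w"
      unfolding twist_def using sgn_word_nonzero[OF ss] by simp
    then show ?thesis unfolding x y elt_mat_PTL[OF w] by (simp add: algebra_simps sum_subtractf)
  qed
  then have "\<forall>d\<in>balanced_diagrams k. c d - e d = 0" by (rule tilde_mat_independent[OF parameters(2)])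
  then show "x = y" unfolding x y by (intro sum.cong) auto
qed

text \<open>Balanced \<open>tilde\<close> matrices commute with E and preserve types, which gives
  one inclusion. For the other, the matrix of an operator in the centralizer is brought to the
  parameter - s q and expanded by \<open>tilde_mat_spans\<close>.\<close>

lemma rho_image: "rho s q k ` carrier (PTL \<delta> k) = centralizer (End_alg k) (range (act_on q k))"
proof
  show "rho s q k ` carrier (PTL \<delta> k) \<subseteq> centralizer (End_alg k) (range (act_on q k))"
  proof
    fix T assume "T \<in> rho s q k ` carrier (PTL \<delta> k)"
    then obtain c where T: "T = rho s q k (\<Sum>d\<in>balanced_diagrams k. scale (c d) (tilde \<delta> k d))"
      unfolding PTL_def by auto
    let ?M = "\<lambda>w' w. \<Sum>d\<in>balanced_diagrams k. c d * tilde_mat (- s * q) k d w' w"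
    have TM: "T = mat_op k (twist s ?M)"
      unfolding T rho_def using elt_mat_PTL[of _ _ c] by (intro mat_op_cong) (simp add: twist_def)
    have bal: "d \<in> motzkin_diagrams k" "card (cups d) = card (caps d)" if "d \<in> balanced_diagrams k" for d
      using that unfolding balanced_diagrams_def by auto
    have "commutes_raising (- s * q) k ?M"
      unfolding commutes_raising_def
      using tilde_mat_commutes_raising[OF parameters(2) bal(1)]
      by (auto simp: raise_sum raise_scale coraise_sum coraise_scale commutes_raising_def)
    then have cr: "commutes_raising q k (twist s ?M)" unfolding commutes_raising_twist[OF ss] .
    have "weight w' = weight w \<and> active w' = active w" if w: "length w' = k" "length w = k" "?M w' w \<noteq> 0" for w' w
    proof -
      obtain d where d: "d \<in> balanced_diagrams k" "c d * tilde_mat (- s * q) k d w' w \<noteq> 0"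
        using w(3) by (rule sum.not_neutral_contains_not_neutral)
      then show ?thesis using tilde_mat_nonzero[OF parameters(2) bal(1)[OF d(1)] w(1,2)] bal(2)[OF d(1)] by auto
    qed
    then have "preserves_type k (twist s ?M)" unfolding preserves_type_def twist_def by auto
    then have "\<forall>u v. mat_vec k (twist s ?M) (free_op q u v) = free_op q u (mat_vec k (twist s ?M) v)"
      using commutes_free_op[OF gq cr] by blast
    then show "T \<in> centralizer (End_alg k) (range (act_on q k))"
      unfolding centralizer_act_on[OF parameters(1)] TM mat_op_commutes_act_on[OF parameters(1)]
      using mat_op_End by blast
  qed
  show "centralizer (End_alg k) (range (act_on q k)) \<subseteq> rho s q k ` carrier (PTL \<delta> k)"
  proof
    fix T assume T: "T \<in> centralizer (End_alg k) (range (act_on q k))"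
    define M where "M = op_mat T"
    have TM: "mat_op k M = T" using T mat_op_op_mat unfolding centralizer_act_on[OF parameters(1)] M_def by blast
    have "\<forall>u v. mat_vec k M (free_op q u v) = free_op q u (mat_vec k M v)"
      using T unfolding centralizer_act_on[OF parameters(1)] TM[symmetric] mat_op_commutes_act_on[OF parameters(1)] by blast
    then have cr: "commutes_raising q k M" and pt: "preserves_type k M" using free_op_commutes[OF gq] by blast+
    have cr': "commutes_raising (- s * q) k (twist s M)"
      using cr commutes_raising_twist[OF ss, of q k "twist s M"] by (simp add: twist_twist[OF ss])
    have pt': "weight w' = weight w \<and> active w' = active w"
      if "length w' = k" "length w = k" "twist s M w' w \<noteq> 0" for w' w
      using pt that unfolding preserves_type_def twist_def by auto
    obtain c where c: "\<forall>w' w. length w' = k \<longrightarrow> length w = k \<longrightarrow>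
        twist s M w' w = (\<Sum>d\<in>balanced_diagrams k. c d * tilde_mat (- s * q) k d w' w)"
      using tilde_mat_spans[OF parameters(3) cr' pt'] by blast
    let ?x = "\<Sum>d\<in>balanced_diagrams k. scale (c d) (tilde \<delta> k d)"
    have "rho s q k ?x = mat_op k (twist s (twist s M))"
      unfolding rho_def using elt_mat_PTL[of _ _ c] c by (intro mat_op_cong) (simp add: twist_def)
    then have "T = rho s q k ?x" by (simp add: twist_twist[OF ss] TM)
    moreover have "?x \<in> carrier (PTL \<delta> k)" unfolding PTL_def by auto
    ultimately show "T \<in> rho s q k ` carrier (PTL \<delta> k)" by blast
  qed
qed

lemma End_Uq_carrier: "carrier (End_Uq q k) = centralizer (End_alg k) (range (act_on q k))"
proof -
  have "T \<in> carrier (End_Uq q k) \<longleftrightarrow>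
      T \<in> End_space k \<and> (\<forall>f\<in>Uq_rep q k ` carrier (Uq q). \<forall>x\<in>tensor_power k. T (f x) = f (T x))" for T
    unfolding End_Uq_def by auto
  then have "T \<in> carrier (End_Uq q k) \<longleftrightarrow> T \<in> centralizer (End_alg k) (range (act_on q k))" for T
    unfolding Uq_rep_image[OF parameters(1,4)] centralizer_act_on[OF parameters(1)] by auto
  then show ?thesis by blast
qed

lemma rho_iso: "rho s q k \<in> alg_iso (PTL \<delta> k) (End_Uq q k)"
proof -
  have bij: "bij_betw (rho s q k) (carrier (PTL \<delta> k)) (carrier (End_Uq q k))"
    unfolding bij_betw_def End_Uq_carrier using rho_inj rho_image by blast
  have ops: "x \<otimes>\<^bsub>End_Uq q k\<^esub> y = x \<otimes>\<^bsub>End_alg k\<^esub> y" "x \<oplus>\<^bsub>End_Uq q k\<^esub> y = x \<oplus>\<^bsub>End_alg k\<^esub> y"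
    "\<one>\<^bsub>End_Uq q k\<^esub> = \<one>\<^bsub>End_alg k\<^esub>" "c \<odot>\<^bsub>End_Uq q k\<^esub> x = c \<odot>\<^bsub>End_alg k\<^esub> x" for x y c
    unfolding End_Uq_def by simp_all
  have "rho s q k \<in> alg_hom (PTL \<delta> k) (End_Uq q k)"
    using rho_hom bij unfolding alg_hom_def ring_hom_def ops by (auto simp: bij_betw_def)
  then show ?thesis unfolding alg_iso_def using bij by blast
qed

end

section \<open>Ladders over highest weight vectors\<close>

text \<open>Joint eigenvectors of K1 and K2 with exponents a and b, in terms of their support; the
  zero vector has every type.\<close>

definition typed :: "nat \<Rightarrow> nat \<Rightarrow> nat \<Rightarrow> (basis list \<Rightarrow> 'a::field) \<Rightarrow> bool" where
  "typed k a b v \<longleftrightarrow> (\<forall>x. v x \<noteq> 0 \<longrightarrow> length x = k \<and> npos x = a \<and> nneg x = b)"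

definition highest :: "'a::field \<Rightarrow> nat \<Rightarrow> nat \<Rightarrow> nat \<Rightarrow> (basis list \<Rightarrow> 'a) \<Rightarrow> bool" where
  "highest q k a b u \<longleftrightarrow> typed k a b u \<and> raising q u = (\<lambda>x. 0)"

lemma npos_nneg_simps [simp]:
  "npos [] = 0" "nneg [] = 0"
  "npos (c # w) = (if c = Pos then Suc (npos w) else npos w)"
  "nneg (c # w) = (if c = Neg then Suc (nneg w) else nneg w)"
  by (simp_all add: npos_def nneg_def)

lemma raise_nonzero_counts:
  "raising t v x \<noteq> 0 \<Longrightarrow> \<exists>y. length y = length x \<and> v y \<noteq> 0 \<and> npos x = Suc (npos y) \<and> nneg y = Suc (nneg x)"
proof (induction x arbitrary: v)
  case (Cons a x)
  show ?case
  proof (cases "raising t (\<lambda>y. v (a # y)) x = 0")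
    case True
    then have "a = Pos" "v (Neg # x) \<noteq> 0" using Cons.prems by (auto split: if_splits)
    then show ?thesis by (intro exI[of _ "Neg # x"]) auto
  next
    case False
    from Cons.IH[OF this] obtain y where "length y = length x" "v (a # y) \<noteq> 0" "npos x = Suc (npos y)" "nneg y = Suc (nneg x)" by blast
    then show ?thesis by (intro exI[of _ "a # y"]) auto
  qed
qed simp

lemma lower_nonzero_counts:
  "lowering t v x \<noteq> 0 \<Longrightarrow> \<exists>y. length y = length x \<and> v y \<noteq> 0 \<and> npos y = Suc (npos x) \<and> nneg x = Suc (nneg y)"
proof (induction x arbitrary: v)
  case (Cons a x)
  show ?case
  proof (cases "lowering t (\<lambda>y. v (a # y)) x = 0")
    case True
    then have "a = Neg" "v (Pos # x) \<noteq> 0" using Cons.prems by (auto split: if_splits)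
    then show ?thesis by (intro exI[of _ "Pos # x"]) auto
  next
    case False
    from Cons.IH[OF this] obtain y where "length y = length x" "v (a # y) \<noteq> 0" "npos y = Suc (npos x)" "nneg x = Suc (nneg y)" by blast
    then show ?thesis by (intro exI[of _ "a # y"]) auto
  qed
qed simp

lemma typed_raise: "typed k a (Suc b) v \<Longrightarrow> typed k (Suc a) b (raising t v)"
  unfolding typed_def using raise_nonzero_counts by (metis Suc_inject)

lemma typed_raise_zero: "typed k a 0 v \<Longrightarrow> raising t v = (\<lambda>x. 0)"
  unfolding typed_def using raise_nonzero_counts by (metis Suc_neq_Zero ext)

lemma typed_lower: "typed k (Suc a) b v \<Longrightarrow> typed k a (Suc b) (lowering t v)"
  unfolding typed_def using lower_nonzero_counts by (metis Suc_inject)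

lemma typed_lower_zero: "typed k 0 b v \<Longrightarrow> lowering t v = (\<lambda>x. 0)"
  unfolding typed_def using lower_nonzero_counts by (metis Suc_neq_Zero ext)

lemma typed_homog: "typed k a b v \<Longrightarrow> homog k (int a - int b) v"
  unfolding typed_def homog_def using npos_nneg(2) by metis

lemma typed_zero: "typed k a b (\<lambda>x. 0)"
  by (simp add: typed_def)

lemma typed_add: "typed k a b u \<Longrightarrow> typed k a b v \<Longrightarrow> typed k a b (\<lambda>x. u x + v x)"
  unfolding typed_def by (metis add_0)

lemma typed_scale: "typed k a b v \<Longrightarrow> typed k a b (\<lambda>x. c * v x)"
  unfolding typed_def by auto

lemma raise_fun_zero [simp]: "raising t (\<lambda>x. 0) = (\<lambda>x. 0)"
  by (rule ext) simp

lemma lower_fun_zero [simp]: "lowering t (\<lambda>x. 0) = (\<lambda>x. 0)"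
  by (rule ext) simp

lemma lower_pow_zero [simp]: "(lowering t ^^ i) (\<lambda>x. 0) = (\<lambda>x. 0)"
  by (induction i) simp_all

lemma raise_pow_zero [simp]: "(raising t ^^ i) (\<lambda>x. 0) = (\<lambda>x. 0)"
  by (induction i) simp_all

lemma raise_fun_scale: "raising t (\<lambda>x. c * v x) = (\<lambda>x. c * raising t v x)"
  by (rule ext) (rule raise_scale)

lemma lower_fun_scale: "lowering t (\<lambda>x. c * v x) = (\<lambda>x. c * lowering t v x)"
  by (rule ext) (rule lower_scale)

lemma raise_fun_add: "raising t (\<lambda>x. u x + v x) = (\<lambda>x. raising t u x + raising t v x)"
  by (rule ext) (rule raise_add)

lemma lower_fun_add: "lowering t (\<lambda>x. u x + v x) = (\<lambda>x. lowering t u x + lowering t v x)"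
  by (rule ext) (rule lower_add)

lemma raise_pow_scale: "(raising t ^^ i) (\<lambda>x. c * v x) = (\<lambda>x. c * (raising t ^^ i) v x)"
  by (induction i) (simp_all add: raise_fun_scale)

lemma lower_pow_scale: "(lowering t ^^ i) (\<lambda>x. c * v x) = (\<lambda>x. c * (lowering t ^^ i) v x)"
  by (induction i) (simp_all add: lower_fun_scale)

lemma lower_pow_add: "(lowering t ^^ i) (\<lambda>x. u x + v x) = (\<lambda>x. (lowering t ^^ i) u x + (lowering t ^^ i) v x)"
  by (induction i) (simp_all add: lower_fun_add)

lemma typed_lower_pow:
  "typed k a b u \<Longrightarrow> i \<le> a \<Longrightarrow> typed k (a - i) (b + i) ((lowering t ^^ i) u)"
proof (induction i)
  case (Suc i)
  then have "typed k (Suc (a - Suc i)) (b + i) ((lowering t ^^ i) u)" by (simp add: Suc_diff_Suc)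
  then show ?case using typed_lower by fastforce
qed simp

lemma typed_lower_pow_zero:
  assumes "typed k a b u" "a < i"
  shows "(lowering t ^^ i) u = (\<lambda>x. 0)"
proof -
  obtain m where m: "i = m + Suc a" using assms(2) by (metis add.commute less_imp_Suc_add add_Suc_right)
  have "typed k 0 (b + a) ((lowering t ^^ a) u)" using typed_lower_pow[OF assms(1), of a] by simp
  then have "(lowering t ^^ Suc a) u = (\<lambda>x. 0)" using typed_lower_zero by simp
  then show ?thesis unfolding m funpow_add comp_def by simp
qed

lemma typed_raise_pow:
  "typed k a b u \<Longrightarrow> i \<le> b \<Longrightarrow> typed k (a + i) (b - i) ((raising t ^^ i) u)"
proof (induction i)
  case (Suc i)
  then have "typed k (a + i) (Suc (b - Suc i)) ((raising t ^^ i) u)" by (simp add: Suc_diff_Suc)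
  then show ?case using typed_raise by fastforce
qed simp

lemma typed_raise_pow_zero:
  assumes "typed k a b u" "b < i"
  shows "(raising t ^^ i) u = (\<lambda>x. 0)"
proof -
  obtain m where m: "i = m + Suc b" using assms(2) by (metis add.commute less_imp_Suc_add add_Suc_right)
  have "typed k (a + b) 0 ((raising t ^^ b) u)" using typed_raise_pow[OF assms(1), of b] by simp
  then have "(raising t ^^ Suc b) u = (\<lambda>x. 0)" using typed_raise_zero by simp
  then show ?thesis unfolding m funpow_add comp_def by simp
qed

section \<open>Raising and lowering along a single ladder\<close>

lemma highest_raise_lower:
  assumes "generic q" "highest q k a b u"
  shows "raising q ((lowering q ^^ Suc i) u) =
    (\<lambda>x. qbracket q (int i + 1) * qbracket q (int a - int b - int i) * (lowering q ^^ i) u x)"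
proof -
  have "lowering q (raising q u) = (\<lambda>x. 0)" using assms(2) unfolding highest_def by simp
  then show ?thesis
    using raise_lower_pow[OF assms(1) typed_homog] assms(2) unfolding highest_def by blast
qed

lemma highest_negative:
  assumes "generic q" "highest q k a b u" "a < b"
  shows "u = (\<lambda>x. 0)"
  using negative_weight_zero[OF assms(1) typed_homog, of k a b u] assms(2,3) unfolding highest_def by simp

text \<open>With j = a - b, the vector F^(j+1) u is killed by E because [j - j] = 0, and it has
  negative weight, so it vanishes.\<close>

lemma highest_lower_zero:
  assumes "generic q" "highest q k a b u" "a < b + i"
  shows "(lowering q ^^ i) u = (\<lambda>x. 0)"
proof (cases "a < b")
  case True
  then show ?thesis using highest_negative[OF assms(1,2)] by simp
next
  case False
  define j where "j = a - b"
  have ab: "int a - int b = int j" using False unfolding j_def by simp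
  have z: "(lowering q ^^ Suc j) u = (\<lambda>x. 0)"
  proof (rule negative_weight_zero[OF assms(1)])
    show "homog k (int a - int b - 2 * int (Suc j)) ((lowering q ^^ Suc j) u)"
      using assms(2) homog_lower_pow typed_homog unfolding highest_def by blast
    have "raising q ((lowering q ^^ Suc j) u) = (\<lambda>x. 0)"
      unfolding highest_raise_lower[OF assms(1,2)] ab by (simp add: qbracket_def)
    then show "lowering q (raising q ((lowering q ^^ Suc j) u)) = (\<lambda>x. 0)" by simp
    show "int a - int b - 2 * int (Suc j) < 0" unfolding ab by simp
  qed
  obtain m where m: "i = m + Suc j" using assms(3) False unfolding j_def
    by (metis Suc_leI add.commute le_add_diff_inverse2 less_diff_conv2 not_less)
  show ?thesis unfolding m funpow_add comp_def z by simp
qed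

text \<open>The scalar by which E^i F^i acts on a highest weight vector of weight j.\<close>

definition ladder_const :: "'a::field \<Rightarrow> int \<Rightarrow> nat \<Rightarrow> 'a" where
  "ladder_const q j i = (\<Prod>l<i. qbracket q (int l + 1) * qbracket q (j - int l))"

lemma ladder_const_nonzero:
  assumes "generic q" "int i \<le> j"
  shows "ladder_const q j i \<noteq> 0"
  unfolding ladder_const_def using qbracket_nonzero[OF assms(1)] assms(2) by simp

lemma highest_raise_pow_lower_pow:
  assumes "generic q" "highest q k a b u"
  shows "\<exists>c. (raising q ^^ l) ((lowering q ^^ (l + i)) u) = (\<lambda>x. c * (lowering q ^^ i) u x)"
proof (induction l)
  case 0
  show ?case by (rule exI[of _ 1]) simp
next
  case (Suc l)
  then obtain c where c: "(raising q ^^ l) ((lowering q ^^ (l + i)) u) = (\<lambda>x. c * (lowering q ^^ i) u x)" ..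
  have "(raising q ^^ Suc l) ((lowering q ^^ (Suc l + i)) u) = (raising q ^^ l) (raising q ((lowering q ^^ Suc (l + i)) u))"
    by (simp add: funpow_swap1)
  then show ?case
    unfolding highest_raise_lower[OF assms] raise_pow_scale c by (auto simp flip: mult.assoc)
qed

lemma highest_ladder:
  assumes "generic q" "highest q k a b u"
  shows "(raising q ^^ l) ((lowering q ^^ l) u) = (\<lambda>x. ladder_const q (int a - int b) l * u x)"
proof (induction l)
  case 0
  show ?case by (simp add: ladder_const_def)
next
  case (Suc l)
  have "(raising q ^^ Suc l) ((lowering q ^^ Suc l) u) = (raising q ^^ l) (raising q ((lowering q ^^ Suc l) u))"
    by (simp add: funpow_swap1)
  then show ?case
    unfolding highest_raise_lower[OF assms] raise_pow_scale Suc by (simp add: ladder_const_def mult_ac)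
qed

text \<open>Rung i has type (a, b) if the top of its ladder has type (a + i, b - i); the condition i
  \<le> b guards the subtraction of natural numbers.\<close>

inductive ladder_span :: "'a::field \<Rightarrow> nat \<Rightarrow> nat \<Rightarrow> nat \<Rightarrow> (basis list \<Rightarrow> 'a) \<Rightarrow> bool" for q k a b where
  zero: "ladder_span q k a b (\<lambda>x. 0)"
| add: "ladder_span q k a b v \<Longrightarrow> i \<le> b \<Longrightarrow> highest q k (a + i) (b - i) u \<Longrightarrow>
    ladder_span q k a b (\<lambda>x. v x + (lowering q ^^ i) u x)"

lemma highest_scale: "highest q k a b u \<Longrightarrow> highest q k a b (\<lambda>x. c * u x)"
  unfolding highest_def using typed_scale by (auto simp: raise_fun_scale)

lemma highest_add: "highest q k a b u \<Longrightarrow> highest q k a b v \<Longrightarrow> highest q k a b (\<lambda>x. u x + v x)"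
  unfolding highest_def using typed_add by (auto simp: raise_fun_add)

lemma ladder_span_typed: "ladder_span q k a b v \<Longrightarrow> typed k a b v"
proof (induction rule: ladder_span.induct)
  case zero show ?case by (rule typed_zero)
next
  case (add v i u)
  then have "typed k a b ((lowering q ^^ i) u)"
    using typed_lower_pow[of k "a + i" "b - i" u i q] unfolding highest_def by simp
  then show ?case using add.IH typed_add by blast
qed

text \<open>E maps rung i + 1 to a nonzero multiple of rung i, unless i = b - a - 1, in which case
  rung i is the bottom of its ladder. These bottom rungs, collected in u, are all that can be
  missing from the image of E.\<close>

lemma ladder_preimage:
  assumes "generic q" "ladder_span q k (Suc a) b y"
  shows "\<exists>v u. ladder_span q k a (Suc b) v \<and> (a < b \<longrightarrow> highest q k (Suc a + (b - Suc a)) (b - (b - Suc a)) u) \<and>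
    y = (\<lambda>x. raising q v x + (if a < b then (lowering q ^^ (b - Suc a)) u x else 0))"
  using assms(2)
proof (induction rule: ladder_span.induct)
  case zero
  show ?case
    by (rule exI[of _ "\<lambda>x. 0"], rule exI[of _ "\<lambda>x. 0"])
      (auto simp: highest_def typed_zero intro: ladder_span.zero)
next
  case (add y i w)
  then obtain v u where vu: "ladder_span q k a (Suc b) v" "a < b \<longrightarrow> highest q k (Suc a + (b - Suc a)) (b - (b - Suc a)) u"
    "y = (\<lambda>x. raising q v x + (if a < b then (lowering q ^^ (b - Suc a)) u x else 0))" by blast
  show ?case
  proof (cases "a < b \<and> i = b - Suc a")
    case True
    then have "highest q k (Suc a + (b - Suc a)) (b - (b - Suc a)) (\<lambda>x. u x + w x)"
      using highest_add vu(2) add.hyps(3) by blast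
    then show ?thesis
      using vu True by (intro exI[of _ v] exI[of _ "\<lambda>x. u x + w x"]) (auto simp: lower_pow_add fun_eq_iff)
  next
    case False
    let ?c = "qbracket q (int i + 1) * qbracket q (int (Suc a + i) - int (b - i) - int i)"
    have "int (Suc a + i) - int (b - i) - int i \<noteq> 0"
    proof
      assume "int (Suc a + i) - int (b - i) - int i = 0"
      then have "Suc a + i = b" using add.hyps(2) by (simp add: of_nat_diff)
      then show False using False by auto
    qed
    then have c: "?c \<noteq> 0" using qbracket_nonzero[OF assms(1)] by simp
    let ?w = "\<lambda>x. inverse ?c * w x"
    have "highest q k (a + Suc i) (Suc b - Suc i) ?w" using highest_scale[OF add.hyps(3)] by simp
    then have L: "ladder_span q k a (Suc b) (\<lambda>x. v x + (lowering q ^^ Suc i) ?w x)"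
      using add.hyps(2) by (intro ladder_span.add[OF vu(1)]) auto
    have "raising q ((lowering q ^^ Suc i) ?w) = (\<lambda>x. inverse ?c * raising q ((lowering q ^^ Suc i) w) x)"
      unfolding lower_pow_scale raise_fun_scale ..
    also have "\<dots> = (\<lambda>x. (inverse ?c * ?c) * (lowering q ^^ i) w x)"
      unfolding highest_raise_lower[OF assms(1) add.hyps(3)] by (simp only: mult.assoc)
    also have "inverse ?c * ?c = 1" using c by (rule left_inverse)
    finally have "raising q ((lowering q ^^ Suc i) ?w) = (lowering q ^^ i) w" by (simp only: mult_1_left)
    then have "raising q (\<lambda>x. v x + (lowering q ^^ Suc i) ?w x) = (\<lambda>x. raising q v x + (lowering q ^^ i) w x)"
      unfolding raise_fun_add by simp
    then show ?thesis
      using vu L by (intro exI[of _ "\<lambda>x. v x + (lowering q ^^ Suc i) ?w x"] exI[of _ u]) (auto simp: fun_eq_iff)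
  qed
qed

text \<open>E v is a sum of rungs by induction on b. Lifting it through E leaves a difference d for
  which E d is a bottom rung or zero. In the first case F E d = 0 in negative weight, so d = 0; in
  the second d is itself a highest weight vector.\<close>

lemma typed_ladder_span:
  assumes "generic q" "typed k a b v"
  shows "ladder_span q k a b v"
  using assms(2)
proof (induction b arbitrary: a v)
  case 0
  then have "highest q k (a + 0) (0 - 0) v" unfolding highest_def using typed_raise_zero by simp
  then show ?case using ladder_span.add[OF ladder_span.zero, of 0 0 q k a v] by simp
next
  case (Suc b)
  obtain w u where w: "ladder_span q k a (Suc b) w" "a < b \<longrightarrow> highest q k (Suc a + (b - Suc a)) (b - (b - Suc a)) u"
    "raising q v = (\<lambda>x. raising q w x + (if a < b then (lowering q ^^ (b - Suc a)) u x else 0))"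
    using ladder_preimage[OF assms(1) Suc.IH[OF typed_raise[OF Suc.prems]]] by blast
  define d where "d = (\<lambda>x. v x + - 1 * w x)"
  have d: "typed k a (Suc b) d"
    unfolding d_def using typed_add[OF Suc.prems typed_scale[OF ladder_span_typed[OF w(1)]]] .
  have rd: "raising q d = (\<lambda>x. if a < b then (lowering q ^^ (b - Suc a)) u x else 0)"
    unfolding d_def raise_fun_add raise_fun_scale w(3) by (simp add: fun_eq_iff)
  have v: "v = (\<lambda>x. w x + d x)" unfolding d_def by simp
  show ?case
  proof (cases "a < b")
    case True
    have "lowering q (raising q d) = (lowering q ^^ Suc (b - Suc a)) u"
      unfolding rd using True by simp
    also have "\<dots> = (\<lambda>x. 0)"
      by (rule highest_lower_zero[OF assms(1) w(2)[rule_format, OF True]]) (use True in simp)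
    finally have "d = (\<lambda>x. 0)" using True by (intro negative_weight_zero[OF assms(1) typed_homog[OF d]]) auto
    then show ?thesis using w(1) v by simp
  next
    case False
    then have "highest q k (a + 0) (Suc b - 0) d" unfolding highest_def rd using d by simp
    then show ?thesis using ladder_span.add[OF w(1), of 0 d] v by simp
  qed
qed

text \<open>
  The factors \<open>F E - c\<close>, with \<open>c\<close> running through the eigenvalues of \<open>F E\<close> on the vectors of weight
  \<open>j\<close> in the image of \<open>F\<close>.
\<close>

primrec casimir_poly :: "'a::field \<Rightarrow> int \<Rightarrow> nat \<Rightarrow> (basis list \<Rightarrow> 'a) \<Rightarrow> basis list \<Rightarrow> 'a" where
  "casimir_poly q j 0 v = v"
| "casimir_poly q j (Suc n) v = (\<lambda>x. lowering q (raising q (casimir_poly q j n v)) x +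
     - (qbracket q (int n + 1) * qbracket q (j + int n + 2)) * casimir_poly q j n v x)"

lemma homog_add: "homog k m u \<Longrightarrow> homog k m v \<Longrightarrow> homog k m (\<lambda>x. u x + v x)"
  unfolding homog_def by (metis add_0)

lemma homog_scale: "homog k m v \<Longrightarrow> homog k m (\<lambda>x. c * v x)"
  unfolding homog_def by auto

lemma homog_casimir_poly: "homog k m v \<Longrightarrow> homog k m (casimir_poly q j n v)"
proof (induction n)
  case (Suc n)
  have "homog k m (lowering q (raising q (casimir_poly q j n v)))"
    using homog_lower[OF homog_raise[OF Suc.IH[OF Suc.prems]]] by simp
  then show ?case unfolding casimir_poly.simps using Suc by (intro homog_add homog_scale)
qed simp

text \<open>The constant of step n + 1 in weight j is that of step n in weight j + 2 plus [j + 2],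
  the scalar picked up when F E is moved past F.\<close>

lemma casimir_coefficient:
  assumes "generic q"
  shows "qbracket q (int n + 1 + 1) * qbracket q (j + int (Suc n) + 2) =
    qbracket q (int n + 1) * qbracket q (j + 2 + int n + 2) + qbracket q (j + 2)"
proof -
  have t: "q \<noteq> 0" "q \<noteq> inverse q" using assms generic_inverse unfolding generic_def by auto
  show ?thesis
    using qbracket_step[OF t, of "int n + 1" "j + 2 * int n + 4"] by (simp add: algebra_simps)
qed

text \<open>The first factor turns F y into F F E y. Each later one passes through the outer F and
  becomes, by \<open>casimir_coefficient\<close>, a factor for weight j + 2.\<close>

lemma casimir_poly_lower:
  assumes "generic q" "homog k (j + 2) y"
  shows "casimir_poly q j (Suc n) (lowering q y) = lowering q (casimir_poly q (j + 2) n (lowering q (raising q y)))"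
proof (induction n)
  case 0
  have "qbracket q 1 = 1" using generic_inverse[OF assms(1)] by (simp add: qbracket_def power_int_minus)
  then show ?case
    unfolding casimir_poly.simps homog_raise_lower[OF assms] lower_fun_add lower_fun_scale by (simp add: fun_eq_iff)
next
  case (Suc n)
  let ?z = "casimir_poly q (j + 2) n (lowering q (raising q y))"
  have z: "homog k (j + 2) ?z"
    using homog_lower[OF homog_raise[OF assms(2)], of q q]
    by (intro homog_casimir_poly) (simp only: add_diff_cancel_right')
  have "casimir_poly q j (Suc (Suc n)) (lowering q y) = (\<lambda>x. lowering q (raising q (lowering q ?z)) x +
      - (qbracket q (int (Suc n) + 1) * qbracket q (j + int (Suc n) + 2)) * lowering q ?z x)"
    unfolding casimir_poly.simps(2)[of q j "Suc n"] Suc.IH ..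
  also have "\<dots> = (\<lambda>x. lowering q (lowering q (raising q ?z)) x +
      - (qbracket q (int n + 1) * qbracket q (j + 2 + int n + 2)) * lowering q ?z x)"
    unfolding homog_raise_lower[OF assms(1) z] lower_fun_add lower_fun_scale
    using casimir_coefficient[OF assms(1), of n j] by (simp add: fun_eq_iff algebra_simps)
  also have "\<dots> = lowering q (casimir_poly q (j + 2) (Suc n) (lowering q (raising q y)))"
    unfolding casimir_poly.simps(2)[of q "j + 2" n] lower_fun_add lower_fun_scale ..
  finally show ?case .
qed

text \<open>Iterating the previous step replaces n factors by powers of E and F. As E^n y vanishes
  once n exceeds the number of letters \<open>Neg\<close>, enough factors kill the image of
  F.\<close>

lemma casimir_poly_lower_pow:
  assumes "generic q" "homog k (j + 2) y"
  shows "casimir_poly q j n (lowering q y) = (lowering q ^^ Suc n) ((raising q ^^ n) y)"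
  using assms(2)
proof (induction n arbitrary: j y)
  case (Suc n)
  have "homog k (j + 2 + 2) (raising q y)" using homog_raise[OF Suc.prems] .
  then show ?case
    unfolding casimir_poly_lower[OF assms(1) Suc.prems] using Suc.IH by (simp add: funpow_swap1)
qed simp

lemma casimir_poly_highest:
  assumes "raising q u = (\<lambda>x. 0)"
  shows "casimir_poly q j n u = (\<lambda>x. (\<Prod>i<n. - (qbracket q (int i + 1) * qbracket q (j + int i + 2))) * u x)"
proof (induction n)
  case (Suc n)
  show ?case
    unfolding casimir_poly.simps Suc raise_fun_scale assms lower_fun_scale by (simp add: fun_eq_iff)
qed simp

section \<open>The double centralizer\<close>

text \<open>Operators realized on words of length k by some element of the free algebra. The closure
  rules allow projections to be assembled without ever writing that element down.\<close>

definition alg_op :: "'a::field \<Rightarrow> nat \<Rightarrow> ((basis list \<Rightarrow> 'a) \<Rightarrow> basis list \<Rightarrow> 'a) \<Rightarrow> bool" where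
  "alg_op q k \<phi> \<longleftrightarrow> (\<exists>u. \<forall>v x. length x = k \<longrightarrow> \<phi> v x = free_op q u v x)"

lemma free_op_fun_add: "free_op q u (\<lambda>w. v w + v' w) x = free_op q u v x + free_op q u v' x"
proof -
  have "(\<lambda>w. v w + v' w) = (\<lambda>w. \<Sum>b\<in>{True, False}. 1 * (if b then v w else v' w))" by (simp add: fun_eq_iff)
  then show ?thesis
    using free_op_sum[of q u "\<lambda>_. 1" "\<lambda>b w. if b then v w else v' w" "{True, False}"] by simp
qed

lemma free_op_expand:
  assumes "length z = k"
  shows "free_op q u v z = (\<Sum>w\<in>words k. v w * free_op q u (\<lambda>y. if y = w then 1 else 0) z)"
proof -
  have "free_op q u v z = free_op q u (\<lambda>y. \<Sum>w\<in>words k. v w * (if y = w then 1 else 0)) z"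
    using assms by (intro free_op_cong) (simp add: if_distrib[of "\<lambda>z. _ * z"] sum.delta cong: if_cong)
  then show ?thesis unfolding free_op_sum .
qed

lemma alg_op_id: "alg_op q k (\<lambda>v. v)"
  unfolding alg_op_def by (rule exI[of _ 1]) (simp add: free_op_one)

lemma alg_op_gen: "alg_op q k (gen_op q a)"
  unfolding alg_op_def by (rule exI[of _ "free_gen a"]) (simp add: free_op_gen)

lemma alg_op_comp:
  assumes "alg_op q k \<phi>" "alg_op q k \<psi>"
  shows "alg_op q k (\<lambda>v. \<phi> (\<psi> v))"
proof -
  obtain u u' where u: "\<And>v x. length x = k \<Longrightarrow> \<phi> v x = free_op q u v x" "\<And>v x. length x = k \<Longrightarrow> \<psi> v x = free_op q u' v x"
    using assms unfolding alg_op_def by blast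
  have "\<phi> (\<psi> v) x = free_op q (u * u') v x" if "length x = k" for v x
  proof -
    have "free_op q u (\<psi> v) x = free_op q u (free_op q u' v) x" using u(2) that by (intro free_op_cong) simp
    then show ?thesis using u(1) that by (simp add: free_op_mult)
  qed
  then show ?thesis unfolding alg_op_def by blast
qed

lemma alg_op_add:
  assumes "alg_op q k \<phi>" "alg_op q k \<psi>"
  shows "alg_op q k (\<lambda>v x. \<phi> v x + \<psi> v x)"
proof -
  obtain u u' where u: "\<And>v x. length x = k \<Longrightarrow> \<phi> v x = free_op q u v x" "\<And>v x. length x = k \<Longrightarrow> \<psi> v x = free_op q u' v x"
    using assms unfolding alg_op_def by blast
  then show ?thesis unfolding alg_op_def by (intro exI[of _ "u + u'"]) (simp add: free_op_add)
qed

lemma alg_op_scale: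
  assumes "alg_op q k \<phi>"
  shows "alg_op q k (\<lambda>v x. c * \<phi> v x)"
proof -
  obtain u where u: "\<And>v x. length x = k \<Longrightarrow> \<phi> v x = free_op q u v x"
    using assms unfolding alg_op_def by blast
  then show ?thesis
    unfolding alg_op_def by (intro exI[of _ "free_const c * u"]) (simp add: free_op_mult free_op_const)
qed

lemma alg_op_zero: "alg_op q k (\<lambda>v x. 0)"
  using alg_op_scale[OF alg_op_id, of q k 0] by simp

lemma alg_op_sum: "(\<And>i. i \<in> I \<Longrightarrow> alg_op q k (\<phi> i)) \<Longrightarrow> alg_op q k (\<lambda>v x. \<Sum>i\<in>I. \<phi> i v x)"
proof (induction I rule: infinite_finite_induct)
  case (insert i I)
  then show ?case by (simp add: alg_op_add)
qed (simp_all add: alg_op_zero)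

lemma alg_op_cong:
  assumes "alg_op q k \<phi>" "\<And>v x. length x = k \<Longrightarrow> \<psi> v x = \<phi> v x"
  shows "alg_op q k \<psi>"
  using assms unfolding alg_op_def by metis

lemma gen_op_EF: "gen_op q E = raising q" "gen_op q F = lowering q"
  by (simp_all add: fun_eq_iff)

lemma alg_op_raise_pow: "alg_op q k (raising q ^^ i)"
proof (induction i)
  case 0 show ?case using alg_op_id by (simp add: id_def)
next
  case (Suc i)
  have "alg_op q k (raising q)" using alg_op_gen[of q k E] unfolding gen_op_EF .
  from alg_op_comp[OF this Suc] show ?case by (simp add: comp_def)
qed

lemma alg_op_lower_pow: "alg_op q k (lowering q ^^ i)"
proof (induction i)
  case 0 show ?case using alg_op_id by (simp add: id_def)
next
  case (Suc i)
  have "alg_op q k (lowering q)" using alg_op_gen[of q k F] unfolding gen_op_EF .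
  from alg_op_comp[OF this Suc] show ?case by (simp add: comp_def)
qed

lemma alg_op_diag_prod:
  assumes "\<And>i. i \<in> I \<Longrightarrow> alg_op q k (\<lambda>v x. f i x * v x)"
  shows "alg_op q k (\<lambda>v x. (\<Prod>i\<in>I. f i x) * v x)"
  using assms
proof (induction I rule: infinite_finite_induct)
  case (insert i I)
  have "alg_op q k (\<lambda>v x. f i x * ((\<Prod>i\<in>I. f i x) * v x))"
    using alg_op_comp[of q k "\<lambda>v x. f i x * v x" "\<lambda>v x. (\<Prod>i\<in>I. f i x) * v x"] insert by simp
  then show ?case using insert(1,2) by (simp add: mult.assoc)
qed (simp_all add: alg_op_id)

text \<open>Lagrange interpolation in the eigenvalues of a generator acting diagonally.\<close>

lemma alg_op_count:
  assumes "generic q" "\<And>v. gen_op q g v = (\<lambda>x. q ^ f x * v x)" "\<And>x. f x \<le> length x"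
  shows "alg_op q k (\<lambda>v x. of_bool (f x = a) * v x)"
proof (cases "a \<le> k")
  case False
  then have "of_bool (f x = a) * v x = 0" if "length x = k" for v :: "basis list \<Rightarrow> 'a" and x
    using assms(3)[of x] that by auto
  then show ?thesis by (intro alg_op_cong[OF alg_op_zero]) simp
next
  case True
  let ?I = "{0..k} - {a}"
  let ?f = "\<lambda>i x. inverse (q ^ a - q ^ i) * (q ^ f x + - (q ^ i))"
  have ne: "q ^ a - q ^ i \<noteq> 0" if "i \<in> ?I" for i using generic_power_inject[OF assms(1), of a i] that by auto
  have "alg_op q k (\<lambda>v x. ?f i x * v x)" for i
  proof -
    have "alg_op q k (\<lambda>v x. q ^ f x * v x)" using alg_op_gen[of q k g] unfolding assms(2)[abs_def] .
    from alg_op_scale[OF alg_op_add[OF this alg_op_scale[OF alg_op_id, of q k "- (q ^ i)"]], of "inverse (q ^ a - q ^ i)"]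
    show ?thesis by (simp add: algebra_simps)
  qed
  then have "alg_op q k (\<lambda>v x. (\<Prod>i\<in>?I. ?f i x) * v x)" by (rule alg_op_diag_prod)
  moreover have pr: "(\<Prod>i\<in>?I. ?f i x) = of_bool (f x = a)" if "length x = k" for x
  proof (cases "f x = a")
    case True
    then have "?f i x = 1" if "i \<in> ?I" for i using ne[OF that] by simp
    then have "(\<Prod>i\<in>?I. ?f i x) = 1" by (intro prod.neutral ballI)
    then show ?thesis using True by simp
  next
    case False
    then have "f x \<in> ?I" using assms(3)[of x] that by auto
    moreover have "?f (f x) x = 0" by simp
    ultimately have "(\<Prod>i\<in>?I. ?f i x) = 0" by (intro prod_zero) blast+
    then show ?thesis using False by simp
  qed
  ultimately show ?thesis by (elim alg_op_cong) (simp add: pr)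
qed

section \<open>Projections realized by the quantum group\<close>

definition type_proj :: "nat \<Rightarrow> nat \<Rightarrow> nat \<Rightarrow> (basis list \<Rightarrow> 'a::field) \<Rightarrow> basis list \<Rightarrow> 'a" where
  "type_proj k a b v x = of_bool (length x = k \<and> npos x = a \<and> nneg x = b) * v x"

lemma counts_le_length: "npos x \<le> length x" "nneg x \<le> length x"
  by (simp_all add: npos_def nneg_def)

lemma alg_op_type_proj:
  assumes "generic q"
  shows "alg_op q k (type_proj k a b)"
proof -
  have 1: "alg_op q k (\<lambda>v x. of_bool (npos x = a) * v x)"
    by (rule alg_op_count[OF assms, of K1]) (simp_all add: fun_eq_iff word_wt_counts counts_le_length)
  have 2: "alg_op q k (\<lambda>v x. of_bool (nneg x = b) * v x)"
    by (rule alg_op_count[OF assms, of K2]) (simp_all add: fun_eq_iff word_wt_counts counts_le_length)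
  show ?thesis
    by (rule alg_op_cong[OF alg_op_comp[OF 1 2]]) (simp add: type_proj_def)
qed

lemma typed_type_proj: "typed k a b (type_proj k a b v)"
  unfolding typed_def type_proj_def by auto

lemma type_proj_typed: "typed k a b v \<Longrightarrow> type_proj k a b v = v"
  unfolding typed_def type_proj_def by (rule ext) auto

lemma type_proj_other: "typed k a' b' v \<Longrightarrow> (a', b') \<noteq> (a, b) \<Longrightarrow> type_proj k a b v = (\<lambda>x. 0)"
  unfolding typed_def type_proj_def by (rule ext) auto

text \<open>The projection onto the highest weight vectors of a given type along the image of the lowering operator.\<close>

definition highest_proj :: "'a::field \<Rightarrow> nat \<Rightarrow> nat \<Rightarrow> nat \<Rightarrow> (basis list \<Rightarrow> 'a) \<Rightarrow> basis list \<Rightarrow> 'a" where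
  "highest_proj q k a b v x =
     inverse (\<Prod>i<k. - (qbracket q (int i + 1) * qbracket q (int a - int b + int i + 2))) *
     casimir_poly q (int a - int b) k (type_proj k a b v) x"

lemma alg_op_highest_proj:
  assumes "generic q"
  shows "alg_op q k (highest_proj q k a b)"
proof -
  have EF: "alg_op q k (raising q)" "alg_op q k (lowering q)"
    using alg_op_gen[of q k E] alg_op_gen[of q k F] unfolding gen_op_EF .
  have "alg_op q k (casimir_poly q j n)" for j n
  proof (induction n)
    case 0 show ?case by (rule alg_op_cong[OF alg_op_id]) simp
  next
    case (Suc n)
    have "alg_op q k (\<lambda>v. lowering q (raising q (casimir_poly q j n v)))"
      using alg_op_comp[OF EF(2) alg_op_comp[OF EF(1) Suc]] .
    from alg_op_add[OF this alg_op_scale[OF Suc, of "- (qbracket q (int n + 1) * qbracket q (j + int n + 2))"]]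
    show ?case by (rule alg_op_cong) simp
  qed
  from alg_op_scale[OF alg_op_comp[OF this alg_op_type_proj[OF assms]]]
  show ?thesis by (rule alg_op_cong) (simp add: highest_proj_def)
qed

lemma casimir_poly_zero: "casimir_poly q j n (\<lambda>x. 0) = (\<lambda>x. 0)"
  by (induction n) simp_all

text \<open>For a \<ge> b all constants [i + 1] [a - b + i + 2] are nonzero, so dividing by their
  product normalizes the polynomial to the identity on highest weight vectors.\<close>

lemma highest_proj_highest:
  assumes "generic q" "b \<le> a" "highest q k a b u"
  shows "highest_proj q k a b u = u"
proof -
  let ?c = "\<Prod>i<k. - (qbracket q (int i + 1) * qbracket q (int a - int b + int i + 2))"
  have "?c \<noteq> 0"
    using qbracket_nonzero[OF assms(1)] assms(2) by simp
  then have c: "inverse ?c * (?c * y) = y" for y by (simp only: mult.assoc[symmetric] left_inverse mult_1_left not_False_eq_True)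
  have "raising q u = (\<lambda>x. 0)" "type_proj k a b u = u"
    using assms(3) type_proj_typed unfolding highest_def by auto
  then show ?thesis
    unfolding highest_proj_def[abs_def] by (simp only: casimir_poly_highest c)
qed

lemma highest_proj_zero: "highest_proj q k a b (\<lambda>x. 0) = (\<lambda>x. 0)"
  by (simp add: highest_proj_def[abs_def] type_proj_def[abs_def] casimir_poly_zero)

lemma highest_proj_other: "typed k a' b' v \<Longrightarrow> (a', b') \<noteq> (a, b) \<Longrightarrow> highest_proj q k a b v = (\<lambda>x. 0)"
  unfolding highest_proj_def[abs_def] by (simp add: type_proj_other casimir_poly_zero)

text \<open>If the types match, y has one letter \<open>Neg\<close> less than b \<le> k, so E^k y =
  0 and k factors suffice. Otherwise the type projection already gives zero.\<close>

lemma highest_proj_lower: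
  assumes "generic q" "b \<le> k" "typed k a' b' y"
  shows "highest_proj q k a b (lowering q y) = (\<lambda>x. 0)"
proof (cases a')
  case 0
  then show ?thesis using typed_lower_zero[of k b' y q] assms(3) highest_proj_zero by simp
next
  case (Suc m)
  then have t: "typed k m (Suc b') (lowering q y)" using assms(3) typed_lower by blast
  show ?thesis
  proof (cases "(m, Suc b') = (a, b)")
    case False then show ?thesis using highest_proj_other[OF t] by blast
  next
    case True
    have "homog k (int a - int b + 2) y" using typed_homog[OF assms(3)] True Suc by (auto simp: algebra_simps)
    then have "casimir_poly q (int a - int b) k (lowering q y) = (lowering q ^^ Suc k) ((raising q ^^ k) y)"
      by (rule casimir_poly_lower_pow[OF assms(1)])
    also have "(raising q ^^ k) y = (\<lambda>x. 0)"
      using typed_raise_pow_zero[OF assms(3), of k] True assms(2) by simp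
    finally have "casimir_poly q (int a - int b) k (lowering q y) = (\<lambda>x. 0)" using lower_pow_zero by metis
    then show ?thesis unfolding highest_proj_def[abs_def] using True type_proj_typed[OF t] by simp
  qed
qed

text \<open>E^l F^i u is a multiple of a rung below the top if l < i, hence in the image of F; it is
  zero if l > i and a multiple of u if l = i. So applying E^l and projecting reads off the component
  on rung l.\<close>

lemma highest_proj_ladder:
  assumes "generic q" "b \<le> a" "b \<le> k" "highest q k a' b' u"
  shows "highest_proj q k a b ((raising q ^^ l) ((lowering q ^^ i) u)) =
    (\<lambda>x. if l = i \<and> a' = a \<and> b' = b then ladder_const q (int a - int b) i * u x else 0)"
proof -
  have u: "typed k a' b' u" "raising q u = (\<lambda>x. 0)" using assms(4) unfolding highest_def by auto
  consider "l < i" | "l = i" | "i < l" by linarith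
  then show ?thesis
  proof cases
    case 1
    then obtain m where m: "i = l + Suc m" using less_iff_Suc_add by auto
    obtain c where c: "(raising q ^^ l) ((lowering q ^^ (l + Suc m)) u) = (\<lambda>x. c * (lowering q ^^ Suc m) u x)"
      using highest_raise_pow_lower_pow[OF assms(1,4)] by blast
    have "(\<lambda>x. c * (lowering q ^^ Suc m) u x) = lowering q (\<lambda>x. c * (lowering q ^^ m) u x)"
      by (simp add: lower_fun_scale)
    moreover have "highest_proj q k a b (lowering q (\<lambda>x. c * (lowering q ^^ m) u x)) = (\<lambda>x. 0)"
    proof (cases "m \<le> a'")
      case True
      then show ?thesis using highest_proj_lower[OF assms(1,3) typed_scale[OF typed_lower_pow[OF u(1)]]] by blast
    next
      case False
      then show ?thesis using typed_lower_pow_zero[OF u(1), of m] highest_proj_zero by simp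
    qed
    ultimately show ?thesis unfolding m c by simp
  next
    case 2
    have h: "highest q k a' b' (\<lambda>x. ladder_const q (int a' - int b') i * u x)" using highest_scale[OF assms(4)] .
    show ?thesis
    proof (cases "(a', b') = (a, b)")
      case True
      then show ?thesis unfolding 2 highest_ladder[OF assms(1,4)] using highest_proj_highest[OF assms(1,2)] h by simp
    next
      case False
      then show ?thesis
        unfolding 2 highest_ladder[OF assms(1,4)]
        using highest_proj_other[of k a' b' _ a b q] h unfolding highest_def by auto
    qed
  next
    case 3
    then obtain m where m: "l = Suc m + i" using less_iff_Suc_add by (metis add.commute add_Suc_right)
    have "(raising q ^^ Suc m) u = (\<lambda>x. 0)" by (simp only: funpow_Suc_right comp_def u(2) raise_pow_zero)
    then have "(raising q ^^ l) ((lowering q ^^ i) u) = (\<lambda>x. 0)"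
      unfolding m funpow_add comp_def highest_ladder[OF assms(1,4)] raise_pow_scale by simp
    then show ?thesis using 3 highest_proj_zero by simp
  qed
qed

text \<open>A vector on words of length k is the sum of its parts of finitely many types, and each
  part is a sum of rungs.\<close>

lemma ladder_induct:
  assumes "generic q" "\<And>x. length x \<noteq> k \<Longrightarrow> v x = 0"
    and zero: "P (\<lambda>x. 0)" and add: "\<And>u v. P u \<Longrightarrow> P v \<Longrightarrow> P (\<lambda>x. u x + v x)"
    and ladder: "\<And>a b u i. highest q k a b u \<Longrightarrow> P ((lowering q ^^ i) u)"
  shows "P v"
proof -
  have span: "P u" if "ladder_span q k a b u" for a b u
    using that by (induction rule: ladder_span.induct) (use zero add ladder in blast)+
  have sum: "P (\<lambda>x. \<Sum>i\<in>I. f i x)" if "finite I" "\<And>i. i \<in> I \<Longrightarrow> P (f i)" for I :: "(nat \<times> nat) set" and f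
    using that by (induction I rule: finite_induct) (simp_all add: zero add)
  have "v = (\<lambda>x. \<Sum>p\<in>{0..k} \<times> {0..k}. type_proj k (fst p) (snd p) v x)"
  proof
    fix x
    show "v x = (\<Sum>p\<in>{0..k} \<times> {0..k}. type_proj k (fst p) (snd p) v x)"
    proof (cases "length x = k")
      case True
      have "(\<Sum>p\<in>{0..k} \<times> {0..k}. type_proj k (fst p) (snd p) v x) =
          (\<Sum>p\<in>{0..k} \<times> {0..k}. if p = (npos x, nneg x) then v x else 0)"
        using True by (intro sum.cong) (auto simp: type_proj_def)
      also have "\<dots> = v x" using counts_le_length[of x] True by (simp add: sum.delta')
      finally show ?thesis ..
    qed (simp add: assms(2) type_proj_def)
  qed
  moreover have "P (\<lambda>x. \<Sum>p\<in>{0..k} \<times> {0..k}. type_proj k (fst p) (snd p) v x)"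
    by (intro sum span[OF typed_ladder_span[OF assms(1) typed_type_proj]]) simp
  ultimately show ?thesis by simp
qed

text \<open>
  The operator sending \<open>F\<^sup>i u\<close>, for \<open>u\<close> highest of type \<open>(a, b)\<close>, to the multiple by \<open>u z\<close> of
  \<open>F\<^sup>i u'\<close>, and killing all other ladders.
\<close>

definition ladder_map ::
  "'a::field \<Rightarrow> nat \<Rightarrow> nat \<Rightarrow> nat \<Rightarrow> basis list \<Rightarrow> (basis list \<Rightarrow> 'a) \<Rightarrow> (basis list \<Rightarrow> 'a) \<Rightarrow> basis list \<Rightarrow> 'a" where
  "ladder_map q k a b z u' v x = (\<Sum>i\<le>a - b. inverse (ladder_const q (int a - int b) i) *
     highest_proj q k a b ((raising q ^^ i) v) z * (lowering q ^^ i) u' x)"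

definition ladder_mat ::
  "'a::field \<Rightarrow> nat \<Rightarrow> nat \<Rightarrow> nat \<Rightarrow> basis list \<Rightarrow> (basis list \<Rightarrow> 'a) \<Rightarrow> basis list \<Rightarrow> basis list \<Rightarrow> 'a" where
  "ladder_mat q k a b z u' x w = ladder_map q k a b z u' (\<lambda>y. if y = w then 1 else 0) x"

lemma highest_lower_pow_support:
  assumes "highest q k a b u" "(lowering q ^^ i) u x \<noteq> 0"
  shows "length x = k" "npos x + i = a" "nneg x = b + i"
proof -
  have t: "typed k a b u" using assms(1) unfolding highest_def by simp
  have "i \<le> a" using typed_lower_pow_zero[OF t, of i q] assms(2) by (metis not_le)
  then show "length x = k" "npos x + i = a" "nneg x = b + i"
    using typed_lower_pow[OF t, of i q] assms(2) unfolding typed_def by auto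
qed

lemma mat_vec_ladder_mat:
  assumes "generic q" "length z = k" "highest q k a b u'"
  shows "mat_vec k (ladder_mat q k a b z u') v = ladder_map q k a b z u' v"
proof
  fix x
  show "mat_vec k (ladder_mat q k a b z u') v x = ladder_map q k a b z u' v x"
  proof (cases "length x = k")
    case True
    have co: "highest_proj q k a b ((raising q ^^ i) v) z =
        (\<Sum>w\<in>words k. v w * highest_proj q k a b ((raising q ^^ i) (\<lambda>y. if y = w then 1 else 0)) z)" for i
    proof -
      obtain g where "\<And>v x. length x = k \<Longrightarrow> highest_proj q k a b ((raising q ^^ i) v) x = free_op q g v x"
        using alg_op_comp[OF alg_op_highest_proj[OF assms(1)] alg_op_raise_pow] unfolding alg_op_def by blast
      then show ?thesis using free_op_expand[OF assms(2), of q g v] assms(2) by simp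
    qed
    have "ladder_map q k a b z u' v x = (\<Sum>w\<in>words k. ladder_mat q k a b z u' x w * v w)"
      unfolding ladder_mat_def ladder_map_def co sum_distrib_left sum_distrib_right
      by (subst sum.swap) (simp add: mult_ac)
    then show ?thesis using True by (simp add: mat_vec_def)
  next
    case False
    have "(lowering q ^^ i) u' x = 0" for i
      using highest_lower_pow_support(1)[OF assms(3)] False by blast
    then show ?thesis using False by (simp add: mat_vec_def ladder_map_def)
  qed
qed

lemma ladder_map_ladder:
  assumes "generic q" "b \<le> a" "b \<le> k" "highest q k a' b' u"
  shows "ladder_map q k a b z u' ((lowering q ^^ i) u) =
    (\<lambda>x. if a' = a \<and> b' = b \<and> i \<le> a - b then u z * (lowering q ^^ i) u' x else 0)"
proof
  fix x
  have "ladder_map q k a b z u' ((lowering q ^^ i) u) x =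
      (\<Sum>l\<le>a - b. if l = i then (if a' = a \<and> b' = b then
        inverse (ladder_const q (int a - int b) i) * (ladder_const q (int a - int b) i * u z) * (lowering q ^^ i) u' x else 0) else 0)"
    unfolding ladder_map_def highest_proj_ladder[OF assms] by (intro sum.cong refl) auto
  also have "\<dots> = (if a' = a \<and> b' = b \<and> i \<le> a - b then
      inverse (ladder_const q (int a - int b) i) * (ladder_const q (int a - int b) i * u z) * (lowering q ^^ i) u' x else 0)"
    by (simp add: sum.delta)
  also have "\<dots> = (if a' = a \<and> b' = b \<and> i \<le> a - b then u z * (lowering q ^^ i) u' x else 0)"
  proof (cases "i \<le> a - b")
    case True
    then have "ladder_const q (int a - int b) i \<noteq> 0" using assms(2) by (intro ladder_const_nonzero[OF assms(1)]) simp
    then show ?thesis by simp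
  qed simp
  finally show "ladder_map q k a b z u' ((lowering q ^^ i) u) x =
    (if a' = a \<and> b' = b \<and> i \<le> a - b then u z * (lowering q ^^ i) u' x else 0)" .
qed

text \<open>Rung i goes to rung i with a factor independent of i, and E acts on all ladders of one
  type by the same scalars. F then needs no computation, by
  \<open>commutes_lowering\<close>.\<close>

lemma ladder_mat_commutes:
  assumes "generic q" "b \<le> a" "b \<le> k" "length z = k" "highest q k a b u'"
  shows "mat_op k (ladder_mat q k a b z u') \<in> centralizer (End_alg k) (range (act_on q k))"
proof -
  have q: "q \<noteq> 0" using assms(1) unfolding generic_def by simp
  let ?N = "ladder_mat q k a b z u'" and ?\<Phi> = "ladder_map q k a b z u'"
  note N = mat_vec_ladder_mat[OF assms(1,4,5)]
  have lin: "?\<Phi> (\<lambda>x. u x + v x) = (\<lambda>x. ?\<Phi> u x + ?\<Phi> v x)" "?\<Phi> (\<lambda>x. c * v x) = (\<lambda>x. c * ?\<Phi> v x)" for u v c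
    unfolding N[symmetric] by (rule mat_vec_add, rule mat_vec_scale)
  have E: "raising q (?\<Phi> v) = ?\<Phi> (raising q v)" if "\<And>x. length x \<noteq> k \<Longrightarrow> v x = 0" for v
  proof (rule ladder_induct[OF assms(1) that])
    show "raising q (?\<Phi> (\<lambda>x. 0)) = ?\<Phi> (raising q (\<lambda>x. 0))"
      using lin(2)[of 0 "\<lambda>x. 0"] by simp
    show "raising q (?\<Phi> (\<lambda>x. u x + v x)) = ?\<Phi> (raising q (\<lambda>x. u x + v x))"
      if "raising q (?\<Phi> u) = ?\<Phi> (raising q u)" "raising q (?\<Phi> v) = ?\<Phi> (raising q v)" for u v
      using that by (simp add: lin raise_fun_add)
    fix a' b' u i assume u: "highest q k a' b' u"
    note L = ladder_map_ladder[OF assms(1-3) u]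
    show "raising q (?\<Phi> ((lowering q ^^ i) u)) = ?\<Phi> (raising q ((lowering q ^^ i) u))"
    proof (cases i)
      case 0
      have z: "raising q u = (\<lambda>x. 0)" "raising q u' = (\<lambda>x. 0)" using u assms(5) unfolding highest_def by auto
      have "?\<Phi> (\<lambda>x. 0) = (\<lambda>x. 0)" using lin(2)[of 0 "\<lambda>x. 0"] by simp
      then show ?thesis
        using L[of z u' 0] z by (cases "a' = a \<and> b' = b") (simp_all add: 0 raise_fun_scale)
    next
      case (Suc m)
      let ?c = "qbracket q (int m + 1) * qbracket q (int a' - int b' - int m)"
      have R: "?\<Phi> (raising q ((lowering q ^^ Suc m) u)) =
          (\<lambda>x. ?c * (if a' = a \<and> b' = b \<and> m \<le> a - b then u z * (lowering q ^^ m) u' x else 0))"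
        unfolding highest_raise_lower[OF assms(1) u] lin L ..
      show ?thesis
      proof (cases "a' = a \<and> b' = b")
        case False
        then show ?thesis unfolding Suc R L by auto
      next
        case True
        show ?thesis
        proof (cases "Suc m \<le> a - b")
          case m: True
          have "raising q (?\<Phi> ((lowering q ^^ Suc m) u)) = (\<lambda>x. u z * raising q ((lowering q ^^ Suc m) u') x)"
            unfolding L using True m by (simp add: raise_fun_scale)
          then show ?thesis
            unfolding Suc R highest_raise_lower[OF assms(1,5)] using True m by (simp add: fun_eq_iff mult_ac)
        next
          \<comment> \<open>At the end of the ladder: for m = a - b the coefficient [a - b - m]
            vanishes, and for larger m the map itself gives zero.\<close>
          case m: False
          have "m < a - b \<or> m = a - b \<or> m > a - b" by linarith
          then have "?c = 0 \<or> \<not> m \<le> a - b"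
          proof (elim disjE)
            assume "m = a - b"
            then have "int a' - int b' - int m = 0" using True assms(2) by simp
            then have "qbracket q (int a' - int b' - int m) = 0" unfolding qbracket_def by simp
            then show ?thesis by simp
          qed (use m in auto)
          then have "?\<Phi> (raising q ((lowering q ^^ Suc m) u)) = (\<lambda>x. 0)" unfolding R by auto
          moreover have "?\<Phi> ((lowering q ^^ Suc m) u) = (\<lambda>x. 0)" unfolding L using m by simp
          ultimately show ?thesis unfolding Suc by simp
        qed
      qed
    qed
  qed
  have cr: "commutes_raising q k ?N"
    unfolding commutes_raising_iff
  proof
    fix v :: "basis list \<Rightarrow> 'a"
    let ?r = "\<lambda>w. if length w = k then v w else 0"
    have 1: "mat_vec k ?N v = mat_vec k ?N ?r" by (intro mat_vec_cong) simp
    have 2: "mat_vec k ?N (raising q v) = mat_vec k ?N (raising q ?r)"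
      by (intro mat_vec_cong raise_cong) simp
    show "raising q (mat_vec k ?N v) = mat_vec k ?N (raising q v)"
      unfolding 1 2 unfolding N by (rule E) simp
  qed
  have "preserves_type k ?N"
    unfolding preserves_type_def
  proof (intro allI impI)
    fix x w assume xw: "length x = k" "length w = k" "?N x w \<noteq> 0"
    let ?\<delta> = "\<lambda>y. if y = w then (1 :: 'a) else 0"
    obtain i where i: "inverse (ladder_const q (int a - int b) i) * highest_proj q k a b ((raising q ^^ i) ?\<delta>) z *
        (lowering q ^^ i) u' x \<noteq> 0"
      using xw(3) unfolding ladder_mat_def ladder_map_def by (rule sum.not_neutral_contains_not_neutral)
    then have "(lowering q ^^ i) u' x \<noteq> 0" by auto
    then have x: "npos x + i = a" "nneg x = b + i" using highest_lower_pow_support[OF assms(5)] by blast+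
    have d: "typed k (npos w) (nneg w) ?\<delta>" using xw(2) unfolding typed_def by auto
    have nz: "highest_proj q k a b ((raising q ^^ i) ?\<delta>) \<noteq> (\<lambda>x. 0)" using i by auto
    then have "(raising q ^^ i) ?\<delta> \<noteq> (\<lambda>x. 0)" using highest_proj_zero by metis
    then have iw: "i \<le> nneg w" using typed_raise_pow_zero[OF d] by (metis not_le)
    then have "npos w + i = a \<and> nneg w - i = b"
      using highest_proj_other[OF typed_raise_pow[OF d iw]] nz by (metis prod.inject)
    then have "npos x = npos w" "nneg x = nneg w" using x iw by auto
    then show "weight x = weight w \<and> active x = active w"
      using npos_nneg[of x] npos_nneg[of w] by linarith
  qed
  then show ?thesis
    unfolding centralizer_act_on[OF q] mat_op_commutes_act_on[OF q]
    using commutes_free_op[OF assms(1) cr] mat_op_End by blast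
qed

lemma double_centralizer:
  assumes "generic q" "T \<in> centralizer (End_alg k) (centralizer (End_alg k) (range (act_on q k)))"
  shows "T \<in> range (act_on q k)"
proof -
  have q: "q \<noteq> 0" using assms(1) unfolding generic_def by simp
  have TE: "T \<in> End_space k" and Tc: "\<And>S. S \<in> centralizer (End_alg k) (range (act_on q k)) \<Longrightarrow>
      compose (tensor_power k) T S = compose (tensor_power k) S T"
    using assms(2) unfolding centralizer_def[of _ "centralizer _ _"] End_alg_def by auto
  define M where "M = op_mat T"
  have TM: "T = mat_op k M" using mat_op_op_mat[OF TE] unfolding M_def by simp
  let ?T = "mat_vec k M"
  have T0: "?T (\<lambda>x. 0) = (\<lambda>x. 0)" by (simp add: mat_vec_def fun_eq_iff)
  have com: "?T (ladder_map q k a b z u' v) = ladder_map q k a b z u' (?T v)"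
    if h: "b \<le> a" "b \<le> k" "length z = k" "highest q k a b u'" for a b z u' v
  proof -
    let ?N = "ladder_mat q k a b z u'"
    have "mat_op k (\<lambda>w' w. \<Sum>u\<in>words k. M w' u * ?N u w) = mat_op k (\<lambda>w' w. \<Sum>u\<in>words k. ?N w' u * M u w)"
      using Tc[OF ladder_mat_commutes[OF assms(1) h]] unfolding TM compose_mat_op .
    then have "(\<Sum>u\<in>words k. M w' u * ?N u w) = (\<Sum>u\<in>words k. ?N w' u * M u w)" if "length w' = k" "length w = k" for w' w
      using mat_op_inject that by blast
    then have "?T (mat_vec k ?N v) = mat_vec k ?N (?T v)"
      unfolding mat_vec_mult by (auto simp: mat_vec_def fun_eq_iff intro!: sum.cong)
    then show ?thesis unfolding mat_vec_ladder_mat[OF assms(1) h(3,4)] .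
  qed
  \<comment> \<open>A reference vector for each type, normalized to 1 at a coordinate z. For a type
    without nonzero highest weight vectors, the zero vector and some word of length k are
    defaults.\<close>
  have ex: "\<exists>u z. length z = k \<and> highest q k a b u \<and> ((\<exists>u'. highest q k a b u' \<and> u' \<noteq> (\<lambda>x. 0)) \<longrightarrow> u z = 1)" for a b
  proof (cases "\<exists>u'. highest q k a b u' \<and> u' \<noteq> (\<lambda>x. 0)")
    case True
    then obtain u' z where u: "highest q k a b u'" "u' z \<noteq> 0" by (auto simp: fun_eq_iff)
    then have "length z = k" unfolding highest_def typed_def by auto
    then show ?thesis using highest_scale[OF u(1), of "inverse (u' z)"] u(2)
      by (intro exI[of _ "\<lambda>x. inverse (u' z) * u' x"] exI[of _ z]) simp
  next
    case False
    have "highest q k a b (\<lambda>x. 0)" by (simp add: highest_def typed_zero)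
    moreover have "length (replicate k Nul) = k" by simp
    ultimately show ?thesis using False by blast
  qed
  obtain us zs where us: "\<And>a b. length (zs a b) = k" "\<And>a b. highest q k a b (us a b)"
    "\<And>a b u'. highest q k a b u' \<Longrightarrow> u' \<noteq> (\<lambda>x. 0) \<Longrightarrow> us a b (zs a b) = 1"
    using ex by metis
  \<comment> \<open>The matrix of T on the reference ladder: the entry at l, i is the component on
    rung l of the image of rung i, read at the chosen coordinate.\<close>
  define \<tau> where "\<tau> = (\<lambda>a b l i. inverse (ladder_const q (int a - int b) l) *
      highest_proj q k a b ((raising q ^^ l) (?T ((lowering q ^^ i) (us a b)))) (zs a b))"
  \<comment> \<open>Rung i over u is the image of the reference rung under the intertwiner
    \<open>ladder_map\<close>, with which T commutes. So T acts on every ladder of the type by the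
    same matrix \<open>\<tau>\<close>.\<close>
  have Tl: "?T ((lowering q ^^ i) u) = (\<lambda>x. \<Sum>l\<le>a - b. \<tau> a b l i * (lowering q ^^ l) u x)"
    if u: "highest q k a b u" "b \<le> a" "b \<le> k" "i \<le> a - b" for a b u i
  proof (cases "u = (\<lambda>x. 0)")
    case True
    then show ?thesis using T0 by simp
  next
    case False
    have "ladder_map q k a b (zs a b) u ((lowering q ^^ i) (us a b)) = (lowering q ^^ i) u"
      using ladder_map_ladder[OF assms(1) u(2,3) us(2)[of a b]] us(3)[OF u(1) False] u(4) by simp
    then have "?T ((lowering q ^^ i) u) = ladder_map q k a b (zs a b) u (?T ((lowering q ^^ i) (us a b)))"
      using com[OF u(2,3) us(1) u(1)] by metis
    then show ?thesis unfolding \<tau>_def ladder_map_def[abs_def] .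
  qed
  let ?I = "{(a, b). a \<le> k \<and> b \<le> a}"
  have finI: "finite ?I" by (rule finite_subset[of _ "{0..k} \<times> {0..k}"]) auto
  \<comment> \<open>For each type: isolate rung i by E^i and the projection, divide by
    \<open>ladder_const\<close>, lower to rung l and multiply by the matrix entry. All of this is
    realized by the quantum group.\<close>
  define A where "A = (\<lambda>v x. \<Sum>p\<in>?I. \<Sum>i\<le>fst p - snd p. \<Sum>l\<le>fst p - snd p.
    (\<tau> (fst p) (snd p) l i * inverse (ladder_const q (int (fst p) - int (snd p)) i)) *
    (lowering q ^^ l) (highest_proj q k (fst p) (snd p) ((raising q ^^ i) v)) x)"
  have "alg_op q k A"
    unfolding A_def
    by (intro alg_op_sum alg_op_scale alg_op_comp[OF alg_op_lower_pow]
        alg_op_comp[OF alg_op_highest_proj[OF assms(1)]] alg_op_raise_pow)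
  then obtain g where g: "\<And>v x. length x = k \<Longrightarrow> A v x = free_op q g v x" unfolding alg_op_def by blast
  \<comment> \<open>Rungs that vanish are set aside. For the others a nonzero coefficient exhibits a
    word of type (a, b), which bounds a and b by k and puts the type into the index set of
    A.\<close>
  have Al: "A ((lowering q ^^ i) u) = ?T ((lowering q ^^ i) u)" if u: "highest q k a b u" for a b u i
  proof (cases "u = (\<lambda>x. 0) \<or> \<not> i + b \<le> a")
    case True
    then have "(lowering q ^^ i) u = (\<lambda>x. 0)" using highest_lower_zero[OF assms(1) u, of i] by auto
    moreover have "A (\<lambda>x. 0) = (\<lambda>x. 0)" unfolding A_def by (simp add: highest_proj_zero)
    ultimately show ?thesis using T0 by simp
  next
    case False
    then obtain y where "u y \<noteq> 0" by (auto simp: fun_eq_iff)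
    then have y: "length y = k" "npos y = a" "nneg y = b" using u unfolding highest_def typed_def by auto
    have ab: "b \<le> a" "b \<le> k" "a \<le> k" "i \<le> a - b"
      using False counts_le_length[of y] y by auto
    have lc: "ladder_const q (int a - int b) i \<noteq> 0" using ab by (intro ladder_const_nonzero[OF assms(1)]) simp
    have lc': "c * inverse (ladder_const q (int a - int b) i) * (ladder_const q (int a - int b) i * d) = c * d" for c d
      using lc by (simp add: field_simps)
    \<comment> \<open>Of all projections in A only the one with the type and the index of the given
      rung is nonzero on it.\<close>
    have inner: "(\<Sum>i'\<le>fst p - snd p. \<Sum>l\<le>fst p - snd p.
        (\<tau> (fst p) (snd p) l i' * inverse (ladder_const q (int (fst p) - int (snd p)) i')) *
        (lowering q ^^ l) (highest_proj q k (fst p) (snd p) ((raising q ^^ i') ((lowering q ^^ i) u))) x) =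
      (if p = (a, b) then \<Sum>l\<le>a - b. \<tau> a b l i * (lowering q ^^ l) u x else 0)" if p: "p \<in> ?I" for p x
    proof -
      have p': "snd p \<le> fst p" "snd p \<le> k" using p by auto
      note hp = highest_proj_ladder[OF assms(1) p' u]
      show ?thesis
      proof (cases "p = (a, b)")
        case True
        have "(lowering q ^^ l) (highest_proj q k a b ((raising q ^^ i') ((lowering q ^^ i) u))) x =
            (if i' = i then ladder_const q (int a - int b) i * (lowering q ^^ l) u x else 0)" for l i'
          using hp[of i' i] True by (cases "i' = i") (simp_all add: lower_pow_scale)
        then have "(\<Sum>i'\<le>fst p - snd p. \<Sum>l\<le>fst p - snd p.
            (\<tau> (fst p) (snd p) l i' * inverse (ladder_const q (int (fst p) - int (snd p)) i')) *
            (lowering q ^^ l) (highest_proj q k (fst p) (snd p) ((raising q ^^ i') ((lowering q ^^ i) u))) x) =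
          (\<Sum>i'\<le>a - b. if i' = i then \<Sum>l\<le>a - b. (\<tau> a b l i * inverse (ladder_const q (int a - int b) i)) *
            (ladder_const q (int a - int b) i * (lowering q ^^ l) u x) else 0)"
          using True by (intro sum.cong refl) auto
        also have "\<dots> = (\<Sum>l\<le>a - b. \<tau> a b l i * (lowering q ^^ l) u x)"
          using ab(4) by (simp add: sum.delta lc')
        finally show ?thesis using True by simp
      next
        case False
        then have "highest_proj q k (fst p) (snd p) ((raising q ^^ i') ((lowering q ^^ i) u)) = (\<lambda>x. 0)" for i'
          using hp[of i' i] by (auto simp: prod_eq_iff)
        then show ?thesis using False by simp
      qed
    qed
    have "A ((lowering q ^^ i) u) x = (\<Sum>p\<in>?I. if p = (a, b) then \<Sum>l\<le>a - b. \<tau> a b l i * (lowering q ^^ l) u x else 0)" for x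
      unfolding A_def using inner by (intro sum.cong refl) blast
    then have "A ((lowering q ^^ i) u) = (\<lambda>x. \<Sum>l\<le>a - b. \<tau> a b l i * (lowering q ^^ l) u x)"
      using ab finI by (simp add: sum.delta fun_eq_iff)
    then show ?thesis using Tl[OF u ab(1,2,4)] by simp
  qed
  have main: "\<forall>x. length x = k \<longrightarrow> ?T v x = free_op q g v x" if "\<And>x. length x \<noteq> k \<Longrightarrow> v x = 0" for v
  proof (rule ladder_induct[OF assms(1) that])
    show "\<forall>x. length x = k \<longrightarrow> ?T (\<lambda>x. 0) x = free_op q g (\<lambda>x. 0) x"
      unfolding T0 by (simp add: free_op_length)
    show "\<forall>x. length x = k \<longrightarrow> ?T (\<lambda>x. u x + v x) x = free_op q g (\<lambda>x. u x + v x) x"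
      if "\<forall>x. length x = k \<longrightarrow> ?T u x = free_op q g u x" "\<forall>x. length x = k \<longrightarrow> ?T v x = free_op q g v x" for u v
      using that unfolding mat_vec_add free_op_fun_add by simp
    show "\<forall>x. length x = k \<longrightarrow> ?T ((lowering q ^^ i) u) x = free_op q g ((lowering q ^^ i) u) x"
      if "highest q k a b u" for a b u i
      using Al[OF that] g by metis
  qed
  have "T = act_on q k g"
  proof
    fix x
    show "T x = act_on q k g x"
    proof (cases "x \<in> tensor_power k")
      case True
      have "Poly_Mapping.lookup (T x) w = Poly_Mapping.lookup (act_on q k g x) w" if "length w = k" for w
        using main[of "Poly_Mapping.lookup x"] tensor_power_lookup[OF True] that
        unfolding TM lookup_mat_op[OF True] lookup_act_on[OF q True] by blast
      then show ?thesis
        using tensor_power_eqI End_maps[OF TE True] act_on_maps[OF q True] by blast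
    next
      case False
      then show ?thesis unfolding TM by (simp add: mat_op_def act_on_def)
    qed
  qed
  then show ?thesis by blast
qed

lemma subset_double_centralizer:
  assumes "\<And>s. s \<in> S \<Longrightarrow> s \<in> carrier A"
  shows "S \<subseteq> centralizer A (centralizer A S)"
  using assms unfolding centralizer_def by fastforce

theorem theorem11p4:
  fixes q s \<delta> :: "'a::field" and k :: nat
  assumes "q \<noteq> 0"
    and "\<forall>n>0. q ^ n \<noteq> 1"
    and "s = 1 \<or> s = - 1"
    and "\<delta> = 1 + s * (q + inverse q)"
  shows "\<exists>\<rho>. PTL_action \<delta> s q k \<rho> \<and>
    \<rho> \<in> alg_iso (PTL \<delta> k) (End_Uq q k) \<and>
    \<rho> ` carrier (PTL \<delta> k) = centralizer (End_alg k) (Uq_rep q k ` carrier (Uq q)) \<and>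
    Uq_rep q k ` carrier (Uq q) = centralizer (End_alg k) (\<rho> ` carrier (PTL \<delta> k))"
proof -
  have gq: "generic q" using assms(1,2) unfolding generic_def by simp
  have ss: "s * s = 1" using assms(3) by auto
  have "inverse s = s" using assms(3) by auto
  then have "inverse (- s * q) = - s * inverse q" by (simp only: inverse_mult_distrib inverse_minus_eq)
  then have \<delta>: "\<delta> = 1 - (- s * q) - inverse (- s * q)" by (simp only: assms(4)) (simp add: algebra_simps)
  have U: "Uq_rep q k ` carrier (Uq q) = range (act_on q k)"
    using Uq_rep_image[OF assms(1) generic_inverse[OF gq]] .
  \<comment> \<open>The image of the partial Temperley--Lieb algebra is the centralizer of the
    quantum group, so what remains of the duality is this double centralizer property.\<close>
  have "range (act_on q k) = centralizer (End_alg k) (centralizer (End_alg k) (range (act_on q k)))"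
  proof
    show "range (act_on q k) \<subseteq> centralizer (End_alg k) (centralizer (End_alg k) (range (act_on q k)))"
      by (rule subset_double_centralizer) (use act_on_End[OF assms(1)] in \<open>auto simp: End_alg_def\<close>)
    show "centralizer (End_alg k) (centralizer (End_alg k) (range (act_on q k))) \<subseteq> range (act_on q k)"
      using double_centralizer[OF gq] by blast
  qed
  then show ?thesis
    unfolding U
    using rho_action[OF gq ss \<delta>] rho_iso[OF gq ss \<delta>] rho_image[OF gq ss \<delta>] by metis
qed

end
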